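(* It is decidable whether, for a given formula $\alpha$ of Constrained TPTL, there exists a non-Zeno timed word $w$ with $w,1,0\models\alpha$. The complexity of this problem cannot be bounded by any primitive recursive function.
   Context: TPTL$^1$ (one-variable timed propositional temporal logic) formulas over a finite alphabet $\Sigma$ are generated by $p\mid x.\alpha\mid x\sim c\mid \alpha\wedge\beta\mid\alpha\vee\beta\mid\alpha\,U\,\beta\mid\alpha\,\tilde U\,\beta$, with $p\in\Sigma$, $x$ the unique clock variable, $c\in\mathbb{N}$, and $\sim\in\{=,\neq,<,\le,>,\ge\}$. Semantics over a timed word $w=(a_1,t_1)(a_2,t_2)\dots$ ($t_i$ strictly increasing, unbounded), position $i\ge1$ and $v\in\mathbb{R}_{\ge0}$: $w,i,v\models p$ iff $a_i=p$; $w,i,v\models x\sim c$ iff $t_i-v\sim c$; $w,i,v\models x.\alpha$ iff $w,i,t_i\models\alpha$; $\wedge,\vee$ as usual; $w,i,v\models\alpha U\beta$ iff $\exists j>i$ with $w,j,v\models\beta$ and $w,k,v\models\alpha$ for all $i<k<j$; $w,i,v\models\alpha\tilde U\beta$ iff for all $j>i$, $w,j,v\models\beta$ or $\exists k\in(i,j)$ with $w,k,v\models\alpha$. Abbreviation $F\alpha\equiv\mathrm{true}\,U\,\alpha$. Positive formulas: $\varphi,\psi::= p\mid x.\varphi\mid x\sim c\mid\varphi\vee\psi\mid\varphi\wedge\psi\mid\varphi\tilde U\psi\mid F((x\le c)\wedge\psi)$. Constrained TPTL formulas: $\alpha,\beta::=p\mid x.\alpha\mid x\sim c\mid\alpha\vee\beta\mid\alpha\wedge\beta\mid\alpha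 U\beta\mid\varphi$ with $\varphi$ positive. *)

theory Defs
  imports Complex_Main "HOL-Library.Nat_Bijection"
begin

datatype cmp = CEq | CNeq | CLt | CLe | CGt | CGe

text \<open>Letters of the alphabet are natural numbers; the alphabet of an instance is
  the finite set {0..<k}.  The unique clock variable x is implicit.\<close>
datatype tptl =
    Prop nat
  | Freeze tptl
  | Constr cmp nat
  | And tptl tptl
  | Or tptl tptl
  | Until tptl tptl
  | Release tptl tptl

fun cmp_holds :: "cmp \<Rightarrow> real \<Rightarrow> real \<Rightarrow> bool" where
  "cmp_holds CEq a b = (a = b)"
| "cmp_holds CNeq a b = (a \<noteq> b)"
| "cmp_holds CLt a b = (a < b)"
| "cmp_holds CLe a b = (a \<le> b)"
| "cmp_holds CGt a b = (a > b)"
| "cmp_holds CGe a b = (a \<ge> b)"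

text \<open>true is expressed inside the logic as x.(x = 0), valid everywhere;
  F alpha = true U alpha.\<close>
definition TT :: tptl where "TT = Freeze (Constr CEq 0)"
definition Fin :: "tptl \<Rightarrow> tptl" where "Fin a = Until TT a"

text \<open>Timed words: position i (0-based here, position i+1 of the paper)
  carries letter fst (w i) and timestamp snd (w i).\<close>
type_synonym tword = "nat \<Rightarrow> nat \<times> real"

definition timed_word :: "nat \<Rightarrow> tword \<Rightarrow> bool" where
  "timed_word k w \<longleftrightarrow>
     (\<forall>i. fst (w i) < k) \<and> (\<forall>i. 0 \<le> snd (w i)) \<and>
     (\<forall>i. snd (w i) < snd (w (Suc i))) \<and> (\<forall>T. \<exists>i. T < snd (w i))"

fun sat :: "tword \<Rightarrow> nat \<Rightarrow> real \<Rightarrow> tptl \<Rightarrow> bool" where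
  "sat w i v (Prop p) = (fst (w i) = p)"
| "sat w i v (Freeze a) = sat w i (snd (w i)) a"
| "sat w i v (Constr c n) = cmp_holds c (snd (w i) - v) (real n)"
| "sat w i v (And a b) = (sat w i v a \<and> sat w i v b)"
| "sat w i v (Or a b) = (sat w i v a \<or> sat w i v b)"
| "sat w i v (Until a b) = (\<exists>j>i. sat w j v b \<and> (\<forall>k. i < k \<and> k < j \<longrightarrow> sat w k v a))"
| "sat w i v (Release a b) = (\<forall>j>i. sat w j v b \<or> (\<exists>k. i < k \<and> k < j \<and> sat w k v a))"

inductive positive :: "tptl \<Rightarrow> bool" where
  "positive (Prop p)"
| "positive a \<Longrightarrow> positive (Freeze a)"
| "positive (Constr c n)"
| "positive a \<Longrightarrow> positive b \<Longrightarrow> positive (Or a b)"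
| "positive a \<Longrightarrow> positive b \<Longrightarrow> positive (And a b)"
| "positive a \<Longrightarrow> positive b \<Longrightarrow> positive (Release a b)"
| "positive b \<Longrightarrow> positive (Fin (And (Constr CLe c) b))"

inductive constrained :: "tptl \<Rightarrow> bool" where
  "constrained (Prop p)"
| "constrained a \<Longrightarrow> constrained (Freeze a)"
| "constrained (Constr c n)"
| "constrained a \<Longrightarrow> constrained b \<Longrightarrow> constrained (Or a b)"
| "constrained a \<Longrightarrow> constrained b \<Longrightarrow> constrained (And a b)"
| "constrained a \<Longrightarrow> constrained b \<Longrightarrow> constrained (Until a b)"
| "positive a \<Longrightarrow> constrained a"

definition tptl_sat :: "nat \<Rightarrow> tptl \<Rightarrow> bool" where
  "tptl_sat k a \<longleftrightarrow> (\<exists>w. timed_word k w \<and> sat w 0 0 a)"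

fun enc_cmp :: "cmp \<Rightarrow> nat" where
  "enc_cmp CEq = 0" | "enc_cmp CNeq = 1" | "enc_cmp CLt = 2"
| "enc_cmp CLe = 3" | "enc_cmp CGt = 4" | "enc_cmp CGe = 5"

fun enc :: "tptl \<Rightarrow> nat" where
  "enc (Prop p) = prod_encode (0, p)"
| "enc (Freeze a) = prod_encode (1, enc a)"
| "enc (Constr c n) = prod_encode (2, prod_encode (enc_cmp c, n))"
| "enc (And a b) = prod_encode (3, prod_encode (enc a, enc b))"
| "enc (Or a b) = prod_encode (4, prod_encode (enc a, enc b))"
| "enc (Until a b) = prod_encode (5, prod_encode (enc a, enc b))"
| "enc (Release a b) = prod_encode (6, prod_encode (enc a, enc b))"

definition code :: "nat \<Rightarrow> tptl \<Rightarrow> nat" where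
  "code k a = prod_encode (k, enc a)"

datatype instr = Inc nat nat | Dec nat nat nat

type_synonym prog = "instr list"
type_synonym config = "nat \<times> (nat \<Rightarrow> nat)"

fun step :: "prog \<Rightarrow> config \<Rightarrow> config" where
  "step M (pc, R) =
     (if pc < length M then
        (case M ! pc of
           Inc r l \<Rightarrow> (l, R(r := Suc (R r)))
         | Dec r l1 l2 \<Rightarrow> (if R r = 0 then (l2, R) else (l1, R(r := R r - 1))))
      else (pc, R))"

definition halted :: "prog \<Rightarrow> config \<Rightarrow> bool" where
  "halted M c \<longleftrightarrow> length M \<le> fst c"

definition conf :: "prog \<Rightarrow> nat \<Rightarrow> nat \<Rightarrow> config" where
  "conf M x n = (step M ^^ n) (0, (\<lambda>_. 0)(0 := x))"

definition halts :: "prog \<Rightarrow> nat \<Rightarrow> bool" where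
  "halts M x \<longleftrightarrow> (\<exists>n. halted M (conf M x n))"

definition run_time :: "prog \<Rightarrow> nat \<Rightarrow> nat" where
  "run_time M x = (LEAST n. halted M (conf M x n))"

definition machine_output :: "prog \<Rightarrow> nat \<Rightarrow> nat" where
  "machine_output M x = snd (conf M x (run_time M x)) 0"

definition decides_sat :: "prog \<Rightarrow> bool" where
  "decides_sat M \<longleftrightarrow>
     (\<forall>k a. constrained a \<longrightarrow>
        halts M (code k a) \<and> (machine_output M (code k a) = 1 \<longleftrightarrow> tptl_sat k a))"

inductive primrec_fn :: "nat \<Rightarrow> (nat list \<Rightarrow> nat) \<Rightarrow> bool" where
  zero: "primrec_fn n (\<lambda>_. 0)"
| succ: "primrec_fn 1 (\<lambda>xs. Suc (hd xs))"
| proj: "i < n \<Longrightarrow> primrec_fn n (\<lambda>xs. xs ! i)"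
| comp: "primrec_fn m g \<Longrightarrow> length fs = m \<Longrightarrow> (\<forall>f\<in>set fs. primrec_fn n f) \<Longrightarrow>
         primrec_fn n (\<lambda>xs. g (map (\<lambda>f. f xs) fs))"
| prec: "primrec_fn n g \<Longrightarrow> primrec_fn (n + 2) h \<Longrightarrow>
         primrec_fn (Suc n) (\<lambda>xs. rec_nat (g (tl xs)) (\<lambda>y acc. h (y # acc # tl xs)) (hd xs))"

end

theory Submission
  imports Defs "HOL-Library.Sublist" "HOL-Library.Infinite_Set"
begin

text \<open>
  Decidability: cut a run into unit intervals and record, for the obligations that are pending at an
  integer time, their formulas and clock regions, grouped by fractional part and sorted. This word over
  a finite alphabet evolves by a finite transducer which may forget letters, since an obligation that
  is dropped only helps. A formula of Constrained TPTL is satisfiable iff there is an infinite run whose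
  words eventually avoid the letters that stand for unbounded eventualities. By Higman's lemma the
  existence and the non-existence of such a run both have finite certificates, so a counter machine
  can search for the two kinds in parallel.

  Lower bound: punctual constraints of length one can copy counters, stored as the number of events of a
  unit interval, but cannot prevent additional events, so a formula describes a counter system whose
  counters may grow spontaneously. If the system first unwinds a Hardy computation into a budget, spends the
  budget on a program and finally winds it back, then the Hardy value of the configuration never
  decreases, and equal finite counts at both ends exclude every spontaneous gain. A decision procedure
  with primitive recursive running time fits into such a budget, and a formula that describes the run of
  the procedure on its own code contradicts its correctness.
\<close>

section \<open>Loop programs and counter machines\<close>

text \<open>No bound on the procedure is available, so both answers are only made semidecidable:
  enumerability comes from closure properties and from finite derivations (\<open>re_wf\<close>)
  rather than from explicit programs, and even the parameters \<open>G\<close>, \<open>D\<close>,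
  \<open>M\<close> of the word system are found by search. What makes the grammar work is that an
  eventuality without a deadline never lies under \<open>Release\<close>; a model therefore meets
  all of them before some position \<open>J\<close>.

  The lower bound does without a recursion theorem. The number \<open>e\<close> is the code of the
  alphabet size and of the part \<open>machF\<close> of the formula, which does not depend on
  \<open>e\<close>. The same \<open>e\<close> is the number of tokens demanded by
  \<open>ends e\<close>, the input of the program, the argument of the budget and the number of
  applications of \<open>fgh m\<close> in it. From \<open>e\<close> the program rebuilds the code of
  the complete formula, and it accepts, with its registers restored, if the procedure does not
  answer 1.\<close>

datatype com = Up nat | Down nat | Seq com com (infixr ";;" 60) | IfDec nat com com | For nat com

type_synonym regs = "nat \<Rightarrow> nat"

fun den :: "com \<Rightarrow> regs \<Rightarrow> regs" where
  "den (Up r) R = R(r := Suc (R r))"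
| "den (Down r) R = R(r := R r - 1)"
| "den (c ;; d) R = den d (den c R)"
| "den (IfDec r c d) R = (if R r = 0 then den d R else den c (R(r := R r - 1)))"
| "den (For r c) R = (den c ^^ R r) (R(r := 0))"

fun tm :: "com \<Rightarrow> regs \<Rightarrow> nat" where
  "tm (Up r) R = 1"
| "tm (Down r) R = 1"
| "tm (c ;; d) R = tm c R + tm d (den c R)"
| "tm (IfDec r c d) R = Suc (if R r = 0 then tm d R else tm c (R(r := R r - 1)))"
| "tm (For r c) R = Suc (\<Sum>i<R r. Suc (tm c ((den c ^^ i) (R(r := 0)))))"

fun used :: "com \<Rightarrow> nat set" where
  "used (Up r) = {r}"
| "used (Down r) = {r}"
| "used (c ;; d) = used c \<union> used d"
| "used (IfDec r c d) = insert r (used c \<union> used d)"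
| "used (For r c) = insert r (used c)"

fun wf_com :: "com \<Rightarrow> bool" where
  "wf_com (Up r) = True"
| "wf_com (Down r) = True"
| "wf_com (c ;; d) = (wf_com c \<and> wf_com d)"
| "wf_com (IfDec r c d) = (wf_com c \<and> wf_com d)"
| "wf_com (For r c) = (r \<notin> used c \<and> wf_com c)"

fun clen :: "com \<Rightarrow> nat" where
  "clen (Up r) = 1"
| "clen (Down r) = 1"
| "clen (c ;; d) = clen c + clen d"
| "clen (IfDec r c d) = Suc (clen c + clen d)"
| "clen (For r c) = Suc (clen c)"

text \<open>Code of \<open>c\<close> for the addresses from \<open>i\<close> on, with exit to
  \<open>j\<close>. Every instruction names its successors, so sequencing and looping cost no extra
  jumps.\<close>

fun compile :: "com \<Rightarrow> nat \<Rightarrow> nat \<Rightarrow> prog" where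
  "compile (Up r) i j = [Inc r j]"
| "compile (Down r) i j = [Dec r j j]"
| "compile (c ;; d) i j = compile c i (i + clen c) @ compile d (i + clen c) j"
| "compile (IfDec r c d) i j =
     Dec r (Suc i) (Suc i + clen c) # compile c (Suc i) j @ compile d (Suc i + clen c) j"
| "compile (For r c) i j = Dec r (Suc i) j # compile c (Suc i) i"

lemma length_compile [simp]: "length (compile c i j) = clen c"
  by (induction c i j rule: compile.induct) auto

lemma finite_used [simp]: "finite (used c)"
  by (induction c) auto

lemma funpow_fun_upd:
  assumes "\<And>R. f (R(r := v)) = (f R)(r := v)"
  shows "(f ^^ n) (R(r := v)) = ((f ^^ n) R)(r := v)"
proof (induction n)
  case (Suc n)
  have "(f ^^ Suc n) (R(r := v)) = f (((f ^^ n) R)(r := v))"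
    by (simp only: funpow.simps comp_apply Suc)
  also have "\<dots> = ((f ^^ Suc n) R)(r := v)" by (simp only: assms funpow.simps comp_apply)
  finally show ?case .
qed simp

lemma den_unused:
  assumes "r \<notin> used c"
  shows "den c (R(r := v)) = (den c R)(r := v) \<and> tm c (R(r := v)) = tm c R"
  using assms
proof (induction c arbitrary: R v)
  case (For q c)
  then have q: "q \<noteq> r" and rc: "r \<notin> used c" by auto
  note IH = For.IH[OF rc, THEN conjunct1] For.IH[OF rc, THEN conjunct2]
  have *: "(den c ^^ n) (R(r := v)) = ((den c ^^ n) R)(r := v)" for n R v
    by (rule funpow_fun_upd) (rule IH)
  have tw: "(R(r := v))(q := 0) = (R(q := 0))(r := v)" using q by (rule fun_upd_twist[symmetric])
  have "(R(r := v)) q = R q" using q by simp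
  then show ?case unfolding den.simps tm.simps by (simp only: tw * IH)
next
  case (IfDec q c d)
  then have q: "q \<noteq> r" and rc: "r \<notin> used c" "r \<notin> used d" by auto
  note IH = IfDec.IH(1)[OF rc(1), THEN conjunct1] IfDec.IH(1)[OF rc(1), THEN conjunct2]
    IfDec.IH(2)[OF rc(2), THEN conjunct1] IfDec.IH(2)[OF rc(2), THEN conjunct2]
  have tw: "(R(r := v))(q := w) = (R(q := w))(r := v)" for w using q by (rule fun_upd_twist[symmetric])
  have "(R(r := v)) q = R q" using q by simp
  then show ?case unfolding den.simps tm.simps by (auto simp only: tw IH split: if_splits)
qed (auto simp: fun_upd_twist)

lemma funpow_eqI: "g 0 = x \<Longrightarrow> (\<And>n. f (g n) = g (Suc n)) \<Longrightarrow> (f ^^ n) x = g n"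
  by (induction n) auto

lemma den_other: "r \<notin> used c \<Longrightarrow> den c R r = R r"
  using den_unused[of r c R "R r"] by (metis fun_upd_same fun_upd_triv)

definition placed :: "prog \<Rightarrow> nat \<Rightarrow> prog \<Rightarrow> bool" where
  "placed M i p \<longleftrightarrow> (\<exists>a b. M = a @ p @ b \<and> length a = i)"

lemma placed_append: "placed M i (p @ q) \<longleftrightarrow> placed M i p \<and> placed M (i + length p) q"
proof
  assume "placed M i (p @ q)"
  then obtain a b where "M = a @ (p @ q) @ b" "length a = i" by (auto simp: placed_def)
  then have "M = a @ p @ (q @ b)" "M = (a @ p) @ q @ b" "length (a @ p) = i + length p" by auto
  then show "placed M i p \<and> placed M (i + length p) q"
    unfolding placed_def using \<open>length a = i\<close> by blast
next
  assume A: "placed M i p \<and> placed M (i + length p) q"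
  then obtain a b where 1: "M = a @ p @ b" "length a = i" by (auto simp: placed_def)
  from A obtain a' b' where 2: "M = a' @ q @ b'" "length a' = i + length p" by (auto simp: placed_def)
  note * = 1 2
  then have "(a @ p) @ b = a' @ q @ b'" "length (a @ p) = length a'" by auto
  then have "b = q @ b'" by (metis append_eq_append_conv)
  then show "placed M i (p @ q)" using * by (auto simp: placed_def)
qed

lemma placed_Cons: "placed M i (x # p) \<longleftrightarrow> (i < length M \<and> M ! i = x) \<and> placed M (Suc i) p"
proof -
  have "placed M i [x] \<longleftrightarrow> i < length M \<and> M ! i = x"
  proof
    assume "i < length M \<and> M ! i = x"
    then have "M = take i M @ [x] @ drop (Suc i) M" "length (take i M) = i"
      using id_take_nth_drop[of i M] by auto
    then show "placed M i [x]" unfolding placed_def by blast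
  qed (auto simp: placed_def)
  then show ?thesis using placed_append[of M i "[x]" p] by simp
qed

lemma compile_correct:
  assumes "wf_com c" "placed M i (compile c i j)"
  shows "(step M ^^ tm c R) (i, R) = (j, den c R)"
  using assms
proof (induction c arbitrary: i j R)
  case (Seq c d)
  have "placed M i (compile c i (i + clen c))" "placed M (i + clen c) (compile d (i + clen c) j)"
    using Seq.prems by (simp_all add: placed_append)
  then have "(step M ^^ tm c R) (i, R) = (i + clen c, den c R)"
    "(step M ^^ tm d (den c R)) (i + clen c, den c R) = (j, den d (den c R))"
    using Seq by simp_all
  then show ?case by (simp add: funpow_add add.commute[of "tm c R"])
next
  case (IfDec r c d)
  then have *: "step M (i, R) = (if R r = 0 then (Suc i + clen c, R) else (Suc i, R(r := R r - 1)))"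
    by (simp add: placed_Cons)
  show ?case using IfDec
    by (auto simp: funpow_swap1[symmetric] funpow_Suc_right * placed_Cons placed_append simp del: step.simps funpow.simps(2))
next
  case (For r c)
  then have r: "r \<notin> used c" and IH: "\<And>R. (step M ^^ tm c R) (Suc i, R) = (i, den c R)"
    and at: "i < length M" "M ! i = Dec r (Suc i) j"
    by (simp_all add: placed_Cons)
  \<comment> \<open>The number of rounds is detached from the rest of the registers, so that the
    induction can peel off the first round and continue from the state it leaves.\<close>
  have "(step M ^^ Suc (\<Sum>k<n. Suc (tm c ((den c ^^ k) (S(r := 0)))))) (i, S(r := n))
      = (j, (den c ^^ n) (S(r := 0)))" for n S
  proof (induction n arbitrary: S)
    case 0
    then show ?case using at by simp
  next
    case (Suc n)
    let ?S = "den c (S(r := 0))"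
    have st: "step M (i, S(r := Suc n)) = (Suc i, S(r := n))" using at by simp
    have t: "tm c (S(r := n)) = tm c (S(r := 0))" "den c (S(r := n)) = ?S(r := n)"
      using den_unused[OF r] by simp_all
    have r0: "?S(r := 0) = ?S" using den_other[OF r, of "S(r := 0)"] by (simp add: fun_upd_idem)
    have sum: "Suc (\<Sum>k<Suc n. Suc (tm c ((den c ^^ k) (S(r := 0)))))
      = Suc (\<Sum>k<n. Suc (tm c ((den c ^^ k) ?S))) + Suc (tm c (S(r := 0)))"
      by (subst sum.lessThan_Suc_shift) (simp add: funpow_swap1)
    have "(step M ^^ Suc (tm c (S(r := 0)))) (i, S(r := Suc n)) = (i, ?S(r := n))"
      using IH[of "S(r := n)"] st t by (simp add: funpow_Suc_right del: funpow.simps(2) step.simps)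
    moreover have "(step M ^^ Suc (\<Sum>k<n. Suc (tm c ((den c ^^ k) ?S)))) (i, ?S(r := n)) = (j, (den c ^^ n) ?S)"
      using Suc[of ?S] by (simp only: r0)
    ultimately have "(step M ^^ (Suc (\<Sum>k<n. Suc (tm c ((den c ^^ k) ?S))) + Suc (tm c (S(r := 0)))))
       (i, S(r := Suc n)) = (j, (den c ^^ n) ?S)"
      by (simp only: funpow_add comp_apply)
    then show ?case by (simp only: sum funpow_swap1 funpow.simps(2) comp_apply)
  qed
  from this[where n = "R r" and S = R] show ?case by simp
qed (auto simp: placed_Cons)

section \<open>Unary primitive recursive functions, with iteration over Cantor pairs, and their loop
  programs\<close>

inductive UF :: "(nat \<Rightarrow> nat) \<Rightarrow> bool" where
  UF_zero: "UF (\<lambda>x. 0)"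
| UF_id: "UF (\<lambda>x. x)"
| UF_Suc: "UF Suc"
| UF_fst: "UF (\<lambda>x. fst (prod_decode x))"
| UF_snd: "UF (\<lambda>x. snd (prod_decode x))"
| UF_pair: "UF f \<Longrightarrow> UF g \<Longrightarrow> UF (\<lambda>x. prod_encode (f x, g x))"
| UF_comp: "UF f \<Longrightarrow> UF g \<Longrightarrow> UF (\<lambda>x. f (g x))"
| UF_iter: "UF f \<Longrightarrow> UF (\<lambda>x. (f ^^ fst (prod_decode x)) (snd (prod_decode x)))"

text \<open>\<open>P a b s\<close> reads register \<open>a\<close>, writes register \<open>b\<close> and uses the registers from \<open>s\<close> on
  as scratch space, which it leaves empty.\<close>
definition computes :: "(nat \<Rightarrow> nat \<Rightarrow> nat \<Rightarrow> com) \<Rightarrow> (nat \<Rightarrow> nat) \<Rightarrow> bool" where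
  "computes P f \<longleftrightarrow> (\<forall>a b s. a < s \<and> b < s \<and> a \<noteq> b \<longrightarrow> wf_com (P a b s) \<and>
     used (P a b s) \<subseteq> {a, b} \<union> {s..} \<and>
     (\<forall>R. R b = 0 \<and> (\<forall>r\<ge>s. R r = 0) \<longrightarrow> den (P a b s) R = R(b := f (R a))))"

lemma computesI:
  assumes "\<And>a b s. a < s \<Longrightarrow> b < s \<Longrightarrow> a \<noteq> b \<Longrightarrow> wf_com (P a b s)"
    and "\<And>a b s. a < s \<Longrightarrow> b < s \<Longrightarrow> a \<noteq> b \<Longrightarrow> used (P a b s) \<subseteq> {a, b} \<union> {s..}"
    and "\<And>a b s R. a < s \<Longrightarrow> b < s \<Longrightarrow> a \<noteq> b \<Longrightarrow> R b = 0 \<Longrightarrow> (\<And>r. r \<ge> s \<Longrightarrow> R r = 0)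
      \<Longrightarrow> den (P a b s) R = R(b := f (R a))"
  shows "computes P f"
  unfolding computes_def by (intro allI impI conjI assms) auto

lemma computesD:
  assumes "computes P f" "a < s" "b < s" "a \<noteq> b"
  shows "wf_com (P a b s)"
    and "used (P a b s) \<subseteq> {a, b} \<union> {s..}"
    and "R b = 0 \<Longrightarrow> (\<And>r. r \<ge> s \<Longrightarrow> R r = 0) \<Longrightarrow> den (P a b s) R = R(b := f (R a))"
proof -
  note * = assms(1)[unfolded computes_def, rule_format, of a s b]
  show "wf_com (P a b s)" "used (P a b s) \<subseteq> {a, b} \<union> {s..}"
    using * assms by blast+
  show "R b = 0 \<Longrightarrow> (\<And>r. r \<ge> s \<Longrightarrow> R r = 0) \<Longrightarrow> den (P a b s) R = R(b := f (R a))"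
    using * assms by blast
qed

definition addto :: "nat \<Rightarrow> nat \<Rightarrow> nat \<Rightarrow> com" where
  "addto a b s = For a (Up b ;; Up s) ;; For s (Up a)"

definition clear :: "nat \<Rightarrow> nat \<Rightarrow> com" where
  "clear a s = For a (Down s)"

definition move :: "nat \<Rightarrow> nat \<Rightarrow> com" where
  "move a b = For a (Up b)"

lemma den_For:
  "g 0 = R(r := 0) \<Longrightarrow> (\<And>n. den c (g n) = g (Suc n)) \<Longrightarrow> den (For r c) R = g (R r)"
  by (simp add: funpow_eqI)

lemma den_move: "a \<noteq> b \<Longrightarrow> den (move a b) R = R(a := 0, b := R b + R a)"
  unfolding move_def by (subst den_For[where g = "\<lambda>n. R(a := 0, b := R b + n)"]) auto

lemma den_addto:
  assumes "a \<noteq> b" "a \<noteq> s" "b \<noteq> s" "R s = 0"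
  shows "den (addto a b s) R = R(b := R b + R a)"
proof -
  have 1: "den (For a (Up b ;; Up s)) R = R(a := 0, b := R b + R a, s := R a)"
    using assms by (subst den_For[where g = "\<lambda>n. R(a := 0, b := R b + n, s := n)"]) (auto simp: fun_eq_iff)
  have 2: "den (For s (Up a)) S = S(s := 0, a := S a + S s)" for S
    using den_move[of s a S] assms by (simp add: move_def)
  show ?thesis unfolding addto_def den.simps(3) 1 2 using assms by (auto simp: fun_eq_iff)
qed

lemma den_clear: "a \<noteq> s \<Longrightarrow> R s = 0 \<Longrightarrow> den (clear a s) R = R(a := 0)"
  unfolding clear_def by (subst den_For[where g = "\<lambda>n. R(a := 0)"]) (auto simp: fun_eq_iff)

lemma wf_addto [simp]: "a \<noteq> b \<Longrightarrow> a \<noteq> s \<Longrightarrow> b \<noteq> s \<Longrightarrow> wf_com (addto a b s)"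
  and wf_clear [simp]: "a \<noteq> s \<Longrightarrow> wf_com (clear a s)"
  and wf_move [simp]: "a \<noteq> b \<Longrightarrow> wf_com (move a b)"
  by (auto simp: addto_def clear_def move_def)

definition triprog :: "nat \<Rightarrow> nat \<Rightarrow> nat \<Rightarrow> com" where
  "triprog t b s = For t (Up s ;; addto s b (Suc s)) ;; clear s (Suc s)"

lemma den_triprog:
  assumes "t < s" "b < s" "t \<noteq> b" "R s = 0" "R (Suc s) = 0"
  shows "den (triprog t b s) R = R(t := 0, b := R b + triangle (R t))"
proof -
  have st: "den (Up s ;; addto s b (Suc s)) (R(t := 0, s := n, b := R b + triangle n))
    = R(t := 0, s := Suc n, b := R b + triangle (Suc n))" for n
    using assms unfolding den.simps(1,3) by (subst den_addto) (auto simp: fun_eq_iff)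
  have 1: "den (For t (Up s ;; addto s b (Suc s))) R = R(t := 0, s := R t, b := R b + triangle (R t))"
  proof (rule den_For[where g = "\<lambda>n. R(t := 0, s := n, b := R b + triangle n)"])
    show "R(t := 0, s := 0, b := R b + triangle 0) = R(t := 0)" using assms by (auto simp: fun_eq_iff)
  qed (rule st)
  show ?thesis unfolding triprog_def den.simps(3) 1
    using assms by (subst den_clear) (auto simp: fun_eq_iff)
qed

lemma wf_triprog: "t < s \<Longrightarrow> b < s \<Longrightarrow> t \<noteq> b \<Longrightarrow> wf_com (triprog t b s)"
  by (auto simp: triprog_def addto_def clear_def)

definition pairprog :: "nat \<Rightarrow> nat \<Rightarrow> nat \<Rightarrow> nat \<Rightarrow> com" where
  "pairprog m n b s = addto m b s ;; move n m ;; triprog m b s"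

lemma den_pairprog:
  assumes "m < s" "n < s" "b < s" "m \<noteq> n" "m \<noteq> b" "n \<noteq> b" "R b = 0" "R s = 0" "R (Suc s) = 0"
  shows "den (pairprog m n b s) R = R(m := 0, n := 0, b := prod_encode (R m, R n))"
  using assms unfolding pairprog_def
  by (simp add: den_addto den_move den_triprog prod_encode_def) (auto simp: fun_eq_iff)

lemma wf_pairprog: "m < s \<Longrightarrow> n < s \<Longrightarrow> b < s \<Longrightarrow> m \<noteq> n \<Longrightarrow> m \<noteq> b \<Longrightarrow> n \<noteq> b \<Longrightarrow> wf_com (pairprog m n b s)"
  by (simp add: pairprog_def wf_triprog)

text \<open>Cantor's pairing enumerates the diagonals: the pair after \<open>(m, Suc n)\<close> is \<open>(Suc m, n)\<close>,
  and the one after \<open>(m, 0)\<close> is \<open>(0, Suc m)\<close>.\<close>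
definition decprog :: "nat \<Rightarrow> nat \<Rightarrow> nat \<Rightarrow> nat \<Rightarrow> com" where
  "decprog a m n s = addto a s (Suc s) ;; For s (IfDec n (Up m) (Up n ;; move m n))"

fun next_pair :: "nat \<times> nat \<Rightarrow> nat \<times> nat" where
  "next_pair (m, Suc n) = (Suc m, n)"
| "next_pair (m, 0) = (0, Suc m)"

lemma prod_encode_next_pair: "prod_encode (next_pair p) = Suc (prod_encode p)"
  by (induction p rule: next_pair.induct) (simp_all add: prod_encode_def)

lemma prod_decode_Suc: "prod_decode (Suc x) = next_pair (prod_decode x)"
  by (metis prod_decode_inverse prod_encode_inverse prod_encode_next_pair)

lemma prod_decode_0: "prod_decode 0 = (0, 0)"
  by (simp add: prod_decode_def prod_decode_aux.simps)

lemma den_decprog: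
  assumes "a < s" "m < s" "n < s" "a \<noteq> m" "a \<noteq> n" "m \<noteq> n" "R m = 0" "R n = 0" "R s = 0" "R (Suc s) = 0"
  shows "den (decprog a m n s) R = R(m := fst (prod_decode (R a)), n := snd (prod_decode (R a)))"
proof -
  have st: "den (IfDec n (Up m) (Up n ;; move m n)) S
     = S(m := fst (next_pair (S m, S n)), n := snd (next_pair (S m, S n)))" for S
    using assms(6) by (cases "S n") (auto simp: den_move fun_eq_iff)
  have *: "((\<lambda>R. den (IfDec n (Up m) (Up n ;; move m n)) R) ^^ x) S
      = S(m := fst (prod_decode x), n := snd (prod_decode x))" if "S m = 0" "S n = 0" for x S
    by (rule funpow_eqI, use that in \<open>simp add: prod_decode_0 fun_eq_iff\<close>, simp only: st)
      (use assms(6) in \<open>auto simp: prod_decode_Suc fun_eq_iff\<close>)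
  show ?thesis using assms unfolding decprog_def
    by (simp add: den_addto * fun_eq_iff del: den.simps(4))
qed

lemma wf_decprog: "a < s \<Longrightarrow> m < s \<Longrightarrow> n < s \<Longrightarrow> a \<noteq> m \<Longrightarrow> a \<noteq> n \<Longrightarrow> m \<noteq> n \<Longrightarrow> wf_com (decprog a m n s)"
  by (auto simp: decprog_def move_def)

lemma used_addto [simp]: "used (addto a b s) = {a, b, s}"
  and used_clear [simp]: "used (clear a s) = {a, s}"
  and used_move [simp]: "used (move a b) = {a, b}"
  and used_triprog [simp]: "used (triprog t b s) = {t, b, s, Suc s}"
  and used_pairprog [simp]: "used (pairprog m n b s) = {m, n, b, s, Suc s}"
  and used_decprog [simp]: "used (decprog a m n s) = {a, m, n, s, Suc s}"
  by (auto simp: addto_def clear_def move_def triprog_def pairprog_def decprog_def)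

lemma UF_computable: "UF f \<Longrightarrow> \<exists>P. computes P f"
proof (induction rule: UF.induct)
  case UF_zero
  have "computes (\<lambda>a b s. Down s) (\<lambda>x. 0)"
    by (rule computesI) (auto simp: fun_eq_iff)
  then show ?case by blast
next
  case UF_id
  have "computes (\<lambda>a b s. addto a b s) (\<lambda>x. x)"
    by (rule computesI) (auto simp: den_addto)
  then show ?case by blast
next
  case UF_Suc
  have "computes (\<lambda>a b s. addto a b s ;; Up b) Suc"
    by (rule computesI) (auto simp: den_addto)
  then show ?case by blast
next
  case UF_fst
  have "computes (\<lambda>a b s. decprog a b s (Suc s) ;; clear s (Suc s)) (\<lambda>x. fst (prod_decode x))"
    by (rule computesI) (auto simp: den_decprog den_clear wf_decprog fun_eq_iff)
  then show ?case by blast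
next
  case UF_snd
  have "computes (\<lambda>a b s. decprog a s b (Suc s) ;; clear s (Suc s)) (\<lambda>x. snd (prod_decode x))"
    by (rule computesI) (auto simp: den_decprog den_clear wf_decprog fun_eq_iff)
  then show ?case by blast
next
  case (UF_pair f g)
  then obtain P Q where P: "computes P f" and Q: "computes Q g" by blast
  have "computes (\<lambda>a b s. P a s (s + 2) ;; Q a (s + 1) (s + 2) ;; pairprog s (s + 1) b (s + 2))
     (\<lambda>x. prod_encode (f x, g x))"
  proof (rule computesI, goal_cases)
    case (1 a b s)
    then show ?case using computesD(1)[OF P, of a "s + 2" s] computesD(1)[OF Q, of a "s + 2" "s + 1"]
      by (simp add: wf_pairprog)
  next
    case (2 a b s)
    then show ?case using computesD(2)[OF P, of a "s + 2" s] computesD(2)[OF Q, of a "s + 2" "s + 1"]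
      by (auto simp: subset_iff)
  next
    case (3 a b s R)
    have "den (P a s (s + 2)) R = R(s := f (R a))"
      using 3 by (intro computesD(3)[OF P]) auto
    moreover have "den (Q a (s + 1) (s + 2)) (R(s := f (R a))) = R(s := f (R a), s + 1 := g (R a))"
      using 3 by (subst computesD(3)[OF Q]) auto
    ultimately show ?case using 3 by (simp add: den_pairprog) (auto simp: fun_eq_iff)
  qed
  then show ?case by blast
next
  case (UF_comp f g)
  then obtain P Q where P: "computes P f" and Q: "computes Q g" by blast
  have "computes (\<lambda>a b s. Q a s (s + 1) ;; P s b (s + 1) ;; clear s (s + 1)) (\<lambda>x. f (g x))"
  proof (rule computesI, goal_cases)
    case (1 a b s)
    then show ?case using computesD(1)[OF P, of s "s + 1" b] computesD(1)[OF Q, of a "s + 1" s]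
      by simp
  next
    case (2 a b s)
    then show ?case using computesD(2)[OF P, of s "s + 1" b] computesD(2)[OF Q, of a "s + 1" s]
      by (auto simp: subset_iff)
  next
    case (3 a b s R)
    have "den (Q a s (s + 1)) R = R(s := g (R a))"
      using 3 by (intro computesD(3)[OF Q]) auto
    moreover have "den (P s b (s + 1)) (R(s := g (R a))) = R(s := g (R a), b := f (g (R a)))"
      using 3 by (subst computesD(3)[OF P]) auto
    ultimately show ?case using 3 by (simp add: den_clear) (auto simp: fun_eq_iff)
  qed
  then show ?case by blast
next
  case (UF_iter f)
  then obtain P where P: "computes P f" by blast
  let ?body = "\<lambda>s. P (s + 1) (s + 2) (s + 3) ;; clear (s + 1) (s + 3) ;; move (s + 2) (s + 1)"
  have "computes (\<lambda>a b s. decprog a s (s + 1) (s + 3) ;; For s (?body s) ;; move (s + 1) b)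
     (\<lambda>x. (f ^^ fst (prod_decode x)) (snd (prod_decode x)))"
  proof (rule computesI, goal_cases)
    case (1 a b s)
    then show ?case using computesD(1,2)[OF P, of "s + 1" "s + 3" "s + 2"]
      by (auto simp: wf_decprog subset_iff)
  next
    case (2 a b s)
    then show ?case using computesD(2)[OF P, of "s + 1" "s + 3" "s + 2"]
      by (auto simp: subset_iff)
  next
    case (3 a b s R)
    have body: "(den (?body s) ^^ n) S = S(s + 1 := (f ^^ n) (S (s + 1)))"
      if "\<And>r. r \<ge> s + 2 \<Longrightarrow> S r = 0" for n S
    proof (rule funpow_eqI)
      fix n
      let ?S = "S(s + 1 := (f ^^ n) (S (s + 1)))"
      have "den (P (s + 1) (s + 2) (s + 3)) ?S = ?S(s + 2 := f (?S (s + 1)))"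
        using that by (intro computesD(3)[OF P]) auto
      moreover have "den (clear (s + 1) (s + 3)) U = U(s + 1 := 0)" if "U (s + 3) = 0" for U
        using that by (simp add: den_clear)
      ultimately show "den (?body s) ?S = S(s + 1 := (f ^^ Suc n) (S (s + 1)))"
        using that by (simp add: den_move fun_eq_iff)
    qed simp
    let ?m = "fst (prod_decode (R a))" and ?n = "snd (prod_decode (R a))"
    have 1: "den (decprog a s (s + 1) (s + 3)) R = R(s := ?m, s + 1 := ?n)"
      using 3 by (intro den_decprog) auto
    have 2: "den (For s (?body s)) (R(s := ?m, s + 1 := ?n)) = R(s + 1 := (f ^^ ?m) ?n)"
      unfolding den.simps(5) using 3 by (subst body) (auto simp: fun_eq_iff)
    show ?case unfolding den.simps(3)[of "decprog _ _ _ _"] den.simps(3)[of "For _ _"] 1 2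
      using 3 by (simp add: den_move) (auto simp: fun_eq_iff)
  qed
  then show ?case by blast
qed

named_theorems UFI

abbreviation pf :: "nat \<Rightarrow> nat" where "pf x \<equiv> fst (prod_decode x)"
abbreviation ps :: "nat \<Rightarrow> nat" where "ps x \<equiv> snd (prod_decode x)"

lemma UF_const [UFI]: "UF (\<lambda>x. c)"
proof (induction c)
  case (Suc c)
  then show ?case using UF_comp[OF UF_Suc] by simp
qed (rule UF_zero)

lemma UF_Suc' [UFI]: "UF f \<Longrightarrow> UF (\<lambda>x. Suc (f x))"
  by (rule UF_comp[OF UF_Suc])

lemma UF_fst' [UFI]: "UF f \<Longrightarrow> UF (\<lambda>x. pf (f x))"
  by (rule UF_comp[OF UF_fst])

lemma UF_snd' [UFI]: "UF f \<Longrightarrow> UF (\<lambda>x. ps (f x))"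
  by (rule UF_comp[OF UF_snd])

lemma UF_funpow: "UF f \<Longrightarrow> UF n \<Longrightarrow> UF z \<Longrightarrow> UF (\<lambda>x. (f ^^ n x) (z x))"
  using UF_comp[OF UF_iter UF_pair, of f n z] by simp

declare UF_id [UFI] UF_pair [UFI]

lemma UF_add [UFI]: "UF f \<Longrightarrow> UF g \<Longrightarrow> UF (\<lambda>x. f x + g x)"
proof -
  assume *: "UF f" "UF g"
  have "(Suc ^^ m) n = m + n" for m n by (induction m) auto
  then show ?thesis using UF_funpow[OF UF_Suc *] by simp
qed

lemma UF_pred [UFI]: "UF f \<Longrightarrow> UF (\<lambda>x. f x - 1)"
proof -
  assume f: "UF f"
  let ?s = "\<lambda>p. prod_encode (Suc (pf p), pf p)"
  have "UF ?s" by (intro UFI)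
  then have u: "UF (\<lambda>x. ps ((?s ^^ f x) (prod_encode (0, 0))))"
    using f by (intro UFI UF_funpow \<open>UF ?s\<close>)
  have "(?s ^^ n) (prod_encode (0, 0)) = prod_encode (n, n - 1)" for n
    by (rule funpow_eqI) auto
  then show ?thesis using u by simp
qed

lemma UF_diff [UFI]: "UF f \<Longrightarrow> UF g \<Longrightarrow> UF (\<lambda>x. f x - g x)"
proof -
  assume *: "UF f" "UF g"
  have "((\<lambda>x. x - 1) ^^ n) m = m - n" for m n :: nat
    by (rule funpow_eqI) auto
  then show ?thesis using UF_funpow[OF UF_pred[OF UF_id] *(2,1)] by simp
qed

lemma UF_mult [UFI]: "UF f \<Longrightarrow> UF g \<Longrightarrow> UF (\<lambda>x. f x * g x)"
proof -
  assume *: "UF f" "UF g"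
  let ?s = "\<lambda>p. prod_encode (pf p + ps p, ps p)"
  have "UF ?s" by (intro UFI)
  then have u: "UF (\<lambda>x. pf ((?s ^^ f x) (prod_encode (0, g x))))"
    by (intro UFI UF_funpow \<open>UF ?s\<close> *)
  have "(?s ^^ m) (prod_encode (0, n)) = prod_encode (m * n, n)" for m n
    by (rule funpow_eqI) auto
  then show ?thesis using u by simp
qed

section \<open>Recursively enumerable predicates on numbers\<close>

definition re0 :: "(nat \<Rightarrow> bool) \<Rightarrow> bool" where
  "re0 P \<longleftrightarrow> (\<exists>f. UF f \<and> (\<forall>x. P x \<longleftrightarrow> (\<exists>c. f (prod_encode (x, c)) = 0)))"

lemma re0I: "UF f \<Longrightarrow> (\<And>x. P x \<longleftrightarrow> (\<exists>c. f (prod_encode (x, c)) = 0)) \<Longrightarrow> re0 P"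
  unfolding re0_def by blast

lemma re0E:
  assumes "re0 P"
  obtains f where "UF f" "P = (\<lambda>x. \<exists>c. f (prod_encode (x, c)) = 0)"
  proof -
  obtain f where "UF f" "\<And>x. P x \<longleftrightarrow> (\<exists>c. f (prod_encode (x, c)) = 0)"
    using assms unfolding re0_def by blast
  then show ?thesis using that[of f] by presburger
qed

lemma ex_pair_iff: "(\<exists>c. Q (pf c) (ps c)) \<longleftrightarrow> (\<exists>a b. Q a b)"
  by (metis fst_conv snd_conv prod_encode_inverse)

lemma re0_comp: "re0 P \<Longrightarrow> UF g \<Longrightarrow> re0 (\<lambda>x. P (g x))"
proof (erule re0E)
  fix f assume *: "UF f" "UF g" and P: "P = (\<lambda>x. \<exists>c. f (prod_encode (x, c)) = 0)"
  have "UF (\<lambda>z. f (prod_encode (g (pf z), ps z)))"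
    by (intro UFI UF_comp[OF *(1)] UF_comp[OF *(2)])
  then show "re0 (\<lambda>x. P (g x))" by (rule re0I) (simp add: P)
qed

lemma re0_conj: "re0 P \<Longrightarrow> re0 Q \<Longrightarrow> re0 (\<lambda>x. P x \<and> Q x)"
proof (elim re0E)
  fix f g assume *: "UF f" "UF g" and
    P: "P = (\<lambda>x. \<exists>c. f (prod_encode (x, c)) = 0)" "Q = (\<lambda>x. \<exists>c. g (prod_encode (x, c)) = 0)"
  have "UF (\<lambda>z. f (prod_encode (pf z, pf (ps z))) + g (prod_encode (pf z, ps (ps z))))"
    by (intro UFI UF_comp[OF *(1)] UF_comp[OF *(2)])
  then show "re0 (\<lambda>x. P x \<and> Q x)"
    by (rule re0I)
      (simp add: P ex_pair_iff[of "\<lambda>a b. f (prod_encode (_, a)) = 0 \<and> g (prod_encode (_, b)) = 0"])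
qed

lemma re0_disj: "re0 P \<Longrightarrow> re0 Q \<Longrightarrow> re0 (\<lambda>x. P x \<or> Q x)"
proof (elim re0E)
  fix f g assume *: "UF f" "UF g" and
    P: "P = (\<lambda>x. \<exists>c. f (prod_encode (x, c)) = 0)" "Q = (\<lambda>x. \<exists>c. g (prod_encode (x, c)) = 0)"
  show "re0 (\<lambda>x. P x \<or> Q x)"
    by (rule re0I[OF UF_mult[OF *]]) (auto simp: P)
qed

lemma re0_ex: "re0 P \<Longrightarrow> re0 (\<lambda>x. \<exists>y. P (prod_encode (x, y)))"
proof (elim re0E)
  fix f assume *: "UF f" and P: "P = (\<lambda>x. \<exists>c. f (prod_encode (x, c)) = 0)"
  have "UF (\<lambda>z. f (prod_encode (prod_encode (pf z, pf (ps z)), ps (ps z))))"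
    by (intro UFI UF_comp[OF *])
  then show "re0 (\<lambda>x. \<exists>y. P (prod_encode (x, y)))"
    by (rule re0I)
      (simp add: P ex_pair_iff[of "\<lambda>a b. f (prod_encode (prod_encode (_, a), b)) = 0"])
qed

lemma re0_zero: "UF f \<Longrightarrow> re0 (\<lambda>x. f x = 0)"
  by (rule re0I[of "\<lambda>z. f (pf z)"]) (auto intro!: UFI intro: UF_comp)

lemma re0_eq: "UF f \<Longrightarrow> UF g \<Longrightarrow> re0 (\<lambda>x. f x = g x)"
proof -
  assume "UF f" "UF g"
  then have "re0 (\<lambda>x. (f x - g x) + (g x - f x) = 0)"
    by (intro re0_zero UFI)
  then show ?thesis by (rule back_subst[of re0]) (auto simp: fun_eq_iff)
qed

lemma re0_neq: "UF f \<Longrightarrow> UF g \<Longrightarrow> re0 (\<lambda>x. f x \<noteq> g x)"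
proof -
  assume "UF f" "UF g"
  then have "re0 (\<lambda>x. 1 - ((f x - g x) + (g x - f x)) = 0)"
    by (intro re0_zero UFI)
  then show ?thesis by (rule back_subst[of re0]) (auto simp: fun_eq_iff)
qed

lemma re0_le: "UF f \<Longrightarrow> UF g \<Longrightarrow> re0 (\<lambda>x. f x \<le> g x)"
proof -
  assume "UF f" "UF g"
  then have "re0 (\<lambda>x. f x - g x = 0)" by (intro re0_zero UFI)
  then show ?thesis by (rule back_subst[of re0]) (auto simp: fun_eq_iff)
qed

lemma re0_True: "re0 (\<lambda>x. True)"
  using re0_zero[OF UF_zero] by simp

definition lhd :: "nat \<Rightarrow> nat" where "lhd n = pf (n - 1)"
definition ltl :: "nat \<Rightarrow> nat" where "ltl n = ps (n - 1)"

lemma UF_lhd [UFI]: "UF f \<Longrightarrow> UF (\<lambda>x. lhd (f x))" and UF_ltl [UFI]: "UF f \<Longrightarrow> UF (\<lambda>x. ltl (f x))"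
  unfolding lhd_def ltl_def by (intro UFI, assumption)+

lemma list_code_simps [simp]: "lhd (Suc (prod_encode (x, l))) = x" "ltl (Suc (prod_encode (x, l))) = l" "ltl 0 = 0"
  by (simp_all add: lhd_def ltl_def prod_decode_0)

lemma length_le_list_encode: "length xs \<le> list_encode xs"
proof (induction xs)
  case (Cons x xs)
  then show ?case using le_prod_encode_2[of "list_encode xs" x] by simp
qed simp

text \<open>Bounded universal quantification keeps the existential form because the witnesses for
  the finitely many members fit into one coded list.\<close>

lemma re0_ball:
  assumes "re0 P" "UF l"
  shows "re0 (\<lambda>x. \<forall>y\<in>set (list_decode (l x)). P (prod_encode (x, y)))"
proof -
  obtain f where f: "UF f" and P: "P = (\<lambda>x. \<exists>c. f (prod_encode (x, c)) = 0)"
    using assms(1) by (rule re0E)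
  \<comment> \<open>the state \<open>(x, l, cs, acc)\<close> consumes the list \<open>l\<close> and the list \<open>cs\<close> of witnesses in parallel\<close>
  define s where "s z = (let x = pf z; l = pf (ps z); cs = pf (ps (ps z)); acc = ps (ps (ps z)) in
     prod_encode (x, prod_encode (ltl l, prod_encode (ltl cs,
       acc + (1 - (1 - l)) * f (prod_encode (prod_encode (x, lhd l), lhd cs))))))" for z
  have "UF s" unfolding s_def Let_def by (intro UFI UF_comp[OF f])
  define st where "st x l cs acc = prod_encode (x, prod_encode (l, prod_encode (cs, acc)))" for x l cs acc
  define acc where "acc z = ps (ps (ps z))" for z
  \<comment> \<open>The code of a list bounds its length, so \<open>l x\<close> rounds suffice; in
    surplus rounds the list is 0 and the factor \<open>1 - (1 - l)\<close> suppresses any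
    contribution.\<close>
  have UFacc: "UF (\<lambda>z. acc ((s ^^ l (pf z)) (st (pf z) (l (pf z)) (ps z) 0)))"
    unfolding st_def acc_def
    by (intro UFI UF_funpow \<open>UF s\<close> UF_comp[OF assms(2)])
  have s_st: "s (st x l cs a) = st x (ltl l) (ltl cs)
      (a + (1 - (1 - l)) * f (prod_encode (prod_encode (x, lhd l), lhd cs)))" for x l cs a
    by (simp add: s_def st_def)
  have s0: "(s ^^ n) (st x 0 cs a) = st x 0 ((ltl ^^ n) cs) a" for n x cs a
    by (rule funpow_eqI[of "\<lambda>n. st x 0 ((ltl ^^ n) cs) a"]) (auto simp: s_st)
  \<comment> \<open>Choosing a list of witnesses is choosing its head and its tail
    independently.\<close>
  have ex: "(\<exists>cs. Q (lhd cs) (ltl cs)) \<longleftrightarrow> (\<exists>c cs. Q c cs)" for Q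
    by (metis list_code_simps(1,2))
  have main: "(\<exists>cs. acc ((s ^^ n) (st x (list_encode ls) cs a)) = 0)
      \<longleftrightarrow> a = 0 \<and> (\<forall>y\<in>set ls. P (prod_encode (x, y)))" if "length ls \<le> n" for ls n x a
    using that
  proof (induction ls arbitrary: n a)
    case Nil
    then show ?case by (simp add: s0) (simp add: acc_def st_def)
  next
    case (Cons y ls)
    then obtain m where n: "n = Suc m" and m: "length ls \<le> m" by (cases n) auto
    have "acc ((s ^^ n) (st x (list_encode (y # ls)) cs a)) =
       acc ((s ^^ m) (st x (list_encode ls) (ltl cs) (a + f (prod_encode (prod_encode (x, y), lhd cs)))))" for cs
      unfolding n funpow_Suc_right comp_apply s_st by simp
    then have "(\<exists>cs. acc ((s ^^ n) (st x (list_encode (y # ls)) cs a)) = 0) \<longleftrightarrow>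
       (\<exists>c cs. acc ((s ^^ m) (st x (list_encode ls) cs (a + f (prod_encode (prod_encode (x, y), c))))) = 0)"
      by (simp only: ex[of "\<lambda>c cs. acc ((s ^^ m) (st x (list_encode ls) cs (a + f (prod_encode (prod_encode (x, y), c))))) = 0"])
    also have "\<dots> \<longleftrightarrow> a = 0 \<and> (\<forall>y\<in>set (y # ls). P (prod_encode (x, y)))"
      unfolding Cons.IH[OF m] by (auto simp: P)
    finally show ?case .
  qed
  show ?thesis
  proof (rule re0I[OF UFacc], goal_cases)
    case (1 x)
    have "length (list_decode (l x)) \<le> l x"
      using length_le_list_encode[of "list_decode (l x)"] by simp
    from main[OF this, of x 0] show ?case by simp
  qed
qed

lemma re0_mem:
  assumes "UF f" "UF g"
  shows "re0 (\<lambda>x. f x \<in> set (list_decode (g x)))"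
proof -
  have *: "y \<in> set (list_decode l) \<longleftrightarrow> (\<exists>i. (ltl ^^ i) l \<noteq> 0 \<and> lhd ((ltl ^^ i) l) = y)" for y l
  proof (induction l rule: less_induct)
    case (less l)
    show ?case
    proof (cases "l = 0")
      case True
      have "(ltl ^^ i) 0 = 0" for i by (induction i) auto
      then show ?thesis using True by simp
    next
      case False
      then obtain x t where l: "l = Suc (prod_encode (x, t))"
        by (metis not0_implies_Suc prod.collapse prod_decode_inverse)
      then have "t < l" using le_prod_encode_2[of t x] by simp
      have "(\<exists>i. (ltl ^^ i) l \<noteq> 0 \<and> lhd ((ltl ^^ i) l) = y) \<longleftrightarrow>
         x = y \<or> (\<exists>i. (ltl ^^ i) t \<noteq> 0 \<and> lhd ((ltl ^^ i) t) = y)"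
        (is "?L \<longleftrightarrow> ?R")
      proof
        assume ?L
        then obtain i where i: "(ltl ^^ i) l \<noteq> 0 \<and> lhd ((ltl ^^ i) l) = y" by blast
        then show ?R by (cases i) (auto simp: l funpow_Suc_right simp del: funpow.simps(2))
      next
        assume ?R
        then show ?L
        proof
          assume "x = y" then show ?L by (intro exI[of _ 0]) (simp add: l)
        next
          assume "\<exists>i. (ltl ^^ i) t \<noteq> 0 \<and> lhd ((ltl ^^ i) t) = y"
          then obtain i where "(ltl ^^ i) t \<noteq> 0 \<and> lhd ((ltl ^^ i) t) = y" ..
          then show ?L
            by (intro exI[of _ "Suc i"]) (simp add: l funpow_Suc_right del: funpow.simps(2))
        qed
      qed
      then show ?thesis using less[OF \<open>t < l\<close>] by (simp add: l) blast
    qed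
  qed
  let ?t = "\<lambda>z. (ltl ^^ ps z) (g (pf z))"
  have t: "UF ?t" using UF_ltl[OF UF_id] by (intro UF_funpow UFI UF_comp[OF assms(2)])
  have "re0 (\<lambda>z. ?t z \<noteq> 0 \<and> lhd (?t z) = f (pf z))"
    by (intro re0_conj re0_eq re0_neq UFI t UF_comp[OF assms(1)])
  from re0_ex[OF this] show ?thesis by (simp add: *)
qed

text \<open>The tool for recursive definitions: a derivation of \<open>P x\<close> is stored as a
  finite set \<open>Z\<close> in which every member has a rule instance with premises in
  \<open>Z\<close>. The decreasing measure \<open>m\<close> excludes circular
  justifications.\<close>

lemma re0_wf:
  assumes Q: "re0 Q"
    and P: "\<And>x. P x \<longleftrightarrow> (\<exists>l. Q (prod_encode (x, l)) \<and> (\<forall>y\<in>set (list_decode l). P y))"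
    and m: "\<And>x l y. Q (prod_encode (x, l)) \<Longrightarrow> y \<in> set (list_decode l) \<Longrightarrow> m y < (m x :: nat)"
  shows "re0 P"
proof -
  define C where "C Z \<longleftrightarrow> (\<forall>z\<in>set (list_decode Z). \<exists>l. Q (prod_encode (z, l)) \<and>
     (\<forall>y\<in>set (list_decode l). y \<in> set (list_decode Z)))" for Z
  have "re0 (\<lambda>w. \<forall>y\<in>set (list_decode (ps w)). ps (prod_encode (w, y)) \<in> set (list_decode (pf (pf (pf (prod_encode (w, y)))))))"
    by (rule re0_ball[of "\<lambda>v. ps v \<in> set (list_decode (pf (pf (pf v))))" ps]) (intro re0_mem UFI)+
  then have 1: "re0 (\<lambda>w. \<forall>y\<in>set (list_decode (ps w)). y \<in> set (list_decode (pf (pf w))))" by simp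
  have "re0 (\<lambda>w. Q (prod_encode (ps (pf w), ps w)))" by (intro re0_comp[OF Q] UFI)
  from re0_ex[OF re0_conj[OF this 1]]
  have "re0 (\<lambda>v. \<exists>l. Q (prod_encode (ps v, l)) \<and> (\<forall>y\<in>set (list_decode l). y \<in> set (list_decode (pf v))))"
    by simp
  from re0_ball[OF this UF_id] have C: "re0 C" unfolding C_def by simp
  have "re0 (\<lambda>v. pf v \<in> set (list_decode (ps v)) \<and> C (ps v))"
    by (intro re0_conj re0_mem re0_comp[OF C] UFI)
  from re0_ex[OF this] have *: "re0 (\<lambda>x. \<exists>Z. x \<in> set (list_decode Z) \<and> C Z)" by simp
  have "P x \<longleftrightarrow> (\<exists>Z. x \<in> set (list_decode Z) \<and> C Z)" for x
  proof
    assume "\<exists>Z. x \<in> set (list_decode Z) \<and> C Z"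
    then obtain Z where x: "x \<in> set (list_decode Z)" and Z: "C Z" by blast
    from x show "P x"
    proof (induction "m x" arbitrary: x rule: less_induct)
      case less
      then obtain l where l: "Q (prod_encode (x, l))" "\<forall>y\<in>set (list_decode l). y \<in> set (list_decode Z)"
        using Z unfolding C_def by blast
      then have "\<forall>y\<in>set (list_decode l). P y" using less m by blast
      then show ?case using P l by blast
    qed
  next
    assume "P x"
    then show "\<exists>Z. x \<in> set (list_decode Z) \<and> C Z"
    proof (induction "m x" arbitrary: x rule: less_induct)
      case less
      from \<open>P x\<close> obtain l where l: "Q (prod_encode (x, l))" "\<forall>y\<in>set (list_decode l). P y" using P by blast
      then have "\<forall>y\<in>set (list_decode l). \<exists>Z. y \<in> set (list_decode Z) \<and> C Z" using less m by blast
      then obtain Z where Z: "\<And>y. y \<in> set (list_decode l) \<Longrightarrow> y \<in> set (list_decode (Z y)) \<and> C (Z y)" by metis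
      define U where "U = list_encode (x # concat (map (\<lambda>y. list_decode (Z y)) (list_decode l)))"
      have U: "set (list_decode U) = insert x (\<Union>y\<in>set (list_decode l). set (list_decode (Z y)))"
        by (simp add: U_def del: list_encode.simps)
      have "\<exists>k. Q (prod_encode (z, k)) \<and> (\<forall>y\<in>set (list_decode k). y \<in> set (list_decode U))"
        if "z \<in> set (list_decode U)" for z
        using that unfolding U
      proof
        assume "z = x"
        then show "\<exists>k. Q (prod_encode (z, k)) \<and> (\<forall>y\<in>set (list_decode k).
            y \<in> insert x (\<Union>y\<in>set (list_decode l). set (list_decode (Z y))))"
          using l Z by blast
      next
        assume "z \<in> (\<Union>y\<in>set (list_decode l). set (list_decode (Z y)))"
        then obtain y where "y \<in> set (list_decode l)" "z \<in> set (list_decode (Z y))" by blast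
        then show "\<exists>k. Q (prod_encode (z, k)) \<and> (\<forall>y\<in>set (list_decode k).
            y \<in> insert x (\<Union>y\<in>set (list_decode l). set (list_decode (Z y))))"
          using Z[of y] unfolding C_def by blast
      qed
      then have "C U" unfolding C_def by blast
      then show ?case using U by blast
    qed
  qed
  then show ?thesis using * by presburger
qed

section \<open>Coded types and semidecidable predicates\<close>

text \<open>An existential quantifier over the type becomes one over numbers that must reject
  non-codes; hence the range has to be enumerable.\<close>

class coded =
  fixes cd :: "'a \<Rightarrow> nat"
  assumes inj_cd: "inj cd" and re0_range: "re0 (\<lambda>n. \<exists>x. n = cd x)"

lemma cd_eq [simp]: "cd x = cd y \<longleftrightarrow> x = y"
  using inj_cd by (auto simp: inj_def)

instantiation nat :: coded
begin
definition cd_nat :: "nat \<Rightarrow> nat" where "cd_nat n = n"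
instance by standard (auto simp: cd_nat_def inj_def re0_True)
end

instantiation prod :: (coded, coded) coded
begin
definition cd_prod :: "'a \<times> 'b \<Rightarrow> nat" where "cd_prod p = prod_encode (cd (fst p), cd (snd p))"
instance
proof
  show "inj (cd :: 'a \<times> 'b \<Rightarrow> nat)" by (auto simp: inj_def cd_prod_def)
  have "re0 (\<lambda>n. (\<exists>x::'a. pf n = cd x) \<and> (\<exists>x::'b. ps n = cd x))"
    by (intro re0_conj re0_comp[OF re0_range] UFI)
  moreover have "((\<exists>x::'a. pf n = cd x) \<and> (\<exists>x::'b. ps n = cd x)) \<longleftrightarrow> (\<exists>x::'a \<times> 'b. n = cd x)" for n
    unfolding cd_prod_def by (metis fst_conv snd_conv prod.collapse prod_decode_inverse prod_encode_inverse)
  ultimately show "re0 (\<lambda>n. \<exists>x::'a \<times> 'b. n = cd x)" by simp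
qed
end

instantiation list :: (coded) coded
begin
definition cd_list :: "'a list \<Rightarrow> nat" where "cd_list xs = list_encode (map cd xs)"
instance
proof
  show "inj (cd :: 'a list \<Rightarrow> nat)"
    by (auto simp: inj_def cd_list_def list_encode_eq inj_map_eq_map[OF inj_cd])
  have "re0 (\<lambda>z. \<exists>x::'a. ps z = cd x)" by (rule re0_comp[OF re0_range]) (intro UFI)
  from re0_ball[OF this UF_id] have "re0 (\<lambda>n. \<forall>y\<in>set (list_decode n). \<exists>x::'a. y = cd x)" by simp
  moreover have "(\<forall>y\<in>set (list_decode n). \<exists>x::'a. y = cd x) \<longleftrightarrow> (\<exists>xs::'a list. n = cd xs)" for n
  proof -
    have "(\<exists>xs::'a list. n = cd xs) \<longleftrightarrow> (\<exists>xs::'a list. list_decode n = map cd xs)"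
      by (metis cd_list_def list_decode_inverse list_encode_inverse)
    then show ?thesis by (simp add: ex_map_conv)
  qed
  ultimately show "re0 (\<lambda>n. \<exists>x::'a list. n = cd x)" by simp
qed
end

lemma enc_cmp_eq: "enc_cmp c = enc_cmp d \<longleftrightarrow> c = d"
  by (cases c; cases d) auto

lemma enc_cmp_range: "(\<exists>c. n = enc_cmp c) \<longleftrightarrow> n \<le> 5"
proof
  assume "n \<le> 5"
  then consider "n = 0" | "n = 1" | "n = 2" | "n = 3" | "n = 4" | "n = 5" by linarith
  then show "\<exists>c. n = enc_cmp c" by cases (metis enc_cmp.simps)+
next
  assume "\<exists>c. n = enc_cmp c"
  then obtain c where "n = enc_cmp c" ..
  then show "n \<le> 5" by (cases c) auto
qed

instantiation cmp :: coded
begin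
definition cd_cmp :: "cmp \<Rightarrow> nat" where "cd_cmp = enc_cmp"
instance by standard (auto simp: cd_cmp_def inj_def enc_cmp_eq enc_cmp_range intro!: re0_le UFI)
end

lemma le_triangle: "n \<le> triangle n"
  by (induction n) auto

lemma enc_eq: "enc a = enc b \<longleftrightarrow> a = b"
proof (induction a arbitrary: b)
  case (Prop x) then show ?case by (cases b) auto
next
  case (Freeze a) then show ?case by (cases b) auto
next
  case (Constr x1 x2) then show ?case by (cases b) (auto simp: enc_cmp_eq)
next
  case (And a1 a2) then show ?case by (cases b) auto
next
  case (Or a1 a2) then show ?case by (cases b) auto
next
  case (Until a1 a2) then show ?case by (cases b) auto
next
  case (Release a1 a2) then show ?case by (cases b) auto
qed

instantiation tptl :: coded
begin
definition cd_tptl :: "tptl \<Rightarrow> nat" where "cd_tptl = enc"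
instance
proof
  show "inj (cd :: tptl \<Rightarrow> nat)" by (auto simp: inj_def cd_tptl_def enc_eq)
  \<comment> \<open>\<open>Q\<close> links a code with the list of the codes of its immediate
    subformulas. The measure for \<open>re0_wf\<close> is the code itself: a formula with
    subformulas has a positive tag, which makes the second component of the pair strictly smaller
    than the pair.\<close>
  define Q where "Q z \<longleftrightarrow> (let x = pf z; l = ps z in
     (pf x = 0 \<and> l = 0) \<or> (pf x = 1 \<and> l = Suc (prod_encode (ps x, 0))) \<or>
     (pf x = 2 \<and> pf (ps x) \<le> 5 \<and> l = 0) \<or>
     (3 \<le> pf x \<and> pf x \<le> 6 \<and> l = Suc (prod_encode (pf (ps x), Suc (prod_encode (ps (ps x), 0))))))" for z
  have "re0 Q" unfolding Q_def Let_def by (intro re0_conj re0_disj re0_eq re0_le UFI)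
  then show "re0 (\<lambda>n. \<exists>x::tptl. n = cd x)"
  proof (rule re0_wf[where m = id])
    fix x l y
    assume "Q (prod_encode (x, l))" and y: "y \<in> set (list_decode l)"
    then have Q: "(pf x = 0 \<and> l = 0) \<or> (pf x = 1 \<and> l = Suc (prod_encode (ps x, 0))) \<or>
     (pf x = 2 \<and> pf (ps x) \<le> 5 \<and> l = 0) \<or>
     (3 \<le> pf x \<and> pf x \<le> 6 \<and> l = Suc (prod_encode (pf (ps x), Suc (prod_encode (ps (ps x), 0)))))"
      by (simp add: Q_def)
    have "ps x < x" if "pf x > 0"
    proof -
      have "x = prod_encode (pf x, ps x)" by simp
      also have "\<dots> = triangle (pf x + ps x) + pf x" by (simp only: prod_encode_def split_conv)
      finally show ?thesis using that le_triangle[of "pf x + ps x"] by linarith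
    qed
    moreover have "pf z \<le> z" "ps z \<le> z" for z
      using le_prod_encode_1[of "pf z" "ps z"] le_prod_encode_2[of "ps z" "pf z"] by simp_all
    moreover have "pf x > 0 \<and> (y = ps x \<or> y = pf (ps x) \<or> y = ps (ps x))"
      using Q y by auto
    ultimately show "id y < id x" by (metis id_apply le_less_trans)
  next
    fix x
    have *: "x = prod_encode (pf x, ps x)" by simp
    have **: "ps x = prod_encode (pf (ps x), ps (ps x))" by simp
    have Q: "(\<exists>l. Q (prod_encode (x, l)) \<and> (\<forall>y\<in>set (list_decode l). \<exists>a. y = enc a)) \<longleftrightarrow>
        pf x = 0 \<or> (pf x = 1 \<and> (\<exists>a. ps x = enc a)) \<or> (pf x = 2 \<and> (\<exists>c. pf (ps x) = enc_cmp c)) \<or>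
        (3 \<le> pf x \<and> pf x \<le> 6 \<and> (\<exists>a. pf (ps x) = enc a) \<and> (\<exists>a. ps (ps x) = enc a))" (is "_ \<longleftrightarrow> ?R")
    proof -
      have Qx: "Q (prod_encode (x, l)) \<longleftrightarrow> (pf x = 0 \<and> l = 0) \<or> (pf x = 1 \<and> l = Suc (prod_encode (ps x, 0))) \<or>
         (pf x = 2 \<and> pf (ps x) \<le> 5 \<and> l = 0) \<or>
         (3 \<le> pf x \<and> pf x \<le> 6 \<and> l = Suc (prod_encode (pf (ps x), Suc (prod_encode (ps (ps x), 0)))))" for l
        by (simp only: Q_def Let_def prod_encode_inverse fst_conv snd_conv)
      have ls: "list_decode 0 = []" "list_decode (Suc (prod_encode (y, 0))) = [y]"
        "list_decode (Suc (prod_encode (y, Suc (prod_encode (z, 0))))) = [y, z]" for y z by simp_all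
      have ball: "(\<forall>y\<in>set []. A y) \<longleftrightarrow> True" "(\<forall>y\<in>set [u]. A y) \<longleftrightarrow> A u" "(\<forall>y\<in>set [u, v]. A y) \<longleftrightarrow> A u \<and> A v"
        for A :: "nat \<Rightarrow> bool" and u v by simp_all
      have one: "(\<exists>l. (A1 \<and> l = l1 \<or> A2 \<and> l = l2 \<or> A3 \<and> A3' \<and> l = l1 \<or> A4 \<and> A4' \<and> l = l4) \<and> B l) \<longleftrightarrow>
        A1 \<and> B l1 \<or> A2 \<and> B l2 \<or> A3 \<and> A3' \<and> B l1 \<or> A4 \<and> A4' \<and> B l4"
        for A1 A2 A3 A3' A4 A4' and l1 l2 l4 :: nat and B by blast
      show ?thesis unfolding Qx one ls ball enc_cmp_range by simp
    qed
    have "(\<exists>a. x = enc a) \<longleftrightarrow> ?R"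
    proof
      assume "\<exists>a. x = enc a"
      then obtain a where "x = enc a" ..
      then show ?R by (cases a) auto
    next
      assume ?R
      then consider "x = enc (Prop (ps x))" | a where "x = enc (Freeze a)"
        | c where "x = enc (Constr c (ps (ps x)))"
        | a b where "3 \<le> pf x" "pf x \<le> 6" "pf (ps x) = enc a" "ps (ps x) = enc b"
        using * ** by (metis enc.simps(1,2,3))
      then show "\<exists>a. x = enc a"
      proof cases
        case (4 a b)
        then have "x = prod_encode (pf x, prod_encode (enc a, enc b))" using * ** by metis
        moreover have "pf x = 3 \<or> pf x = 4 \<or> pf x = 5 \<or> pf x = 6" using 4 by linarith
        ultimately show ?thesis by (metis enc.simps(4-7))
      qed blast+
    qed
    then show "(\<exists>a::tptl. x = cd a) \<longleftrightarrow> (\<exists>l. Q (prod_encode (x, l)) \<and> (\<forall>y\<in>set (list_decode l). \<exists>a::tptl. y = cd a))"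
      unfolding cd_tptl_def Q .
  qed
qed
end

section \<open>Enumerable predicates and computable functions on coded types\<close>

definition re :: "('a::coded \<Rightarrow> bool) \<Rightarrow> bool" where
  "re P \<longleftrightarrow> (\<exists>Q. re0 Q \<and> (\<forall>x. P x \<longleftrightarrow> Q (cd x)))"

text \<open>For a total function an enumerable graph amounts to computability. The stronger
  \<open>sf\<close>, given by a \<open>UF\<close> function on codes, serves to get constructors and
  substitution started.\<close>

definition cf :: "('a::coded \<Rightarrow> 'b::coded) \<Rightarrow> bool" where
  "cf f \<longleftrightarrow> re (\<lambda>p. snd p = f (fst p))"

definition sf :: "('a::coded \<Rightarrow> 'b::coded) \<Rightarrow> bool" where
  "sf f \<longleftrightarrow> (\<exists>g. UF g \<and> (\<forall>x. cd (f x) = g (cd x)))"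

lemma reI: "re0 Q \<Longrightarrow> (\<And>x. P x \<longleftrightarrow> Q (cd x)) \<Longrightarrow> re P"
  unfolding re_def by blast

lemma re_sf: assumes "re P" "sf f" shows "re (\<lambda>x. P (f x))"
proof -
  obtain Q g where "re0 Q" "\<And>x. P x \<longleftrightarrow> Q (cd x)" "UF g" "\<And>x. cd (f x) = g (cd x)"
    using assms unfolding re_def sf_def by blast
  then show ?thesis by (intro reI[OF re0_comp[of Q g]]) auto
qed

named_theorems sfi

lemma sfI: "UF g \<Longrightarrow> (\<And>x. cd (f x) = g (cd x)) \<Longrightarrow> sf f"
  unfolding sf_def by blast

lemma sf_const [sfi]: "sf (\<lambda>x. c)"
  by (rule sfI[OF UF_const]) (rule refl)

lemma sf_id [sfi]: "sf (\<lambda>x. x)"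
  by (rule sfI[OF UF_id]) (rule refl)

lemma sf_lift1: assumes "UF h" "\<And>y. cd (c y) = h (cd y)" "sf f" shows "sf (\<lambda>x. c (f x))"
proof -
  obtain g where g: "UF g" "\<And>x. cd (f x) = g (cd x)" using assms(3) unfolding sf_def by blast
  show ?thesis by (rule sfI[OF UF_comp[OF assms(1) g(1)]]) (simp add: assms(2) g(2))
qed

lemma sf_lift2:
  assumes "UF h" "\<And>y z. cd (c y z) = h (prod_encode (cd y, cd z))" "sf f" "sf g"
  shows "sf (\<lambda>x. c (f x) (g x))"
proof -
  obtain k where k: "UF k" "\<And>x. cd (f x) = k (cd x)" using assms(3) unfolding sf_def by blast
  obtain l where l: "UF l" "\<And>x. cd (g x) = l (cd x)" using assms(4) unfolding sf_def by blast
  show ?thesis by (rule sfI[OF UF_comp[OF assms(1) UF_pair[OF k(1) l(1)]]]) (simp add: assms(2) k(2) l(2))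
qed

lemma sf_fst [sfi]: "sf f \<Longrightarrow> sf (\<lambda>x. fst (f x))"
  by (rule sf_lift1[where h = pf]) (auto simp: cd_prod_def intro!: UFI)

lemma sf_snd [sfi]: "sf f \<Longrightarrow> sf (\<lambda>x. snd (f x))"
  by (rule sf_lift1[where h = ps]) (auto simp: cd_prod_def intro!: UFI)

lemma sf_pair [sfi]: "sf f \<Longrightarrow> sf g \<Longrightarrow> sf (\<lambda>x. (f x, g x))"
  by (rule sf_lift2[where h = id]) (auto simp: cd_prod_def id_def intro!: UFI)

lemma sf_Cons [sfi]: "sf f \<Longrightarrow> sf g \<Longrightarrow> sf (\<lambda>x. f x # g x)"
  by (rule sf_lift2[where h = Suc]) (auto simp: cd_list_def intro!: UF_Suc)

lemma sf_Suc [sfi]: "sf f \<Longrightarrow> sf (\<lambda>x. Suc (f x))"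
  by (rule sf_lift1[where h = Suc]) (auto simp: cd_nat_def intro!: UF_Suc)

lemma sf_add [sfi]: "sf f \<Longrightarrow> sf g \<Longrightarrow> sf (\<lambda>x. f x + g x :: nat)"
  by (rule sf_lift2[where h = "\<lambda>x. pf x + ps x"]) (auto simp: cd_nat_def intro!: UFI)

lemma sf_mult [sfi]: "sf f \<Longrightarrow> sf g \<Longrightarrow> sf (\<lambda>x. f x * g x :: nat)"
  by (rule sf_lift2[where h = "\<lambda>x. pf x * ps x"]) (auto simp: cd_nat_def intro!: UFI)

lemma sf_diff [sfi]: "sf f \<Longrightarrow> sf g \<Longrightarrow> sf (\<lambda>x. f x - g x :: nat)"
  by (rule sf_lift2[where h = "\<lambda>x. pf x - ps x"]) (auto simp: cd_nat_def intro!: UFI)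

lemma sf_Prop [sfi]: "sf f \<Longrightarrow> sf (\<lambda>x. Prop (f x))"
  by (rule sf_lift1[where h = "\<lambda>x. prod_encode (0, x)"]) (auto simp: cd_nat_def cd_tptl_def intro!: UFI)

lemma sf_Freeze [sfi]: "sf f \<Longrightarrow> sf (\<lambda>x. Freeze (f x))"
  by (rule sf_lift1[where h = "\<lambda>x. prod_encode (1, x)"]) (auto simp: cd_tptl_def intro!: UFI)

lemma sf_Constr [sfi]: "sf f \<Longrightarrow> sf g \<Longrightarrow> sf (\<lambda>x. Constr (f x) (g x))"
  by (rule sf_lift2[where h = "\<lambda>x. prod_encode (2, x)"])
    (auto simp: cd_tptl_def cd_cmp_def cd_nat_def intro!: UFI)

lemma sf_And [sfi]: "sf f \<Longrightarrow> sf g \<Longrightarrow> sf (\<lambda>x. And (f x) (g x))"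
  by (rule sf_lift2[where h = "\<lambda>x. prod_encode (3, x)"]) (auto simp: cd_tptl_def intro!: UFI)

lemma sf_Or [sfi]: "sf f \<Longrightarrow> sf g \<Longrightarrow> sf (\<lambda>x. Or (f x) (g x))"
  by (rule sf_lift2[where h = "\<lambda>x. prod_encode (4, x)"]) (auto simp: cd_tptl_def intro!: UFI)

lemma sf_Until [sfi]: "sf f \<Longrightarrow> sf g \<Longrightarrow> sf (\<lambda>x. Until (f x) (g x))"
  by (rule sf_lift2[where h = "\<lambda>x. prod_encode (5, x)"]) (auto simp: cd_tptl_def intro!: UFI)

lemma sf_Release [sfi]: "sf f \<Longrightarrow> sf g \<Longrightarrow> sf (\<lambda>x. Release (f x) (g x))"
  by (rule sf_lift2[where h = "\<lambda>x. prod_encode (6, x)"]) (auto simp: cd_tptl_def intro!: UFI)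

lemma re_conj: assumes "re P" "re Q" shows "re (\<lambda>x. P x \<and> Q x)"
proof -
  obtain P' Q' where "re0 P'" "\<And>x. P x \<longleftrightarrow> P' (cd x)" "re0 Q'" "\<And>x. Q x \<longleftrightarrow> Q' (cd x)"
    using assms unfolding re_def by blast
  then show ?thesis by (intro reI[OF re0_conj[of P' Q']]) auto
qed

lemma re_disj: assumes "re P" "re Q" shows "re (\<lambda>x. P x \<or> Q x)"
proof -
  obtain P' Q' where "re0 P'" "\<And>x. P x \<longleftrightarrow> P' (cd x)" "re0 Q'" "\<And>x. Q x \<longleftrightarrow> Q' (cd x)"
    using assms unfolding re_def by blast
  then show ?thesis by (intro reI[OF re0_disj[of P' Q']]) auto
qed

lemma re_ex:
  fixes P :: "'a::coded \<Rightarrow> 'b::coded \<Rightarrow> bool"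
  assumes "re (\<lambda>p. P (fst p) (snd p))" shows "re (\<lambda>x. \<exists>y. P x y)"
proof -
  obtain Q where Q: "re0 Q" "\<And>p. P (fst p) (snd p) \<longleftrightarrow> Q (cd p)" using assms unfolding re_def by blast
  have "re0 (\<lambda>z. (\<exists>y::'b. ps z = cd y) \<and> Q z)" by (intro re0_conj re0_comp[OF re0_range] UFI Q)
  from re0_ex[OF this] have "re0 (\<lambda>n. \<exists>m. (\<exists>y::'b. m = cd y) \<and> Q (prod_encode (n, m)))" by simp
  moreover have "P x y \<longleftrightarrow> Q (prod_encode (cd x, cd y))" for x y using Q(2)[of "(x, y)"] by (simp add: cd_prod_def)
  ultimately show ?thesis by (intro reI[where Q = "\<lambda>n. \<exists>m. (\<exists>y::'b. m = cd y) \<and> Q (prod_encode (n, m))"]) auto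
qed

lemma re_ball0:
  fixes P :: "'a::coded \<Rightarrow> 'b::coded \<Rightarrow> bool"
  assumes "re (\<lambda>p. P (fst p) (snd p))" "sf f" shows "re (\<lambda>x. \<forall>y\<in>set (f x). P x y)"
proof -
  obtain Q where Q: "re0 Q" "\<And>p. P (fst p) (snd p) \<longleftrightarrow> Q (cd p)" using assms(1) unfolding re_def by blast
  obtain g where g: "UF g" "\<And>x. cd (f x) = g (cd x)" using assms(2) unfolding sf_def by blast
  have "P x y \<longleftrightarrow> Q (prod_encode (cd x, cd y))" for x y using Q(2)[of "(x, y)"] by (simp add: cd_prod_def)
  moreover have "set (list_decode (g (cd x))) = cd ` set (f x)" for x
    using g(2)[of x] by (metis cd_list_def list_encode_inverse set_map)
  ultimately show ?thesis by (intro reI[OF re0_ball[OF Q(1) g(1)]]) auto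
qed

lemma re_eq0: 
  fixes f g :: "'a::coded \<Rightarrow> 'b::coded"
  shows "sf f \<Longrightarrow> sf g \<Longrightarrow> re (\<lambda>x. f x = g x)"
proof -
  have "re (\<lambda>p::'b \<times> 'b. fst p = snd p)"
    by (rule reI[of "\<lambda>z. pf z = ps z"]) (auto simp: cd_prod_def intro!: re0_eq UFI)
  from re_sf[OF this sf_pair, of f g] show "sf f \<Longrightarrow> sf g \<Longrightarrow> re (\<lambda>x. f x = g x)"
    by simp
qed

lemma re_neq0: 
  fixes f g :: "'a::coded \<Rightarrow> 'b::coded"
  shows "sf f \<Longrightarrow> sf g \<Longrightarrow> re (\<lambda>x. f x \<noteq> g x)"
proof -
  have "re (\<lambda>p::'b \<times> 'b. fst p \<noteq> snd p)"
    by (rule reI[of "\<lambda>z. pf z \<noteq> ps z"]) (auto simp: cd_prod_def intro!: re0_neq UFI)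
  from re_sf[OF this sf_pair, of f g] show "sf f \<Longrightarrow> sf g \<Longrightarrow> re (\<lambda>x. f x \<noteq> g x)"
    by simp
qed

lemma cf_sf: assumes "sf f" shows "cf f"
proof -
  obtain g where g: "UF g" "\<And>x. cd (f x) = g (cd x)" using assms unfolding sf_def by blast
  have "sf (\<lambda>p::'a \<times> 'b. f (fst p))"
    by (rule sfI[OF UF_comp[OF g(1) UF_fst]]) (simp add: g(2) cd_prod_def)
  then show ?thesis unfolding cf_def by (intro re_eq0 sfi)
qed

lemma re_comp:
  fixes P :: "'b::coded \<Rightarrow> bool" and f :: "'a::coded \<Rightarrow> 'b"
  assumes "re P" "cf f" shows "re (\<lambda>x. P (f x))"
proof -
  have "re (\<lambda>p::'a \<times> 'b. P (snd p))" by (rule re_sf[OF assms(1)]) (intro sfi)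
  with assms(2) have "re (\<lambda>p::'a \<times> 'b. snd p = f (fst p) \<and> P (snd p))"
    unfolding cf_def by (rule re_conj)
  from re_ex[OF this] show ?thesis by simp
qed

lemma cf_comp:
  fixes f :: "'b::coded \<Rightarrow> 'c::coded" and g :: "'a::coded \<Rightarrow> 'b"
  assumes "cf f" "cf g" shows "cf (\<lambda>x. f (g x))"
proof -
  have "re (\<lambda>q::('a \<times> 'c) \<times> 'b. snd q = g (fst (fst q)))"
    using re_sf[OF assms(2)[unfolded cf_def], of "\<lambda>q::('a \<times> 'c) \<times> 'b. (fst (fst q), snd q)"] by (simp add: sfi)
  moreover have "re (\<lambda>q::('a \<times> 'c) \<times> 'b. snd (fst q) = f (snd q))"
    using re_sf[OF assms(1)[unfolded cf_def], of "\<lambda>q::('a \<times> 'c) \<times> 'b. (snd q, snd (fst q))"] by (simp add: sfi)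
  ultimately have "re (\<lambda>q::('a \<times> 'c) \<times> 'b. snd q = g (fst (fst q)) \<and> snd (fst q) = f (snd q))"
    by (rule re_conj)
  from re_ex[OF this] show ?thesis unfolding cf_def by simp
qed

named_theorems cfi

lemma cf_pair [cfi]:
  fixes f :: "'a::coded \<Rightarrow> 'b::coded" and g :: "'a \<Rightarrow> 'c::coded"
  assumes "cf f" "cf g" shows "cf (\<lambda>x. (f x, g x))"
proof -
  have "re (\<lambda>p::'a \<times> 'b \<times> 'c. fst (snd p) = f (fst p))"
    using re_sf[OF assms(1)[unfolded cf_def], of "\<lambda>p::'a \<times> 'b \<times> 'c. (fst p, fst (snd p))"] by (simp add: sfi)
  moreover have "re (\<lambda>p::'a \<times> 'b \<times> 'c. snd (snd p) = g (fst p))"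
    using re_sf[OF assms(2)[unfolded cf_def], of "\<lambda>p::'a \<times> 'b \<times> 'c. (fst p, snd (snd p))"] by (simp add: sfi)
  ultimately have "re (\<lambda>p::'a \<times> 'b \<times> 'c. fst (snd p) = f (fst p) \<and> snd (snd p) = g (fst p))"
    by (rule re_conj)
  then show ?thesis unfolding cf_def by (simp add: prod_eq_iff)
qed

lemma cf_comp2:
  assumes "cf (\<lambda>p. h (fst p) (snd p))" "cf f" "cf g" shows "cf (\<lambda>x. h (f x) (g x))"
  using cf_comp[OF assms(1) cf_pair[OF assms(2,3)]] by simp

lemma cf_const [cfi]: "cf (\<lambda>x. c)" and cf_id [cfi]: "cf (\<lambda>x. x)"
  by (intro cf_sf sfi)+

lemma cf_fst [cfi]: "cf f \<Longrightarrow> cf (\<lambda>x. fst (f x))"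
  and cf_snd [cfi]: "cf f' \<Longrightarrow> cf (\<lambda>x. snd (f' x))"
  and cf_Suc [cfi]: "cf n \<Longrightarrow> cf (\<lambda>x. Suc (n x))"
  and cf_Freeze [cfi]: "cf a \<Longrightarrow> cf (\<lambda>x. Freeze (a x))"
  and cf_Prop [cfi]: "cf n \<Longrightarrow> cf (\<lambda>x. Prop (n x))"
  by (erule cf_comp[rotated], intro cf_sf sfi)+

lemma cf_Cons [cfi]: "cf f \<Longrightarrow> cf g \<Longrightarrow> cf (\<lambda>x. f x # g x)"
  and cf_add [cfi]: "cf m \<Longrightarrow> cf n \<Longrightarrow> cf (\<lambda>x. m x + n x :: nat)"
  and cf_mult [cfi]: "cf m \<Longrightarrow> cf n \<Longrightarrow> cf (\<lambda>x. m x * n x :: nat)"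
  and cf_diff [cfi]: "cf m \<Longrightarrow> cf n \<Longrightarrow> cf (\<lambda>x. m x - n x :: nat)"
  and cf_Constr [cfi]: "cf c \<Longrightarrow> cf n \<Longrightarrow> cf (\<lambda>x. Constr (c x) (n x))"
  and cf_And [cfi]: "cf a \<Longrightarrow> cf b \<Longrightarrow> cf (\<lambda>x. And (a x) (b x))"
  and cf_Or [cfi]: "cf a \<Longrightarrow> cf b \<Longrightarrow> cf (\<lambda>x. Or (a x) (b x))"
  and cf_Until [cfi]: "cf a \<Longrightarrow> cf b \<Longrightarrow> cf (\<lambda>x. Until (a x) (b x))"
  and cf_Release [cfi]: "cf a \<Longrightarrow> cf b \<Longrightarrow> cf (\<lambda>x. Release (a x) (b x))"
  by (rule cf_comp2, intro cf_sf sfi; assumption)+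

lemma re_eq: assumes "cf f" "cf g" shows "re (\<lambda>x. f x = g x)"
  using re_comp[OF re_eq0[OF sf_fst[OF sf_id] sf_snd[OF sf_id]] cf_pair[OF assms]] by simp

lemma re_neq: assumes "cf f" "cf g" shows "re (\<lambda>x. f x \<noteq> g x)"
  using re_comp[OF re_neq0[OF sf_fst[OF sf_id] sf_snd[OF sf_id]] cf_pair[OF assms]] by simp

lemma re_ball:
  fixes P :: "'a::coded \<Rightarrow> 'b::coded \<Rightarrow> bool"
  assumes "re (\<lambda>p. P (fst p) (snd p))" "cf f" shows "re (\<lambda>x. \<forall>y\<in>set (f x). P x y)"
proof -
  have "re (\<lambda>q::('a \<times> 'b list) \<times> 'b. P (fst (fst q)) (snd q))"
    using re_sf[OF assms(1), of "\<lambda>q::('a \<times> 'b list) \<times> 'b. (fst (fst q), snd q)"] by (simp add: sfi)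
  then have "re (\<lambda>p::'a \<times> 'b list. \<forall>y\<in>set (snd p). P (fst p) y)"
    by (intro re_ball0 sfi)
  from re_comp[OF this cf_pair[OF cf_id assms(2)]] show ?thesis by simp
qed

lemma re_wf:
  fixes P :: "'a::coded \<Rightarrow> bool"
  assumes Q: "re (\<lambda>p. Q (fst p) (snd p))"
    and P: "\<And>x. P x \<longleftrightarrow> (\<exists>l. Q x l \<and> (\<forall>y\<in>set l. P y))"
    and m: "\<And>x l y. Q x l \<Longrightarrow> y \<in> set l \<Longrightarrow> m y < (m x :: nat)"
  shows "re P"
proof -
  obtain R where R: "re0 R" "\<And>p. Q (fst p) (snd p) \<longleftrightarrow> R (cd p)" using Q unfolding re_def by blast
  have QR: "Q x l \<longleftrightarrow> R (prod_encode (cd x, cd l))" for x l using R(2)[of "(x, l)"] by (simp add: cd_prod_def)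
  define S where "S z \<longleftrightarrow> (\<exists>x::'a. pf z = cd x) \<and> (\<exists>l::'a list. ps z = cd l) \<and> R z" for z
  define P0 where "P0 n \<longleftrightarrow> (\<exists>x. n = cd x \<and> P x)" for n
  define m0 where "m0 n = m (inv cd n)" for n
  have "re0 S" unfolding S_def by (intro re0_conj re0_comp[OF re0_range] UFI R)
  moreover have "P0 n \<longleftrightarrow> (\<exists>l. S (prod_encode (n, l)) \<and> (\<forall>y\<in>set (list_decode l). P0 y))" for n
  proof
    assume "P0 n"
    then obtain x where x: "n = cd x" "P x" by (auto simp: P0_def)
    then obtain l where l: "Q x l" "\<forall>y\<in>set l. P y" using P by blast
    have "S (prod_encode (n, cd l))" using l x QR by (auto simp: S_def)
    moreover have "\<forall>y\<in>set (list_decode (cd l)). P0 y" using l by (auto simp: P0_def cd_list_def)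
    ultimately show "\<exists>l. S (prod_encode (n, l)) \<and> (\<forall>y\<in>set (list_decode l). P0 y)" by blast
  next
    assume "\<exists>l. S (prod_encode (n, l)) \<and> (\<forall>y\<in>set (list_decode l). P0 y)"
    then obtain l where l: "S (prod_encode (n, l))" "\<forall>y\<in>set (list_decode l). P0 y" by blast
    then obtain x :: 'a and k :: "'a list" where x: "n = cd x" and k: "l = cd k" and R: "R (prod_encode (n, l))"
      by (auto simp: S_def)
    have "Q x k" using R by (simp add: QR x k)
    moreover have "\<forall>y\<in>set k. P y" using l(2) by (auto simp: P0_def k cd_list_def)
    ultimately have "P x" using P[of x] by blast
    then show "P0 n" using x by (auto simp: P0_def)
  qed
  moreover have "m0 y < m0 n" if S: "S (prod_encode (n, l))" "y \<in> set (list_decode l)" for n l y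
  proof -
    obtain x :: 'a and k :: "'a list" where x: "n = cd x" and k: "l = cd k" and R: "R (prod_encode (n, l))"
      using S by (auto simp: S_def)
    then obtain z where z: "y = cd z" "z \<in> set k" using S(2) by (auto simp: cd_list_def)
    have "Q x k" using R by (simp add: QR x k)
    from m[OF this z(2)] show ?thesis by (simp add: m0_def x z(1) inv_f_f[OF inj_cd])
  qed
  ultimately have "re0 P0" by (rule re0_wf)
  then show ?thesis by (rule reI) (auto simp: P0_def)
qed

definition dec :: "('a::coded \<Rightarrow> bool) \<Rightarrow> bool" where
  "dec P \<longleftrightarrow> re P \<and> re (\<lambda>x. \<not> P x)"

named_theorems deci

lemma decI: "re P \<Longrightarrow> re (\<lambda>x. \<not> P x) \<Longrightarrow> dec P" and dec_re: "dec P \<Longrightarrow> re P"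
  by (simp_all add: dec_def)

lemma dec_conj [deci]: "dec P \<Longrightarrow> dec Q \<Longrightarrow> dec (\<lambda>x. P x \<and> Q x)"
  and dec_disj [deci]: "dec P \<Longrightarrow> dec Q \<Longrightarrow> dec (\<lambda>x. P x \<or> Q x)"
  and dec_imp [deci]: "dec P \<Longrightarrow> dec Q \<Longrightarrow> dec (\<lambda>x. P x \<longrightarrow> Q x)"
  and dec_not [deci]: "dec P \<Longrightarrow> dec (\<lambda>x. \<not> P x)"
  unfolding dec_def de_Morgan_conj de_Morgan_disj imp_conv_disj not_not
  by (elim conjE, intro conjI re_conj re_disj; assumption)+

lemma dec_eq [deci]: "cf f \<Longrightarrow> cf g \<Longrightarrow> dec (\<lambda>x. f x = g x)"
  by (simp add: dec_def re_eq re_neq)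

lemma dec_comp: "dec P \<Longrightarrow> cf f \<Longrightarrow> dec (\<lambda>x. P (f x))"
  by (simp add: dec_def re_comp[of P f] re_comp[of "\<lambda>x. \<not> P x" f])

lemma dec_comp2: "dec (\<lambda>p. P (fst p) (snd p)) \<Longrightarrow> cf f \<Longrightarrow> cf g \<Longrightarrow> dec (\<lambda>x. P (f x) (g x))"
  using dec_comp[OF _ cf_pair, of "\<lambda>p. P (fst p) (snd p)" f g] by simp

lemma dec_le [deci]: assumes "cf f" "cf g" shows "dec (\<lambda>x. f x \<le> (g x :: nat))"
  using dec_eq[OF cf_diff[OF assms] cf_const[of 0]] by simp

lemma dec_less [deci]: assumes "cf f" "cf g" shows "dec (\<lambda>x. f x < (g x :: nat))"
  using dec_le[OF cf_Suc[OF assms(1)] assms(2)] by (simp add: Suc_le_eq)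

lemma cf_If [cfi]:
  fixes f g :: "'a::coded \<Rightarrow> 'b::coded"
  assumes "dec P" "cf f" "cf g" shows "cf (\<lambda>x. if P x then f x else g x)"
proof -
  have *: "re (\<lambda>p::'a \<times> 'b. P (fst p))" "re (\<lambda>p::'a \<times> 'b. \<not> P (fst p))"
    using assms(1) re_sf[OF _ sf_fst[OF sf_id]] unfolding dec_def by blast+
  have "re (\<lambda>p. (P (fst p) \<and> snd p = f (fst p)) \<or> (\<not> P (fst p) \<and> snd p = g (fst p)))"
    using assms(2,3) unfolding cf_def by (intro re_disj re_conj *)
  then show ?thesis unfolding cf_def by (rule back_subst[of re]) auto
qed

text \<open>The graph of a fold is a derivation over the tails of the list. Most list functions
  below are obtained by writing them as folds.\<close>

lemma cf_foldr [cfi]: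
  fixes h :: "'a::coded \<Rightarrow> 'b::coded \<Rightarrow> 'c::coded \<Rightarrow> 'c"
  assumes h: "cf (\<lambda>p. h (fst p) (fst (snd p)) (snd (snd p)))" and l: "cf l" and z: "cf z"
  shows "cf (\<lambda>a. foldr (h a) (l a) (z a))"
proof -
  let ?P = "\<lambda>x::'a \<times> 'b list \<times> 'c. snd (snd x) = foldr (h (fst x)) (fst (snd x)) (z (fst x))"
  let ?Q = "\<lambda>(x::'a \<times> 'b list \<times> 'c) l. (fst (snd x) = [] \<and> snd (snd x) = z (fst x) \<and> l = []) \<or>
     (\<exists>y. \<exists>l'. \<exists>r. fst (snd x) = y # l' \<and> snd (snd x) = h (fst x) y r \<and> l = [(fst x, l', r)])"
  have "re ?P"
  proof (rule re_wf[where m = "\<lambda>x. length (fst (snd x))"])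
    have h': "cf (\<lambda>q. h (f1 q) (f2 q) (f3 q))" if "cf f1" "cf f2" "cf f3"
      for f1 f2 f3 and q :: "'q::coded itself" using cf_comp[OF h cf_pair[OF that(1) cf_pair[OF that(2,3)]]] by simp
    show "re (\<lambda>p. ?Q (fst p) (snd p))"
      by (intro re_disj re_conj re_ex re_eq cfi h' cf_comp[OF z])
    show "?P x \<longleftrightarrow> (\<exists>l. ?Q x l \<and> (\<forall>y\<in>set l. ?P y))" for x
      by (cases x; cases "fst (snd x)") auto
  qed auto
  then have "re (\<lambda>q::'a \<times> 'c. ?P (fst q, l (fst q), snd q))"
    by (rule re_comp) (intro cfi cf_comp[OF l])
  then show ?thesis unfolding cf_def by simp
qed

section \<open>Word systems that may forget letters\<close>

text \<open>Nash-Williams' argument: among the bad sequences one is built whose words are, one after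
  the other, as short as possible. Letters are compared by equality, which is a well-quasi-order
  because the alphabet is finite.\<close>

lemma higman:
  fixes f :: "nat \<Rightarrow> 'a list"
  assumes A: "finite A" and f: "\<And>n. set (f n) \<subseteq> A"
  shows "\<exists>i j. i < j \<and> subseq (f i) (f j)"
proof (rule ccontr)
  define bad where "bad g \<longleftrightarrow> (\<forall>n. set (g n) \<subseteq> A) \<and> (\<forall>i j. i < j \<longrightarrow> \<not> subseq (g i) (g j))" for g :: "nat \<Rightarrow> 'a list"
  assume "\<not> ?thesis"
  then have badf: "bad f" using f by (auto simp: bad_def)
  define ext where "ext p w \<longleftrightarrow> (\<exists>g. bad g \<and> map g [0..<length p] = p \<and> g (length p) = w)" for p w
  define nxt where "nxt p = arg_min length (ext p)" for p
  define pre where "pre n = rec_nat [] (\<lambda>_ p. p @ [nxt p]) n" for n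
  define m where "m n = nxt (pre n)" for n
  have pre0: "pre 0 = []" and preS: "pre (Suc n) = pre n @ [m n]" for n
    by (simp_all add: pre_def m_def)
  have len: "length (pre n) = n" for n by (induction n) (simp_all add: pre0 preS)
  have mapm: "pre n = map m [0..<n]" for n by (induction n) (simp_all add: pre0 preS)
  have ex: "\<exists>g. bad g \<and> map g [0..<n] = pre n" for n
  proof (induction n)
    case 0
    then show ?case using badf pre0 by auto
  next
    case (Suc n)
    then obtain g where "bad g" "map g [0..<n] = pre n" by blast
    then have "ext (pre n) (g n)" by (auto simp: ext_def len)
    then have "ext (pre n) (m n)" unfolding m_def nxt_def by (rule arg_min_natI)
    then show ?case by (auto simp: ext_def len preS)
  qed
  have min: "length (m n) \<le> length (g n)" if "bad g" "\<And>k. k < n \<Longrightarrow> g k = m k" for g n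
  proof -
    have "map g [0..<n] = pre n" using that(2) by (auto simp: mapm)
    then have "ext (pre n) (g n)" using that(1) by (auto simp: ext_def len)
    then show ?thesis unfolding m_def nxt_def by (rule arg_min_nat_le)
  qed
  have badm: "bad m" unfolding bad_def
  proof (intro conjI allI impI)
    fix n
    obtain g where g: "bad g" "map g [0..<Suc n] = pre (Suc n)" using ex by blast
    then have "g n = m n" unfolding mapm by simp
    then show "set (m n) \<subseteq> A" using g(1) by (metis bad_def)
  next
    fix i j :: nat assume "i < j"
    obtain g where g: "bad g" "map g [0..<Suc j] = pre (Suc j)" using ex by blast
    have "g k = m k" if "k < Suc j" for k
      using g(2) that unfolding mapm map_eq_conv by (auto simp: less_Suc_eq)
    then have "g i = m i" "g j = m j" using \<open>i < j\<close> by simp_all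
    then show "\<not> subseq (m i) (m j)" using g(1) \<open>i < j\<close> by (metis bad_def)
  qed
  have mA: "set (m n) \<subseteq> A" and mbad: "i < j \<Longrightarrow> \<not> subseq (m i) (m j)" for n i j
    using badm by (simp_all add: bad_def)
  have ne: "m n \<noteq> []" for n
    using mbad[of n "Suc n"] by (metis lessI list_emb_Nil)
  have hdA: "hd (m n) \<in> A" for n using mA[of n] hd_in_set[OF ne[of n]] by blast
  have "finite ((\<lambda>n. hd (m n)) ` UNIV)"
    by (rule finite_subset[OF _ A]) (use hdA in auto)
  then obtain k where "infinite {n. hd (m n) = hd (m k)}"
    using pigeonhole_infinite[of UNIV "\<lambda>n. hd (m n)"] by auto
  then obtain a where a: "infinite {n. hd (m n) = a}" by blast
  define h where "h = Infinite_Set.enumerate {n. hd (m n) = a}"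
  have h: "strict_mono h" unfolding h_def by (rule strict_mono_enumerate[OF a])
  have ha: "hd (m (h n)) = a" for n using enumerate_in_set[OF a, of n] by (simp add: h_def)
  \<comment> \<open>Infinitely many words of the minimal sequence begin with the same letter
    \<open>a\<close>. Its start up to \<open>h 0\<close>, followed by the tails of these words, is
    again bad and has a shorter word at \<open>h 0\<close>.\<close>
  define g where "g n = (if n < h 0 then m n else tl (m (h (n - h 0))))" for n
  have split: "m (h n) = a # tl (m (h n))" for n using ha[of n] ne[of "h n"] by (metis list.collapse)
  have "set (g n) \<subseteq> A" for n
  proof (cases "n < h 0")
    case False
    have "set (tl (m (h (n - h 0)))) \<subseteq> set (m (h (n - h 0)))" using ne by (auto dest: list.set_sel(2))
    then show ?thesis using False mA[of "h (n - h 0)"] by (auto simp: g_def)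
  qed (use mA in \<open>simp add: g_def\<close>)
  moreover have "\<not> subseq (g i) (g j)" if ij: "i < j" for i j
  proof -
    consider "j < h 0" | "i < h 0" "h 0 \<le> j" | "h 0 \<le> i" by linarith
    then show ?thesis
    proof cases
      case 1
      then show ?thesis using mbad ij by (simp add: g_def)
    next
      case 2
      have "h 0 \<le> h (j - h 0)" using h by (simp add: strict_mono_less_eq)
      then have *: "\<not> subseq (m i) (m (h (j - h 0)))" using mbad 2 by simp
      have "subseq (m i) (tl (m (h (j - h 0)))) \<Longrightarrow> subseq (m i) (m (h (j - h 0)))"
        by (subst split) (rule list_emb_Cons)
      then show ?thesis using 2 * by (auto simp: g_def)
    next
      case 3
      then have "h (i - h 0) < h (j - h 0)" using ij h by (simp add: strict_mono_less)
      then have *: "\<not> subseq (m (h (i - h 0))) (m (h (j - h 0)))" by (rule mbad)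
      have "subseq (tl (m (h (i - h 0)))) (tl (m (h (j - h 0)))) \<Longrightarrow> subseq (m (h (i - h 0))) (m (h (j - h 0)))"
        using split[of "i - h 0"] split[of "j - h 0"] by (metis subseq_Cons2)
      then show ?thesis using 3 ij * by (auto simp: g_def)
    qed
  qed
  ultimately have "bad g" by (simp add: bad_def)
  then have "length (m (h 0)) \<le> length (g (h 0))" by (rule min) (simp add: g_def)
  then show False using ne[of "h 0"] by (cases "m (h 0)") (simp_all add: g_def)
qed

text \<open>Otherwise one could go on choosing members of \<open>U\<close> that lie above none of
  those chosen before, against Higman's lemma.\<close>

lemma finite_basis:
  fixes U :: "'a list set"
  assumes A: "finite A" and U: "\<And>u. u \<in> U \<Longrightarrow> set u \<subseteq> A"
  shows "\<exists>B. set B \<subseteq> U \<and> (\<forall>u\<in>U. \<exists>b\<in>set B. subseq b u)"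
proof (rule ccontr)
  assume "\<not> ?thesis"
  then have "\<forall>B. set B \<subseteq> U \<longrightarrow> (\<exists>u\<in>U. \<forall>b\<in>set B. \<not> subseq b u)" by blast
  then obtain p where p: "\<And>B. set B \<subseteq> U \<Longrightarrow> p B \<in> U \<and> (\<forall>b\<in>set B. \<not> subseq b (p B))" by metis
  define S where "S n = rec_nat [] (\<lambda>_ B. p B # B) n" for n
  have S: "S 0 = []" "S (Suc n) = p (S n) # S n" for n by (simp_all add: S_def)
  have SU: "set (S n) \<subseteq> U" for n by (induction n) (use p S in auto)
  have mem: "i < j \<Longrightarrow> p (S i) \<in> set (S j)" for i j by (induction j) (auto simp: S less_Suc_eq)
  obtain i j where "i < j" "subseq (p (S i)) (p (S j))"
    using higman[OF A, of "\<lambda>n. p (S n)"] U p[OF SU] by blast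
  then show False using p[OF SU, of j] mem[of i j] by blast
qed

text \<open>A system consists of rules, initial and final states, the alphabet and the letters that may occur
  infinitely often. A rule \<open>(q, xo, y, q')\<close> reads \<open>xo\<close>, which has at most one letter, and writes \<open>y\<close>.\<close>

type_synonym ('q, 'l) nsys = "('q \<times> 'l list \<times> 'l \<times> 'q) list \<times> 'q list \<times> 'q list \<times> 'l list \<times> 'l list"

abbreviation rules :: "('q, 'l) nsys \<Rightarrow> ('q \<times> 'l list \<times> 'l \<times> 'q) list" where "rules S \<equiv> fst S"
abbreviation starts :: "('q, 'l) nsys \<Rightarrow> 'q list" where "starts S \<equiv> fst (snd S)"
abbreviation finals :: "('q, 'l) nsys \<Rightarrow> 'q list" where "finals S \<equiv> fst (snd (snd S))"
abbreviation alph :: "('q, 'l) nsys \<Rightarrow> 'l list" where "alph S \<equiv> fst (snd (snd (snd S)))"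
abbreviation oks :: "('q, 'l) nsys \<Rightarrow> 'l list" where "oks S \<equiv> snd (snd (snd (snd S)))"

inductive path :: "('q, 'l) nsys \<Rightarrow> 'q \<Rightarrow> 'l list \<Rightarrow> 'l list \<Rightarrow> 'q \<Rightarrow> bool" for S where
  path_Nil: "path S q [] [] q"
| path_Cons: "(q, xo, y, q') \<in> set (rules S) \<Longrightarrow> path S q' u v q'' \<Longrightarrow> path S q (xo @ u) (y # v) q''"

definition stp :: "('q, 'l) nsys \<Rightarrow> 'l list \<Rightarrow> 'l list \<Rightarrow> bool" where
  "stp S u v \<longleftrightarrow> (\<exists>q\<in>set (starts S). \<exists>q'\<in>set (finals S). path S q u v q')"

text \<open>The last conjunct is the forgetting: whatever is written by a rule that reads may also
  be written without reading. Thus the successors of a word are also successors of its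
  subsequences.\<close>

definition wf_nsys :: "('q, 'l) nsys \<Rightarrow> bool" where
  "wf_nsys S \<longleftrightarrow> (\<forall>q xo y q'. (q, xo, y, q') \<in> set (rules S) \<longrightarrow>
     length xo \<le> 1 \<and> y \<in> set (alph S) \<and> (q, [], y, q') \<in> set (rules S))"

definition Good :: "('q, 'l) nsys \<Rightarrow> 'l list \<Rightarrow> bool" where
  "Good S u \<longleftrightarrow> (\<exists>f. f 0 = u \<and> (\<forall>n. stp S (f n) (f (Suc n))) \<and> (\<exists>N. \<forall>n\<ge>N. set (f n) \<subseteq> set (oks S)))"

text \<open>Subsequences are tested by residuals, so that a finite automaton, and hence a finite
  certificate, can follow the test along a step of the system.\<close>

definition res :: "'l \<Rightarrow> 'l list \<Rightarrow> 'l list" where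
  "res y b = (if b \<noteq> [] \<and> hd b = y then tl b else b)"

definition ress :: "'l list list \<Rightarrow> 'l \<Rightarrow> 'l list list" where
  "ress B y = map (res y) B"

definition covers :: "'l list list \<Rightarrow> 'l list \<Rightarrow> bool" where
  "covers B w \<longleftrightarrow> [] \<in> set (foldl ress B w)"

lemma subseq_res: "subseq (res y b) w \<longleftrightarrow> subseq b (y # w)"
  by (cases b) (auto simp: res_def)

lemma covers_iff: "covers B w \<longleftrightarrow> (\<exists>b\<in>set B. subseq b w)"
proof (induction w arbitrary: B)
  case Nil
  then show ?case unfolding covers_def by (metis foldl_Nil list_emb_Nil2 list_emb_Nil)
next
  case (Cons y w)
  have "covers B (y # w) \<longleftrightarrow> covers (ress B y) w" by (simp add: covers_def)
  then show ?case unfolding Cons by (auto simp: ress_def subseq_res)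
qed

lemma covers_Cons: "covers B (y # w) \<longleftrightarrow> covers (ress B y) w"
  by (simp add: covers_def)

lemma path_append: "path S q u v q' \<Longrightarrow> path S q' u' v' q'' \<Longrightarrow> path S q (u @ u') (v @ v') q''"
  by (induction rule: path.induct) (auto intro: path.intros)

lemma path_split:
  assumes "wf_nsys S" "path S q (u @ u') v q''"
  shows "\<exists>q' v1 v2. v = v1 @ v2 \<and> path S q u v1 q' \<and> path S q' u' v2 q''"
  using assms(2)
proof (induction q "u @ u'" v q'' arbitrary: u rule: path.induct)
  case (path_Nil q)
  then show ?case by (auto intro: path.intros)
next
  case (path_Cons q xo y q' w v q'')
  show ?case
  proof (cases "u = []")
    case True
    then show ?thesis using path.path_Cons[OF path_Cons(1,2)] path_Cons(4)
      by (intro exI[of _ q] exI[of _ "[]"] exI[of _ "y # v"]) (auto intro: path.intros)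
  next
    case False
    have "length xo \<le> 1" using assms(1) path_Cons(1) unfolding wf_nsys_def by blast
    then consider "xo = []" | x where "xo = [x]" by (cases xo) auto
    then obtain u1 where u: "u = xo @ u1" "w = u1 @ u'"
    proof cases
      case 1
      then show ?thesis using that path_Cons(4) by auto
    next
      case (2 x)
      then show ?thesis using that[of "tl u"] path_Cons(4) False by (cases u) auto
    qed
    obtain p v1 v2 where "v = v1 @ v2" "path S q' u1 v1 p" "path S p u' v2 q''" using path_Cons(3)[OF u(2)] by blast
    then show ?thesis using path.path_Cons[OF path_Cons(1)] u(1)
      by (intro exI[of _ p] exI[of _ "y # v1"] exI[of _ v2]) auto
  qed
qed

lemma path_mono:
  assumes wf: "wf_nsys S" and "path S q u v q'" "subseq u' u"
  shows "path S q u' v q'"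
  using assms(2,3)
proof (induction arbitrary: u' rule: path.induct)
  case (path_Nil q)
  then have "u' = []" by simp
  then show ?case by (simp add: path.path_Nil)
next
  case (path_Cons q xo y p u v q'')
  have l: "length xo \<le> 1" and n: "(q, [], y, p) \<in> set (rules S)"
    using wf path_Cons(1) unfolding wf_nsys_def by blast+
  show ?case
  proof (cases "subseq u' u")
    case True
    then show ?thesis using path.path_Cons[OF n path_Cons.IH[OF True]] by simp
  next
    case False
    then obtain x where x: "xo = [x]" using l path_Cons.prems by (cases xo) auto
    then obtain u1 where "u' = x # u1" "subseq u1 u"
      using path_Cons.prems False by (cases u') (auto split: if_splits)
    then show ?thesis using path.path_Cons[OF path_Cons(1) path_Cons.IH, of u1] x by simp
  qed
qed

lemma stp_mono: "wf_nsys S \<Longrightarrow> stp S u v \<Longrightarrow> subseq u' u \<Longrightarrow> stp S u' v"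
proof -
  assume wf: "wf_nsys S" and "stp S u v" and u: "subseq u' u"
  then obtain q q' where "q \<in> set (starts S)" "q' \<in> set (finals S)" "path S q u v q'" unfolding stp_def by blast
  then show "stp S u' v" using path_mono[OF wf _ u] unfolding stp_def by blast
qed

lemma path_alph: "wf_nsys S \<Longrightarrow> path S q u v q' \<Longrightarrow> set v \<subseteq> set (alph S)"
proof -
  assume wf: "wf_nsys S"
  show "path S q u v q' \<Longrightarrow> set v \<subseteq> set (alph S)"
  proof (induction rule: path.induct)
    case (path_Cons q xo y q' u v q'')
    then show ?case using wf unfolding wf_nsys_def by auto
  qed simp
qed

definition nstates :: "('q, 'l) nsys \<Rightarrow> 'q set" where
  "nstates S = set (starts S) \<union> (\<lambda>t. snd (snd (snd t))) ` set (rules S)"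

lemma path_nstates: "path S q u v q' \<Longrightarrow> q \<in> nstates S \<Longrightarrow> q' \<in> nstates S"
proof (induction rule: path.induct)
  case (path_Cons q xo y q' u v q'')
  have "q' \<in> nstates S" unfolding nstates_def using path_Cons(1) by (intro UnI2 image_eqI[OF _ path_Cons(1)]) simp
  then show ?case by (rule path_Cons)
qed

definition residuals :: "'l list list \<Rightarrow> 'l list list set" where
  "residuals B = {C. list_all2 suffix C B}"

lemma finite_residuals: "finite (residuals B)"
proof (induction B)
  case (Cons b B)
  have "residuals (b # B) = (\<lambda>(c, C). c # C) ` ({c. suffix c b} \<times> residuals B)"
    by (auto simp: residuals_def list_all2_Cons2 image_iff)
  moreover have "finite {c. suffix c b}" using finite_set[of "suffixes b"] by (simp add: set_suffixes_eq)
  ultimately show ?case using Cons by simp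
qed (simp add: residuals_def)

lemma residuals_ress: "C \<in> residuals B \<Longrightarrow> ress C y \<in> residuals B"
  unfolding residuals_def ress_def mem_Collect_eq list_all2_map1
  by (erule list_all2_mono) (auto simp: res_def intro: suffix_order.trans[OF suffix_tl])

lemma residuals_foldl: "C \<in> residuals B \<Longrightarrow> foldl ress C w \<in> residuals B"
  by (induction w arbitrary: C) (auto simp: residuals_ress)

lemma residuals_refl: "B \<in> residuals B"
  by (simp add: residuals_def list.rel_refl)

text \<open>\<open>J\<close> is an inductive invariant of the automaton that reads a word above \<open>b\<close> (its unread part is the second
  component) and tests the output over the alphabet \<open>Y\<close> against \<open>B\<close>: it shows that all successors of words above \<open>b\<close> lie above \<open>B\<close>.\<close>

definition Kcert :: "('q, 'l) nsys \<Rightarrow> 'l list \<Rightarrow> 'l list list \<Rightarrow> 'l list \<Rightarrow> ('q \<times> 'l list \<times> 'l list list) list \<Rightarrow> bool" where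
  "Kcert S Y B b J \<longleftrightarrow> (\<forall>q\<in>set (starts S). (q, b, B) \<in> set J) \<and>
     (\<forall>j\<in>set J. \<forall>t\<in>set (rules S).
        fst t = fst j \<and> fst (snd (snd t)) \<in> set Y \<and> fst (snd t) @ drop (length (fst (snd t))) (fst (snd j)) = fst (snd j) \<longrightarrow>
        (snd (snd (snd t)), drop (length (fst (snd t))) (fst (snd j)), ress (snd (snd j)) (fst (snd (snd t)))) \<in> set J) \<and>
     (\<forall>j\<in>set J. fst j \<in> set (finals S) \<and> fst (snd j) = [] \<longrightarrow> [] \<in> set (snd (snd j)))"

lemma Kcert_sound:
  assumes "Kcert S Y B b J" "stp S b v" "set v \<subseteq> set Y"
  shows "covers B v"
proof -
  have "path S q u v q' \<Longrightarrow> (q, u, C) \<in> set J \<Longrightarrow> set v \<subseteq> set Y \<Longrightarrow> q' \<in> set (finals S) \<Longrightarrow> covers C v" for q u v q' C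
  proof (induction arbitrary: C rule: path.induct)
    case (path_Nil q)
    then show ?case using assms(1) unfolding Kcert_def covers_def by fastforce
  next
    case (path_Cons q xo y q' u v q'')
    have "(q', u, ress C y) \<in> set J"
      using assms(1)[unfolded Kcert_def, THEN conjunct2, THEN conjunct1, rule_format, OF path_Cons(4,1)] path_Cons(5)
      by simp
    then show ?case using path_Cons by (simp add: covers_Cons)
  qed
  then show ?thesis using assms unfolding stp_def Kcert_def by blast
qed

text \<open>The largest candidate works: all triples from which every completed output over
  \<open>Y\<close> is covered. It is finite because unread parts are suffixes of \<open>b\<close>
  and tests are residuals of \<open>B\<close>.\<close>

lemma Kcert_complete:
  assumes "\<And>v. stp S b v \<Longrightarrow> set v \<subseteq> set Y \<Longrightarrow> covers B v"
  shows "\<exists>J. Kcert S Y B b J"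
proof -
  define J where "J = {(q, u, C). q \<in> nstates S \<and> suffix u b \<and> C \<in> residuals B \<and>
     (\<forall>v q'. path S q u v q' \<and> q' \<in> set (finals S) \<and> set v \<subseteq> set Y \<longrightarrow> covers C v)}"
  have "J \<subseteq> nstates S \<times> {u. suffix u b} \<times> residuals B" by (auto simp: J_def)
  moreover have "finite {c. suffix c b}" using finite_set[of "suffixes b"] by (simp add: set_suffixes_eq)
  ultimately have "finite J"
    by (intro finite_subset[of J "nstates S \<times> {u. suffix u b} \<times> residuals B"]) (simp_all add: finite_residuals nstates_def)
  then obtain Jl where Jl: "set Jl = J" using finite_list by blast
  have "Kcert S Y B b Jl" unfolding Kcert_def Jl
  proof (intro conjI ballI impI)
    fix q assume "q \<in> set (starts S)"
    then show "(q, b, B) \<in> J" using assms by (auto simp: J_def nstates_def residuals_refl stp_def)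
  next
    fix j t assume j: "j \<in> J" and t: "t \<in> set (rules S)" and
      *: "fst t = fst j \<and> fst (snd (snd t)) \<in> set Y \<and> fst (snd t) @ drop (length (fst (snd t))) (fst (snd j)) = fst (snd j)"
    obtain q u C where jj: "j = (q, u, C)" by (cases j)
    obtain xo y q' where tt: "t = (q, xo, y, q')" using * jj by (cases t) auto
    let ?u = "drop (length xo) u"
    have u: "u = xo @ ?u" using * by (simp add: jj tt)
    have "suffix ?u b" using j u suffix_order.trans[of ?u u b] by (auto simp: J_def jj suffix_drop)
    moreover have "covers (ress C y) v" if "path S q' ?u v q''" "q'' \<in> set (finals S)" "set v \<subseteq> set Y" for v q''
    proof -
      have "path S q u (y # v) q''" using path_Cons[OF t[unfolded tt] that(1)] u by simp
      moreover have "set (y # v) \<subseteq> set Y" using that * by (simp add: tt)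
      ultimately have "covers C (y # v)" using j that(2) unfolding J_def jj by blast
      then show ?thesis by (simp add: covers_Cons)
    qed
    moreover have "q' \<in> nstates S" using t tt by (force simp: nstates_def)
    ultimately have "(q', ?u, ress C y) \<in> J" using j by (auto simp: J_def jj residuals_ress)
    then show "(snd (snd (snd t)), drop (length (fst (snd t))) (fst (snd j)), ress (snd (snd j)) (fst (snd (snd t)))) \<in> J"
      by (simp add: jj tt)
  next
    fix j assume "j \<in> J" and "fst j \<in> set (finals S) \<and> fst (snd j) = []"
    then have "covers (snd (snd j)) []" using path_Nil[of S "fst j"] by (fastforce simp: J_def)
    then show "[] \<in> set (snd (snd j))" by (simp add: covers_def)
  qed
  then show ?thesis by blast
qed

text \<open>A backward certificate. By monotonicity it suffices to inspect the generators: a word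
  above \<open>B\<close> starts no run of \<open>n\<close> steps over \<open>oks S\<close>, and for
  \<open>n = 0\<close> this forces \<open>B\<close> to be empty.\<close>

fun badB :: "('q, 'l) nsys \<Rightarrow> nat \<Rightarrow> 'l list list \<Rightarrow> bool" where
  "badB S 0 B \<longleftrightarrow> B = []"
| "badB S (Suc n) B \<longleftrightarrow> (\<exists>C. badB S n C \<and> (\<forall>b\<in>set B. \<exists>J. Kcert S (oks S) C b J))"

text \<open>\<open>A\<close> generates an upward closed set that contains \<open>u\<close> and is
  preserved by steps. A run that from some point on stays in \<open>oks S\<close> must then lie
  above a generator over \<open>oks S\<close>, hence above \<open>B\<close>, and dies within
  \<open>n\<close> steps.\<close>

definition unsat_cert :: "('q, 'l) nsys \<Rightarrow> 'l list \<Rightarrow> bool" where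
  "unsat_cert S u \<longleftrightarrow> (\<exists>A. \<exists>n. \<exists>B. badB S n B \<and> covers A u \<and>
     (\<forall>a\<in>set A. (\<exists>J. Kcert S (alph S) A a J) \<and> ((\<forall>x\<in>set a. x \<in> set (oks S)) \<longrightarrow> covers B a)))"

lemma unsat_cert_sound:
  assumes wf: "wf_nsys S" and "unsat_cert S u"
  shows "\<not> Good S u"
proof
  assume "Good S u"
  then obtain f N where f: "f 0 = u" "\<And>n. stp S (f n) (f (Suc n))" "\<And>n. n \<ge> N \<Longrightarrow> set (f n) \<subseteq> set (oks S)"
    unfolding Good_def by blast
  obtain A n B where B: "badB S n B" and A: "covers A u"
    "\<And>a. a \<in> set A \<Longrightarrow> (\<exists>J. Kcert S (alph S) A a J) \<and> ((\<forall>x\<in>set a. x \<in> set (oks S)) \<longrightarrow> covers B a)"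
    using assms(2) unfolding unsat_cert_def by blast
  have fA: "covers A (f i)" for i
  proof (induction i)
    case (Suc i)
    then obtain a where a: "a \<in> set A" "subseq a (f i)" by (auto simp: covers_iff)
    then have "stp S a (f (Suc i))" using stp_mono[OF wf f(2)] by blast
    moreover have "set (f (Suc i)) \<subseteq> set (alph S)" using f(2)[of i] path_alph[OF wf] unfolding stp_def by blast
    ultimately show ?case using A(2)[OF a(1)] Kcert_sound by blast
  qed (simp add: A f)
  have "badB S n B \<Longrightarrow> i \<ge> N \<Longrightarrow> \<not> covers B (f i)" for i
  proof (induction n arbitrary: B i)
    case 0
    then show ?case by (simp add: covers_iff)
  next
    case (Suc n)
    then obtain C where C: "badB S n C" "\<And>b. b \<in> set B \<Longrightarrow> \<exists>J. Kcert S (oks S) C b J" by auto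
    show ?case
    proof
      assume "covers B (f i)"
      then obtain b where b: "b \<in> set B" "subseq b (f i)" by (auto simp: covers_iff)
      then have "stp S b (f (Suc i))" using stp_mono[OF wf f(2)] by blast
      then have "covers C (f (Suc i))" using C(2)[OF b(1)] Kcert_sound f(3)[of "Suc i"] Suc.prems by (metis le_SucI)
      then show False using Suc.IH[OF C(1), of "Suc i"] Suc.prems by simp
    qed
  qed
  then have no: "\<not> covers B (f N)" using B by simp
  obtain a where a: "a \<in> set A" "subseq a (f N)" using fA[of N] by (auto simp: covers_iff)
  have "set a \<subseteq> set (oks S)" using f(3)[of N] subseq_conv_nths[of a "f N"] a(2) by (auto dest: in_set_nthsD)
  then have "covers B a" using A(2)[OF a(1)] by blast
  then show False using no a(2) by (auto simp: covers_iff intro: subseq_order.trans)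
qed

section \<open>Words with an infinite run over the admissible letters\<close>

definition Gset :: "('q, 'l) nsys \<Rightarrow> 'l list set" where
  "Gset S = {u. \<exists>f. f 0 = u \<and> (\<forall>n. stp S (f n) (f (Suc n)) \<and> set (f n) \<subseteq> set (oks S))}"

lemma GsetI:
  assumes "u \<in> X" "\<And>w. w \<in> X \<Longrightarrow> set w \<subseteq> set (oks S) \<and> (\<exists>v\<in>X. stp S w v)"
  shows "u \<in> Gset S"
proof -
  obtain nx where nx: "\<And>w. w \<in> X \<Longrightarrow> nx w \<in> X \<and> stp S w (nx w)" using assms(2) by metis
  have "(nx ^^ n) u \<in> X" for n by (induction n) (use assms(1) nx in auto)
  then show ?thesis using nx assms(2) unfolding Gset_def by (auto intro!: exI[of _ "\<lambda>n. (nx ^^ n) u"])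
qed

lemma Gset_step: "u \<in> Gset S \<Longrightarrow> set u \<subseteq> set (oks S) \<and> (\<exists>v\<in>Gset S. stp S u v)"
proof -
  assume "u \<in> Gset S"
  then obtain f where f: "f 0 = u" "\<And>n. stp S (f n) (f (Suc n)) \<and> set (f n) \<subseteq> set (oks S)" unfolding Gset_def by blast
  then have "f 1 \<in> Gset S" unfolding Gset_def by (auto intro!: exI[of _ "\<lambda>n. f (Suc n)"])
  then show ?thesis using f(1) f(2)[of 0] by auto
qed

lemma Good_iff: "Good S u \<longleftrightarrow> (\<exists>w\<in>Gset S. (stp S)\<^sup>*\<^sup>* u w)"
proof
  assume "Good S u"
  then obtain f N where f: "f 0 = u" "\<And>n. stp S (f n) (f (Suc n))" "\<And>n. n \<ge> N \<Longrightarrow> set (f n) \<subseteq> set (oks S)"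
    unfolding Good_def by blast
  have "(stp S)\<^sup>*\<^sup>* u (f n)" for n by (induction n) (use f in \<open>auto intro: rtranclp.rtrancl_into_rtrancl\<close>)
  moreover have "f N \<in> Gset S"
    unfolding Gset_def using f(2) f(3)[of "N + _"] by (intro CollectI exI[of _ "\<lambda>n. f (N + n)"]) simp
  ultimately show "\<exists>w\<in>Gset S. (stp S)\<^sup>*\<^sup>* u w" by blast
next
  assume "\<exists>w\<in>Gset S. (stp S)\<^sup>*\<^sup>* u w"
  then obtain w where "(stp S)\<^sup>*\<^sup>* u w" and w: "Good S w" unfolding Gset_def Good_def by blast
  then show "Good S u"
  proof (induction rule: converse_rtranclp_induct)
    case (step y z)
    then obtain f N where f: "f 0 = z" "\<And>n. stp S (f n) (f (Suc n))" "\<And>n. n \<ge> N \<Longrightarrow> set (f n) \<subseteq> set (oks S)"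
      unfolding Good_def by blast
    have "stp S (case_nat y f n) (case_nat y f (Suc n))" for n using f step(1) by (cases n) auto
    moreover have "set (case_nat y f n) \<subseteq> set (oks S)" if "n \<ge> Suc N" for n using f that by (cases n) auto
    ultimately show ?case unfolding Good_def by (intro exI[of _ "case_nat y f"]) auto
  qed
qed

text \<open>Approximations from above to \<open>Gset S\<close>, the greatest set of words over
  \<open>oks S\<close> in which every word has a successor.\<close>

fun Xs :: "('q, 'l) nsys \<Rightarrow> nat \<Rightarrow> 'l list set" where
  "Xs S 0 = {w. set w \<subseteq> set (oks S)}"
| "Xs S (Suc n) = {w. set w \<subseteq> set (oks S) \<and> (\<exists>v\<in>Xs S n. stp S w v)}"

lemma Xs_oks: "w \<in> Xs S n \<Longrightarrow> set w \<subseteq> set (oks S)"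
  by (cases n) auto

lemma Xs_decseq: "Xs S (Suc n) \<subseteq> Xs S n"
  by (induction n) auto

lemma subseq_set: "subseq u w \<Longrightarrow> set u \<subseteq> set w"
  using subseq_conv_nths[of u w] by (auto dest: in_set_nthsD)

lemma Xs_down: "wf_nsys S \<Longrightarrow> w \<in> Xs S n \<Longrightarrow> subseq u w \<Longrightarrow> u \<in> Xs S n"
  by (cases n) (auto dest: subseq_set intro: stp_mono)

text \<open>The words that drop out at some stage have a finite basis. After the last of its members
  has dropped out, downward closure of the stages makes the chain stationary, and a stationary stage
  consists of words with infinite runs.\<close>

lemma Xs_limit:
  assumes wf: "wf_nsys S"
  shows "\<exists>N. Xs S N \<subseteq> Gset S"
proof -
  let ?U = "{w. set w \<subseteq> set (oks S) \<and> (\<exists>n. w \<notin> Xs S n)}"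
  obtain B where B: "set B \<subseteq> ?U" "\<And>u. u \<in> ?U \<Longrightarrow> \<exists>b\<in>set B. subseq b u"
    using finite_basis[of "set (oks S)" ?U] by auto
  then have "\<forall>b\<in>set B. \<exists>n. b \<notin> Xs S n" by blast
  then obtain k where k: "\<And>b. b \<in> set B \<Longrightarrow> b \<notin> Xs S (k b)" by metis
  define N where "N = Max (insert 0 (k ` set B))"
  have dec: "m \<le> n \<Longrightarrow> Xs S n \<subseteq> Xs S m" for m n by (rule lift_Suc_antimono_le[of "Xs S"]) (rule Xs_decseq)
  have "w \<in> Xs S n" if w: "w \<in> Xs S N" for w n
  proof (rule ccontr)
    assume "w \<notin> Xs S n"
    then obtain b where b: "b \<in> set B" "subseq b w" using B(2)[of w] Xs_oks[OF w] by blast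
    have "k b \<le> N" using b(1) unfolding N_def by (intro Max_ge) auto
    then have "b \<in> Xs S (k b)" using Xs_down[OF wf w b(2)] dec by blast
    then show False using k[OF b(1)] by blast
  qed
  then have "w \<in> Xs S (Suc N)" if "w \<in> Xs S N" for w using that by blast
  then have "\<And>w. w \<in> Xs S N \<Longrightarrow> set w \<subseteq> set (oks S) \<and> (\<exists>v\<in>Xs S N. stp S w v)"
    unfolding Xs.simps(2) by blast
  then have "w \<in> Gset S" if "w \<in> Xs S N" for w using GsetI[OF that] by blast
  then show ?thesis by blast
qed

lemma unsat_cert_complete:
  assumes wf: "wf_nsys S" and bad: "\<not> Good S u"
  shows "unsat_cert S u"
proof -
  obtain N where N: "Xs S N \<subseteq> Gset S" using Xs_limit[OF wf] by blast
  have Bn: "\<exists>B. badB S n B \<and> (\<forall>w. set w \<subseteq> set (oks S) \<and> w \<notin> Xs S n \<longrightarrow> covers B w)" for n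
  proof (induction n)
    case 0
    then show ?case by auto
  next
    case (Suc n)
    then obtain C where C: "badB S n C" "\<And>w. set w \<subseteq> set (oks S) \<Longrightarrow> w \<notin> Xs S n \<Longrightarrow> covers C w" by blast
    let ?U = "{w. set w \<subseteq> set (oks S) \<and> w \<notin> Xs S (Suc n)}"
    obtain B where B: "set B \<subseteq> ?U" "\<And>u. u \<in> ?U \<Longrightarrow> \<exists>b\<in>set B. subseq b u"
      using finite_basis[of "set (oks S)" ?U] by auto
    have "\<exists>J. Kcert S (oks S) C b J" if "b \<in> set B" for b
    proof (rule Kcert_complete)
      fix v assume "stp S b v" "set v \<subseteq> set (oks S)"
      then show "covers C v" using C(2) B(1) that by auto
    qed
    then have "badB S (Suc n) B" using C(1) by auto
    then show ?case using B(2) by (auto simp: covers_iff)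
  qed
  obtain B where B: "badB S N B" "\<And>w. set w \<subseteq> set (oks S) \<Longrightarrow> w \<notin> Xs S N \<Longrightarrow> covers B w" using Bn by blast
  let ?R = "{w. (stp S)\<^sup>*\<^sup>* u w}"
  have "set w \<subseteq> set (alph S) \<union> set u" if "w \<in> ?R" for w
    using that unfolding mem_Collect_eq
    by (cases rule: rtranclp.cases) (auto simp: stp_def dest: path_alph[OF wf])
  then obtain A where A: "set A \<subseteq> ?R" "\<And>w. w \<in> ?R \<Longrightarrow> \<exists>a\<in>set A. subseq a w"
    using finite_basis[of "set (alph S) \<union> set u" ?R] by auto
  have "\<exists>J. Kcert S (alph S) A a J" if "a \<in> set A" for a
  proof (rule Kcert_complete)
    fix v assume "stp S a v"
    then have "v \<in> ?R" using A(1) that by (auto intro: rtranclp.rtrancl_into_rtrancl)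
    then show "covers A v" using A(2) by (auto simp: covers_iff)
  qed
  moreover have "covers B a" if "a \<in> set A" "\<forall>x\<in>set a. x \<in> set (oks S)" for a
  proof -
    have "a \<notin> Xs S N" using that A(1) N bad unfolding Good_iff by blast
    then show ?thesis using B(2) that by auto
  qed
  moreover have "covers A u" using A(2)[of u] by (auto simp: covers_iff)
  ultimately show ?thesis using B(1) unfolding unsat_cert_def by blast
qed

text \<open>Certifies that every word over \<open>oks S\<close> not above \<open>B\<close> has a
  successor of the same kind. Each member of \<open>T\<close> belongs to an input read so far: its
  first component is the residual of \<open>B\<close> after the input, and the second lists
  reachable states together with the residuals of \<open>B\<close> after the output written on the
  way. This is a determinised product automaton, so the infinitely many words are checked by
  finitely many local conditions.\<close>

definition Tcert :: "('q, 'l) nsys \<Rightarrow> 'l list list \<Rightarrow> ('l list list \<times> ('q \<times> 'l list list) list) list \<Rightarrow> bool" where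
  "Tcert S B T \<longleftrightarrow>
     (\<exists>t\<in>set T. fst t = B \<and> (\<forall>p\<in>set (snd t). fst p \<in> set (starts S) \<and> snd p = B)) \<and>
     (\<forall>t\<in>set T. \<forall>x\<in>set (oks S). \<exists>t'\<in>set T. fst t' = ress (fst t) x \<and>
        (\<forall>p'\<in>set (snd t'). \<exists>p\<in>set (snd t). \<exists>v. path S (fst p) [x] v (fst p') \<and>
           (\<forall>y\<in>set v. y \<in> set (oks S)) \<and> snd p' = foldl ress (snd p) v)) \<and>
     (\<forall>t\<in>set T. [] \<notin> set (fst t) \<longrightarrow> (\<exists>p\<in>set (snd t). \<exists>q'\<in>set (finals S). \<exists>v. path S (fst p) [] v q' \<and>
        (\<forall>y\<in>set v. y \<in> set (oks S)) \<and> \<not> covers (snd p) v))"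

definition sat_cert :: "('q, 'l) nsys \<Rightarrow> 'l list \<Rightarrow> bool" where
  "sat_cert S u \<longleftrightarrow> (\<exists>w. \<exists>n. \<exists>B. \<exists>T. (stp S ^^ n) u w \<and> (\<forall>x\<in>set w. x \<in> set (oks S)) \<and> \<not> covers B w \<and> Tcert S B T)"

lemma sat_cert_sound:
  assumes "sat_cert S u"
  shows "Good S u"
proof -
  obtain w n B T where w: "(stp S ^^ n) u w" "set w \<subseteq> set (oks S)" "\<not> covers B w" and T: "Tcert S B T"
    using assms unfolding sat_cert_def by blast
  have inv: "\<exists>t\<in>set T. fst t = foldl ress B w \<and> (\<forall>p\<in>set (snd t). \<exists>q\<in>set (starts S). \<exists>v.
     path S q w v (fst p) \<and> set v \<subseteq> set (oks S) \<and> snd p = foldl ress B v)" if "set w \<subseteq> set (oks S)" for w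
    using that
  proof (induction w rule: rev_induct)
    case Nil
    from T obtain t where "t \<in> set T" "fst t = B" "\<forall>p\<in>set (snd t). fst p \<in> set (starts S) \<and> snd p = B"
      unfolding Tcert_def by blast
    then show ?case by (intro bexI[of _ t]) (auto intro!: path_Nil exI[of _ "[]"])
  next
    case (snoc x w)
    then have "set w \<subseteq> set (oks S)" and x: "x \<in> set (oks S)" by simp_all
    from snoc.IH[OF this(1)] obtain t where t: "t \<in> set T" "fst t = foldl ress B w" and
      P: "\<And>p. p \<in> set (snd t) \<Longrightarrow> \<exists>q\<in>set (starts S). \<exists>v. path S q w v (fst p) \<and> set v \<subseteq> set (oks S) \<and> snd p = foldl ress B v"
      by blast
    from T[unfolded Tcert_def, THEN conjunct2, THEN conjunct1, rule_format, OF t(1) x]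
    obtain t' where t': "t' \<in> set T" "fst t' = ress (fst t) x" and
      Q: "\<And>p'. p' \<in> set (snd t') \<Longrightarrow> \<exists>p\<in>set (snd t). \<exists>v. path S (fst p) [x] v (fst p') \<and>
         (\<forall>y\<in>set v. y \<in> set (oks S)) \<and> snd p' = foldl ress (snd p) v"
      by blast
    have "\<exists>q\<in>set (starts S). \<exists>v. path S q (w @ [x]) v (fst p') \<and> set v \<subseteq> set (oks S) \<and> snd p' = foldl ress B v"
      if p': "p' \<in> set (snd t')" for p'
    proof -
      obtain p v where p: "p \<in> set (snd t)" "path S (fst p) [x] v (fst p')" "set v \<subseteq> set (oks S)" "snd p' = foldl ress (snd p) v"
        using Q[OF p'] by blast
      obtain q v0 where "q \<in> set (starts S)" "path S q w v0 (fst p)" "set v0 \<subseteq> set (oks S)" "snd p = foldl ress B v0"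
        using P[OF p(1)] by blast
      then show ?thesis using p path_append[of S q w v0 "fst p" "[x]" v "fst p'"]
        by (intro bexI[of _ q] exI[of _ "v0 @ v"]) auto
    qed
    then show ?case using t' t by (intro bexI[of _ t']) auto
  qed
  have step: "\<exists>v. set v \<subseteq> set (oks S) \<and> \<not> covers B v \<and> stp S w v" if wo: "set w \<subseteq> set (oks S)" "\<not> covers B w" for w
  proof -
    obtain t where t: "t \<in> set T" "fst t = foldl ress B w" and
      P: "\<And>p. p \<in> set (snd t) \<Longrightarrow> \<exists>q\<in>set (starts S). \<exists>v. path S q w v (fst p) \<and> set v \<subseteq> set (oks S) \<and> snd p = foldl ress B v"
      using inv[OF wo(1)] by blast
    have "[] \<notin> set (fst t)" using wo(2) t by (simp add: covers_def)
    then obtain p q' v where p: "p \<in> set (snd t)" "q' \<in> set (finals S)" "path S (fst p) [] v q'" "set v \<subseteq> set (oks S)" "\<not> covers (snd p) v"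
      using T t(1) unfolding Tcert_def by blast
    obtain q v0 where "q \<in> set (starts S)" "path S q w v0 (fst p)" "set v0 \<subseteq> set (oks S)" "snd p = foldl ress B v0"
      using P[OF p(1)] by blast
    then show ?thesis using p path_append[of S q w v0 "fst p" "[]" v q']
      by (intro exI[of _ "v0 @ v"]) (auto simp: covers_def stp_def)
  qed
  have "w \<in> Gset S" by (rule GsetI[of _ "{w. set w \<subseteq> set (oks S) \<and> \<not> covers B w}"]) (use w step in auto)
  moreover have "(stp S)\<^sup>*\<^sup>* u w" using w(1) by (metis relpowp_imp_rtranclp)
  ultimately show ?thesis unfolding Good_iff by blast
qed

text \<open>\<open>Gset S\<close> is downward closed, so its complement within the words over
  \<open>oks S\<close> has a finite basis \<open>B\<close>; the subset construction for this
  \<open>B\<close> supplies \<open>T\<close>.\<close>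

lemma sat_cert_complete:
  assumes wf: "wf_nsys S" and "Good S u"
  shows "sat_cert S u"
proof -
  obtain w where w: "w \<in> Gset S" "(stp S)\<^sup>*\<^sup>* u w" using assms(2) unfolding Good_iff by blast
  then obtain n where n: "(stp S ^^ n) u w" by (metis rtranclp_imp_relpowp)
  let ?U = "{v. set v \<subseteq> set (oks S) \<and> v \<notin> Gset S}"
  obtain B where B: "set B \<subseteq> ?U" "\<And>u. u \<in> ?U \<Longrightarrow> \<exists>b\<in>set B. subseq b u"
    using finite_basis[of "set (oks S)" ?U] by auto
  have down: "v \<in> Gset S" if xv: "x \<in> Gset S" "subseq v x" for v x
  proof -
    obtain y where y: "y \<in> Gset S" "stp S x y" "set x \<subseteq> set (oks S)" using Gset_step[OF xv(1)] by blast
    have "stp S v y" using stp_mono[OF wf y(2) xv(2)] .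
    show ?thesis
      by (rule GsetI[of _ "insert v (Gset S)"]) (use y \<open>stp S v y\<close> subseq_set[OF xv(2)] Gset_step in blast)+
  qed
  have G: "v \<in> Gset S \<longleftrightarrow> \<not> covers B v" if "set v \<subseteq> set (oks S)" for v
  proof
    assume "v \<in> Gset S"
    then show "\<not> covers B v" using B(1) down unfolding covers_iff by blast
  next
    assume "\<not> covers B v"
    then show "v \<in> Gset S" using B(2)[of v] that unfolding covers_iff by blast
  qed
  \<comment> \<open>For the empty input only start states with nothing written are listed, as
    \<open>Tcert\<close> demands. Output that precedes the first letter read is attributed to the
    reading of that letter, or to the last clause of \<open>Tcert\<close> if there is none.\<close>
  define Q where "Q w = (if w = [] then {(q, B) | q. q \<in> set (starts S)}
     else {(p, foldl ress B v) | p v. set v \<subseteq> set (oks S) \<and> (\<exists>q\<in>set (starts S). path S q w v p)})" for w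
  define ls where "ls X = (SOME xs. set xs = X)" for X :: "('a \<times> 'b list list) set"
  have Qsub: "Q w \<subseteq> nstates S \<times> residuals B" for w
  proof
    fix x assume x: "x \<in> Q w"
    show "x \<in> nstates S \<times> residuals B"
    proof (cases "w = []")
      case True
      then show ?thesis using x by (auto simp: Q_def residuals_refl nstates_def)
    next
      case False
      then obtain p v q where "x = (p, foldl ress B v)" "q \<in> set (starts S)" "path S q w v p" using x by (auto simp: Q_def)
      then show ?thesis using path_nstates[of S q w v p] by (auto simp: nstates_def residuals_foldl residuals_refl)
    qed
  qed
  have finNR: "finite (nstates S \<times> residuals B)" by (simp add: finite_residuals nstates_def)
  have ls: "set (ls (Q w)) = Q w" for w
    unfolding ls_def by (rule someI_ex[OF finite_list]) (rule finite_subset[OF Qsub finNR])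
  let ?T = "(\<lambda>w. (foldl ress B w, ls (Q w))) ` {w. set w \<subseteq> set (oks S)}"
  have "?T \<subseteq> residuals B \<times> ls ` Pow (nstates S \<times> residuals B)"
  proof
    fix t assume "t \<in> ?T"
    then obtain w where "t = (foldl ress B w, ls (Q w))" by blast
    moreover have "foldl ress B w \<in> residuals B" by (simp add: residuals_foldl residuals_refl)
    ultimately show "t \<in> residuals B \<times> ls ` Pow (nstates S \<times> residuals B)" using Qsub[of w] by blast
  qed
  moreover have "finite (residuals B \<times> ls ` Pow (nstates S \<times> residuals B))"
    by (intro finite_cartesian_product finite_residuals finite_imageI finite_Pow_iff[THEN iffD2] finNR)
  ultimately have "finite ?T" by (rule finite_subset)
  from finite_list[OF this] obtain T where T: "set T = ?T" ..
  have "Tcert S B T" unfolding Tcert_def T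
  proof (intro conjI ballI impI)
    show "\<exists>t\<in>?T. fst t = B \<and> (\<forall>p\<in>set (snd t). fst p \<in> set (starts S) \<and> snd p = B)"
    proof (rule bexI[of _ "(B, ls (Q []))"])
      show "fst (B, ls (Q [])) = B \<and> (\<forall>p\<in>set (snd (B, ls (Q []))). fst p \<in> set (starts S) \<and> snd p = B)"
        unfolding snd_conv ls by (auto simp: Q_def)
      show "(B, ls (Q [])) \<in> ?T" by (rule image_eqI[of _ _ "[]"]) simp_all
    qed
  next
    fix t x assume "t \<in> ?T" and x: "x \<in> set (oks S)"
    then obtain w where w: "set w \<subseteq> set (oks S)" "t = (foldl ress B w, ls (Q w))" by blast
    have "\<exists>p\<in>Q w. \<exists>v. path S (fst p) [x] v (fst p') \<and> (\<forall>y\<in>set v. y \<in> set (oks S)) \<and> snd p' = foldl ress (snd p) v"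
      if p': "p' \<in> Q (w @ [x])" for p'
    proof -
      obtain v q where v: "q \<in> set (starts S)" "path S q (w @ [x]) v (fst p')" "set v \<subseteq> set (oks S)" "snd p' = foldl ress B v"
        using p' by (auto simp: Q_def)
      obtain p v1 v2 where s: "v = v1 @ v2" "path S q w v1 p" "path S p [x] v2 (fst p')"
        using path_split[OF wf v(2)] by blast
      show ?thesis
      proof (cases "w = []")
        case True
        then have "(q, B) \<in> Q w" using v by (simp add: Q_def)
        then show ?thesis using v True by (intro bexI[of _ "(q, B)"]) auto
      next
        case False
        then have "(p, foldl ress B v1) \<in> Q w" using s v by (auto simp: Q_def)
        then show ?thesis using s v by (intro bexI[of _ "(p, foldl ress B v1)"]) auto
      qed
    qed
    then show "\<exists>t'\<in>?T. fst t' = ress (fst t) x \<and> (\<forall>p'\<in>set (snd t'). \<exists>p\<in>set (snd t). \<exists>v. path S (fst p) [x] v (fst p') \<and>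
           (\<forall>y\<in>set v. y \<in> set (oks S)) \<and> snd p' = foldl ress (snd p) v)"
    proof (intro bexI[of _ "(foldl ress B (w @ [x]), ls (Q (w @ [x])))"] conjI)
      show "(foldl ress B (w @ [x]), ls (Q (w @ [x]))) \<in> ?T"
        using w x by (intro image_eqI[of _ _ "w @ [x]"]) simp_all
    qed (use w in \<open>simp_all add: ls\<close>)
  next
    fix t assume "t \<in> ?T" and ne: "[] \<notin> set (fst t)"
    then obtain w where w: "set w \<subseteq> set (oks S)" "t = (foldl ress B w, ls (Q w))" by blast
    then have "w \<in> Gset S" using ne G by (simp add: covers_def)
    then obtain v where v: "v \<in> Gset S" "stp S w v" using Gset_step by blast
    then have vo: "set v \<subseteq> set (oks S)" "\<not> covers B v" using Gset_step G by blast+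
    obtain q q' where q: "q \<in> set (starts S)" "q' \<in> set (finals S)" "path S q w v q'" using v(2) unfolding stp_def by blast
    show "\<exists>p\<in>set (snd t). \<exists>q'\<in>set (finals S). \<exists>v. path S (fst p) [] v q' \<and>
        (\<forall>y\<in>set v. y \<in> set (oks S)) \<and> \<not> covers (snd p) v"
    proof (cases "w = []")
      case True
      then have "(q, B) \<in> set (snd t)" using q unfolding w(2) snd_conv ls by (simp add: Q_def)
      then show ?thesis using q vo True by (intro bexI[of _ "(q, B)"] bexI[of _ q'] exI[of _ v]) auto
    next
      case False
      then have "(q', foldl ress B v) \<in> set (snd t)"
        using q vo unfolding w(2) snd_conv ls by (auto simp: Q_def)
      then show ?thesis using q vo path_Nil[of S q']
        by (intro bexI[of _ "(q', foldl ress B v)"] bexI[of _ q'] exI[of _ "[]"]) (auto simp: covers_def)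
    qed
  qed
  moreover have "set w \<subseteq> set (oks S)" "\<not> covers B w" using w(1) G Gset_step by blast+
  ultimately show ?thesis unfolding sat_cert_def using n by blast
qed

definition FF :: tptl where "FF = Freeze (Constr CNeq 0)"

section \<open>Constrained TPTL as a word system\<close>

text \<open>Read at an auxiliary position in front of the word, \<open>phi a\<close> turns the initial clock value 0 into the
  timestamp of an event: of the first one or, if that is later than 0, of one more auxiliary event. Gaps beyond
  the constants of \<open>a\<close> may be shortened to \<open>G\<close>, so \<open>psi G\<close> can be added; it forces infinitely many events.\<close>

definition phi :: "tptl \<Rightarrow> tptl" where
  "phi a = Until TT (Freeze (Or a (Until FF a)))"

definition psi :: "nat \<Rightarrow> tptl" where
  "psi G = Release FF (Freeze (Fin (And (Constr CLe G) TT)))"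

lemma sat_TT [simp]: "sat w i v TT" and sat_FF [simp]: "\<not> sat w i v FF"
  by (simp_all add: TT_def FF_def)

fun consts_less :: "nat \<Rightarrow> tptl \<Rightarrow> bool" where
  "consts_less G (Prop p) = True"
| "consts_less G (Freeze a) = consts_less G a"
| "consts_less G (Constr c n) = (n < G)"
| "consts_less G (And a b) = (consts_less G a \<and> consts_less G b)"
| "consts_less G (Or a b) = (consts_less G a \<and> consts_less G b)"
| "consts_less G (Until a b) = (consts_less G a \<and> consts_less G b)"
| "consts_less G (Release a b) = (consts_less G a \<and> consts_less G b)"

lemma consts_less_mono: "consts_less G a \<Longrightarrow> G \<le> H \<Longrightarrow> consts_less H a"
  by (induction a) auto

lemma consts_less_ex: "\<exists>G. consts_less G a"
proof (induction a)
  case (Constr c n)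
  then show ?case by (intro exI[of _ "Suc n"]) simp
next
  case (And a b)
  then show ?case by simp (meson consts_less_mono max.cobounded1 max.cobounded2)
next
  case (Or a b)
  then show ?case by simp (meson consts_less_mono max.cobounded1 max.cobounded2)
next
  case (Until a b)
  then show ?case by simp (meson consts_less_mono max.cobounded1 max.cobounded2)
next
  case (Release a b)
  then show ?case by simp (meson consts_less_mono max.cobounded1 max.cobounded2)
qed auto

text \<open>A formula sees time only through comparisons of differences with its constants.\<close>

lemma sat_cong:
  assumes fst: "\<And>i. fst (w i) = fst (w' i)"
    and t: "\<And>i j n c. i \<le> j \<Longrightarrow> n < G \<Longrightarrow>
      cmp_holds c (snd (w j) - snd (w i)) (real n) = cmp_holds c (snd (w' j) - snd (w' i)) (real n)"
    and "\<And>j n c. i \<le> j \<Longrightarrow> n < G \<Longrightarrow> cmp_holds c (snd (w j) - v) (real n) = cmp_holds c (snd (w' j) - v') (real n)"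
    and "consts_less G a"
  shows "sat w i v a \<longleftrightarrow> sat w' i v' a"
  using assms(3,4)
proof (induction a arbitrary: i v v')
  case (Freeze a)
  have "sat w i (snd (w i)) a \<longleftrightarrow> sat w' i (snd (w' i)) a"
    by (rule Freeze.IH) (use t Freeze.prems in auto)
  then show ?case by simp
next
  case (And a b)
  then show ?case using And.IH[of i v v'] by simp
next
  case (Or a b)
  then show ?case using Or.IH[of i v v'] by simp
next
  case (Until a b)
  have "sat w j v a \<longleftrightarrow> sat w' j v' a" "sat w j v b \<longleftrightarrow> sat w' j v' b" if "i < j" for j
    using Until.prems that by (auto intro!: Until.IH)
  then show ?case by auto
next
  case (Release a b)
  have "sat w j v a \<longleftrightarrow> sat w' j v' a" "sat w j v b \<longleftrightarrow> sat w' j v' b" if "i < j" for j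
    using Release.prems that by (auto intro!: Release.IH)
  then show ?case by auto
qed (auto simp: fst)

lemma sat_shift:
  assumes "\<And>i. fst (w' i) = fst (w (i + d)) \<and> snd (w' i) = snd (w (i + d)) - c"
  shows "sat w' i (v - c) a \<longleftrightarrow> sat w (i + d) v a"
proof (induction a arbitrary: i v)
  case (Freeze a)
  then show ?case using assms[of i] by simp
next
  case (Until a b)
  have "(\<exists>j>i. P (j + d) \<and> (\<forall>k. i < k \<and> k < j \<longrightarrow> Q (k + d))) \<longleftrightarrow>
        (\<exists>j>i + d. P j \<and> (\<forall>k. i + d < k \<and> k < j \<longrightarrow> Q k))" (is "?A \<longleftrightarrow> ?B") for P Q
  proof
    assume ?A
    then obtain j where j: "j > i" "P (j + d)" "\<And>k. i < k \<Longrightarrow> k < j \<Longrightarrow> Q (k + d)" by blast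
    have "Q k" if "i + d < k" "k < j + d" for k using j(3)[of "k - d"] that by simp
    then show ?B using j by (intro exI[of _ "j + d"]) auto
  next
    assume ?B
    then obtain j where j: "j > i + d" "P j" "\<And>k. i + d < k \<Longrightarrow> k < j \<Longrightarrow> Q k" by blast
    then show ?A by (intro exI[of _ "j - d"]) auto
  qed
  then show ?case using Until by simp
next
  case (Release a b)
  have "(\<forall>j>i. P (j + d) \<or> (\<exists>k. i < k \<and> k < j \<and> Q (k + d))) \<longleftrightarrow>
        (\<forall>j>i + d. P j \<or> (\<exists>k. i + d < k \<and> k < j \<and> Q k))" (is "?A \<longleftrightarrow> ?B") for P Q
  proof
    assume A: ?A
    show ?B
    proof (intro allI impI)
      fix j assume j: "i + d < j"
      then have "i < j - d" by simp
      from A[rule_format, OF this] consider "P (j - d + d)" | k where "i < k" "k < j - d" "Q (k + d)" by blast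
      then show "P j \<or> (\<exists>k. i + d < k \<and> k < j \<and> Q k)"
      proof cases
        case (2 k)
        then show ?thesis by (intro disjI2 exI[of _ "k + d"]) auto
      qed (use j in simp)
    qed
  next
    assume B: ?B
    show ?A
    proof (intro allI impI)
      fix j assume j: "i < j"
      then consider "P (j + d)" | k where "i + d < k" "k < j + d" "Q k" using B[rule_format, of "j + d"] by auto
      then show "P (j + d) \<or> (\<exists>k. i < k \<and> k < j \<and> Q (k + d))"
      proof cases
        case (2 k)
        then show ?thesis by (intro disjI2 exI[of _ "k - d"]) auto
      qed simp
    qed
  qed
  then show ?case using Release by simp
qed (use assms in \<open>auto simp: algebra_simps\<close>)

lemma tptl_sat_from_phi:
  assumes w: "\<And>i. i \<ge> 1 \<Longrightarrow> fst (w i) < k" "\<And>i. snd (w i) < snd (w (Suc i))" "\<And>T. \<exists>i. T < snd (w i)"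
    and s: "sat w 0 v (phi a)"
  shows "tptl_sat k a"
proof -
  have mono: "i < j \<Longrightarrow> snd (w i) < snd (w j)" for i j
    by (rule strict_mono_less[THEN iffD2]) (auto simp: strict_mono_Suc_iff w)
  have *: "tptl_sat k a" if "sat w d c a" "d \<ge> 1" "c \<le> snd (w d)" for d c
  proof -
    define w' where "w' i = (fst (w (i + d)), snd (w (i + d)) - c)" for i
    have "sat w' 0 (c - c) a \<longleftrightarrow> sat w (0 + d) c a" by (rule sat_shift) (simp add: w'_def)
    then have "sat w' 0 0 a" using that by simp
    moreover have "timed_word k w'" unfolding timed_word_def
    proof (intro conjI allI)
      fix i
      show "fst (w' i) < k" "snd (w' i) < snd (w' (Suc i))" using w that by (auto simp: w'_def)
      show "0 \<le> snd (w' i)" using mono[of d "i + d"] that by (cases i) (auto simp: w'_def)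
    next
      fix T
      obtain i where i: "T + c < snd (w i)" using w(3) by blast
      show "\<exists>i. T < snd (w' i)"
      proof (cases "d \<le> i")
        case True
        then show ?thesis using i by (intro exI[of _ "i - d"]) (auto simp: w'_def)
      next
        case False
        then show ?thesis using i mono[of i d] by (intro exI[of _ 0]) (auto simp: w'_def)
      qed
    qed
    ultimately show ?thesis unfolding tptl_sat_def by blast
  qed
  from s obtain j where j: "j > 0" "sat w j (snd (w j)) a \<or> sat w j (snd (w j)) (Until FF a)"
    by (auto simp: phi_def)
  from j(2) show ?thesis
  proof
    assume "sat w j (snd (w j)) (Until FF a)"
    then obtain l where l: "l > j" "sat w l (snd (w j)) a" by auto
    then show ?thesis using * mono[of j l] by simp
  qed (use * j in simp)
qed

lemma tptl_sat_to_phi: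
  assumes "tptl_sat k a" and G: "consts_less G a" "0 < G"
  shows "\<exists>w. (\<forall>i. fst (w i) < k) \<and> (\<forall>i. snd (w i) < snd (w (Suc i))) \<and> (\<forall>T. \<exists>i. T < snd (w i)) \<and>
    snd (w 0) = - 1 / 4 \<and> 0 \<le> snd (w 1) \<and> sat w 0 v (phi a) \<and> sat w 0 v (psi G)"
proof -
  obtain w0 where w0: "timed_word k w0" "sat w0 0 0 a" using assms(1) unfolding tptl_sat_def by blast
  have k: "0 < k" using w0(1) unfolding timed_word_def by (metis gr_zeroI not_less0)
  have "\<exists>w. timed_word k w \<and> sat w 0 (snd (w 0)) (Or a (Until FF a))"
  proof (cases "snd (w0 0) = 0")
    case True
    then show ?thesis using w0 by (intro exI[of _ w0]) simp
  next
    case False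
    define w where "w = case_nat (0, 0) w0"
    have "timed_word k w"
      unfolding timed_word_def
    proof (intro conjI allI)
      fix i
      have f: "fst (w0 n) < k" and p: "0 \<le> snd (w0 n)" and m: "snd (w0 n) < snd (w0 (Suc n))" for n
        using w0(1) unfolding timed_word_def by blast+
      have "0 < snd (w0 0)" using p[of 0] False by simp
      then show "fst (w i) < k" "0 \<le> snd (w i)" "snd (w i) < snd (w (Suc i))"
        unfolding w_def by (cases i; use k f p m in simp)+
    next
      fix T
      obtain i where "T < snd (w0 i)" using w0(1) unfolding timed_word_def by blast
      then show "\<exists>i. T < snd (w i)" by (intro exI[of _ "Suc i"]) (simp add: w_def)
    qed
    moreover have "sat w0 0 (0 - 0) a \<longleftrightarrow> sat w (0 + 1) 0 a" by (rule sat_shift) (simp add: w_def)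
    then have "sat w 0 (snd (w 0)) (Until FF a)" using w0(2) by (auto simp: w_def intro!: exI[of _ 1])
    ultimately show ?thesis by auto
  qed
  then obtain w1 where w1: "timed_word k w1" "sat w1 0 (snd (w1 0)) (Or a (Until FF a))" by blast
  \<comment> \<open>Gaps are cut down to \<open>G\<close>. A difference that contains a cut gap
    exceeds every constant of \<open>a\<close> before and after, and the other differences do not
    change.\<close>
  define d where "d i = min (snd (w1 (Suc i)) - snd (w1 i)) (real G)" for i
  define t where "t n = (\<Sum>i<n. d i)" for n
  define w2 where "w2 i = (fst (w1 i), t i)" for i
  have d: "0 < d i" "d i \<le> G" "d i \<le> snd (w1 (Suc i)) - snd (w1 i)" for i
    using w1(1) G(2) by (auto simp: d_def timed_word_def)
  have tdiff: "t j - t i = (\<Sum>k=i..<j. d k)" if "i \<le> j" for i j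
    using that by (simp add: t_def lessThan_atLeast0 sum_diff_nat_ivl[of 0 i j d, simplified])
  have wdiff: "snd (w1 j) - snd (w1 i) = (\<Sum>k=i..<j. snd (w1 (Suc k)) - snd (w1 k))" if "i \<le> j" for i j
    using sum_Suc_diff'[OF that, of "\<lambda>i. snd (w1 i)"] by simp
  have cmp: "cmp_holds c (snd (w1 j) - snd (w1 i)) (real n) = cmp_holds c (snd (w2 j) - snd (w2 i)) (real n)"
    if ij: "i \<le> j" and n: "n < G" for i j n c
  proof (cases "\<forall>k\<in>{i..<j}. snd (w1 (Suc k)) - snd (w1 k) \<le> G")
    case True
    then have "snd (w1 j) - snd (w1 i) = t j - t i"
      unfolding wdiff[OF ij] tdiff[OF ij] by (intro sum.cong) (auto simp: d_def)
    then show ?thesis by (simp add: w2_def)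
  next
    case False
    then obtain k where k: "k \<in> {i..<j}" "d k = G" by (auto simp: d_def)
    have "d k \<le> (\<Sum>k=i..<j. d k)" using k(1) d(1) by (intro member_le_sum) (auto intro: less_imp_le)
    then have a: "real n < snd (w2 j) - snd (w2 i)" using k n by (simp add: w2_def tdiff[OF ij])
    also have "\<dots> \<le> snd (w1 j) - snd (w1 i)"
      unfolding w2_def snd_conv wdiff[OF ij] tdiff[OF ij] by (intro sum_mono d)
    finally show ?thesis using a by (cases c) auto
  qed
  have "sat w1 0 (snd (w1 0)) (Or a (Until FF a)) \<longleftrightarrow> sat w2 0 (snd (w2 0)) (Or a (Until FF a))"
    by (rule sat_cong[where G = G]) (use cmp G in \<open>auto simp: w2_def FF_def\<close>)
  then have s2: "sat w2 0 (snd (w2 0)) (Or a (Until FF a))" using w1 by simp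
  \<comment> \<open>Time still diverges: with finitely many gaps of length \<open>G\<close> the new
    word is eventually a translate of the old one, with infinitely many of them it advances by at
    least 1 infinitely often.\<close>
  have unb: "\<exists>i. T < t i" for T
  proof (cases "finite {i. d i = G}")
    case True
    then obtain m where "\<forall>i\<in>{i. d i = G}. i < m" using finite_nat_set_iff_bounded by blast
    have m: "d i = snd (w1 (Suc i)) - snd (w1 i)" if "m \<le> i" for i
    proof -
      have "d i \<noteq> G" using \<open>\<forall>i\<in>_. i < m\<close> that by (auto simp: not_less[symmetric])
      then show ?thesis by (auto simp: d_def min_def split: if_splits)
    qed
    obtain j where j: "T + snd (w1 m) < snd (w1 j)" using w1(1) unfolding timed_word_def by blast
    have tm: "0 \<le> t m" unfolding t_def by (intro sum_nonneg) (use d in \<open>auto intro: less_imp_le\<close>)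
    show ?thesis
    proof (cases "m \<le> j")
      case True
      have "t j - t m = snd (w1 j) - snd (w1 m)"
        unfolding tdiff[OF True] wdiff[OF True] by (intro sum.cong) (use m in auto)
      then show ?thesis using j tm by (intro exI[of _ j]) linarith
    next
      case False
      have "strict_mono (\<lambda>i. snd (w1 i))" using w1(1) by (simp add: strict_mono_Suc_iff timed_word_def)
      from strict_mono_less_eq[OF this, of j m] have "snd (w1 j) \<le> snd (w1 m)" using False by simp
      then show ?thesis using j tm by (intro exI[of _ m]) linarith
    qed
  next
    case False
    define S where "S = {i. d i = G}"
    obtain N :: nat where N: "T < real N" using reals_Archimedean2 by blast
    obtain F where F: "F \<subseteq> S" "finite F" "card F = N" using infinite_arbitrarily_large[of S N] False unfolding S_def by blast
    obtain m where m: "\<forall>i\<in>F. i < m" using F(2) finite_nat_set_iff_bounded by blast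
    have "real N \<le> (\<Sum>i\<in>F. d i)"
    proof -
      have "(\<Sum>i\<in>F. d i) = real N * G" using F by (subst sum.cong[of F F d "\<lambda>_. real G"]) (auto simp: S_def)
      moreover have "real N * 1 \<le> real N * G" using G(2) by (intro mult_left_mono) auto
      ultimately show ?thesis by simp
    qed
    also have "\<dots> \<le> t m" unfolding t_def by (rule sum_mono2) (use m d in \<open>auto intro: less_imp_le\<close>)
    finally show ?thesis using N by (intro exI[of _ m]) linarith
  qed
  \<comment> \<open>The auxiliary front position needs a time before 0 and after the clock value
    -1/2 with which the run will start.\<close>
  define w where "w = case_nat (0, - 1 / 4) w2"
  have "sat w2 0 (snd (w2 0) - 0) (Or a (Until FF a)) \<longleftrightarrow> sat w (0 + 1) (snd (w2 0)) (Or a (Until FF a))"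
    by (rule sat_shift) (simp add: w_def)
  then have "sat w 1 (snd (w 1)) (Or a (Until FF a))" using s2 by (simp add: w_def)
  then have "sat w 1 v (Freeze (Or a (Until FF a)))" by (simp only: sat.simps(2))
  then have "sat w 0 v (phi a)" unfolding phi_def sat.simps(6)
    by (intro exI[of _ 1] conjI) simp_all
  moreover have "snd (w (Suc (Suc j))) - snd (w (Suc j)) \<le> G" for j
    using d(2)[of j] by (simp add: w_def w2_def t_def)
  then have "sat w 0 v (psi G)"
  proof -
    assume *: "\<And>j. snd (w (Suc (Suc j))) - snd (w (Suc j)) \<le> G"
    have "sat w j v (Freeze (Fin (And (Constr CLe G) TT)))" if "j > 0" for j
      using *[of "j - 1"] that by (auto simp: Fin_def intro!: exI[of _ "Suc j"])
    then show ?thesis unfolding psi_def sat.simps(7) by blast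
  qed
  moreover have "\<forall>i. fst (w i) < k" using w1(1) k by (auto simp: w_def w2_def timed_word_def split: nat.split)
  moreover have "\<forall>i. snd (w i) < snd (w (Suc i))" using d(1) by (auto simp: w_def w2_def t_def split: nat.split)
  moreover have "\<exists>i. T < snd (w i)" for T using unb[of T] by (metis old.nat.simps(5) snd_conv w2_def w_def)
  moreover have "snd (w 0) = - 1 / 4" "0 \<le> snd (w 1)" by (simp_all add: w_def w2_def t_def)
  ultimately show ?thesis by blast
qed

section \<open>Clock regions and local evaluation\<close>

fun cmpn :: "cmp \<Rightarrow> nat \<Rightarrow> nat \<Rightarrow> bool" where
  "cmpn CEq a b = (a = b)"
| "cmpn CNeq a b = (a \<noteq> b)"
| "cmpn CLt a b = (a < b)"
| "cmpn CLe a b = (a \<le> b)"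
| "cmpn CGt a b = (a > b)"
| "cmpn CGe a b = (a \<ge> b)"

text \<open>Regions of clock values: \<open>2 * m\<close> stands for the value \<open>m\<close>, and \<open>2 * m + 1\<close> for the open interval
  between \<open>m\<close> and \<open>m + 1\<close>.\<close>
definition isreg :: "real \<Rightarrow> nat \<Rightarrow> bool" where
  "isreg d r \<longleftrightarrow> (if even r then d = r / 2 else (r - 1) / 2 < d \<and> d < (r + 1) / 2)"

lemma isreg_exact: "isreg (real m) (2 * m)"
  and isreg_open: "real m < d \<Longrightarrow> d < real m + 1 \<Longrightarrow> isreg d (2 * m + 1)"
  by (auto simp: isreg_def field_simps)

text \<open>On the doubled scale a region compares with \<open>2 * n\<close> as its values compare
  with \<open>n\<close>; truncation at \<open>L\<close> is invisible since
  \<open>2 * n < L\<close>.\<close>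

lemma cmpn_isreg:
  assumes "isreg d r" "2 * n < L"
  shows "cmpn c (min r L) (2 * n) \<longleftrightarrow> cmp_holds c d (real n)"
proof -
  have *: "r = 2 * n \<longleftrightarrow> d = n" "r < 2 * n \<longleftrightarrow> d < n"
  proof -
    consider m where "r = 2 * m" "d = m" | m where "r = 2 * m + 1" "m < d" "d < m + 1"
      using assms(1) by (cases "even r") (auto simp: isreg_def elim!: evenE oddE)
    then show "r = 2 * n \<longleftrightarrow> d = n" "r < 2 * n \<longleftrightarrow> d < n"
    proof (atomize (full), cases)
      case (2 m)
      have "d \<noteq> n" using 2 by (metis Suc_eq_plus1 less_Suc_eq_le not_less of_nat_1 of_nat_add of_nat_less_iff)
      moreover have "m < n \<longleftrightarrow> d < n"
      proof
        assume "m < n" then have "real m + 1 \<le> n" by linarith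
        then show "d < n" using 2 by linarith
      next
        assume "d < n" then have "real m < real n" using 2 by linarith
        then show "m < n" by simp
      qed
      moreover have "r \<noteq> 2 * n" "r < 2 * n \<longleftrightarrow> m < n" using 2 by presburger+
      ultimately show "(r = 2 * n) = (d = n) \<and> (r < 2 * n) = (d < n)" by blast
    qed auto
  qed
  have "min r L = 2 * n \<longleftrightarrow> r = 2 * n" "min r L < 2 * n \<longleftrightarrow> r < 2 * n" using assms(2) by auto
  then have e: "min r L = 2 * n \<longleftrightarrow> d = n" and l: "min r L < 2 * n \<longleftrightarrow> d < n" using * by blast+
  have le: "min r L \<le> 2 * n \<longleftrightarrow> d \<le> n" using e l unfolding le_less by blast
  show ?thesis
  proof (cases c)
    case CGt
    then show ?thesis using le by (simp only: cmpn.simps cmp_holds.simps not_le[symmetric])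
  next
    case CGe
    then show ?thesis using l by (simp only: cmpn.simps cmp_holds.simps not_less[symmetric])
  qed (simp_all only: cmpn.simps cmp_holds.simps e l le)
qed

text \<open>Local evaluation at a position with letter \<open>p\<close> and clock region \<open>r\<close>: the eventualities that are postponed to the
  next position are looked up in \<open>N\<close> for the current clock value and in \<open>R\<close> for a clock reset at this position.\<close>

fun lc :: "nat \<Rightarrow> nat \<Rightarrow> tptl list \<Rightarrow> tptl list \<Rightarrow> tptl \<Rightarrow> bool" where
  "lc p r N R (Prop q) = (p = q)"
| "lc p r N R (Freeze a) = lc p 0 R R a"
| "lc p r N R (Constr c n) = cmpn c r (2 * n)"
| "lc p r N R (And a b) = (lc p r N R a \<and> lc p r N R b)"
| "lc p r N R (Or a b) = (lc p r N R a \<or> lc p r N R b)"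
| "lc p r N R (Until a b) = (Until a b \<in> set N)"
| "lc p r N R (Release a b) = (Release a b \<in> set N)"

text \<open>The modalities are strict: an obligation that is pending at a position is unfolded at
  the following one, where its right argument is tested at once.\<close>

fun pst :: "nat \<Rightarrow> nat \<Rightarrow> tptl list \<Rightarrow> tptl list \<Rightarrow> tptl \<Rightarrow> bool" where
  "pst p r N R (Until a b) = (lc p r N R b \<or> (lc p r N R a \<and> Until a b \<in> set N))"
| "pst p r N R (Release a b) = (lc p r N R b \<and> (lc p r N R a \<or> Release a b \<in> set N))"
| "pst p r N R _ = False"

text \<open>There is no negation, so additional promises in \<open>N\<close> can only make more
  formulas true.\<close>

lemma lc_mono: "lc p r N R a \<Longrightarrow> set N \<subseteq> set N' \<Longrightarrow> lc p r N' R a"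
  by (induction a) auto

lemma pst_mono: "pst p r N R a \<Longrightarrow> set N \<subseteq> set N' \<Longrightarrow> pst p r N' R a"
  using lc_mono[of p r N R] by (cases a) auto

fun imm :: "tptl \<Rightarrow> tptl list" where
  "imm (Prop p) = []"
| "imm (Freeze a) = [a]"
| "imm (Constr c n) = []"
| "imm (And a b) = [a, b]"
| "imm (Or a b) = [a, b]"
| "imm (Until a b) = [a, b]"
| "imm (Release a b) = [a, b]"

definition subclosed :: "tptl list \<Rightarrow> bool" where
  "subclosed D \<longleftrightarrow> (\<forall>a\<in>set D. \<forall>b\<in>set (imm a). b \<in> set D)"

lemma subclosedD: "subclosed D \<Longrightarrow> a \<in> set D \<Longrightarrow> b \<in> set (imm a) \<Longrightarrow> b \<in> set D"
  unfolding subclosed_def by blast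

text \<open>The constants in use are at most \<open>G\<close>: the regions up to
  \<open>2 * G\<close> are kept apart, and \<open>2 * G + 1\<close> stands for all values beyond
  \<open>G\<close>.\<close>

definition cap :: "nat \<Rightarrow> nat" where "cap G = 2 * G + 1"

text \<open>\<open>Ob j v a\<close> is a promise that \<open>a\<close> holds at \<open>j\<close> for
  clock value \<open>v\<close>. Promises that are locally consistent at each next position and never
  postpone an \<open>Until\<close> for ever are kept; \<open>Release\<close> needs no such progress
  condition.\<close>

lemma sound_sem:
  assumes D: "subclosed D" "\<And>a. a \<in> set D \<Longrightarrow> consts_less (Suc G) a"
    and step: "\<And>j v a. Ob j v a \<Longrightarrow> \<exists>r N R. isreg (snd (w (Suc j)) - v) r \<and>
      pst (fst (w (Suc j))) (min r (cap G)) N R a \<and>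
      (\<forall>b\<in>set N. Ob (Suc j) v b) \<and> (\<forall>b\<in>set R. Ob (Suc j) (snd (w (Suc j))) b)"
    and dis: "\<And>j v a b. Ob j v (Until a b) \<Longrightarrow> \<exists>m. \<not> Ob (j + m) v (Until a b)"
    and ob: "Ob j v a" "a \<in> set D"
  shows "sat w j v a"
proof -
  \<comment> \<open>Truthfulness of local evaluation. It goes by induction on the formula, because
    only \<open>Until\<close> and \<open>Release\<close> are looked up among the promises, and their
    truth reduces to \<open>P\<close> for the two arguments.\<close>
  define P where "P a \<longleftrightarrow> (\<forall>i v r N R. isreg (snd (w i) - v) r \<and> lc (fst (w i)) (min r (cap G)) N R a \<and>
    (\<forall>b\<in>set N. Ob i v b) \<and> (\<forall>b\<in>set R. Ob i (snd (w i)) b) \<longrightarrow> sat w i v a)" for a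
  have U: "sat w j v (Until a b)" if "P a" "P b" "Ob j v (Until a b)" for a b j v
  proof (rule ccontr)
    assume no: "\<not> ?thesis"
    have "Ob (j + m) v (Until a b) \<and> (\<forall>k. j < k \<and> k \<le> j + m \<longrightarrow> sat w k v a)" for m
    proof (induction m)
      case 0
      then show ?case using that by auto
    next
      case (Suc m)
      obtain r N R where *: "isreg (snd (w (Suc (j + m))) - v) r"
        "pst (fst (w (Suc (j + m)))) (min r (cap G)) N R (Until a b)"
        "\<forall>b\<in>set N. Ob (Suc (j + m)) v b" "\<forall>b\<in>set R. Ob (Suc (j + m)) (snd (w (Suc (j + m)))) b"
        using step[of "j + m" v "Until a b"] Suc by blast
      show ?case
      proof (cases "lc (fst (w (Suc (j + m)))) (min r (cap G)) N R b")
        case True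
        then have "sat w (Suc (j + m)) v b" using \<open>P b\<close> * unfolding P_def by blast
        then have "sat w j v (Until a b)" using Suc by (auto intro!: exI[of _ "Suc (j + m)"])
        then show ?thesis using no by blast
      next
        case False
        then have l: "lc (fst (w (Suc (j + m)))) (min r (cap G)) N R a" "Until a b \<in> set N" using *(2) by auto
        then have "sat w (Suc (j + m)) v a" using \<open>P a\<close> * unfolding P_def by blast
        then show ?thesis using Suc l *(3) by (auto simp: le_Suc_eq)
      qed
    qed
    then show False using dis[OF that(3)] by blast
  qed
  have Rl: "sat w j v (Release a b)" if "P a" "P b" "Ob j v (Release a b)" for a b j v
  proof -
    have st: "sat w (Suc i) v b \<and> (sat w (Suc i) v a \<or> Ob (Suc i) v (Release a b))" if ob: "Ob i v (Release a b)" for i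
    proof -
      obtain r N R where *: "isreg (snd (w (Suc i)) - v) r"
        "pst (fst (w (Suc i))) (min r (cap G)) N R (Release a b)"
        "\<forall>b\<in>set N. Ob (Suc i) v b" "\<forall>b\<in>set R. Ob (Suc i) (snd (w (Suc i))) b"
        using step[OF ob] by blast
      from *(2) have "lc (fst (w (Suc i))) (min r (cap G)) N R b"
        "lc (fst (w (Suc i))) (min r (cap G)) N R a \<or> Release a b \<in> set N" by simp_all
      then show ?thesis using \<open>P a\<close> \<open>P b\<close> * unfolding P_def by blast
    qed
    have ind: "(\<exists>k. j < k \<and> k \<le> j + m \<and> sat w k v a) \<or> Ob (j + m) v (Release a b)" for m
    proof (induction m)
      case (Suc m)
      then consider k where "j < k" "k \<le> j + m" "sat w k v a" | "Ob (j + m) v (Release a b)" by blast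
      then show ?case
      proof cases
        case (1 k)
        then show ?thesis by (intro disjI1 exI[of _ k]) simp
      next
        case 2
        from st[OF this] show ?thesis by (auto intro: exI[of _ "Suc (j + m)"])
      qed
    qed (use that in simp)
    have *: "sat w (Suc (j + m)) v b \<or> (\<exists>k. j < k \<and> k \<le> j + m \<and> sat w k v a)" for m
      using ind[of m] st[of "j + m"] by blast
    show ?thesis unfolding sat.simps
    proof (intro allI impI)
      fix i assume "j < i"
      then show "sat w i v b \<or> (\<exists>k>j. k < i \<and> sat w k v a)"
        using *[of "i - Suc j"] by (auto simp: less_eq_Suc_le)
    qed
  qed
  have P: "a \<in> set D \<Longrightarrow> P a" for a
  proof (induction a)
    case (Prop x)
    then show ?case by (auto simp: P_def)
  next
    case (Freeze a)
    then have "P a" using subclosedD[OF D(1) Freeze.prems] by simp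
    moreover have "isreg (x - x) 0" for x using isreg_exact[of 0] by simp
    ultimately show ?case unfolding P_def lc.simps sat.simps by (metis min_0L)
  next
    case (Constr c n)
    then have "2 * n < cap G" using D(2) by (fastforce simp: cap_def)
    then show ?case unfolding P_def lc.simps sat.simps using cmpn_isreg by blast
  next
    case (And a b)
    then have "P a" "P b" using subclosedD[OF D(1) And.prems] by simp_all
    then show ?case unfolding P_def lc.simps sat.simps by blast
  next
    case (Or a b)
    then have "P a" "P b" using subclosedD[OF D(1) Or.prems] by simp_all
    then show ?case unfolding P_def lc.simps sat.simps by blast
  next
    case (Until a b)
    then have "P a" "P b" using subclosedD[OF D(1) Until.prems] by simp_all
    then show ?case using U unfolding P_def[of "Until a b"] lc.simps by blast
  next
    case (Release a b)
    then have "P a" "P b" using subclosedD[OF D(1) Release.prems] by simp_all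
    then show ?case using Rl unfolding P_def[of "Release a b"] lc.simps by blast
  qed
  obtain r N R where *: "pst (fst (w (Suc j))) (min r (cap G)) N R a" using step[OF ob(1)] by blast
  show ?thesis
  proof (cases a)
    case (Until b c)
    then show ?thesis using U P subclosedD[OF D(1) ob(2)] ob by simp
  next
    case (Release b c)
    then show ?thesis using Rl P subclosedD[OF D(1) ob(2)] ob by simp
  qed (use * in auto)
qed

text \<open>In \<open>bsat J\<close> the eventualities that are not positive have to be met before position \<open>J\<close>.\<close>
fun bsat :: "nat \<Rightarrow> tword \<Rightarrow> nat \<Rightarrow> real \<Rightarrow> tptl \<Rightarrow> bool" where
  "bsat J w i v (Prop p) = (fst (w i) = p)"
| "bsat J w i v (Freeze a) = bsat J w i (snd (w i)) a"
| "bsat J w i v (Constr c n) = cmp_holds c (snd (w i) - v) (real n)"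
| "bsat J w i v (And a b) = (bsat J w i v a \<and> bsat J w i v b)"
| "bsat J w i v (Or a b) = (bsat J w i v a \<or> bsat J w i v b)"
| "bsat J w i v (Until a b) = (\<exists>j>i. (positive (Until a b) \<or> j < J) \<and> bsat J w j v b \<and> (\<forall>k. i < k \<and> k < j \<longrightarrow> bsat J w k v a))"
| "bsat J w i v (Release a b) = (\<forall>j>i. bsat J w j v b \<or> (\<exists>k. i < k \<and> k < j \<and> bsat J w k v a))"

lemma positive_TT: "positive TT"
  unfolding TT_def by (intro positive.intros)

lemma positive_UntilE:
  assumes "positive (Until a b)"
  obtains c d where "a = TT" "b = And (Constr CLe c) d" "positive d"
  using assms by (cases rule: positive.cases) (auto simp: Fin_def)

lemma bsat_positive: "positive a \<Longrightarrow> bsat J w i v a \<longleftrightarrow> sat w i v a"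
proof (induction a arbitrary: i v rule: positive.induct)
  case (7 b c)
  then have "positive (Until TT (And (Constr CLe c) b))" using positive.intros(7) by (simp add: Fin_def)
  then show ?case using 7 by (simp add: Fin_def) (simp add: TT_def)
qed auto

lemma bsat_mono: "bsat J w i v a \<Longrightarrow> J \<le> J' \<Longrightarrow> bsat J' w i v a"
proof (induction a arbitrary: i v)
  case (Until a b)
  then show ?case by simp (meson less_le_trans)
next
  case (Release a b)
  then show ?case by simp blast
qed auto

text \<open>Below \<open>Release\<close> and inside bounded eventualities a constrained formula is
  positive. So the remaining eventualities need only finitely many witnesses in a given model, and a
  bound beyond all of them exists.\<close>

lemma constrained_bsat: "constrained a \<Longrightarrow> sat w i v a \<Longrightarrow> \<exists>J. bsat J w i v a"
proof (induction a arbitrary: i v rule: constrained.induct)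
  case (4 a b)
  then show ?case by (metis bsat.simps(5) sat.simps(5))
next
  case (5 a b)
  then show ?case by simp (meson bsat_mono max.cobounded1 max.cobounded2)
next
  case (6 a b)
  then obtain j where j: "j > i" "sat w j v b" "\<And>k. i < k \<Longrightarrow> k < j \<Longrightarrow> sat w k v a" by auto
  obtain Jb where Jb: "bsat Jb w j v b" using 6 j by blast
  have "\<exists>J. bsat J w k v a" if "i < k" "k < j" for k using 6 j that by blast
  then obtain Ja where Ja: "\<And>k. i < k \<Longrightarrow> k < j \<Longrightarrow> bsat (Ja k) w k v a" by metis
  define J where "J = Max (insert Jb (insert (Suc j) (Ja ` {i<..<j})))"
  have J: "Jb \<le> J" "Suc j \<le> J" and Jk: "\<And>k. i < k \<Longrightarrow> k < j \<Longrightarrow> Ja k \<le> J"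
    unfolding J_def by (rule Max_ge; simp)+
  have "bsat J w i v (Until a b)"
    using j(1) J bsat_mono[OF Jb J(1)] bsat_mono[OF Ja Jk] by auto
  then show ?case by blast
qed (auto simp: bsat_positive)

definition pend :: "tptl \<Rightarrow> bool" where
  "pend a \<longleftrightarrow> (\<exists>b c. a = Until b c \<or> a = Release b c)"

lemma lc_complete:
  assumes D: "subclosed D" "\<And>a. a \<in> set D \<Longrightarrow> consts_less (Suc G) a"
    and "a \<in> set D" "isreg (snd (w i) - v) r" "bsat J w i v a"
    and "\<And>b. b \<in> set D \<Longrightarrow> pend b \<Longrightarrow> bsat J w i v b \<Longrightarrow> b \<in> set N"
    and R: "\<And>b. b \<in> set D \<Longrightarrow> pend b \<Longrightarrow> bsat J w i (snd (w i)) b \<Longrightarrow> b \<in> set R"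
  shows "lc (fst (w i)) (min r (cap G)) N R a"
  using assms(3-6)
proof (induction a arbitrary: v r N)
  case (Freeze a)
  have "isreg (x - x) 0" for x using isreg_exact[of 0] by simp
  then have "lc (fst (w i)) (min 0 (cap G)) R R a"
    using Freeze subclosedD[OF D(1) Freeze.prems(1)] R by (intro Freeze.IH[of "snd (w i)"]) auto
  then show ?case by simp
next
  case (Constr c n)
  then have "2 * n < cap G" using D(2) by (fastforce simp: cap_def)
  then show ?case using Constr cmpn_isreg by simp
next
  case (And a b)
  then show ?case using subclosedD[OF D(1) And.prems(1)] by simp
next
  case (Or a b)
  then show ?case using subclosedD[OF D(1) Or.prems(1)] by auto
qed (auto simp: pend_def)

text \<open>The converse of \<open>sound_sem\<close> at one position, for the canonical promises:
  all pending formulas of \<open>D\<close> that are true in the sense of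
  \<open>bsat J\<close>.\<close>

lemma pst_complete:
  assumes D: "subclosed D" "\<And>a. a \<in> set D \<Longrightarrow> consts_less (Suc G) a"
    and a: "a \<in> set D" "pend a" "isreg (snd (w (Suc j)) - v) r" "bsat J w j v a"
    and N: "\<And>b. b \<in> set D \<Longrightarrow> pend b \<Longrightarrow> bsat J w (Suc j) v b \<Longrightarrow> b \<in> set N"
    and R: "\<And>b. b \<in> set D \<Longrightarrow> pend b \<Longrightarrow> bsat J w (Suc j) (snd (w (Suc j))) b \<Longrightarrow> b \<in> set R"
  shows "pst (fst (w (Suc j))) (min r (cap G)) N R a"
proof -
  have lc: "lc (fst (w (Suc j))) (min r (cap G)) N R b" if "b \<in> set D" "bsat J w (Suc j) v b" for b
    by (rule lc_complete[OF D that(1) a(3) that(2)]) (use N R in auto)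
  from a(2) consider b c where "a = Until b c" | b c where "a = Release b c" by (auto simp: pend_def)
  then show ?thesis
  proof cases
    case (1 b c)
    have bc: "b \<in> set D" "c \<in> set D" using subclosedD[OF D(1) a(1)] 1 by auto
    from a(4) obtain i where i: "i > j" "positive a \<or> i < J" "bsat J w i v c" "\<And>k. j < k \<Longrightarrow> k < i \<Longrightarrow> bsat J w k v b"
      by (auto simp: 1)
    show ?thesis
    proof (cases "i = Suc j")
      case True
      then show ?thesis using lc[OF bc(2)] i by (simp add: 1)
    next
      case False
      then have "bsat J w (Suc j) v a" using i unfolding 1 bsat.simps by (intro exI[of _ i]) auto
      moreover have "bsat J w (Suc j) v b" using i False by simp
      ultimately show ?thesis using lc[OF bc(1)] N[OF a(1,2)] by (simp add: 1)
    qed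
  next
    case (2 b c)
    have bc: "b \<in> set D" "c \<in> set D" using subclosedD[OF D(1) a(1)] 2 by auto
    have all: "bsat J w i v c \<or> (\<exists>k. j < k \<and> k < i \<and> bsat J w k v b)" if "i > j" for i
      using a(4) that by (simp add: 2)
    have c: "bsat J w (Suc j) v c" using all[of "Suc j"] by auto
    show ?thesis
    proof (cases "bsat J w (Suc j) v b")
      case True
      then show ?thesis using lc[OF bc(1)] lc[OF bc(2)] c by (simp add: 2)
    next
      case False
      have "bsat J w (Suc j) v a" unfolding 2 bsat.simps
      proof (intro allI impI)
        fix i assume "Suc j < i"
        then consider "bsat J w i v c" | k where "j < k" "k < i" "bsat J w k v b" using all[of i] by auto
        then show "bsat J w i v c \<or> (\<exists>k>Suc j. k < i \<and> bsat J w k v b)"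
        proof cases
          case (2 k)
          then have "k \<noteq> Suc j" using False by blast
          then show ?thesis using 2 by (intro disjI2 exI[of _ k]) auto
        qed simp
      qed
      then show ?thesis using lc[OF bc(2)] c N[OF a(1,2)] by (simp add: 2)
    qed
  qed
qed

text \<open>A letter collects the obligations (with the regions of their clocks) that share a fractional part. An
  entry \<open>(xo, eo, y)\<close> describes one fractional part during a unit interval: the letter before, the event, if
  any, and the letter afterwards. The events before and after that fractional part act on
  a row through relations on letters, of which there are finitely many.\<close>

type_synonym letter = "(tptl \<times> nat) list"
type_synonym event = "nat \<times> tptl list"
type_synonym entry = "letter list \<times> event list \<times> letter"
type_synonym lrel = "(letter \<times> letter) list"

definition proj :: "letter \<Rightarrow> nat \<Rightarrow> tptl list" where
  "proj y r = map fst (filter (\<lambda>s. snd s = r) y)"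

definition sh :: "nat \<Rightarrow> nat \<Rightarrow> nat" where "sh G r = min (Suc r) (cap G)"

definition proc :: "event \<Rightarrow> letter \<Rightarrow> letter \<Rightarrow> bool" where
  "proc e x y \<longleftrightarrow> (\<forall>s\<in>set x. pst (fst e) (snd s) (proj y (snd s)) (snd e) (fst s))"

text \<open>A clock with the fractional part of the row takes an integer value exactly at this
  entry. Two regions are passed on the way, and an event here (\<open>atev\<close>) sees the one in
  between. Clocks frozen by that event are in region 1, the interval between 0 and 1, immediately
  afterwards.\<close>

definition noev :: "nat \<Rightarrow> letter \<Rightarrow> letter \<Rightarrow> bool" where
  "noev G x y \<longleftrightarrow> (\<forall>s\<in>set x. (fst s, sh G (sh G (snd s))) \<in> set y)"

definition atev :: "nat \<Rightarrow> event \<Rightarrow> letter \<Rightarrow> letter \<Rightarrow> bool" where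
  "atev G e x y \<longleftrightarrow>
     (\<forall>s\<in>set x. pst (fst e) (sh G (snd s)) (proj y (sh G (sh G (snd s)))) (snd e) (fst s)) \<and>
     (\<forall>a\<in>set (snd e). (a, 1) \<in> set y)"

definition mid :: "nat \<Rightarrow> event list \<Rightarrow> letter \<Rightarrow> letter \<Rightarrow> bool" where
  "mid G eo x y \<longleftrightarrow> (if eo = [] then noev G x y else atev G (hd eo) x y)"

definition side :: "event list \<Rightarrow> letter \<Rightarrow> letter \<Rightarrow> bool" where
  "side eo x y \<longleftrightarrow> (if eo = [] then set x \<subseteq> set y else proc (hd eo) x y)"

lemma proj_mem: "a \<in> set (proj y r) \<longleftrightarrow> (a, r) \<in> set y"
  by (force simp: proj_def)

lemma proj_mono: "set y \<subseteq> set y' \<Longrightarrow> set (proj y r) \<subseteq> set (proj y' r)"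
  by (auto simp: proj_mem)

lemma proc_mono: "proc e x y \<Longrightarrow> set x' \<subseteq> set x \<Longrightarrow> set y \<subseteq> set y' \<Longrightarrow> proc e x' y'"
  unfolding proc_def using pst_mono[OF _ proj_mono] by blast

lemma mid_mono: "mid G eo x y \<Longrightarrow> set x' \<subseteq> set x \<Longrightarrow> set y \<subseteq> set y' \<Longrightarrow> mid G eo x' y'"
proof (cases "eo = []")
  case False
  assume *: "mid G eo x y" "set x' \<subseteq> set x" "set y \<subseteq> set y'"
  show ?thesis unfolding mid_def if_not_P[OF False] atev_def
  proof (intro conjI ballI)
    fix s assume "s \<in> set x'"
    then show "pst (fst (hd eo)) (sh G (snd s)) (proj y' (sh G (sh G (snd s)))) (snd (hd eo)) (fst s)"
      using * False by (intro pst_mono[OF _ proj_mono[OF *(3)]]) (auto simp: mid_def atev_def)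
  qed (use * False in \<open>auto simp: mid_def atev_def\<close>)
qed (auto simp: mid_def noev_def)

lemma side_mono: "side eo x y \<Longrightarrow> set x' \<subseteq> set x \<Longrightarrow> side eo x' y"
  unfolding side_def by (metis proc_mono subset_refl subset_trans)

fun procs :: "letter list \<Rightarrow> event list \<Rightarrow> letter \<Rightarrow> letter \<Rightarrow> bool" where
  "procs lt [] x y \<longleftrightarrow> set x \<subseteq> set y"
| "procs lt (e # E) x y \<longleftrightarrow> (\<exists>z\<in>set lt. proc e x z \<and> procs lt E z y)"

lemma procs_anti: "procs lt E x y \<Longrightarrow> set x' \<subseteq> set x \<Longrightarrow> procs lt E x' y"
  by (cases E) (auto intro: proc_mono)

lemma procs_snoc:
  "x \<in> set lt \<Longrightarrow> z \<in> set lt \<Longrightarrow> procs lt (E @ [e]) x z \<longleftrightarrow> (\<exists>y\<in>set lt. procs lt E x y \<and> proc e y z)"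
proof (induction E arbitrary: x)
  case Nil
  then show ?case by (auto intro: proc_mono)
next
  case (Cons d E)
  then show ?case by (auto simp: Cons.IH)
qed

definition relE :: "letter list \<Rightarrow> event list \<Rightarrow> lrel" where
  "relE lt E = filter (\<lambda>p. procs lt E (fst p) (snd p)) (List.product lt lt)"

definition preR :: "letter list \<Rightarrow> event \<Rightarrow> lrel \<Rightarrow> lrel" where
  "preR lt e s = filter (\<lambda>p. \<exists>y\<in>set lt. proc e (fst p) y \<and> (y, snd p) \<in> set s) (List.product lt lt)"

definition postR :: "letter list \<Rightarrow> event \<Rightarrow> lrel \<Rightarrow> lrel" where
  "postR lt e m = filter (\<lambda>p. \<exists>y\<in>set lt. (fst p, y) \<in> set m \<and> proc e y (snd p)) (List.product lt lt)"

definition relI :: "letter list \<Rightarrow> lrel" where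
  "relI lt = filter (\<lambda>p. set (fst p) \<subseteq> set (snd p)) (List.product lt lt)"

lemma relI: "relI lt = relE lt []"
  by (simp add: relI_def relE_def)

lemma relE_mem: "(x, y) \<in> set (relE lt E) \<longleftrightarrow> x \<in> set lt \<and> y \<in> set lt \<and> procs lt E x y"
  by (auto simp: relE_def)

lemma preR_relE: "preR lt e (relE lt E) = relE lt (e # E)"
  unfolding preR_def relE_def[of lt "e # E"] by (rule filter_cong) (auto simp: relE_mem)

lemma postR_relE: "postR lt e (relE lt E) = relE lt (E @ [e])"
  unfolding postR_def relE_def[of lt "E @ [e]"]
  by (rule filter_cong) (auto simp: relE_mem procs_snoc)

definition preO :: "letter list \<Rightarrow> event list \<Rightarrow> lrel \<Rightarrow> lrel" where
  "preO lt eo s = (if eo = [] then s else preR lt (hd eo) s)"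

definition postO :: "letter list \<Rightarrow> event list \<Rightarrow> lrel \<Rightarrow> lrel" where
  "postO lt eo m = (if eo = [] then m else postR lt (hd eo) m)"

lemma preO_relE: "length eo \<le> 1 \<Longrightarrow> preO lt eo (relE lt E) = relE lt (eo @ E)"
  by (cases eo) (auto simp: preO_def preR_relE)

lemma postO_relE: "length eo \<le> 1 \<Longrightarrow> postO lt eo (relE lt E) = relE lt (E @ eo)"
  by (cases eo) (auto simp: postO_def postR_relE)

definition opts :: "'a list \<Rightarrow> 'a list list" where
  "opts xs = [] # map (\<lambda>x. [x]) xs"

lemma opts_length: "x \<in> set (opts xs) \<Longrightarrow> length x \<le> 1"
  and opts_mem: "x \<in> set (opts xs) \<longleftrightarrow> x = [] \<or> (\<exists>y\<in>set xs. x = [y])"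
  by (auto simp: opts_def)

definition lts :: "nat \<Rightarrow> tptl list \<Rightarrow> letter list" where
  "lts G D = subseqs (List.product D [0..<Suc (cap G)])"

definition evl :: "nat \<Rightarrow> tptl list \<Rightarrow> event list" where
  "evl k D = List.product [0..<k] (subseqs D)"

text \<open>Read at integer times: an eventuality with deadline \<open>c\<close> may be pending only
  while its clock is below \<open>c\<close>. Since truncated regions end up at \<open>cap G\<close>,
  which exceeds every such \<open>2 * c\<close>, no eventuality is pending for ever in a run over
  these letters.\<close>

definition okst :: "tptl list \<Rightarrow> nat \<Rightarrow> tptl \<times> nat \<Rightarrow> bool" where
  "okst D G s \<longleftrightarrow> (\<exists>a\<in>set D. \<exists>b\<in>set D. fst s = Release a b \<or>
     (\<exists>c\<in>set [0..<Suc G]. fst s = Until a (And (Constr CLe c) b) \<and> snd s < 2 * c))"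

text \<open>\<open>xo = []\<close> is used for a row that inherits nothing, such as the fractional
  part of a new event. Inclusion instead of equality makes the rule remain valid when its input
  letter is left out.\<close>

definition mids :: "letter list \<Rightarrow> nat \<Rightarrow> lrel \<times> lrel \<times> letter list \<times> event list \<times> letter \<Rightarrow> bool" where
  "mids lt G t \<longleftrightarrow> (\<exists>x\<in>set lt. \<exists>x1\<in>set lt. \<exists>x2\<in>set lt. set (concat (fst (snd (snd t)))) \<subseteq> set x \<and>
     (x, x1) \<in> set (fst t) \<and> mid G (fst (snd (snd (snd t)))) x1 x2 \<and>
     (x2, snd (snd (snd (snd t)))) \<in> set (fst (snd t)))"

text \<open>The relation of the events already passed is accumulated at its end. The relation of the
  events to come is guessed at the start and consumed from its front; a final state demands that
  nothing is left of it but \<open>relI\<close>.\<close>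

definition mk :: "letter list \<Rightarrow> lrel \<times> lrel \<times> letter list \<times> event list \<times> letter \<Rightarrow>
    (lrel \<times> lrel) \<times> letter list \<times> letter \<times> lrel \<times> lrel" where
  "mk lt t = ((fst t, preO lt (fst (snd (snd (snd t)))) (fst (snd t))), fst (snd (snd t)),
     snd (snd (snd (snd t))), postO lt (fst (snd (snd (snd t)))) (fst t), fst (snd t))"

text \<open>The states are the pairs of relations of the events to the left and to the right of the current entry.\<close>

definition sys :: "nat \<Rightarrow> nat \<Rightarrow> tptl list \<Rightarrow> lrel list \<Rightarrow> (lrel \<times> lrel, letter) nsys" where
  "sys G k D M = (map (mk (lts G D)) (filter (mids (lts G D) G)
       (List.product M (List.product M (List.product (opts (lts G D)) (List.product (opts (evl k D)) (lts G D)))))),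
     map (\<lambda>s. (relI (lts G D), s)) M, map (\<lambda>m. (m, relI (lts G D))) M, lts G D,
     filter (\<lambda>x. \<forall>s\<in>set x. okst D G s) (lts G D))"

text \<open>Every event list is built up from the front, so closure under \<open>preR\<close>
  already yields all \<open>relE lt E\<close>, including those that arise by
  \<open>postR\<close>.\<close>

definition closedM :: "nat \<Rightarrow> nat \<Rightarrow> tptl list \<Rightarrow> lrel list \<Rightarrow> bool" where
  "closedM G k D M \<longleftrightarrow> relI (lts G D) \<in> set M \<and> (\<forall>m\<in>set M. \<forall>e\<in>set (evl k D). preR (lts G D) e m \<in> set M)"

lemma mids_iff: "mids lt G (m, s, xo, eo, y) \<longleftrightarrow> (\<exists>x\<in>set lt. \<exists>x1\<in>set lt. \<exists>x2\<in>set lt. set (concat xo) \<subseteq> set x \<and>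
     (x, x1) \<in> set m \<and> mid G eo x1 x2 \<and> (x2, y) \<in> set s)"
  by (simp add: mids_def)

lemma sys_rules: "(q, xo, y, q') \<in> set (rules (sys G k D M)) \<longleftrightarrow> (\<exists>m\<in>set M. \<exists>s\<in>set M. \<exists>eo\<in>set (opts (evl k D)).
    xo \<in> set (opts (lts G D)) \<and> y \<in> set (lts G D) \<and> mids (lts G D) G (m, s, xo, eo, y) \<and>
    q = (m, preO (lts G D) eo s) \<and> q' = (postO (lts G D) eo m, s))"
  unfolding sys_def fst_conv set_map set_filter set_product by (force simp: mk_def)

lemma wf_sys: "wf_nsys (sys G k D M)"
  unfolding wf_nsys_def
proof (intro allI impI conjI)
  fix q xo y q' assume "(q, xo, y, q') \<in> set (rules (sys G k D M))"
  then obtain m s eo where *: "m \<in> set M" "s \<in> set M" "eo \<in> set (opts (evl k D))"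
    "xo \<in> set (opts (lts G D))" "y \<in> set (lts G D)" "mids (lts G D) G (m, s, xo, eo, y)"
    "q = (m, preO (lts G D) eo s)" "q' = (postO (lts G D) eo m, s)" unfolding sys_rules by blast
  show "length xo \<le> 1" using *(4) by (rule opts_length)
  show "y \<in> set (alph (sys G k D M))" using *(5) by (simp add: sys_def)
  have "mids (lts G D) G (m, s, [], eo, y)" using *(6) unfolding mids_iff by auto
  moreover have "[] \<in> set (opts (lts G D))" by (simp add: opts_def)
  ultimately show "(q, [], y, q') \<in> set (rules (sys G k D M))"
    using * unfolding sys_rules by blast
qed

definition rowval :: "letter list \<Rightarrow> nat \<Rightarrow> event list \<Rightarrow> entry \<Rightarrow> event list \<Rightarrow> bool" where
  "rowval lt G E1 z E2 \<longleftrightarrow> (\<exists>x\<in>set lt. \<exists>x1\<in>set lt. \<exists>x2\<in>set lt. set (concat (fst z)) \<subseteq> set x \<and>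
     procs lt E1 x x1 \<and> mid G (fst (snd z)) x1 x2 \<and> procs lt E2 x2 (snd (snd z)))"

definition evz :: "entry list \<Rightarrow> event list" where
  "evz zs = concat (map (\<lambda>z. fst (snd z)) zs)"

fun rows :: "letter list \<Rightarrow> nat \<Rightarrow> event list \<Rightarrow> entry list \<Rightarrow> bool" where
  "rows lt G E [] = True"
| "rows lt G E (z # zs) = (rowval lt G E z (evz zs) \<and> rows lt G (E @ fst (snd z)) zs)"

definition entries :: "nat \<Rightarrow> nat \<Rightarrow> tptl list \<Rightarrow> entry list \<Rightarrow> bool" where
  "entries G k D zs \<longleftrightarrow> (\<forall>z\<in>set zs. fst z \<in> set (opts (lts G D)) \<and> fst (snd z) \<in> set (opts (evl k D)) \<and> snd (snd z) \<in> set (lts G D))"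

lemma evz_simps [simp]: "evz [] = []" "evz (z # zs) = fst (snd z) @ evz zs" "evz (zs @ ws) = evz zs @ evz ws"
  by (simp_all add: evz_def)

lemma path_rows:
  assumes "path (sys G k D M) q u v q'" "fst q = relE (lts G D) E" "snd q' = relI (lts G D)"
  shows "\<exists>zs. entries G k D zs \<and> u = concat (map fst zs) \<and> v = map (\<lambda>z. snd (snd z)) zs \<and>
    rows (lts G D) G E zs \<and> snd q = relE (lts G D) (evz zs)"
  using assms
proof (induction arbitrary: E rule: path.induct)
  case (path_Nil q)
  then show ?case by (intro exI[of _ "[]"]) (simp add: entries_def relI)
next
  case (path_Cons q xo y q' u v q'')
  then obtain m s eo where *: "m \<in> set M" "s \<in> set M" "eo \<in> set (opts (evl k D))"
    "xo \<in> set (opts (lts G D))" "y \<in> set (lts G D)" "mids (lts G D) G (m, s, xo, eo, y)"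
    "q = (m, preO (lts G D) eo s)" "q' = (postO (lts G D) eo m, s)" unfolding sys_rules by blast
  have eo: "length eo \<le> 1" using *(3) by (rule opts_length)
  have m: "m = relE (lts G D) E" using path_Cons.prems * by simp
  then have "fst q' = relE (lts G D) (E @ eo)" using * postO_relE[OF eo] by simp
  from path_Cons.IH[OF this path_Cons.prems(2)] obtain zs where
    zs: "entries G k D zs" "u = concat (map fst zs)" "v = map (\<lambda>z. snd (snd z)) zs"
    "rows (lts G D) G (E @ eo) zs" "s = relE (lts G D) (evz zs)" using * by auto
  have "rowval (lts G D) G E (xo, eo, y) (evz zs)"
    using *(6) unfolding mids_iff rowval_def m zs(5) relE_mem by auto
  then show ?case using * zs preO_relE[OF eo]
    by (intro exI[of _ "(xo, eo, y) # zs"]) (simp add: entries_def)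
qed

lemma relE_closedM:
  assumes "closedM G k D M" "set E \<subseteq> set (evl k D)"
  shows "relE (lts G D) E \<in> set M"
  using assms(2)
proof (induction E)
  case Nil
  then show ?case using assms(1) by (simp add: closedM_def relI)
next
  case (Cons e E)
  then show ?case using assms(1) by (simp add: closedM_def preR_relE[symmetric])
qed

lemma entries_evz: "entries G k D zs \<Longrightarrow> set (evz zs) \<subseteq> set (evl k D)"
  by (induction zs) (auto simp: entries_def opts_mem)

lemma rows_path:
  assumes M: "closedM G k D M" and "entries G k D zs" "rows (lts G D) G E zs" "set E \<subseteq> set (evl k D)"
  shows "path (sys G k D M) (relE (lts G D) E, relE (lts G D) (evz zs)) (concat (map fst zs)) (map (\<lambda>z. snd (snd z)) zs)
    (relE (lts G D) (E @ evz zs), relI (lts G D))"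
  using assms(2-)
proof (induction zs arbitrary: E)
  case Nil
  then show ?case by (simp add: relI path_Nil)
next
  case (Cons z zs)
  obtain xo eo y where z: "z = (xo, eo, y)" by (cases z)
  have e: "entries G k D zs" "xo \<in> set (opts (lts G D))" "eo \<in> set (opts (evl k D))" "y \<in> set (lts G D)"
    using Cons.prems(1) by (auto simp: entries_def z)
  have eo: "length eo \<le> 1" using e(3) by (rule opts_length)
  have Eeo: "set (E @ eo) \<subseteq> set (evl k D)" using e(3) Cons.prems by (auto simp: opts_mem)
  have r: "rowval (lts G D) G E (xo, eo, y) (evz zs)" "rows (lts G D) G (E @ eo) zs" using Cons.prems by (auto simp: z)
  have "mids (lts G D) G (relE (lts G D) E, relE (lts G D) (evz zs), xo, eo, y)"
    using r(1) e(4) unfolding mids_iff rowval_def relE_mem by auto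
  moreover have "relE (lts G D) E \<in> set M" using relE_closedM[OF M] Cons.prems by simp
  moreover have "relE (lts G D) (evz zs) \<in> set M" using relE_closedM[OF M entries_evz[OF e(1)]] .
  ultimately have "((relE (lts G D) E, relE (lts G D) (eo @ evz zs)), xo, y,
      (relE (lts G D) (E @ eo), relE (lts G D) (evz zs))) \<in> set (rules (sys G k D M))"
    unfolding sys_rules using e preO_relE[OF eo] postO_relE[OF eo]
    by (intro bexI[of _ "relE (lts G D) E"] bexI[of _ "relE (lts G D) (evz zs)"] bexI[of _ eo]) simp_all
  from path_Cons[OF this Cons.IH[OF e(1) r(2) Eeo]] show ?case by (simp add: z)
qed

lemma stp_rows:
  assumes "stp (sys G k D M) u v"
  shows "\<exists>zs. entries G k D zs \<and> u = concat (map fst zs) \<and> v = map (\<lambda>z. snd (snd z)) zs \<and> rows (lts G D) G [] zs"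
proof -
  obtain q q' where "q \<in> set (starts (sys G k D M))" "q' \<in> set (finals (sys G k D M))" "path (sys G k D M) q u v q'"
    using assms unfolding stp_def by blast
  then show ?thesis using path_rows[of G k D M q u v q' "[]"] by (auto simp: sys_def relI)
qed

lemma rows_stp:
  assumes M: "closedM G k D M" and zs: "entries G k D zs" "rows (lts G D) G [] zs"
  shows "stp (sys G k D M) (concat (map fst zs)) (map (\<lambda>z. snd (snd z)) zs)"
proof -
  have "relE (lts G D) (evz zs) \<in> set M" using relE_closedM[OF M entries_evz[OF zs(1)]] .
  then show ?thesis using rows_path[OF M zs] unfolding stp_def by (auto simp: sys_def relI)
qed

lemma rows_nth:
  "rows lt G E zs \<longleftrightarrow> (\<forall>r<length zs. rowval lt G (E @ evz (take r zs)) (zs ! r) (evz (drop (Suc r) zs)))"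
proof (induction zs arbitrary: E)
  case (Cons z zs)
  show ?case unfolding rows.simps Cons.IH length_Cons All_less_Suc2 by simp
qed simp

text \<open>The letters a row runs through when the entries of a unit are passed one after the other.\<close>
definition chain :: "nat \<Rightarrow> entry list \<Rightarrow> nat \<Rightarrow> (nat \<Rightarrow> letter) \<Rightarrow> bool" where
  "chain G zs r Y \<longleftrightarrow> set (concat (fst (zs ! r))) \<subseteq> set (Y 0) \<and> Y (length zs) = snd (snd (zs ! r)) \<and>
     (\<forall>i<length zs. if i = r then mid G (fst (snd (zs ! i))) (Y i) (Y (Suc i))
       else side (fst (snd (zs ! i))) (Y i) (Y (Suc i)))"

lemma procs_chain:
  assumes "procs lt (evz ws) x y" "\<And>w. w \<in> set ws \<Longrightarrow> length (fst (snd w)) \<le> 1"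
  shows "\<exists>c. set x \<subseteq> set (c 0) \<and> c (length ws) = y \<and> (\<forall>i<length ws. side (fst (snd (ws ! i))) (c i) (c (Suc i)))"
  using assms
proof (induction ws arbitrary: x)
  case Nil
  then show ?case by (intro exI[of _ "\<lambda>_. y"]) simp
next
  case (Cons w ws)
  have "\<exists>z. procs lt (evz ws) z y \<and> (\<forall>z'. set z \<subseteq> set z' \<longrightarrow> side (fst (snd w)) x z')"
  proof (cases "fst (snd w)")
    case Nil
    then show ?thesis using Cons.prems by (intro exI[of _ x]) (auto simp: side_def)
  next
    case (Cons e E)
    then have "E = []" using Cons.prems(2)[of w] by simp
    then obtain z where "proc e x z" "procs lt (evz ws) z y" using Cons.prems(1) Cons by auto
    then show ?thesis using Cons by (intro exI[of _ z]) (auto simp: side_def intro: proc_mono)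
  qed
  then obtain z where z: "procs lt (evz ws) z y" "\<And>z'. set z \<subseteq> set z' \<Longrightarrow> side (fst (snd w)) x z'" by blast
  obtain c where c: "set z \<subseteq> set (c 0)" "c (length ws) = y" "\<forall>i<length ws. side (fst (snd (ws ! i))) (c i) (c (Suc i))"
    using Cons.IH[OF z(1)] Cons.prems(2) by auto
  show ?case
    by (rule exI[of _ "case_nat x c"]) (use c z(2) in \<open>auto simp: nth_Cons split: nat.split\<close>)
qed

lemma chain_procs:
  assumes "\<And>i. i \<le> length ws \<Longrightarrow> c i \<in> set lt" "\<And>i. i < length ws \<Longrightarrow> side (fst (snd (ws ! i))) (c i) (c (Suc i))"
    "\<And>w. w \<in> set ws \<Longrightarrow> length (fst (snd w)) \<le> 1"
  shows "procs lt (evz ws) (c 0) (c (length ws))"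
  using assms
proof (induction ws arbitrary: c)
  case (Cons w ws)
  have "procs lt (evz ws) (c (Suc 0)) (c (Suc (length ws)))"
    by (rule Cons.IH[of "\<lambda>i. c (Suc i)"]) (use Cons.prems Cons.prems(2)[of "Suc _"] in auto)
  moreover have "side (fst (snd w)) (c 0) (c (Suc 0))" using Cons.prems(2)[of 0] by simp
  moreover have "c (Suc 0) \<in> set lt" using Cons.prems(1)[of "Suc 0"] by simp
  moreover have "fst (snd w) = [] \<or> (\<exists>e. fst (snd w) = [e])" using Cons.prems(3)[of w] by (cases "fst (snd w)") auto
  ultimately show ?case by (auto simp: side_def intro: procs_anti)
qed simp

text \<open>The two relations are resolved into intermediate letters, one per entry. Starting
  exactly with the letter read makes the chains of consecutive units fit together.\<close>

lemma rowval_chain: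
  assumes "rowval lt G (evz (take r zs)) (zs ! r) (evz (drop (Suc r) zs))" "r < length zs"
    and l: "\<And>z. z \<in> set zs \<Longrightarrow> length (fst (snd z)) \<le> 1"
  shows "\<exists>Y. chain G zs r Y \<and> Y 0 = concat (fst (zs ! r))"
proof -
  obtain x x1 x2 where x: "set (concat (fst (zs ! r))) \<subseteq> set x" "procs lt (evz (take r zs)) x x1"
    "mid G (fst (snd (zs ! r))) x1 x2" "procs lt (evz (drop (Suc r) zs)) x2 (snd (snd (zs ! r)))"
    using assms(1) unfolding rowval_def by blast
  obtain c where c: "set x \<subseteq> set (c 0)" "c r = x1" "\<And>i. i < r \<Longrightarrow> side (fst (snd (zs ! i))) (c i) (c (Suc i))"
  proof -
    have "length (fst (snd w)) \<le> 1" if "w \<in> set (take r zs)" for w using l[OF in_set_takeD[OF that]] .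
    from procs_chain[OF x(2) this] show ?thesis using that assms(2) by (auto simp: min_def)
  qed
  obtain d where d: "set x2 \<subseteq> set (d 0)" "d (length zs - Suc r) = snd (snd (zs ! r))"
    "\<And>i. i < length zs - Suc r \<Longrightarrow> side (fst (snd (zs ! (Suc r + i)))) (d i) (d (Suc i))"
  proof -
    have "length (fst (snd w)) \<le> 1" if "w \<in> set (drop (Suc r) zs)" for w using l[OF in_set_dropD[OF that]] .
    from procs_chain[OF x(4) this] show ?thesis using that assms(2) by auto
  qed
  have "chain G zs r (\<lambda>i. if i \<le> r then c i else d (i - Suc r))" unfolding chain_def
  proof (intro conjI allI impI)
    fix i assume i: "i < length zs"
    consider "i = r" | "i < r" | j where "i = Suc r + j" by (metis less_imp_Suc_add linorder_neqE_nat add_Suc)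
    then show "if i = r then mid G (fst (snd (zs ! i))) (if i \<le> r then c i else d (i - Suc r)) (if Suc i \<le> r then c (Suc i) else d (Suc i - Suc r))
       else side (fst (snd (zs ! i))) (if i \<le> r then c i else d (i - Suc r)) (if Suc i \<le> r then c (Suc i) else d (Suc i - Suc r))"
    proof cases
      case 1
      then show ?thesis using mid_mono[OF x(3) _ d(1)] c(2) by simp
    next
      case 2
      then show ?thesis using c(3) by simp
    next
      case (3 j)
      then show ?thesis using d(3)[of j] i by simp
    qed
  qed (use x c d assms(2) in auto)
  then obtain Y where Y: "chain G zs r Y" by blast
  let ?x = "concat (fst (zs ! r))"
  have "chain G zs r (Y(0 := ?x))" unfolding chain_def
  proof (intro conjI allI impI)
    fix i assume "i < length zs"
    then have "if i = r then mid G (fst (snd (zs ! i))) (Y i) (Y (Suc i)) else side (fst (snd (zs ! i))) (Y i) (Y (Suc i))"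
      and "set ?x \<subseteq> set (Y 0)" using Y by (auto simp: chain_def)
    then show "if i = r then mid G (fst (snd (zs ! i))) ((Y(0 := ?x)) i) ((Y(0 := ?x)) (Suc i))
       else side (fst (snd (zs ! i))) ((Y(0 := ?x)) i) ((Y(0 := ?x)) (Suc i))"
      using mid_mono[of G "fst (snd (zs ! i))" "Y i" "Y (Suc i)" ?x "Y (Suc i)"]
        side_mono[of "fst (snd (zs ! i))" "Y i" "Y (Suc i)" ?x]
      by (cases "i = 0"; cases "i = r") (simp_all only: fun_upd_def if_True if_False refl simp_thms nat.distinct subset_refl)
  qed (use Y assms(2) in \<open>auto simp: chain_def\<close>)
  then show ?thesis by (intro exI[of _ "Y(0 := ?x)"]) simp
qed

lemma chain_rowval:
  assumes c: "chain G zs r Y" "r < length zs" "\<And>i. i \<le> length zs \<Longrightarrow> Y i \<in> set lt"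
    and l: "\<And>z. z \<in> set zs \<Longrightarrow> length (fst (snd z)) \<le> 1"
  shows "rowval lt G (evz (take r zs)) (zs ! r) (evz (drop (Suc r) zs))"
proof -
  have st: "i \<noteq> r \<Longrightarrow> i < length zs \<Longrightarrow> side (fst (snd (zs ! i))) (Y i) (Y (Suc i))"
    and m: "mid G (fst (snd (zs ! r))) (Y r) (Y (Suc r))" for i
    using c unfolding chain_def by (metis, metis)
  have "procs lt (evz (take r zs)) (Y 0) (Y (length (take r zs)))"
    by (rule chain_procs) (use c st l in \<open>auto dest: in_set_takeD\<close>)
  moreover have "procs lt (evz (drop (Suc r) zs)) (Y (Suc r + 0)) (Y (Suc r + length (drop (Suc r) zs)))"
    by (rule chain_procs[of _ "\<lambda>i. Y (Suc r + i)"])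
      (use c st[of "Suc r + _"] l in \<open>auto dest: in_set_dropD simp: add.commute\<close>)
  moreover have "Y (length zs) = snd (snd (zs ! r))" "set (concat (fst (zs ! r))) \<subseteq> set (Y 0)" using c(1) by (auto simp: chain_def)
  moreover have "length (take r zs) = r" "Suc r + length (drop (Suc r) zs) = length zs" using c(2) by auto
  ultimately show ?thesis unfolding rowval_def using m c(2,3)
    by (rule_tac bexI[of _ "Y 0"], rule_tac bexI[of _ "Y r"], rule_tac bexI[of _ "Y (Suc r)"]) auto
qed

text \<open>Gives each row a real position. A row that reads a letter inherits the position of that
  letter, and any other row is squeezed in before the next inherited position, or before
  \<open>b\<close> if there is none.\<close>

lemma insert_positions:
  fixes a b :: real
  assumes "\<And>z. z \<in> set zs \<Longrightarrow> length (fst z) \<le> 1" "length pl = length (concat (map fst zs))"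
    "sorted_wrt (<) pl" "\<And>p. p \<in> set pl \<Longrightarrow> a < p \<and> p < b" "a < b"
  shows "\<exists>qs. length qs = length zs \<and> sorted_wrt (<) qs \<and> (\<forall>q\<in>set qs. a < q \<and> q < b) \<and>
    (\<forall>r<length pl. \<exists>r'<length zs. fst (zs ! r') = [concat (map fst zs) ! r] \<and> qs ! r' = pl ! r)"
  using assms
proof (induction zs arbitrary: a pl)
  case Nil
  then show ?case by (intro exI[of _ "[]"]) simp
next
  case (Cons z zs)
  show ?case
  proof (cases "fst z")
    case Nil
    define c where "c = (if pl = [] then b else hd pl)"
    have ac: "a < c" "c \<le> b" using Cons.prems(4)[of "hd pl"] Cons.prems(5) by (auto simp: c_def)
    define q where "q = (a + c) / 2"
    have q: "a < q" "q < c" "q < b" using ac by (auto simp: q_def)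
    have "q < p \<and> p < b" if "p \<in> set pl" for p
      using that q Cons.prems(3,4) by (cases pl) (auto simp: c_def)
    then obtain qs where qs: "length qs = length zs" "sorted_wrt (<) qs" "\<forall>x\<in>set qs. q < x \<and> x < b"
      "\<And>r. r < length pl \<Longrightarrow> \<exists>r'<length zs. fst (zs ! r') = [concat (map fst zs) ! r] \<and> qs ! r' = pl ! r"
      using Cons.IH[of pl q] Cons.prems Nil q by auto
    show ?thesis
    proof (intro exI[of _ "q # qs"] conjI allI impI)
      fix r assume "r < length pl"
      then obtain r' where "r' < length zs" "fst (zs ! r') = [concat (map fst zs) ! r]" "qs ! r' = pl ! r" using qs(4) by blast
      then show "\<exists>r'<length (z # zs). fst ((z # zs) ! r') = [concat (map fst (z # zs)) ! r] \<and> (q # qs) ! r' = pl ! r"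
        using Nil by (intro exI[of _ "Suc r'"]) simp
    qed (use qs q in auto)
  next
    case (Cons x xs)
    then have z: "fst z = [x]" using Cons.prems(1)[of z] by simp
    then obtain p pl' where pl: "pl = p # pl'" using Cons.prems(2) by (cases pl) auto
    obtain qs where qs: "length qs = length zs" "sorted_wrt (<) qs" "\<forall>x\<in>set qs. p < x \<and> x < b"
      "\<And>r. r < length pl' \<Longrightarrow> \<exists>r'<length zs. fst (zs ! r') = [concat (map fst zs) ! r] \<and> qs ! r' = pl' ! r"
      using Cons.IH[of pl' p] Cons.prems z pl by auto
    show ?thesis
    proof (intro exI[of _ "p # qs"] conjI allI impI)
      fix r assume r: "r < length pl"
      show "\<exists>r'<length (z # zs). fst ((z # zs) ! r') = [concat (map fst (z # zs)) ! r] \<and> (p # qs) ! r' = pl ! r"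
      proof (cases r)
        case 0
        then show ?thesis using z pl by (intro exI[of _ 0]) simp
      next
        case (Suc r0)
        then obtain r' where "r' < length zs" "fst (zs ! r') = [concat (map fst zs) ! r0]" "qs ! r' = pl' ! r0"
          using qs(4)[of r0] r pl by auto
        then show ?thesis using z pl Suc by (intro exI[of _ "Suc r'"]) simp
      qed
    qed (use qs pl Cons.prems(4)[of p] in auto)
  qed
qed

text \<open>A run fixes only the order of fractional parts. Actual fractional parts are chosen unit
  by unit, which turns the events into a timed word and the obligations along the chains into
  promises for \<open>sound_sem\<close>.\<close>

lemma core_sound:
  assumes D: "subclosed D" "\<And>a. a \<in> set D \<Longrightarrow> consts_less (Suc G) a" "phi a \<in> set D" "psi G \<in> set D"
    and x0: "(phi a, 1) \<in> set x0" "(psi G, 1) \<in> set x0" and good: "Good (sys G k D M) [x0]"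
  shows "tptl_sat k a"
proof -
  obtain f N0 where f: "f 0 = [x0]" "\<And>n. stp (sys G k D M) (f n) (f (Suc n))"
    "\<And>n. n \<ge> N0 \<Longrightarrow> set (f n) \<subseteq> set (oks (sys G k D M))" using good unfolding Good_def by blast
  have "\<forall>n. \<exists>zs. entries G k D zs \<and> f n = concat (map fst zs) \<and> f (Suc n) = map (\<lambda>z. snd (snd z)) zs \<and> rows (lts G D) G [] zs"
    using stp_rows[OF f(2)] by blast
  then obtain zs where "\<forall>n. entries G k D (zs n) \<and> f n = concat (map fst (zs n)) \<and>
     f (Suc n) = map (\<lambda>z. snd (snd z)) (zs n) \<and> rows (lts G D) G [] (zs n)" by metis
  then have ent: "entries G k D (zs n)" and fc: "f n = concat (map fst (zs n))"
    and fy: "f (Suc n) = map (\<lambda>z. snd (snd z)) (zs n)" and rw: "rows (lts G D) G [] (zs n)" for n by blast+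
  define len where "len n = length (zs n)" for n
  have xol: "length (fst z) \<le> 1" and eol: "length (fst (snd z)) \<le> 1" if "z \<in> set (zs n)" for z n
    using ent[of n] that opts_length unfolding entries_def by blast+
  have lenf: "length (f (Suc n)) = len n" for n by (simp add: fy len_def)
  have "length (concat (map fst zs)) \<le> length zs" if "\<forall>z\<in>set zs. length (fst z) \<le> 1" for zs :: "entry list"
    using that by (induction zs) auto
  then have fle: "length (f n) \<le> len n" for n using xol[of _ n] by (simp add: fc len_def)
  have len0: "0 < len n" for n
    by (induction n) (use fle[of 0] f(1) fle lenf in \<open>auto dest: le_trans simp: less_le_trans\<close>, metis fle lenf less_le_trans)
  have "\<forall>n. \<forall>r<len n. \<exists>Y. chain G (zs n) r Y \<and> Y 0 = concat (fst (zs n ! r))"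
    using rw eol unfolding rows_nth len_def by (auto intro!: rowval_chain)
  then obtain Y where Y: "\<And>n r. r < len n \<Longrightarrow> chain G (zs n) r (Y n r) \<and> Y n r 0 = concat (fst (zs n ! r))" by metis
  \<comment> \<open>The row that reads a letter of \<open>f n\<close> is placed where that letter
    was placed in the preceding unit.\<close>
  define link where "link n pl qs \<longleftrightarrow> (\<forall>r<length pl. \<exists>r'<len n. fst (zs n ! r') = [f n ! r] \<and> qs ! r' = pl ! r)"
    for n and pl qs :: "real list"
  define gd where "gd n qs \<longleftrightarrow> length qs = len n \<and> sorted_wrt (<) qs \<and> (\<forall>q\<in>set qs. 0 < q \<and> q < 1)" for n and qs :: "real list"
  have ins: "\<exists>qs. gd n qs \<and> link n pl qs" if "length pl = length (f n)" "sorted_wrt (<) pl" "\<forall>p\<in>set pl. 0 < p \<and> p < 1" for n pl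
    using insert_positions[of "zs n" pl 0 1] that xol[of _ n] unfolding gd_def link_def len_def fc by auto
  have "\<exists>Q. \<forall>n. (gd n (Q n) \<and> (n = 0 \<longrightarrow> link 0 [1/2] (Q 0))) \<and> link (Suc n) (Q n) (Q (Suc n))"
  proof (rule dependent_nat_choice[of "\<lambda>n q. gd n q \<and> (n = 0 \<longrightarrow> link 0 [1/2] q)" "\<lambda>n q q'. link (Suc n) q q'", THEN exE])
    show "\<exists>q. gd 0 q \<and> (0 = (0::nat) \<longrightarrow> link 0 [1/2] q)" using ins[of "[1/2]" 0] f(1) by auto
    show "\<exists>q'. (gd (Suc n) q' \<and> (Suc n = 0 \<longrightarrow> link 0 [1/2] q')) \<and> link (Suc n) q q'"
      if "gd n q \<and> (n = 0 \<longrightarrow> link 0 [1/2] q)" for q n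
      using ins[of q "Suc n"] that lenf[of n] by (auto simp: gd_def)
  next
    fix Q assume *: "\<forall>n. (gd n (Q n) \<and> (n = 0 \<longrightarrow> link 0 [1/2] (Q n))) \<and> link (Suc n) (Q n) (Q (Suc n))"
    then show "\<exists>Q. \<forall>n. (gd n (Q n) \<and> (n = 0 \<longrightarrow> link 0 [1/2] (Q 0))) \<and> link (Suc n) (Q n) (Q (Suc n))" by (intro exI[of _ Q]) metis
  qed
  then obtain Q where Qg: "\<And>n. gd n (Q n)" and Ql: "\<And>n. link (Suc n) (Q n) (Q (Suc n))" and Q0: "link 0 [1/2] (Q 0)" by blast
  have Q01: "0 < Q n ! i" "Q n ! i < 1" if "i < len n" for n i
    using Qg[of n] that unfolding gd_def by (auto dest!: bspec[of "set (Q n)" _ "Q n ! i"])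
  have Qmono: "Q n ! i < Q n ! j" if "i < j" "j < len n" for n i j
    using Qg[of n] that unfolding gd_def by (auto simp: sorted_wrt_nth_less)
  define T where "T n i = real n + Q n ! i" for n i
  \<comment> \<open>The region, just before entry \<open>i\<close> of unit \<open>n\<close>, of a
    clock with value \<open>q + Q n ! r\<close>: the difference has passed the integer
    \<open>n - q\<close> as soon as entry \<open>r\<close> itself is behind.\<close>
  define rg where "rg n i r q = nat (if i \<le> r then 2 * (int n - q) - 1 else 2 * (int n - q) + 1)" for n i r :: nat and q
  define OB where "OB n i v b \<longleftrightarrow> (\<exists>r q. r < len n \<and> v = real_of_int q + Q n ! r \<and> (q < int n \<or> (q = int n \<and> r < i)) \<and>
     (b, min (rg n i r q) (cap G)) \<in> set (Y n r i))" for n i v b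
  define eo where "eo n i = fst (snd (zs n ! i))" for n i
  have Yside: "side (eo n i) (Y n r i) (Y n r (Suc i))" if "r < len n" "i < len n" "i \<noteq> r" for n i r
    using Y[OF that(1)] that unfolding chain_def eo_def len_def by metis
  have Ymid: "mid G (eo n r) (Y n r r) (Y n r (Suc r))" if "r < len n" for n r
    using Y[OF that(1)] that unfolding chain_def eo_def len_def by metis
  have Yend: "Y n r (len n) = f (Suc n) ! r" if "r < len n" for n r
    using Y[OF that] that by (simp add: chain_def len_def fy)
  have wrap: "OB (Suc n) 0 v b" if ob: "OB n (len n) v b" for n v b
  proof -
    obtain r q where r: "r < len n" "v = real_of_int q + Q n ! r" "q < int n \<or> (q = int n \<and> r < len n)"
      and mem: "(b, min (rg n (len n) r q) (cap G)) \<in> set (Y n r (len n))"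
      using ob unfolding OB_def by blast
    note r = r mem[unfolded Yend[OF r(1)]]
    have "r < length (Q n)" using r(1) Qg[of n] by (simp add: gd_def)
    then obtain r' where r': "r' < len (Suc n)" "fst (zs (Suc n) ! r') = [f (Suc n) ! r]" "Q (Suc n) ! r' = Q n ! r"
      using Ql[of n] unfolding link_def by blast
    have "Y (Suc n) r' 0 = f (Suc n) ! r" using Y[OF r'(1)] r'(2) by simp
    moreover have "rg n (len n) r q = rg (Suc n) 0 r' q" using r(1) by (simp add: rg_def)
    ultimately show ?thesis unfolding OB_def using r r' by (intro exI[of _ r'] exI[of _ q]) auto
  qed
  have shcap: "sh G (min m (cap G)) = min (Suc m) (cap G)" for m by (auto simp: sh_def)
  have none: "OB n (Suc i) v b" if i: "i < len n" "eo n i = []" and ob: "OB n i v b" for n i v b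
  proof -
    obtain r q where r: "r < len n" "v = real_of_int q + Q n ! r" "q < int n \<or> (q = int n \<and> r < i)"
      "(b, min (rg n i r q) (cap G)) \<in> set (Y n r i)" using ob unfolding OB_def by blast
    show ?thesis
    proof (cases "i = r")
      case True
      then have "q < int n" using r by auto
      then have "Suc (Suc (rg n i r q)) = rg n (Suc i) r q" using True by (simp add: rg_def)
      moreover have "(b, sh G (sh G (min (rg n i r q) (cap G)))) \<in> set (Y n r (Suc i))"
        using Ymid[OF r(1)] r(4) i True by (auto simp: mid_def noev_def)
      ultimately show ?thesis unfolding OB_def using r True by (intro exI[of _ r] exI[of _ q]) (simp add: shcap)
    next
      case False
      then have "rg n (Suc i) r q = rg n i r q" by (auto simp: rg_def)
      moreover have "set (Y n r i) \<subseteq> set (Y n r (Suc i))" using Yside[OF r(1) i(1) False] i(2) by (simp add: side_def)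
      ultimately show ?thesis unfolding OB_def using r by (intro exI[of _ r] exI[of _ q]) auto
    qed
  qed
  have ev: "\<exists>m N R. isreg (T n i - v) m \<and> pst (fst e) (min m (cap G)) N R b \<and>
      (\<forall>c\<in>set N. OB n (Suc i) v c) \<and> (\<forall>c\<in>set R. OB n (Suc i) (T n i) c)"
    if i: "i < len n" "eo n i = [e]" and ob: "OB n i v b" for n i v b e
  proof -
    obtain r q where r: "r < len n" "v = real_of_int q + Q n ! r" "q < int n \<or> (q = int n \<and> r < i)"
      "(b, min (rg n i r q) (cap G)) \<in> set (Y n r i)" using ob unfolding OB_def by blast
    have cap1: "min 1 (cap G) = 1" by (simp add: cap_def)
    have R: "OB n (Suc i) (T n i) c" if "c \<in> set (snd e)" for c
    proof -
      have "(c, 1) \<in> set (Y n i (Suc i))" using Ymid[OF i(1)] i(2) that by (simp add: mid_def atev_def)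
      then show ?thesis unfolding OB_def using i cap1
        by (intro exI[of _ i] exI[of _ "int n"]) (simp add: T_def rg_def)
    qed
    show ?thesis
    proof (cases "i = r")
      case True
      then have qn: "q < int n" using r by auto
      let ?N = "proj (Y n r (Suc i)) (min (rg n (Suc i) r q) (cap G))"
      have s: "Suc (rg n i r q) = 2 * nat (int n - q)" "rg n (Suc i) r q = Suc (2 * nat (int n - q))"
        using True qn by (auto simp: rg_def nat_mult_distrib)
      have "pst (fst e) (min (2 * nat (int n - q)) (cap G)) ?N (snd e) b"
        using Ymid[OF r(1)] i True r(4) s shcap by (auto simp: mid_def atev_def)
      moreover have "T n i - v = real (nat (int n - q))" using True r(2) qn by (simp add: T_def)
      moreover have "OB n (Suc i) v c" if "c \<in> set ?N" for c
        unfolding OB_def using that r True by (intro exI[of _ r] exI[of _ q]) (auto simp: proj_mem)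
      ultimately show ?thesis using R isreg_exact by metis
    next
      case False
      let ?m = "rg n i r q"
      let ?N = "proj (Y n r (Suc i)) (min ?m (cap G))"
      have s: "rg n (Suc i) r q = ?m" using False by (auto simp: rg_def)
      have "pst (fst e) (min ?m (cap G)) ?N (snd e) b"
        using Yside[OF r(1) i(1) False] i(2) r(4) by (auto simp: side_def proc_def)
      moreover have "OB n (Suc i) v c" if "c \<in> set ?N" for c
        unfolding OB_def using that r s by (intro exI[of _ r] exI[of _ q]) (auto simp: proj_mem)
      moreover have "isreg (T n i - v) ?m"
      proof (cases "i < r")
        case True
        then have "q < int n" using r by auto
        then have m: "?m = 2 * nat (int n - q - 1) + 1" using True by (simp add: rg_def nat_mult_distrib)
        have "Q n ! i < Q n ! r" using Qmono True r by blast
        then show ?thesis unfolding m using \<open>q < int n\<close> Q01[OF r(1)] Q01[OF i(1)] r(2)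
          by (intro isreg_open) (auto simp: T_def)
      next
        case F: False
        then have "q \<le> int n" using r by auto
        then have m: "?m = 2 * nat (int n - q) + 1" using F False by (simp add: rg_def nat_mult_distrib)
        have "Q n ! r < Q n ! i" using Qmono F False i by (simp add: linorder_neq_iff)
        then show ?thesis unfolding m using \<open>q \<le> int n\<close> Q01[OF r(1)] Q01[OF i(1)] r(2)
          by (intro isreg_open) (auto simp: T_def)
      qed
      ultimately show ?thesis using R by metis
    qed
  qed
  \<comment> \<open>Enumerates the entries of all units in temporal order as pairs of unit and
    index.\<close>
  define adv where "adv p = (if Suc (snd p) < len (fst p) then (fst p, Suc (snd p)) else (Suc (fst p), 0))" for p
  define inst where "inst g = (adv ^^ g) (0, 0)" for g
  have instS: "inst (Suc g) = adv (inst g)" for g by (simp add: inst_def)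
  have il: "snd (inst g) < len (fst (inst g))" for g
    by (induction g) (auto simp: instS adv_def len0, simp add: inst_def len0)
  define Og where "Og g = OB (fst (inst g)) (snd (inst g))" for g
  define Tg where "Tg g = T (fst (inst g)) (snd (inst g))" for g
  define eg where "eg g = eo (fst (inst g)) (snd (inst g))" for g
  have nxt: "OB (fst (inst g)) (Suc (snd (inst g))) v b \<Longrightarrow> Og (Suc g) v b" for g v b
  proof (cases "Suc (snd (inst g)) < len (fst (inst g))")
    case False
    then have "Suc (snd (inst g)) = len (fst (inst g))" using il[of g] by simp
    then show "OB (fst (inst g)) (Suc (snd (inst g))) v b \<Longrightarrow> Og (Suc g) v b"
      using wrap False by (simp add: Og_def instS adv_def)
  qed (simp add: Og_def instS adv_def)
  have Tmono: "Tg g < Tg (Suc g)" for g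
  proof (cases "Suc (snd (inst g)) < len (fst (inst g))")
    case True
    then show ?thesis using Qmono by (simp add: Tg_def instS adv_def T_def)
  next
    case False
    then show ?thesis using Q01(2)[OF il[of g]] Q01(1)[OF len0, of "Suc (fst (inst g))"]
      by (simp add: Tg_def instS adv_def T_def)
  qed
  have reach: "\<exists>g. inst g = (n, 0)" for n
  proof (induction n)
    case 0
    then show ?case by (intro exI[of _ 0]) (simp add: inst_def)
  next
    case (Suc n)
    then obtain g where g: "inst g = (n, 0)" by blast
    have "j < len n \<Longrightarrow> inst (g + j) = (n, j)" for j
      by (induction j) (simp_all add: g instS adv_def)
    from this[of "len n - 1"] have "inst (g + (len n - 1)) = (n, len n - 1)" using len0[of n] by simp
    then show ?case by (intro exI[of _ "Suc (g + (len n - 1))"]) (simp add: instS adv_def)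
  qed
  have Tsm: "strict_mono Tg" using Tmono by (simp add: strict_mono_Suc_iff)
  have fstmono: "g \<le> h \<Longrightarrow> fst (inst g) \<le> fst (inst h)" for g h
    by (rule lift_Suc_mono_le[of "\<lambda>g. fst (inst g)"]) (auto simp: instS adv_def)
  have unb: "\<exists>g\<ge>g0. t < Tg g" for t g0
  proof -
    obtain n :: nat where n: "t < real n" using reals_Archimedean2 by blast
    obtain g where g: "inst g = (max n (Suc (fst (inst g0))), 0)" using reach by blast
    have "\<not> g < g0" using fstmono[of g g0] g by auto
    moreover have "t < Tg g" using n Q01(1)[OF len0, of "max n (Suc (fst (inst g0)))"] g by (simp add: Tg_def T_def max_def split: if_splits)
    ultimately show ?thesis by (intro exI[of _ g]) auto
  qed
  have pers: "Og (g + m) v b" if "Og g v b" "\<And>h. g \<le> h \<Longrightarrow> h < g + m \<Longrightarrow> eg h = []" for g m v b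
    using that(2)
  proof (induction m)
    case (Suc m)
    then have "Og (g + m) v b" "eg (g + m) = []" by auto
    then show ?case using none[OF il[of "g + m"]] nxt[of "g + m"] by (simp add: Og_def eg_def)
  qed (use that in simp)
  have dis: "\<exists>h\<ge>g. \<not> Og h v (Until b c)" for g v b c
  proof (rule ccontr)
    assume "\<not> ?thesis"
    then have all: "\<And>h. h \<ge> g \<Longrightarrow> Og h v (Until b c)" by blast
    \<comment> \<open>A unit that begins after \<open>g\<close>, belongs to the part of the run over
      \<open>oks\<close>, and is so late that the clock with value \<open>v\<close> has reached the
      truncated region \<open>cap G\<close>.\<close>
    define n where "n = max (Suc (fst (inst g))) (max N0 (nat (\<lfloor>v\<rfloor> + 2 * int G + 2)))"
    obtain h where h: "inst h = (n, 0)" using reach by blast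
    have "\<not> h < g" using fstmono[of h g] h by (auto simp: n_def)
    then have "OB n 0 v (Until b c)" using all[of h] h by (simp add: Og_def)
    then obtain r q where r: "r < len n" "v = real_of_int q + Q n ! r" "q < int n" "(Until b c, min (rg n 0 r q) (cap G)) \<in> set (Y n r 0)"
      unfolding OB_def by auto
    have q: "\<lfloor>v\<rfloor> = q" using r(2) Q01[OF r(1)] by (simp add: floor_eq_iff)
    have "nat (\<lfloor>v\<rfloor> + 2 * int G + 2) \<le> n" "N0 \<le> n" by (simp_all add: n_def)
    then have "q + 2 * int G + 2 \<le> int n" using q by linarith
    then have "rg n 0 r q \<ge> cap G" unfolding rg_def cap_def by simp
    then have "min (rg n 0 r q) (cap G) = cap G" by simp
    then have mem: "(Until b c, cap G) \<in> set (concat (fst (zs n ! r)))" using r(4) Y[OF r(1)] by simp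
    then obtain x where x: "x \<in> set (fst (zs n ! r))" "(Until b c, cap G) \<in> set x" by auto
    have "zs n ! r \<in> set (zs n)" using r(1) by (simp add: len_def)
    then have "x \<in> set (f n)" using x(1) by (auto simp: fc)
    then have "x \<in> set (oks (sys G k D M))" using f(3)[OF \<open>N0 \<le> n\<close>] by blast
    then have "okst D G (Until b c, cap G)" using x(2) by (auto simp: sys_def)
    then show False by (auto simp: okst_def cap_def)
  qed
  obtain r0 where r0: "r0 < len 0" "fst (zs 0 ! r0) = [x0]" "Q 0 ! r0 = 1/2"
    using Q0 f(1) unfolding link_def by auto
  \<comment> \<open>The initial clock value is -1 + 1/2; at time 0 its clock shows 1/2, which is the
    region 1 recorded in \<open>x0\<close>.\<close>
  have init: "Og 0 (- 1/2) b" if "(b, 1) \<in> set x0" for b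
    unfolding Og_def OB_def inst_def using r0 Y[OF r0(1)] that
    by (intro exI[of _ r0] exI[of _ "-1"]) (simp add: rg_def cap_def)
  have lcFF: "\<not> lc p m N R FF" for p m N R by (simp add: FF_def)
  let ?Fin = "Fin (And (Constr CLe G) TT)"
  have evO: "\<exists>m N R. isreg (Tg g - v) m \<and> pst (fst (hd (eg g))) (min m (cap G)) N R b \<and>
      (\<forall>c\<in>set N. Og (Suc g) v c) \<and> (\<forall>c\<in>set R. Og (Suc g) (Tg g) c)" if ne: "eg g \<noteq> []" and og: "Og g v b" for g v b
  proof -
    have "zs (fst (inst g)) ! snd (inst g) \<in> set (zs (fst (inst g)))" using il[of g] by (simp add: len_def)
    then have "length (eg g) \<le> 1" unfolding eg_def eo_def by (rule eol)
    then obtain e where e: "eg g = [e]" using ne by (cases "eg g") auto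
    have "eo (fst (inst g)) (snd (inst g)) = [e]" using e by (simp add: eg_def)
    from ev[OF il[of g] this og[unfolded Og_def]] obtain m N R where *: "isreg (Tg g - v) m" "pst (fst e) (min m (cap G)) N R b"
      "\<forall>c\<in>set N. OB (fst (inst g)) (Suc (snd (inst g))) v c"
      "\<forall>c\<in>set R. OB (fst (inst g)) (Suc (snd (inst g))) (Tg g) c" unfolding Tg_def by blast
    then have "\<forall>c\<in>set N. Og (Suc g) v c" "\<forall>c\<in>set R. Og (Suc g) (Tg g) c" using nxt by blast+
    then show ?thesis using * e by (metis list.sel(1))
  qed
  \<comment> \<open>At every event \<open>psi G\<close> renews itself and issues a new
    \<open>Until\<close>, so some \<open>Until\<close> is pending at all entries. If events stopped,
    it would be pending for ever, which \<open>dis\<close> forbids; hence there are infinitely many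
    events.\<close>
  have psiO: "Og g (- 1/2) (psi G)" and untO: "\<exists>v b c. Og g v (Until b c)" for g
  proof (induction g)
    case 0
    show "Og 0 (- 1/2) (psi G)" by (rule init) (rule x0)
    show "\<exists>v b c. Og 0 v (Until b c)" using init[OF x0(1)] unfolding phi_def by blast
  next
    case (Suc g)
    have "Og (Suc g) (- 1/2) (psi G) \<and> (\<exists>v b c. Og (Suc g) v (Until b c))"
    proof (cases "eg g = []")
      case True
      then show ?thesis using pers[of g _ _ 1] Suc by (auto simp: less_Suc_eq) metis
    next
      case False
      from evO[OF False Suc.IH(1)] obtain m N R where *: "pst (fst (hd (eg g))) (min m (cap G)) N R (psi G)"
        "\<forall>c\<in>set N. Og (Suc g) (- 1/2) c" "\<forall>c\<in>set R. Og (Suc g) (Tg g) c" by blast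
      from *(1) have "psi G \<in> set N" "?Fin \<in> set R" using lcFF by (auto simp: psi_def Fin_def)
      then show ?thesis using * unfolding Fin_def by blast
    qed
    then show "Og (Suc g) (- 1/2) (psi G)" "\<exists>v b c. Og (Suc g) v (Until b c)" by blast+
  qed
  define S where "S = {g. eg g \<noteq> []}"
  have "infinite S"
  proof
    assume "finite S"
    then obtain g where g: "\<forall>h\<in>S. h < g" using finite_nat_set_iff_bounded by blast
    then have no: "eg h = []" if "g \<le> h" for h using that by (auto simp: S_def not_less[symmetric])
    obtain v b c where "Og g v (Until b c)" using untO by blast
    then have "Og (g + m) v (Until b c)" for m using pers no by simp
    then show False using dis[of g v b c] by (metis le_Suc_ex)
  qed
  define ge where "ge = Infinite_Set.enumerate S"
  have geS: "ge j \<in> S" for j unfolding ge_def by (rule enumerate_in_set[OF \<open>infinite S\<close>])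
  have gesm: "strict_mono ge" unfolding ge_def by (rule strict_mono_enumerate[OF \<open>infinite S\<close>])
  \<comment> \<open>The entry right after the event number \<open>j - 1\<close>. Entries without
    event up to the next event only carry the promises along.\<close>
  define start where "start j = (case j of 0 \<Rightarrow> 0 | Suc i \<Rightarrow> Suc (ge i))" for j
  have gap: "start j \<le> ge j" "\<And>h. start j \<le> h \<Longrightarrow> h < ge j \<Longrightarrow> eg h = []" for j
  proof -
    show "start j \<le> ge j" using gesm by (cases j) (auto simp: start_def strict_mono_def Suc_le_eq)
    fix h assume h: "start j \<le> h" "h < ge j"
    show "eg h = []"
    proof (cases j)
      case 0
      then show ?thesis using h(2) not_less_Least[of h "\<lambda>n. n \<in> S"] by (auto simp: ge_def enumerate_0 S_def)
    next
      case (Suc i)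
      have "ge j = (LEAST s. s \<in> S \<and> ge i < s)" unfolding Suc ge_def by (rule enumerate_Suc''[OF \<open>infinite S\<close>])
      then show ?thesis using h Suc not_less_Least[of h "\<lambda>s. s \<in> S \<and> ge i < s"] by (auto simp: start_def S_def)
    qed
  qed
  define Ob where "Ob j = Og (start j)" for j
  have ObOg: "Og h v b" if "Ob j v b" "start j \<le> h" "h \<le> ge j" for j h v b
    using pers[of "start j" v b "h - start j"] that gap(2) unfolding Ob_def by auto
  \<comment> \<open>Position 0 is auxiliary and precedes all events; the model of \<open>a\<close>
    that is extracted below uses only later positions.\<close>
  define w where "w = case_nat (0, -1) (\<lambda>j. (fst (hd (eg (ge j))), Tg (ge j)))"
  have wS: "w (Suc j) = (fst (hd (eg (ge j))), Tg (ge j))" for j by (simp add: w_def)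
  have "sat w 0 (- 1/2) (phi a)"
  proof (rule sound_sem[where Ob = Ob, OF D(1,2)])
    fix j v b assume ob: "Ob j v b"
    then have "Og (ge j) v b" using ObOg gap(1) by blast
    moreover have "eg (ge j) \<noteq> []" using geS[of j] by (simp add: S_def)
    ultimately have "\<exists>m N R. isreg (Tg (ge j) - v) m \<and> pst (fst (hd (eg (ge j)))) (min m (cap G)) N R b \<and>
      (\<forall>c\<in>set N. Og (Suc (ge j)) v c) \<and> (\<forall>c\<in>set R. Og (Suc (ge j)) (Tg (ge j)) c)" by (intro evO)
    then show "\<exists>m N R. isreg (snd (w (Suc j)) - v) m \<and> pst (fst (w (Suc j))) (min m (cap G)) N R b \<and>
      (\<forall>c\<in>set N. Ob (Suc j) v c) \<and> (\<forall>c\<in>set R. Ob (Suc j) (snd (w (Suc j))) c)"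
      by (simp add: wS Ob_def start_def)
  next
    fix j v b c assume "Ob j v (Until b c)"
    show "\<exists>m. \<not> Ob (j + m) v (Until b c)"
    proof (rule ccontr)
      assume "\<not> ?thesis"
      then have all: "\<And>m. Ob (j + m) v (Until b c)" by blast
      have "Og h v (Until b c)" if h: "h \<ge> start j" for h
      proof -
        define m where "m = (LEAST m. h \<le> ge (j + m))"
        have "h \<le> ge (j + h)" using strict_mono_imp_increasing[OF gesm, of "j + h"] by simp
        then have m: "h \<le> ge (j + m)" unfolding m_def by (rule LeastI)
        have "start (j + m) \<le> h"
        proof (cases m)
          case (Suc m')
          then have "\<not> h \<le> ge (j + m')" unfolding m_def by (metis lessI not_less_Least)
          then show ?thesis using Suc by (simp add: start_def)
        qed (use h in simp)
        then show ?thesis using ObOg[OF all _ m] by blast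
      qed
      then show False using dis[of "start j" v b c] by blast
    qed
  next
    show "Ob 0 (- 1/2) (phi a)" using init[OF x0(1)] by (simp add: Ob_def start_def)
  qed (use D in auto)
  moreover have "fst (w i) < k" if i1: "i \<ge> 1" for i
  proof -
    obtain j where i: "i = Suc j" using i1 by (cases i) auto
    have "zs (fst (inst (ge j))) ! snd (inst (ge j)) \<in> set (zs (fst (inst (ge j))))" using il by (simp add: len_def)
    then have "eg (ge j) \<in> set (opts (evl k D))" using ent unfolding eg_def eo_def entries_def by blast
    then show ?thesis using geS[of j] by (auto simp: i wS S_def opts_mem evl_def)
  qed
  moreover have "0 < Tg 0" using Q01[OF len0, of 0] by (simp add: Tg_def inst_def T_def)
  then have "0 < Tg g" for g using Tsm by (cases g) (auto simp: strict_mono_def dest: less_trans)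
  then have "snd (w i) < snd (w (Suc i))" for i
    using Tsm gesm by (cases i) (auto simp: w_def strict_mono_def intro: less_trans[of _ 0])
  moreover have "\<exists>i. t < snd (w i)" for t
  proof -
    obtain g where "t < Tg g" using unb by blast
    also have "Tg g \<le> Tg (ge g)" using strict_mono_imp_increasing[OF gesm, of g] Tsm by (simp add: strict_mono_less_eq)
    finally show ?thesis by (intro exI[of _ "Suc g"]) (simp add: wS)
  qed
  ultimately show ?thesis by (intro tptl_sat_from_phi[of w k "- 1/2" a]) auto
qed

section \<open>From timed words to good runs\<close>

lemma constrained_phi: "constrained a \<Longrightarrow> constrained (phi a)"
  unfolding phi_def FF_def TT_def by (intro constrained.intros(2,3,4,6))

lemma positive_psi: "positive (psi G)"
  unfolding psi_def FF_def by (intro positive.intros positive_TT)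

definition init_letter :: "nat \<Rightarrow> tptl list \<Rightarrow> tptl \<Rightarrow> letter" where
  "init_letter G D a = filter (\<lambda>s. s = (phi a, 1) \<or> s = (psi G, 1)) (List.product D [0..<Suc (cap G)])"

lemma filter_sorted_list_of_set:
  assumes "finite B" "A \<subseteq> B"
  shows "filter (\<lambda>x. x \<in> A) (sorted_list_of_set B) = sorted_list_of_set (A :: 'a::linorder set)"
proof (rule sorted_distinct_set_unique)
  have "finite A" using assms finite_subset by blast
  then show "set (filter (\<lambda>x. x \<in> A) (sorted_list_of_set B)) = set (sorted_list_of_set A)" using assms by auto
qed (auto intro: sorted_wrt_filter)

text \<open>The run records, for \<open>n > 0\<close>, everything that is true: the word at time
  \<open>n\<close> lists, for every earlier clock value, all pending formulas of \<open>D\<close>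
  that hold in the sense of \<open>bsat J\<close>. Only at time 0 is the list cut down to the
  initial letter.\<close>

lemma core_complete:
  assumes D: "subclosed D" "\<And>a. a \<in> set D \<Longrightarrow> consts_less (Suc G) a" "phi a \<in> set D" "psi G \<in> set D"
    and M: "closedM G k D M" and a: "constrained a"
    and w: "\<And>i. fst (w i) < k" "\<And>i. snd (w i) < snd (w (Suc i))" "\<And>T. \<exists>i. T < snd (w i)"
      "snd (w 0) = - 1 / 4" "0 \<le> snd (w 1)" "sat w 0 (- 1 / 2) (phi a)" "sat w 0 (- 1 / 2) (psi G)"
  shows "Good (sys G k D M) [init_letter G D a]"
proof -
  obtain J where J: "bsat J w 0 (- 1 / 2) (phi a)" using constrained_bsat[OF constrained_phi[OF a] w(6)] by blast
  have Jpsi: "bsat J w 0 (- 1 / 2) (psi G)" using w(7) bsat_positive[OF positive_psi] by blast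
  define t where "t j = snd (w j)" for j
  have tsm: "strict_mono t" using w(2) by (simp add: strict_mono_Suc_iff t_def)
  have tle: "t i \<le> t j \<longleftrightarrow> i \<le> j" and tless: "t i < t j \<longleftrightarrow> i < j" for i j
    using tsm by (simp_all add: strict_mono_less_eq strict_mono_less)
  \<comment> \<open>For \<open>0 \<le> x\<close> this is the last position strictly before time
    \<open>x\<close>; an event at time \<open>x\<close> itself still counts as future.\<close>
  define jl where "jl x = (LEAST j. x \<le> t (Suc j))" for x :: real
  have jl1: "x \<le> t (Suc (jl x))" for x
  proof -
    obtain i where "x < t i" using w(3) by (auto simp: t_def)
    then have "x \<le> t (Suc i)" using tless[of i "Suc i"] by simp
    then show ?thesis unfolding jl_def by (rule LeastI)
  qed
  have jl2: "t (jl x) < x" if "0 \<le> x" for x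
  proof (cases "jl x")
    case 0
    then show ?thesis using w(4) that by (simp add: t_def)
  next
    case (Suc i)
    then have "\<not> x \<le> t (Suc i)" unfolding jl_def by (metis lessI not_less_Least)
    then show ?thesis using Suc by simp
  qed
  have jl_eq: "jl x = j" if "0 \<le> x" "t j < x" "x \<le> t (Suc j)" for x j
  proof -
    have "t j < t (Suc (jl x))" "t (jl x) < t (Suc j)" using jl1[of x] jl2[OF that(1)] that by linarith+
    then show ?thesis by (simp add: tless)
  qed
  \<comment> \<open>The possible clock values: the initial one and the time stamps from position 1
    on, at which a freeze can occur.\<close>
  define V where "V = insert (- 1 / 2) (t ` {1..})"
  have tV: "t (Suc j) \<in> V" for j unfolding V_def by auto
  have t0: "0 \<le> t (Suc j)" for j using w(5) tle[of 1 "Suc j"] by (simp add: t_def)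
  have Vneg: "x = - 1 / 2" if x: "x \<in> V" "x < 0" for x
  proof (rule ccontr)
    assume "x \<noteq> - 1 / 2"
    then obtain i where "x = t i" "1 \<le> i" using x(1) by (auto simp: V_def)
    then show False using t0[of "i - 1"] x(2) by simp
  qed
  \<comment> \<open>The rows at time \<open>n\<close> are the fractional parts of clock values
    before \<open>n\<close>. They are finitely many since time diverges.\<close>
  define P where "P n = {p::real. 0 \<le> p \<and> p < 1 \<and> (\<exists>q::int. q + p \<in> V \<and> q + p < real n)}" for n :: nat
  have finP: "finite (P n)" for n
  proof -
    obtain i where i: "real n < t i" using w(3) by (auto simp: t_def)
    have "P n \<subseteq> frac ` (insert (- 1 / 2) (t ` {..i}))"
    proof
      fix p assume "p \<in> P n"
      then obtain q :: int where p: "0 \<le> p" "p < 1" "q + p \<in> V" "q + p < real n" by (auto simp: P_def)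
      have "frac (q + p) = p" using p(1,2) by (simp add: frac_unique_iff)
      moreover have "q + p \<in> insert (- 1 / 2) (t ` {..i})" using p(3,4) i tless by (auto simp: V_def) (metis atMost_iff image_eqI le_less_trans less_imp_le not_less order.strict_trans)
      ultimately show "p \<in> frac ` (insert (- 1 / 2) (t ` {..i}))" by (metis imageI)
    qed
    then show ?thesis by (rule finite_subset) simp
  qed
  have Psub: "P n \<subseteq> P (Suc n)" for n by (auto simp: P_def)
  define X where "X = List.product D [0..<Suc (cap G)]"
  define rg where "rg n x p q = nat (if x \<le> p then 2 * (int n - q) - 1 else 2 * (int n - q) + 1)" for n :: nat and x p :: real and q :: int
  \<comment> \<open>The obligation \<open>s\<close> for the clock value \<open>q + p\<close>, at
    time \<open>n + x\<close> but before an event of that very time has been processed.\<close>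
  define C where "C n x p s q \<longleftrightarrow> real_of_int q + p \<in> V \<and> q + p < n + x \<and> snd s = min (rg n x p q) (cap G) \<and>
     pend (fst s) \<and> bsat J w (jl (n + x)) (q + p) (fst s)" for n :: nat and x p :: real and s and q :: int
  define YS where "YS n x p = filter (\<lambda>s. \<exists>q. C n x p s q) X" for n :: nat and x p :: real
  have YS: "(b, m) \<in> set (YS n x p) \<longleftrightarrow> b \<in> set D \<and> (\<exists>q. C n x p (b, m) q)" for b m and n :: nat and x p :: real
    by (auto simp: YS_def X_def C_def)
  have YSl: "YS n x p \<in> set (lts G D)" for n x p
    unfolding YS_def lts_def X_def by (simp add: subseq_filter_left)
  define pl where "pl n = sorted_list_of_set (P n)" for n
  have pl: "set (pl n) = P n" "sorted_wrt (<) (pl n)" for n using finP by (simp_all add: pl_def strict_sorted_iff)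
  define R where "R j = filter (\<lambda>b. pend b \<and> bsat J w j (t j) b) D" for j
  define E where "E n p = (if n + p \<in> t ` {1..} then [(fst (w (Suc (jl (n + p)))), R (Suc (jl (n + p))))] else [])" for n :: nat and p :: real
  define LT where "LT n p = (if n = 0 then init_letter G D a else YS n 0 p)" for n :: nat and p :: real
  define zs where "zs n = map (\<lambda>p. (if p \<in> P n then [LT n p] else [], E n p, YS (Suc n) 0 p)) (pl (Suc n))" for n
  define f where "f n = map (LT n) (pl n)" for n
  have fy: "f (Suc n) = map (\<lambda>z. snd (snd z)) (zs n)" for n by (simp add: f_def zs_def LT_def)
  have "concat (map (\<lambda>p. if p \<in> P n then [LT n p] else []) xs) = map (LT n) (filter (\<lambda>p. p \<in> P n) xs)" for n xs
    by (induction xs) auto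
  then have fc: "f n = concat (map fst (zs n))" for n
    using filter_sorted_list_of_set[OF finP Psub] by (simp add: f_def zs_def pl_def comp_def)
  have init_l: "init_letter G D a \<in> set (lts G D)" unfolding init_letter_def lts_def by (simp add: subseq_filter_left)
  have El: "E n p \<in> set (opts (evl k D))" for n p
    using w(1) by (auto simp: E_def opts_mem evl_def R_def subseq_filter_left)
  have ent: "entries G k D (zs n)" for n
    unfolding entries_def zs_def using YSl init_l El by (auto simp: opts_mem LT_def)
  have evt: "fst (snd z) = E n p" if "x \<in> set (zs n)" "z = (x1, E n p, x2)" for z n p x x1 x2 using that by simp
  have P01: "p \<in> P n \<Longrightarrow> 0 \<le> p \<and> p < 1" for p n by (auto simp: P_def)
  have evP: "x - n \<in> P (Suc n)" if "x \<in> V" "real n \<le> x" "x < real n + 1" for x n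
  proof -
    have "\<exists>q::int. q + (x - n) \<in> V \<and> q + (x - n) < real (Suc n)" using that by (intro exI[of _ "int n"]) simp
    then show ?thesis using that by (simp add: P_def)
  qed
  have rw: "rows (lts G D) G [] (zs n)" for n
    unfolding rows_nth
  proof (intro allI impI)
    fix r assume r: "r < length (zs n)"
    define len where "len = length (pl (Suc n))"
    have rl: "r < len" "length (zs n) = len" using r by (simp_all add: zs_def len_def)
    \<comment> \<open>The extra position 1 behind the last row is the next integer time, where the
      letters of the following unit are read off.\<close>
    define tt where "tt i = (if i < len then pl (Suc n) ! i else 1)" for i
    have ttP: "tt i \<in> P (Suc n)" if "i < len" for i using that pl(1)[of "Suc n"] nth_mem[of i "pl (Suc n)"] by (simp add: tt_def len_def)
    have tt01: "0 \<le> tt i" "i < len \<Longrightarrow> tt i < 1" "tt i \<le> 1" for i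
      using P01[OF ttP, of i] by (cases "i < len"; simp add: tt_def)+
    have ttmono: "tt i < tt j" if "i < j" "i < len" for i j
    proof (cases "j < len")
      case True
      then show ?thesis using pl(2)[of "Suc n"] that by (simp add: tt_def sorted_wrt_nth_less len_def)
    next
      case False
      then show ?thesis using tt01(2)[OF that(2)] by (simp add: tt_def)
    qed
    have ttle: "tt i \<le> tt j \<longleftrightarrow> i \<le> j" if "i < len" "j < len" for i j
      using ttmono[of i j] ttmono[of j i] that by (cases i j rule: linorder_cases) auto
    have ttE: "\<exists>j<len. x = tt j" if "x \<in> P (Suc n)" for x
    proof -
      have "x \<in> set (pl (Suc n))" using that by (simp add: pl)
      then show ?thesis unfolding in_set_conv_nth by (auto simp: tt_def len_def)
    qed
    define p where "p = tt r"
    have p: "p \<in> P (Suc n)" "0 \<le> p" "p < 1" using ttP[OF rl(1)] tt01 rl by (simp_all add: p_def)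
    have zr: "zs n ! r = (if p \<in> P n then [LT n p] else [], E n p, YS (Suc n) 0 p)"
      using rl by (simp add: zs_def p_def tt_def len_def)
    have zi: "fst (snd (zs n ! i)) = E n (tt i)" if "i < len" for i using that by (simp add: zs_def tt_def len_def)
    have nonev: "jl (n + x) = jl (n + y)" if xy: "0 \<le> x" "x \<le> y" "y \<le> 1" and no: "\<And>p. p \<in> P (Suc n) \<Longrightarrow> \<not> (x \<le> p \<and> p < y)" for x y :: real
    proof -
      have "\<not> t (Suc (jl (n + x))) < n + y"
      proof
        assume *: "t (Suc (jl (n + x))) < n + y"
        have "t (Suc (jl (n + x))) - n \<in> P (Suc n)" by (rule evP) (use tV jl1[of "n + x"] * xy in auto)
        then show False using no * jl1[of "n + x"] by force
      qed
      then show ?thesis using jl_eq[of "n + y" "jl (n + x)"] jl2[of "n + x"] xy by simp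
    qed
    have between: "\<not> (tt i < x \<and> x < tt (Suc i))" if x: "x \<in> P (Suc n)" for i x
    proof
      assume *: "tt i < x \<and> x < tt (Suc i)"
      obtain j where j: "j < len" "x = tt j" using ttE[OF x] by blast
      have "i < len" using * tt01(3)[of "Suc i"] by (auto simp: tt_def split: if_splits)
      have "i < j" using * j ttle[OF j(1) \<open>i < len\<close>] by auto
      moreover have "j < Suc i"
      proof (cases "Suc i < len")
        case True
        then show ?thesis using * j ttle[OF True j(1)] by auto
      qed (use j in simp)
      ultimately show False by simp
    qed
    have ch: "chain G (zs n) r (\<lambda>i. YS n (tt i) p)" unfolding chain_def rl(2)
    proof (intro conjI allI impI)
      have "0 < len" using rl by simp
      have "tt 0 \<le> p" using ttle[OF \<open>0 < len\<close> rl(1)] by (simp add: p_def)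
      have no0: "\<not> (0 \<le> x \<and> x < tt 0)" if xP: "x \<in> P (Suc n)" for x
      proof
        assume "0 \<le> x \<and> x < tt 0"
        moreover obtain j where "j < len" "x = tt j" using ttE xP by blast
        ultimately show False using ttle[OF \<open>0 < len\<close>, of j] by simp
      qed
      have j0: "jl (real n + 0) = jl (real n + tt 0)"
        by (rule nonev[OF order_refl tt01(1) tt01(3) no0])
      have sub: "set (YS n 0 p) \<subseteq> set (YS n (tt 0) p)"
      proof clarify
        fix b m assume "(b, m) \<in> set (YS n 0 p)"
        then obtain q where q: "b \<in> set D" "C n 0 p (b, m) q" unfolding YS by blast
        have "C n (tt 0) p (b, m) q" using q(2) j0 \<open>tt 0 \<le> p\<close> p tt01(1)[of 0] by (auto simp: C_def rg_def)
        then show "(b, m) \<in> set (YS n (tt 0) p)" using q(1) YS by blast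
      qed
      have "set (init_letter G D a) \<subseteq> set (YS 0 0 p)" if n0: "n = 0" "p \<in> P 0"
      proof clarify
        fix b m assume bm: "(b, m) \<in> set (init_letter G D a)"
        obtain q :: int where q: "q + p \<in> V" "q + p < 0" using n0 by (auto simp: P_def)
        then have qp: "q + p = - 1 / 2" by (intro Vneg)
        have "q < 0" "-2 < q" using qp p by linarith+
        then have "real_of_int q = -1" by simp
        have "jl 0 = 0" using w(4,5) by (intro jl_eq) (simp_all add: t_def)
        have b: "b = phi a \<or> b = psi G" "m = 1" using bm by (auto simp: init_letter_def)
        have "pend b" using b by (auto simp: pend_def phi_def psi_def)
        moreover have "bsat J w 0 (q + p) b" using b(1) J Jpsi qp by (elim disjE) simp_all
        moreover have "rg 0 0 p q = 1" using \<open>real_of_int q = -1\<close> p by (simp add: rg_def)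
        ultimately have "C 0 0 p (b, m) q" unfolding C_def using q b(2) \<open>jl 0 = 0\<close> by (simp add: cap_def)
        then show "(b, m) \<in> set (YS 0 0 p)" unfolding YS using b D by blast
      qed
      then show "set (concat (fst (zs n ! r))) \<subseteq> set (YS n (tt 0) p)" using sub by (auto simp: zr LT_def)
    next
      have "C n 1 p s q \<longleftrightarrow> C (Suc n) 0 p s q" for s q
        using p by (simp add: C_def rg_def algebra_simps)
      then show "YS n (tt len) p = snd (snd (zs n ! r))" by (simp add: YS_def zr tt_def)
    next
      fix i assume i: "i < len"
      let ?x = "n + tt i"
      have tS: "tt i < tt (Suc i)" using ttmono i by simp
      have regeq: "rg n (tt (Suc i)) p q = rg n (tt i) p q" if "i \<noteq> r" for q
      proof -
        have "tt (Suc i) \<le> p \<longleftrightarrow> tt i \<le> p"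
        proof (cases "Suc i < len")
          case True
          then show ?thesis using ttle[OF True rl(1)] ttle[OF i rl(1)] \<open>i \<noteq> r\<close> by (auto simp: p_def)
        next
          case False
          then have "r < i" using rl i \<open>i \<noteq> r\<close> by simp
          then show ?thesis using False p ttle[OF i rl(1)] by (simp add: tt_def p_def)
        qed
        then show ?thesis by (simp add: rg_def)
      qed
      have reg0: "rg n (tt i) p q = nat (2 * (int n - q) - 1)" "rg n (tt (Suc i)) p q = nat (2 * (int n - q) + 1)" if "i = r" for q
        using that tS by (simp_all add: rg_def p_def)
      have shcap: "sh G (min m (cap G)) = min (Suc m) (cap G)" for m by (auto simp: sh_def)
      have cap1: "min (Suc 0) (cap G) = Suc 0" by (simp add: cap_def)
      have qn: "q < int n" if "i = r" "real_of_int q + p < n + tt i" for q using that by (simp add: p_def)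
      show "if i = r then mid G (fst (snd (zs n ! i))) (YS n (tt i) p) (YS n (tt (Suc i)) p)
        else side (fst (snd (zs n ! i))) (YS n (tt i) p) (YS n (tt (Suc i)) p)"
      proof (cases "?x \<in> t ` {1..}")
        case False
        then have Ei: "E n (tt i) = []" by (simp add: E_def)
        have jeq: "jl ?x = jl (n + tt (Suc i))"
        proof -
          have "\<not> t (Suc (jl ?x)) < n + tt (Suc i)"
          proof
            assume *: "t (Suc (jl ?x)) < n + tt (Suc i)"
            have "t (Suc (jl ?x)) \<noteq> ?x" using False by (metis atLeast_iff image_eqI le_add1 plus_1_eq_Suc)
            then have **: "?x < t (Suc (jl ?x))" using jl1[of ?x] by simp
            have "t (Suc (jl ?x)) - n \<in> P (Suc n)" by (rule evP) (use tV ** * tt01(1)[of i] tt01(3)[of "Suc i"] in auto)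
            then show False using between[of "t (Suc (jl ?x)) - n" i] * ** by auto
          qed
          then show ?thesis using jl_eq[of "n + tt (Suc i)" "jl ?x"] jl2[of ?x] tt01(1)[of i] tS by simp
        qed
        show ?thesis
        proof (cases "i = r")
          case True
          have "noev G (YS n (tt i) p) (YS n (tt (Suc i)) p)" unfolding noev_def
          proof clarify
            fix b m assume "(b, m) \<in> set (YS n (tt i) p)"
            then obtain q where q: "b \<in> set D" "C n (tt i) p (b, m) q" unfolding YS by blast
            have "q < int n" using qn[OF True] q(2) by (simp add: C_def)
            then have "sh G (sh G m) = min (rg n (tt (Suc i)) p q) (cap G)"
              using q(2) by (simp add: C_def reg0[OF True] shcap)
            then have "C n (tt (Suc i)) p (b, sh G (sh G m)) q" using q(2) jeq tS by (simp add: C_def)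
            then show "(fst (b, m), sh G (sh G (snd (b, m)))) \<in> set (YS n (tt (Suc i)) p)" using q(1) YS by auto
          qed
          then show ?thesis using True zi[OF i] Ei by (simp add: mid_def)
        next
          case F: False
          have "set (YS n (tt i) p) \<subseteq> set (YS n (tt (Suc i)) p)"
          proof clarify
            fix b m assume "(b, m) \<in> set (YS n (tt i) p)"
            then obtain q where q: "b \<in> set D" "C n (tt i) p (b, m) q" unfolding YS by blast
            then have "C n (tt (Suc i)) p (b, m) q" using jeq tS regeq[OF F] by (simp add: C_def)
            then show "(b, m) \<in> set (YS n (tt (Suc i)) p)" using q(1) YS by blast
          qed
          then show ?thesis using F zi[OF i] Ei by (simp add: side_def)
        qed
      next
        case True
        define j where "j = jl ?x"
        have x0: "0 \<le> ?x" using tt01(1)[of i] by simp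
        obtain j' where j': "?x = t (Suc j')" using True by (metis atLeast_iff imageE Suc_le_D One_nat_def)
        have "jl ?x = j'" by (rule jl_eq[OF x0]) (simp_all add: j' tless)
        then have tj: "t (Suc j) = ?x" using j' by (simp add: j_def)
        have "\<not> t (Suc (Suc j)) < n + tt (Suc i)"
        proof
          assume *: "t (Suc (Suc j)) < n + tt (Suc i)"
          have **: "?x < t (Suc (Suc j))" using tless[of "Suc j" "Suc (Suc j)"] tj by simp
          have "t (Suc (Suc j)) - n \<in> P (Suc n)" by (rule evP) (use tV ** * tt01(1)[of i] tt01(3)[of "Suc i"] in auto)
          then show False using between[of "t (Suc (Suc j)) - n" i] * ** by auto
        qed
        then have jS: "jl (n + tt (Suc i)) = Suc j" using tS tj x0 by (intro jl_eq) auto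
        let ?e = "(fst (w (Suc j)), R (Suc j))"
        have Ei: "E n (tt i) = [?e]" using True by (simp add: E_def j_def)
        have pst: "pst (fst (w (Suc j))) (min m' (cap G)) N (R (Suc j)) b"
          if b: "b \<in> set D" "C n (tt i) p (b, m) q" and m': "isreg (?x - (q + p)) m'"
            and N: "\<And>c. c \<in> set D \<Longrightarrow> pend c \<Longrightarrow> bsat J w (Suc j) (q + p) c \<Longrightarrow> c \<in> set N" for b m q m' N
          by (rule pst_complete[OF D(1,2) b(1), where v = "q + p" and J = J])
            (use b(2) m' N in \<open>auto simp: C_def j_def[symmetric] tj[unfolded t_def] R_def t_def\<close>)
        show ?thesis
        proof (cases "i = r")
          case ir: True
          have "atev G ?e (YS n (tt i) p) (YS n (tt (Suc i)) p)" unfolding atev_def fst_conv snd_conv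
          proof (intro conjI ballI)
            fix s assume "s \<in> set (YS n (tt i) p)"
            moreover obtain b m where s: "s = (b, m)" by (cases s)
            ultimately obtain q where q: "b \<in> set D" "C n (tt i) p (b, m) q" using YS by blast
            have "q < int n" using qn[OF ir] q(2) by (simp add: C_def)
            then have r1: "sh G m = min (2 * nat (int n - q)) (cap G)"
              and r2: "sh G (sh G m) = min (rg n (tt (Suc i)) p q) (cap G)"
              using q(2) by (simp_all add: C_def reg0[OF ir] shcap nat_mult_distrib[symmetric])
            have "isreg (?x - (q + p)) (2 * nat (int n - q))"
              using isreg_exact[of "nat (int n - q)"] \<open>q < int n\<close> ir by (simp add: p_def)
            then have "pst (fst (w (Suc j))) (min (2 * nat (int n - q)) (cap G)) (proj (YS n (tt (Suc i)) p) (sh G (sh G m))) (R (Suc j)) b"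
            proof (rule pst[OF q])
              fix c assume c: "c \<in> set D" "pend c" "bsat J w (Suc j) (q + p) c"
              then have "C n (tt (Suc i)) p (c, sh G (sh G m)) q" using q(2) jS tS r2 by (simp add: C_def)
              then show "c \<in> set (proj (YS n (tt (Suc i)) p) (sh G (sh G m)))" unfolding proj_mem using c(1) YS by blast
            qed
            then show "pst (fst (w (Suc j))) (sh G (snd s)) (proj (YS n (tt (Suc i)) p) (sh G (sh G (snd s)))) (R (Suc j)) (fst s)"
              using r1 by (simp add: s)
          next
            fix c assume "c \<in> set (R (Suc j))"
            then have c: "c \<in> set D" "pend c" "bsat J w (Suc j) (n + p) c" using tj ir by (auto simp: R_def p_def)
            have "n + p \<in> V" using tV[of j] tj ir by (simp add: p_def)
            then have "C n (tt (Suc i)) p (c, 1) (int n)" using c jS tS ir reg0[OF ir] cap1 by (simp add: C_def p_def)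
            then show "(c, 1) \<in> set (YS n (tt (Suc i)) p)" using c(1) YS by blast
          qed
          then show ?thesis using ir zi[OF i] Ei by (simp add: mid_def)
        next
          case F: False
          have "proc ?e (YS n (tt i) p) (YS n (tt (Suc i)) p)" unfolding proc_def fst_conv snd_conv
          proof (intro ballI)
            fix s assume "s \<in> set (YS n (tt i) p)"
            moreover obtain b m where s: "s = (b, m)" by (cases s)
            ultimately obtain q where q: "b \<in> set D" "C n (tt i) p (b, m) q" using YS by blast
            have qx: "q + p < ?x" using q(2) by (simp add: C_def)
            have m: "m = min (rg n (tt i) p q) (cap G)" using q(2) by (simp add: C_def)
            have "isreg (?x - (q + p)) (rg n (tt i) p q)"
            proof (cases "i < r")
              case True
              then have lt: "tt i < p" using ttmono[OF True i] by (simp add: p_def)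
              then have "q < int n" using qx by linarith
              moreover have "rg n (tt i) p q = 2 * nat (int n - q - 1) + 1" using lt \<open>q < int n\<close> by (simp add: rg_def nat_mult_distrib)
              ultimately show ?thesis using lt p tt01(1)[of i] by (simp only:) (intro isreg_open; simp)
            next
              case False
              then have lt: "p < tt i" using ttmono[of r i] F rl by (simp add: p_def)
              then have "q \<le> int n" using qx tt01(2)[OF i] p by linarith
              moreover have "rg n (tt i) p q = 2 * nat (int n - q) + 1" using lt \<open>q \<le> int n\<close> by (simp add: rg_def nat_mult_distrib)
              ultimately show ?thesis using lt p tt01(2)[OF i] by (simp only:) (intro isreg_open; simp)
            qed
            then have "pst (fst (w (Suc j))) (min (rg n (tt i) p q) (cap G)) (proj (YS n (tt (Suc i)) p) m) (R (Suc j)) b"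
            proof (rule pst[OF q])
              fix c assume c: "c \<in> set D" "pend c" "bsat J w (Suc j) (q + p) c"
              then have "C n (tt (Suc i)) p (c, m) q" using q(2) jS tS regeq[OF F] by (simp add: C_def)
              then show "c \<in> set (proj (YS n (tt (Suc i)) p) m)" unfolding proj_mem using c(1) YS by blast
            qed
            then show "pst (fst (w (Suc j))) (snd s) (proj (YS n (tt (Suc i)) p) (snd s)) (R (Suc j)) (fst s)"
              using m by (simp add: s)
          qed
          then show ?thesis using F zi[OF i] Ei by (simp add: side_def)
        qed
      qed
    qed
    show "rowval (lts G D) G ([] @ evz (take r (zs n))) (zs n ! r) (evz (drop (Suc r) (zs n)))"
      unfolding append_Nil
    proof (rule chain_rowval[OF ch r])
      show "length (fst (snd z)) \<le> 1" if "z \<in> set (zs n)" for z using ent[of n] that opts_length unfolding entries_def by blast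
    qed (rule YSl)
  qed
  have st: "stp (sys G k D M) (f n) (f (Suc n))" for n
    using rows_stp[OF M ent rw, of n] unfolding fc[symmetric] fy[symmetric] .
  have P0: "P 0 = {1/2}"
  proof
    show "P 0 \<subseteq> {1/2}"
    proof
      fix p assume "p \<in> P 0"
      then obtain q :: int where q: "0 \<le> p" "p < 1" "q + p \<in> V" "q + p < 0" by (auto simp: P_def)
      have qp: "q + p = - 1 / 2" using q(3,4) by (rule Vneg)
      have "q < 0" "-2 < q" using qp q by linarith+
      then have "q = -1" by simp
      then show "p \<in> {1/2}" using qp by simp
    qed
    have "real_of_int (-1) + 1 / 2 \<in> V \<and> real_of_int (-1) + 1 / 2 < 0" by (simp add: V_def)
    then show "{1/2} \<subseteq> P 0" unfolding P_def by (auto intro!: exI[of _ "-1"])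
  qed
  have f0: "f 0 = [init_letter G D a]" by (simp add: f_def pl_def P0 LT_def)
  \<comment> \<open>From \<open>N + 1\<close> on, all positions still to come lie beyond
    \<open>J\<close>. A pending eventuality is then positive, and being fulfilled later it has a
    deadline that has not yet passed.\<close>
  obtain N :: nat where N: "t J < real N" using reals_Archimedean2 by blast
  have ok: "set (f n) \<subseteq> set (oks (sys G k D M))" if n: "Suc N \<le> n" for n
  proof
    fix x assume "x \<in> set (f n)"
    then obtain p where p: "p \<in> P n" "x = YS n 0 p" using n pl by (auto simp: f_def LT_def)
    have "t J < t (Suc (jl n))" using jl1[of n] N n by simp
    then have jJ: "J \<le> jl n" by (simp add: tless less_Suc_eq_le)
    have "okst D G s" if s: "s \<in> set x" for s
    proof -
      obtain b m where sb: "s = (b, m)" by (cases s)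
      obtain q where q: "b \<in> set D" "C n 0 p (b, m) q" using YS s p(2) unfolding sb by blast
      note s = sb
      have bs: "pend b" "bsat J w (jl n) (q + p) b" and m: "m = min (rg n 0 p q) (cap G)" and qp: "q + p < n"
        using q(2) by (simp_all add: C_def)
      from bs(1) consider b1 b2 where "b = Release b1 b2" | b1 b2 where "b = Until b1 b2" by (auto simp: pend_def)
      then show ?thesis
      proof cases
        case (1 b1 b2)
        then show ?thesis using subclosedD[OF D(1) q(1)] by (auto simp: okst_def s)
      next
        case (2 b1 b2)
        then obtain i where i: "i > jl n" "positive b \<or> i < J" "bsat J w i (q + p) b2" using bs(2) by auto
        then have "positive b" using jJ by simp
        then obtain c d where c: "b1 = TT" "b2 = And (Constr CLe c) d" using 2 positive_UntilE by blast
        have "t i - (q + p) \<le> c" using i(3) by (simp add: c t_def)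
        moreover have "real n \<le> t i" using jl1[of n] tle[of "Suc (jl n)" i] i(1) by simp
        ultimately have "n - q - p \<le> c" by linarith
        then have nq: "int n - q \<le> int c" using P01[OF p(1)] by linarith
        have "q < int n" using qp P01[OF p(1)] by linarith
        have b2: "b1 \<in> set D" "b2 \<in> set D" using subclosedD[OF D(1) q(1)] 2 by auto
        then have "consts_less (Suc G) b2" using D(2) by blast
        then have "c < Suc G" by (simp add: c)
        moreover have "rg n 0 p q < 2 * c" using nq \<open>q < int n\<close> P01[OF p(1)] by (simp add: rg_def)
        moreover have "d \<in> set D" using subclosedD[OF D(1) b2(2)] by (simp add: c)
        ultimately show ?thesis using b2 unfolding okst_def s 2 c m fst_conv snd_conv
          by (intro bexI[of _ TT] bexI[of _ d] disjI2 bexI[of _ c]) (auto simp: c)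
      qed
    qed
    then show "x \<in> set (oks (sys G k D M))" using p(2) YSl by (auto simp: sys_def)
  qed
  show ?thesis unfolding Good_def using f0 st ok by (intro exI[of _ f]) auto
qed

section \<open>The decision procedure\<close>

lemma cf_comp3:
  assumes "cf (\<lambda>p. h (fst p) (fst (snd p)) (snd (snd p)))" "cf f" "cf g" "cf k" shows "cf (\<lambda>x. h (f x) (g x) (k x))"
  using cf_comp[OF assms(1) cf_pair[OF assms(2) cf_pair[OF assms(3,4)]]] by simp

lemma cf_comp4:
  assumes "cf (\<lambda>p. h (fst p) (fst (snd p)) (fst (snd (snd p))) (snd (snd (snd p))))" "cf f" "cf g" "cf k" "cf l"
  shows "cf (\<lambda>x. h (f x) (g x) (k x) (l x))"
  using cf_comp[OF assms(1) cf_pair[OF assms(2) cf_pair[OF assms(3) cf_pair[OF assms(4,5)]]]] by simp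

lemma dec_comp3:
  assumes "dec (\<lambda>p. h (fst p) (fst (snd p)) (snd (snd p)))" "cf f" "cf g" "cf k" shows "dec (\<lambda>x. h (f x) (g x) (k x))"
  using dec_comp[OF assms(1) cf_pair[OF assms(2) cf_pair[OF assms(3,4)]]] by simp

lemma dec_comp4:
  assumes "dec (\<lambda>p. h (fst p) (fst (snd p)) (fst (snd (snd p))) (snd (snd (snd p))))" "cf f" "cf g" "cf k" "cf l"
  shows "dec (\<lambda>x. h (f x) (g x) (k x) (l x))"
  using dec_comp[OF assms(1) cf_pair[OF assms(2) cf_pair[OF assms(3) cf_pair[OF assms(4,5)]]]] by simp

lemma dec_comp5:
  assumes "dec (\<lambda>p. h (fst p) (fst (snd p)) (fst (snd (snd p))) (fst (snd (snd (snd p)))) (snd (snd (snd (snd p)))))"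
    "cf f" "cf g" "cf k" "cf l" "cf m"
  shows "dec (\<lambda>x. h (f x) (g x) (k x) (l x) (m x))"
  using dec_comp[OF assms(1) cf_pair[OF assms(2) cf_pair[OF assms(3) cf_pair[OF assms(4) cf_pair[OF assms(5,6)]]]]] by simp

lemma dec_ball [deci]:
  fixes P :: "'a::coded \<Rightarrow> 'b::coded \<Rightarrow> bool"
  assumes P: "dec (\<lambda>p. P (fst p) (snd p))" and l: "cf l" shows "dec (\<lambda>x. \<forall>y\<in>set (l x). P x y)"
proof -
  have "cf (\<lambda>x. foldr (\<lambda>y acc. if P x y then acc else (1::nat)) (l x) 0)"
    by (intro cf_foldr cf_If dec_comp2[OF P] cfi l)
  from dec_eq[OF this cf_const[of 0]] have "dec (\<lambda>x. foldr (\<lambda>y acc. if P x y then acc else (1::nat)) (l x) 0 = 0)" .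
  moreover have "foldr (\<lambda>y acc. if Q y then acc else (1::nat)) ys 0 = 0 \<longleftrightarrow> (\<forall>y\<in>set ys. Q y)" for Q and ys :: "'b list"
    by (induction ys) auto
  ultimately show ?thesis by simp
qed

lemma dec_bex [deci]:
  fixes P :: "'a::coded \<Rightarrow> 'b::coded \<Rightarrow> bool"
  assumes P: "dec (\<lambda>p. P (fst p) (snd p))" and l: "cf l" shows "dec (\<lambda>x. \<exists>y\<in>set (l x). P x y)"
  using dec_not[OF dec_ball[OF dec_not[OF P] l]] by simp

lemma dec_mem [deci]:
  fixes f :: "'a::coded \<Rightarrow> 'b::coded"
  assumes f: "cf f" and l: "cf l" shows "dec (\<lambda>x. f x \<in> set (l x))"
proof -
  have "dec (\<lambda>x. \<exists>y\<in>set (l x). f x = y)"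
    by (intro dec_bex dec_eq cf_comp[OF f] cfi l)
  then show ?thesis by simp
qed

lemma re_bex:
  fixes P :: "'a::coded \<Rightarrow> 'b::coded \<Rightarrow> bool"
  assumes P: "re (\<lambda>p. P (fst p) (snd p))" and l: "cf l" shows "re (\<lambda>x. \<exists>y\<in>set (l x). P x y)"
proof -
  have "re (\<lambda>p::'a \<times> 'b. snd p \<in> set (l (fst p)) \<and> P (fst p) (snd p))"
    by (intro re_conj P dec_re dec_mem cf_comp[OF l] cfi)
  from re_ex[OF this] show ?thesis unfolding Bex_def .
qed

lemma re_imp: "dec P \<Longrightarrow> re Q \<Longrightarrow> re (\<lambda>x. P x \<longrightarrow> Q x)"
  unfolding imp_conv_disj dec_def by (intro re_disj; blast)

lemmas rei = re_conj re_disj re_ex re_ball re_bex re_imp re_eq re_neq dec_re[OF dec_mem]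

lemma cf_map [cfi]:
  assumes "cf (\<lambda>p. f (fst p) (snd p))" "cf l" shows "cf (\<lambda>x. map (f x) (l x))"
proof -
  have "map g xs = foldr (\<lambda>y acc. g y # acc) xs []" for g :: "'b \<Rightarrow> 'c" and xs by (induction xs) auto
  then show ?thesis by (simp only:) (intro cf_foldr cf_comp2[OF assms(1)] cfi assms(2))
qed

lemma cf_filter [cfi]:
  assumes "dec (\<lambda>p. P (fst p) (snd p))" "cf l" shows "cf (\<lambda>x. filter (P x) (l x))"
proof -
  have "filter g xs = foldr (\<lambda>y acc. if g y then y # acc else acc) xs []" for g :: "'b \<Rightarrow> bool" and xs by (induction xs) auto
  then show ?thesis by (simp only:) (intro cf_foldr cf_If dec_comp2[OF assms(1)] cfi assms(2))
qed

lemma cf_append [cfi]: assumes "cf f" "cf g" shows "cf (\<lambda>x. f x @ g x)"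
proof -
  have "xs @ ys = foldr (\<lambda>y acc. y # acc) xs ys" for xs ys :: "'b list" by (induction xs) auto
  then show ?thesis by (simp only:) (intro cf_foldr cfi assms)
qed

lemma cf_concat [cfi]: assumes "cf f" shows "cf (\<lambda>x. concat (f x))"
proof -
  have "concat xs = foldr (\<lambda>y acc. y @ acc) xs []" for xs :: "'b list list" by (induction xs) auto
  then show ?thesis by (simp only:) (intro cf_foldr cfi assms)
qed

lemma cf_product [cfi]: assumes "cf f" "cf g" shows "cf (\<lambda>x. List.product (f x) (g x))"
proof -
  have "List.product xs ys = concat (map (\<lambda>x. map (\<lambda>y. (x, y)) ys) xs)" for xs :: "'b list" and ys :: "'c list"
    by (induction xs) auto
  then show ?thesis by (simp only:) (intro cfi cf_comp[OF assms(2)] assms)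
qed

lemma cf_subseqs [cfi]: assumes "cf f" shows "cf (\<lambda>x. subseqs (f x))"
proof -
  have "subseqs xs = foldr (\<lambda>x acc. map (\<lambda>y. x # y) acc @ acc) xs [[]]" for xs :: "'b list"
    by (induction xs) (auto simp: Let_def)
  then show ?thesis by (simp only:) (intro cfi assms)
qed

lemma cf_upt [cfi]: assumes "cf n" shows "cf (\<lambda>x. [0..<n x])"
proof -
  let ?Q = "\<lambda>(x::nat \<times> nat list) l. (fst x = 0 \<and> snd x = [] \<and> l = []) \<or>
    (\<exists>m. \<exists>k. fst x = Suc m \<and> snd x = k @ [m] \<and> l = [(m, k)])"
  have "re (\<lambda>x. snd x = [0..<fst x])"
  proof (rule re_wf[where m = fst])
    show "re (\<lambda>p. ?Q (fst p) (snd p))" by (intro rei cfi)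
    show "snd x = [0..<fst x] \<longleftrightarrow> (\<exists>l. ?Q x l \<and> (\<forall>y\<in>set l. snd y = [0..<fst y]))" for x
    proof (cases "fst x")
      case (Suc m)
      have "(\<exists>l. ?Q x l \<and> (\<forall>y\<in>set l. snd y = [0..<fst y])) \<longleftrightarrow> (\<exists>u. snd x = u @ [m] \<and> u = [0..<m])"
      proof
        assume "\<exists>u. snd x = u @ [m] \<and> u = [0..<m]"
        then show "\<exists>l. ?Q x l \<and> (\<forall>y\<in>set l. snd y = [0..<fst y])"
          by (intro exI[of _ "[(m, [0..<m])]"]) (simp add: Suc del: upt.simps)
      next
        assume "\<exists>l. ?Q x l \<and> (\<forall>y\<in>set l. snd y = [0..<fst y])"
        then obtain l where l: "?Q x l" "\<forall>y\<in>set l. snd y = [0..<fst y]" by blast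
        from l(1) have "\<exists>m'. \<exists>u. fst x = Suc m' \<and> snd x = u @ [m'] \<and> l = [(m', u)]"
          by (rule disjE) (use Suc in simp_all)
        then obtain m' u where "fst x = Suc m'" "snd x = u @ [m']" "l = [(m', u)]" by blast
        moreover from this l(2) have "u = [0..<m']" by (simp del: upt.simps)
        ultimately show "\<exists>u. snd x = u @ [m] \<and> u = [0..<m]" using Suc by simp
      qed
      then show ?thesis by (simp add: Suc)
    qed simp
  qed auto
  then have "cf (\<lambda>n. [0..<n])" by (simp add: cf_def)
  from cf_comp[OF this assms] show ?thesis .
qed

lemma cf_hd [cfi]: assumes "cf l" shows "cf (\<lambda>x. hd (l x))"
proof -
  obtain c :: 'b where "c = hd []" by blast
  then have "hd xs = foldr (\<lambda>y acc. y) xs c" for xs :: "'b list" by (cases xs) auto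
  then show ?thesis by (simp only:) (intro cf_foldr cfi assms)
qed

lemma cf_tl [cfi]: assumes "cf l" shows "cf (\<lambda>x. tl (l x))"
proof -
  have "foldr (\<lambda>y acc. (y # fst acc, fst acc)) xs ([], []) = (xs, tl xs)" for xs :: "'b list" by (induction xs) auto
  then have "tl xs = snd (foldr (\<lambda>y acc. (y # fst acc, fst acc)) xs ([], []))" for xs :: "'b list" by simp
  then show ?thesis by (simp only:) (intro cf_foldr cfi assms)
qed

lemma cf_length [cfi]: assumes "cf l" shows "cf (\<lambda>x. length (l x))"
proof -
  have "length xs = foldr (\<lambda>y acc. Suc acc) xs 0" for xs :: "'b list" by (induction xs) auto
  then show ?thesis by (simp only:) (intro cf_foldr cfi assms)
qed

lemma cf_drop [cfi]: assumes "cf n" "cf l" shows "cf (\<lambda>x. drop (n x) (l x))"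
proof -
  have "foldr (\<lambda>y acc. tl acc) ys xs = drop (length ys) xs" for xs :: "'b list" and ys :: "nat list"
    by (induction ys) (simp_all add: drop_Suc tl_drop)
  then have "drop m xs = foldr (\<lambda>y acc. tl acc) [0..<m] xs" for xs :: "'b list" and m :: nat
    by simp
  then show ?thesis by (simp only:) (intro cf_foldr cfi assms)
qed

lemma cf_foldl [cfi]:
  fixes h :: "'a::coded \<Rightarrow> 'c::coded \<Rightarrow> 'b::coded \<Rightarrow> 'c"
  assumes h: "cf (\<lambda>p. h (fst p) (fst (snd p)) (snd (snd p)))" and l: "cf l" and z: "cf z"
  shows "cf (\<lambda>a. foldl (h a) (z a) (l a))"
proof -
  have "rev xs = foldr (\<lambda>y acc. acc @ [y]) xs []" for xs :: "'b list" by (induction xs) auto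
  then have "foldl g s xs = foldr (\<lambda>x y. g y x) (foldr (\<lambda>y acc. acc @ [y]) xs []) s" for g and s :: 'c and xs :: "'b list"
    by (simp add: foldl_conv_foldr)
  then show ?thesis by (simp only:) (intro cf_foldr cf_comp3[OF h] cfi l z)
qed

section \<open>Computability of the certificates and of the word system\<close>

lemma cf_res: "cf (\<lambda>p. res (fst p) (snd p))"
  unfolding res_def by (intro cfi deci)

lemma cf_ress [cfi]: "cf B \<Longrightarrow> cf y \<Longrightarrow> cf (\<lambda>x. ress (B x) (y x))"
  by (rule cf_comp2[of ress]) (unfold ress_def, intro cfi cf_comp2[OF cf_res])

lemma dec_covers [deci]: "cf B \<Longrightarrow> cf w \<Longrightarrow> dec (\<lambda>x. covers (B x) (w x))"
  by (rule dec_comp2[of covers]) (unfold covers_def, intro cfi deci)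

lemma re_path: "re (\<lambda>x. path (fst x) (fst (snd x)) (fst (snd (snd x))) (fst (snd (snd (snd x)))) (snd (snd (snd (snd x)))))"
proof -
  let ?P = "\<lambda>x::('a::coded, 'b::coded) nsys \<times> 'a \<times> 'b list \<times> 'b list \<times> 'a.
    path (fst x) (fst (snd x)) (fst (snd (snd x))) (fst (snd (snd (snd x)))) (snd (snd (snd (snd x))))"
  let ?Q = "\<lambda>(x::('a::coded, 'b::coded) nsys \<times> 'a \<times> 'b list \<times> 'b list \<times> 'a) l.
    (fst (snd (snd x)) = [] \<and> fst (snd (snd (snd x))) = [] \<and> fst (snd x) = snd (snd (snd (snd x))) \<and> l = []) \<or>
    (\<exists>xo. \<exists>y. \<exists>q'. \<exists>u. \<exists>v. (fst (snd x), xo, y, q') \<in> set (rules (fst x)) \<and> fst (snd (snd x)) = xo @ u \<and>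
       fst (snd (snd (snd x))) = y # v \<and> l = [(fst x, q', u, v, snd (snd (snd (snd x))))])"
  show "re ?P"
  proof (rule re_wf[where m = "\<lambda>x. length (fst (snd (snd (snd x))))"])
    show "re (\<lambda>p. ?Q (fst p) (snd p))" by (intro rei cfi)
    show "?P x \<longleftrightarrow> (\<exists>l. ?Q x l \<and> (\<forall>y\<in>set l. ?P y))" for x
    proof -
      obtain S q u v q' where x: "x = (S, q, u, v, q')" by (cases x) auto
      show ?thesis unfolding x fst_conv snd_conv
      proof
        assume "path S q u v q'"
        then show "\<exists>l. ((u = [] \<and> v = [] \<and> q = q' \<and> l = []) \<or>
          (\<exists>xo y q'' u' v'. (q, xo, y, q'') \<in> set (rules S) \<and> u = xo @ u' \<and> v = y # v' \<and> l = [(S, q'', u', v', q')])) \<and>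
          (\<forall>y\<in>set l. ?P y)"
        proof cases
          case path_Nil
          then show ?thesis by (intro exI[of _ "[]"]) simp
        next
          case (path_Cons xo y q'' u' v')
          then show ?thesis by (intro exI[of _ "[(S, q'', u', v', q')]"]) auto
        qed
      next
        assume "\<exists>l. ((u = [] \<and> v = [] \<and> q = q' \<and> l = []) \<or>
          (\<exists>xo y q'' u' v'. (q, xo, y, q'') \<in> set (rules S) \<and> u = xo @ u' \<and> v = y # v' \<and> l = [(S, q'', u', v', q')])) \<and>
          (\<forall>y\<in>set l. ?P y)"
        then show "path S q u v q'" by (auto intro: path.intros)
      qed
    qed
  qed auto
qed

lemma re_path': "cf S \<Longrightarrow> cf q \<Longrightarrow> cf u \<Longrightarrow> cf v \<Longrightarrow> cf q' \<Longrightarrow> re (\<lambda>x. path (S x) (q x) (u x) (v x) (q' x))"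
  using re_comp[OF re_path, of "\<lambda>x. (S x, q x, u x, v x, q' x)"] by (simp add: cfi)

lemma re_stp: "cf S \<Longrightarrow> cf u \<Longrightarrow> cf v \<Longrightarrow> re (\<lambda>x. stp (S x) (u x) (v x))"
proof -
  have "re (\<lambda>x. stp (fst x) (fst (snd x)) (snd (snd x)))"
    unfolding stp_def by (intro rei cfi re_path')
  from re_comp[OF this, of "\<lambda>x. (S x, u x, v x)"] show "cf S \<Longrightarrow> cf u \<Longrightarrow> cf v \<Longrightarrow> re (\<lambda>x. stp (S x) (u x) (v x))"
    by (simp add: cfi)
qed

lemma re_stp_pow: "cf S \<Longrightarrow> cf n \<Longrightarrow> cf u \<Longrightarrow> cf v \<Longrightarrow> re (\<lambda>x. (stp (S x) ^^ n x) (u x) (v x))"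
proof -
  let ?P = "\<lambda>x. (stp (fst x) ^^ fst (snd x)) (fst (snd (snd x))) (snd (snd (snd x)))"
  let ?Q = "\<lambda>x l. (fst (snd x) = 0 \<and> fst (snd (snd x)) = snd (snd (snd x)) \<and> l = []) \<or>
    (\<exists>m. \<exists>z. fst (snd x) = Suc m \<and> stp (fst x) (fst (snd (snd x))) z \<and> l = [(fst x, m, z, snd (snd (snd x)))])"
  have "re ?P"
  proof (rule re_wf[where m = "\<lambda>x. fst (snd x)"])
    show "re (\<lambda>p. ?Q (fst p) (snd p))" by (intro rei cfi re_stp)
    show "?P x \<longleftrightarrow> (\<exists>l. ?Q x l \<and> (\<forall>y\<in>set l. ?P y))" for x
    proof -
      obtain S n u v where x: "x = (S, n, u, v)" by (cases x) auto
      show ?thesis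
      proof (cases n)
        case (Suc m)
        have "(stp S ^^ Suc m) u v \<longleftrightarrow> (\<exists>z. stp S u z \<and> (stp S ^^ m) z v)"
          using relpowp_Suc_D2[of m "stp S" u v] relpowp_Suc_I2[of "stp S" u _ m v] by blast
        then show ?thesis unfolding x Suc by (auto simp del: relpowp.simps)
      qed (auto simp: x)
    qed
  qed auto
  from re_comp[OF this, of "\<lambda>x. (S x, n x, u x, v x)"]
  show "cf S \<Longrightarrow> cf n \<Longrightarrow> cf u \<Longrightarrow> cf v \<Longrightarrow> re (\<lambda>x. (stp (S x) ^^ n x) (u x) (v x))" by (simp add: cfi)
qed

lemma re_Kcert: "cf S \<Longrightarrow> cf Y \<Longrightarrow> cf B \<Longrightarrow> cf b \<Longrightarrow> cf J \<Longrightarrow> re (\<lambda>x. Kcert (S x) (Y x) (B x) (b x) (J x))"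
  by (rule dec_re, rule dec_comp5[of Kcert]) (unfold Kcert_def, intro deci cfi)

lemma re_badB: "cf S \<Longrightarrow> cf n \<Longrightarrow> cf B \<Longrightarrow> re (\<lambda>x. badB (S x) (n x) (B x))"
proof -
  let ?P = "\<lambda>x. badB (fst x) (fst (snd x)) (snd (snd x))"
  let ?Q = "\<lambda>x l. (fst (snd x) = 0 \<and> snd (snd x) = [] \<and> l = []) \<or>
    (\<exists>m. \<exists>C. fst (snd x) = Suc m \<and> (\<forall>b\<in>set (snd (snd x)). \<exists>J. Kcert (fst x) (oks (fst x)) C b J) \<and> l = [(fst x, m, C)])"
  have "re ?P"
  proof (rule re_wf[where m = "\<lambda>x. fst (snd x)"])
    show "re (\<lambda>p. ?Q (fst p) (snd p))" by (intro rei cfi re_Kcert)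
    show "?P x \<longleftrightarrow> (\<exists>l. ?Q x l \<and> (\<forall>y\<in>set l. ?P y))" for x
    proof -
      obtain S n B where x: "x = (S, n, B)" by (cases x) auto
      show ?thesis
      proof (cases n)
        case (Suc m)
        show ?thesis
        proof
          assume "?P x"
          then obtain C where "badB S m C" "\<forall>b\<in>set B. \<exists>J. Kcert S (oks S) C b J" unfolding x Suc by auto
          then show "\<exists>l. ?Q x l \<and> (\<forall>y\<in>set l. ?P y)" unfolding x Suc by (intro exI[of _ "[(S, m, C)]"]) auto
        qed (auto simp: x Suc)
      qed (auto simp: x)
    qed
  qed auto
  from re_comp[OF this, of "\<lambda>x. (S x, n x, B x)"]
  show "cf S \<Longrightarrow> cf n \<Longrightarrow> cf B \<Longrightarrow> re (\<lambda>x. badB (S x) (n x) (B x))" by (simp add: cfi)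
qed

lemma re_unsat_cert: "cf S \<Longrightarrow> cf u \<Longrightarrow> re (\<lambda>x. unsat_cert (S x) (u x))"
proof -
  have "re (\<lambda>x. unsat_cert (fst x) (snd x))"
    unfolding unsat_cert_def by (intro rei cfi deci re_badB re_Kcert dec_re[OF dec_covers])
  from re_comp[OF this, of "\<lambda>x. (S x, u x)"] show "cf S \<Longrightarrow> cf u \<Longrightarrow> re (\<lambda>x. unsat_cert (S x) (u x))" by (simp add: cfi)
qed

lemma re_Tcert: "cf S \<Longrightarrow> cf B \<Longrightarrow> cf T \<Longrightarrow> re (\<lambda>x. Tcert (S x) (B x) (T x))"
proof -
  have "re (\<lambda>x. Tcert (fst x) (fst (snd x)) (snd (snd x)))"
    unfolding Tcert_def by (intro rei cfi deci re_path' dec_re[OF dec_not[OF dec_covers]])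
  from re_comp[OF this, of "\<lambda>x. (S x, B x, T x)"] show "cf S \<Longrightarrow> cf B \<Longrightarrow> cf T \<Longrightarrow> re (\<lambda>x. Tcert (S x) (B x) (T x))"
    by (simp add: cfi)
qed

lemma re_sat_cert: "cf S \<Longrightarrow> cf u \<Longrightarrow> re (\<lambda>x. sat_cert (S x) (u x))"
proof -
  have "re (\<lambda>x. sat_cert (fst x) (snd x))"
    unfolding sat_cert_def by (intro rei cfi deci re_stp_pow re_Tcert dec_re[OF dec_not[OF dec_covers]])
  from re_comp[OF this, of "\<lambda>x. (S x, u x)"] show "cf S \<Longrightarrow> cf u \<Longrightarrow> re (\<lambda>x. sat_cert (S x) (u x))" by (simp add: cfi)
qed

lemma dec_cmpn [deci]: "cf c \<Longrightarrow> cf m \<Longrightarrow> cf n \<Longrightarrow> dec (\<lambda>x. cmpn (c x) (m x) (n x))"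
proof -
  have "cmpn c m n \<longleftrightarrow> (c = CEq \<and> m = n) \<or> (c = CNeq \<and> m \<noteq> n) \<or> (c = CLt \<and> m < n) \<or> (c = CLe \<and> m \<le> n) \<or>
    (c = CGt \<and> n < m) \<or> (c = CGe \<and> n \<le> m)" for c m n by (cases c) auto
  then show "cf c \<Longrightarrow> cf m \<Longrightarrow> cf n \<Longrightarrow> dec (\<lambda>x. cmpn (c x) (m x) (n x))"
    by (simp only:) (intro deci cfi)
qed

text \<open>Truth and falsity are enumerated by separate derivations with dual rules, both of which
  descend to subformulas.\<close>

lemma dec_lc [deci]: "cf p \<Longrightarrow> cf r \<Longrightarrow> cf N \<Longrightarrow> cf R \<Longrightarrow> cf a \<Longrightarrow> dec (\<lambda>x. lc (p x) (r x) (N x) (R x) (a x))"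
proof (rule dec_comp5[of lc])
  let ?a = "\<lambda>x::nat \<times> nat \<times> tptl list \<times> tptl list \<times> tptl. snd (snd (snd (snd x)))"
  let ?p = "\<lambda>x::nat \<times> nat \<times> tptl list \<times> tptl list \<times> tptl. fst x"
  let ?r = "\<lambda>x::nat \<times> nat \<times> tptl list \<times> tptl list \<times> tptl. fst (snd x)"
  let ?N = "\<lambda>x::nat \<times> nat \<times> tptl list \<times> tptl list \<times> tptl. fst (snd (snd x))"
  let ?R = "\<lambda>x::nat \<times> nat \<times> tptl list \<times> tptl list \<times> tptl. fst (snd (snd (snd x)))"
  let ?lc = "\<lambda>x. lc (?p x) (?r x) (?N x) (?R x) (?a x)"
  let ?Q = "\<lambda>x l. (\<exists>q. ?a x = Prop q \<and> ?p x = q \<and> l = []) \<or>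
    (\<exists>b. ?a x = Freeze b \<and> l = [(?p x, 0, ?R x, ?R x, b)]) \<or>
    (\<exists>c. \<exists>n. ?a x = Constr c n \<and> cmpn c (?r x) (2 * n) \<and> l = []) \<or>
    (\<exists>b. \<exists>c. ?a x = And b c \<and> l = [(?p x, ?r x, ?N x, ?R x, b), (?p x, ?r x, ?N x, ?R x, c)]) \<or>
    (\<exists>b. \<exists>c. ?a x = Or b c \<and> (l = [(?p x, ?r x, ?N x, ?R x, b)] \<or> l = [(?p x, ?r x, ?N x, ?R x, c)])) \<or>
    (\<exists>b. \<exists>c. (?a x = Until b c \<or> ?a x = Release b c) \<and> ?a x \<in> set (?N x) \<and> l = [])"
  let ?Q' = "\<lambda>x l. (\<exists>q. ?a x = Prop q \<and> ?p x \<noteq> q \<and> l = []) \<or>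
    (\<exists>b. ?a x = Freeze b \<and> l = [(?p x, 0, ?R x, ?R x, b)]) \<or>
    (\<exists>c. \<exists>n. ?a x = Constr c n \<and> \<not> cmpn c (?r x) (2 * n) \<and> l = []) \<or>
    (\<exists>b. \<exists>c. ?a x = And b c \<and> (l = [(?p x, ?r x, ?N x, ?R x, b)] \<or> l = [(?p x, ?r x, ?N x, ?R x, c)])) \<or>
    (\<exists>b. \<exists>c. ?a x = Or b c \<and> l = [(?p x, ?r x, ?N x, ?R x, b), (?p x, ?r x, ?N x, ?R x, c)]) \<or>
    (\<exists>b. \<exists>c. (?a x = Until b c \<or> ?a x = Release b c) \<and> ?a x \<notin> set (?N x) \<and> l = [])"
  have "re ?lc"
  proof (rule re_wf[where m = "\<lambda>x. size (?a x)"])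
    show "re (\<lambda>p. ?Q (fst p) (snd p))" by (intro rei cfi dec_re[OF dec_cmpn])
    show "?lc x \<longleftrightarrow> (\<exists>l. ?Q x l \<and> (\<forall>y\<in>set l. ?lc y))" for x
      by (cases "?a x") (auto simp: conj_disj_distribR ex_disj_distrib)
  qed auto
  moreover have "re (\<lambda>x. \<not> ?lc x)"
  proof (rule re_wf[where m = "\<lambda>x. size (?a x)"])
    show "re (\<lambda>p. ?Q' (fst p) (snd p))" by (intro rei cfi dec_re[OF dec_not[OF dec_cmpn]] dec_re[OF dec_not[OF dec_mem]])
    show "\<not> ?lc x \<longleftrightarrow> (\<exists>l. ?Q' x l \<and> (\<forall>y\<in>set l. \<not> ?lc y))" for x
      by (cases "?a x") (auto simp: conj_disj_distribR ex_disj_distrib)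
  qed auto
  ultimately show "dec ?lc" by (rule decI)
qed

lemma dec_pst [deci]: "cf p \<Longrightarrow> cf r \<Longrightarrow> cf N \<Longrightarrow> cf R \<Longrightarrow> cf a \<Longrightarrow> dec (\<lambda>x. pst (p x) (r x) (N x) (R x) (a x))"
proof (rule dec_comp5[of pst])
  let ?U = "\<lambda>p r N R a b c. lc p r N R c \<or> (lc p r N R b \<and> a \<in> set N)"
  let ?W = "\<lambda>p r N R a b c. lc p r N R c \<and> (lc p r N R b \<or> a \<in> set N)"
  have 1: "pst p r N R a \<longleftrightarrow> (\<exists>b. \<exists>c. a = Until b c \<and> ?U p r N R a b c) \<or> (\<exists>b. \<exists>c. a = Release b c \<and> ?W p r N R a b c)"
    for p r N R a by (cases a) auto
  have 2: "\<not> pst p r N R a \<longleftrightarrow> (\<exists>b. \<exists>c. a = Until b c \<and> \<not> ?U p r N R a b c) \<or> (\<exists>b. \<exists>c. a = Release b c \<and> \<not> ?W p r N R a b c) \<or>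
     (\<exists>q. a = Prop q) \<or> (\<exists>b. a = Freeze b) \<or> (\<exists>c. \<exists>n. a = Constr c n) \<or> (\<exists>b. \<exists>c. a = And b c) \<or> (\<exists>b. \<exists>c. a = Or b c)"
    for p r N R a by (cases a) auto
  show "dec (\<lambda>x. pst (fst x) (fst (snd x)) (fst (snd (snd x))) (fst (snd (snd (snd x)))) (snd (snd (snd (snd x)))))"
  proof (rule decI)
    show "re (\<lambda>x. pst (fst x) (fst (snd x)) (fst (snd (snd x))) (fst (snd (snd (snd x)))) (snd (snd (snd (snd x)))))"
      unfolding 1 by (intro rei cfi dec_re[OF dec_lc])
    show "re (\<lambda>x. \<not> pst (fst x) (fst (snd x)) (fst (snd (snd x))) (fst (snd (snd (snd x)))) (snd (snd (snd (snd x)))))"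
      unfolding 2 de_Morgan_conj de_Morgan_disj by (intro rei cfi dec_re[OF dec_not[OF dec_lc]] dec_re[OF dec_not[OF dec_mem]])
  qed
qed

lemma cf_proj [cfi]: "cf y \<Longrightarrow> cf r \<Longrightarrow> cf (\<lambda>x. proj (y x) (r x))"
  by (rule cf_comp2[of proj]) (unfold proj_def, intro cfi deci)

lemma cf_cap [cfi]: "cf G \<Longrightarrow> cf (\<lambda>x. cap (G x))"
  unfolding cap_def by (intro cfi)

lemma cf_sh [cfi]: "cf G \<Longrightarrow> cf r \<Longrightarrow> cf (\<lambda>x. sh (G x) (r x))"
  by (rule cf_comp2[of sh]) (unfold sh_def min_def, intro cfi deci)

lemma dec_proc [deci]: "cf e \<Longrightarrow> cf y \<Longrightarrow> cf z \<Longrightarrow> dec (\<lambda>x. proc (e x) (y x) (z x))"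
  by (rule dec_comp3[of proc]) (unfold proc_def, intro cfi deci)

lemma dec_mid [deci]: "cf G \<Longrightarrow> cf e \<Longrightarrow> cf y \<Longrightarrow> cf z \<Longrightarrow> dec (\<lambda>x. mid (G x) (e x) (y x) (z x))"
  by (rule dec_comp4[of mid]) (unfold mid_def noev_def atev_def if_bool_eq_conj, intro cfi deci)

lemma cf_relI [cfi]: "cf l \<Longrightarrow> cf (\<lambda>x. relI (l x))"
  by (rule cf_comp[of relI]) (unfold relI_def subset_eq, intro cfi deci)

lemma cf_preR [cfi]: "cf l \<Longrightarrow> cf e \<Longrightarrow> cf s \<Longrightarrow> cf (\<lambda>x. preR (l x) (e x) (s x))"
  by (rule cf_comp3[of preR]) (unfold preR_def, intro cfi deci)

lemma cf_postR [cfi]: "cf l \<Longrightarrow> cf e \<Longrightarrow> cf s \<Longrightarrow> cf (\<lambda>x. postR (l x) (e x) (s x))"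
  by (rule cf_comp3[of postR]) (unfold postR_def, intro cfi deci)

lemma cf_opts [cfi]: "cf l \<Longrightarrow> cf (\<lambda>x. opts (l x))"
  by (rule cf_comp[of opts]) (unfold opts_def, intro cfi deci)

lemma cf_lts [cfi]: "cf G \<Longrightarrow> cf D \<Longrightarrow> cf (\<lambda>x. lts (G x) (D x))"
  by (rule cf_comp2[of lts]) (unfold lts_def, intro cfi deci)

lemma cf_evl [cfi]: "cf k \<Longrightarrow> cf D \<Longrightarrow> cf (\<lambda>x. evl (k x) (D x))"
  by (rule cf_comp2[of evl]) (unfold evl_def, intro cfi deci)

lemma dec_okst [deci]: "cf D \<Longrightarrow> cf G \<Longrightarrow> cf s \<Longrightarrow> dec (\<lambda>x. okst (D x) (G x) (s x))"
  by (rule dec_comp3[of okst]) (unfold okst_def, intro cfi deci)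

lemma dec_mids [deci]: "cf l \<Longrightarrow> cf G \<Longrightarrow> cf s \<Longrightarrow> dec (\<lambda>x. mids (l x) (G x) (s x))"
  by (rule dec_comp3[of mids]) (unfold mids_def subset_eq, intro cfi deci)

lemma cf_mk [cfi]: "cf l \<Longrightarrow> cf s \<Longrightarrow> cf (\<lambda>x. mk (l x) (s x))"
  by (rule cf_comp2[of mk]) (unfold mk_def preO_def postO_def, intro cfi deci)

lemma cf_sys: "cf G \<Longrightarrow> cf k \<Longrightarrow> cf D \<Longrightarrow> cf M \<Longrightarrow> cf (\<lambda>x. sys (G x) (k x) (D x) (M x))"
  by (rule cf_comp4[of sys]) (unfold sys_def, intro cfi deci)

lemma re_closedM: "cf G \<Longrightarrow> cf k \<Longrightarrow> cf D \<Longrightarrow> cf M \<Longrightarrow> re (\<lambda>x. closedM (G x) (k x) (D x) (M x))"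
  by (rule dec_re, rule dec_comp4[of closedM]) (unfold closedM_def, intro cfi deci)

lemma cf_phi [cfi]: "cf a \<Longrightarrow> cf (\<lambda>x. phi (a x))"
  unfolding phi_def by (intro cfi)

lemma cf_psi [cfi]: "cf n \<Longrightarrow> cf (\<lambda>x. psi (n x))"
  unfolding psi_def Fin_def by (intro cfi)

lemma cf_init_letter: "cf G \<Longrightarrow> cf D \<Longrightarrow> cf a \<Longrightarrow> cf (\<lambda>x. init_letter (G x) (D x) (a x))"
  by (rule cf_comp3[of init_letter]) (unfold init_letter_def, intro cfi deci)

lemma re_consts_less: "cf n \<Longrightarrow> cf a \<Longrightarrow> re (\<lambda>x. consts_less (n x) (a x))"
proof -
  let ?P = "\<lambda>x. consts_less (fst x) (snd x)"
  let ?Q = "\<lambda>x l. (\<exists>q. snd x = Prop q \<and> l = []) \<or> (\<exists>b. snd x = Freeze b \<and> l = [(fst x, b)]) \<or>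
    (\<exists>c. \<exists>n. snd x = Constr c n \<and> n < fst x \<and> l = []) \<or>
    (\<exists>b. \<exists>c. (snd x = And b c \<or> snd x = Or b c \<or> snd x = Until b c \<or> snd x = Release b c) \<and> l = [(fst x, b), (fst x, c)])"
  have "re ?P"
  proof (rule re_wf[where m = "\<lambda>x. size (snd x)"])
    show "re (\<lambda>p. ?Q (fst p) (snd p))" by (intro rei cfi dec_re[OF dec_less])
    show "?P x \<longleftrightarrow> (\<exists>l. ?Q x l \<and> (\<forall>y\<in>set l. ?P y))" for x by (cases "snd x") auto
  qed auto
  from re_comp[OF this, of "\<lambda>x. (n x, a x)"] show "cf n \<Longrightarrow> cf a \<Longrightarrow> re (\<lambda>x. consts_less (n x) (a x))" by (simp add: cfi)
qed

lemma re_subclosed: "re subclosed"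
proof -
  have "subclosed D \<longleftrightarrow> (\<forall>a\<in>set D. (\<exists>q. a = Prop q) \<or> (\<exists>b. a = Freeze b \<and> b \<in> set D) \<or> (\<exists>c. \<exists>n. a = Constr c n) \<or>
     (\<exists>b. \<exists>c. (a = And b c \<or> a = Or b c \<or> a = Until b c \<or> a = Release b c) \<and> b \<in> set D \<and> c \<in> set D))" for D
  proof -
    have "(\<forall>b\<in>set (imm a). b \<in> set D) \<longleftrightarrow> (\<exists>q. a = Prop q) \<or> (\<exists>b. a = Freeze b \<and> b \<in> set D) \<or> (\<exists>c. \<exists>n. a = Constr c n) \<or>
     (\<exists>b. \<exists>c. (a = And b c \<or> a = Or b c \<or> a = Until b c \<or> a = Release b c) \<and> b \<in> set D \<and> c \<in> set D)" for a
      by (cases a) auto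
    then show ?thesis unfolding subclosed_def by simp
  qed
  then have "subclosed = (\<lambda>D. \<forall>a\<in>set D. (\<exists>q. a = Prop q) \<or> (\<exists>b. a = Freeze b \<and> b \<in> set D) \<or> (\<exists>c. \<exists>n. a = Constr c n) \<or>
     (\<exists>b. \<exists>c. (a = And b c \<or> a = Or b c \<or> a = Until b c \<or> a = Release b c) \<and> b \<in> set D \<and> c \<in> set D))"
    by (rule ext)
  moreover have "re \<dots>" by (intro rei cfi)
  ultimately show ?thesis by simp
qed

text \<open>\<open>G\<close>, \<open>D\<close> and \<open>M\<close> are guessed and verified instead
  of computed from the formula. Correctness does not depend on which ones are found, since
  \<open>params_Good\<close> holds for all of them.\<close>

definition params :: "nat \<Rightarrow> tptl \<Rightarrow> nat \<Rightarrow> tptl list \<Rightarrow> lrel list \<Rightarrow> bool" where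
  "params k a G D M \<longleftrightarrow> consts_less G a \<and> G \<noteq> 0 \<and> subclosed D \<and> (\<forall>b\<in>set D. consts_less (Suc G) b) \<and>
     phi a \<in> set D \<and> psi G \<in> set D \<and> closedM G k D M"

fun subs :: "tptl \<Rightarrow> tptl list" where
  "subs (Prop p) = [Prop p]"
| "subs (Freeze a) = Freeze a # subs a"
| "subs (Constr c n) = [Constr c n]"
| "subs (And a b) = And a b # subs a @ subs b"
| "subs (Or a b) = Or a b # subs a @ subs b"
| "subs (Until a b) = Until a b # subs a @ subs b"
| "subs (Release a b) = Release a b # subs a @ subs b"

lemma subs_refl: "a \<in> set (subs a)"
  by (cases a) auto

lemma subs_closed: "b \<in> set (subs a) \<Longrightarrow> c \<in> set (imm b) \<Longrightarrow> c \<in> set (subs a)"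
  by (induction a) (auto simp: subs_refl)

lemma subs_consts: "b \<in> set (subs a) \<Longrightarrow> consts_less G a \<Longrightarrow> consts_less G b"
  by (induction a) auto

lemma params_ex: "\<exists>G D M. params k a G D M"
proof -
  obtain G0 where "consts_less G0 a" using consts_less_ex by blast
  define G where "G = Suc G0"
  have G: "consts_less G a" "consts_less (Suc G) a" "G \<noteq> 0"
    using consts_less_mono[OF \<open>consts_less G0 a\<close>] by (simp_all add: G_def)
  define D where "D = subs (phi a) @ subs (psi G)"
  have "consts_less (Suc G) (phi a)" "consts_less (Suc G) (psi G)"
    using G by (simp_all add: phi_def psi_def FF_def TT_def Fin_def)
  then have "\<forall>b\<in>set D. consts_less (Suc G) b" using subs_consts unfolding D_def by auto
  moreover have "subclosed D" unfolding subclosed_def D_def using subs_closed by auto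
  moreover have "phi a \<in> set D" "psi G \<in> set D" by (simp_all add: D_def subs_refl)
  moreover have "closedM G k D (subseqs (List.product (lts G D) (lts G D)))"
    unfolding closedM_def relI_def preR_def by (simp add: subseq_filter_left)
  ultimately show ?thesis using G unfolding params_def by blast
qed

lemma params_Good:
  assumes p: "params k a G D M" and a: "constrained a"
  shows "tptl_sat k a \<longleftrightarrow> Good (sys G k D M) [init_letter G D a]"
proof -
  have D: "subclosed D" "\<And>b. b \<in> set D \<Longrightarrow> consts_less (Suc G) b" "phi a \<in> set D" "psi G \<in> set D" "closedM G k D M"
    "consts_less G a" "0 < G" using p by (auto simp: params_def)
  have "1 \<in> set [0..<Suc (cap G)]" by (simp add: cap_def del: upt_Suc)
  then have x0: "(phi a, 1) \<in> set (init_letter G D a)" "(psi G, 1) \<in> set (init_letter G D a)"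
    using D by (auto simp: init_letter_def simp del: upt_Suc)
  show ?thesis
  proof
    assume "tptl_sat k a"
    from tptl_sat_to_phi[OF this D(6,7), of "- 1 / 2"] obtain w where
      "\<forall>i. fst (w i) < k" "\<forall>i. snd (w i) < snd (w (Suc i))" "\<forall>T. \<exists>i. T < snd (w i)"
      "snd (w 0) = - 1 / 4" "0 \<le> snd (w 1)" "sat w 0 (- 1 / 2) (phi a)" "sat w 0 (- 1 / 2) (psi G)" by blast
    then show "Good (sys G k D M) [init_letter G D a]" by (intro core_complete[OF D(1-5) a, of w]) auto
  qed (rule core_sound[OF D(1-4) x0])
qed

definition sat_pred :: "nat \<times> tptl \<Rightarrow> bool" where
  "sat_pred x \<longleftrightarrow> (\<exists>G. \<exists>D. \<exists>M. params (fst x) (snd x) G D M \<and> sat_cert (sys G (fst x) D M) [init_letter G D (snd x)])"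

definition unsat_pred :: "nat \<times> tptl \<Rightarrow> bool" where
  "unsat_pred x \<longleftrightarrow> (\<exists>G. \<exists>D. \<exists>M. params (fst x) (snd x) G D M \<and> unsat_cert (sys G (fst x) D M) [init_letter G D (snd x)])"

lemma sat_pred_iff: "constrained a \<Longrightarrow> sat_pred (k, a) \<longleftrightarrow> tptl_sat k a"
  and unsat_pred_iff: "constrained a \<Longrightarrow> unsat_pred (k, a) \<longleftrightarrow> \<not> tptl_sat k a"
  unfolding sat_pred_def unsat_pred_def fst_conv snd_conv
  using params_ex[of k a] params_Good[of k a] sat_cert_sound sat_cert_complete[OF wf_sys] unsat_cert_sound[OF wf_sys]
    unsat_cert_complete[OF wf_sys] by metis+

lemma re_params: "cf k \<Longrightarrow> cf a \<Longrightarrow> cf G \<Longrightarrow> cf D \<Longrightarrow> cf M \<Longrightarrow> re (\<lambda>x. params (k x) (a x) (G x) (D x) (M x))"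
proof -
  have "re (\<lambda>x. params (fst x) (fst (snd x)) (fst (snd (snd x))) (fst (snd (snd (snd x)))) (snd (snd (snd (snd x)))))"
    unfolding params_def by (intro rei cfi re_consts_less re_closedM re_comp[OF re_subclosed])
  from re_comp[OF this, of "\<lambda>x. (k x, a x, G x, D x, M x)"]
  show "cf k \<Longrightarrow> cf a \<Longrightarrow> cf G \<Longrightarrow> cf D \<Longrightarrow> cf M \<Longrightarrow> re (\<lambda>x. params (k x) (a x) (G x) (D x) (M x))" by (simp add: cfi)
qed

lemma re_sat_pred: "re sat_pred" and re_unsat_pred: "re unsat_pred"
  unfolding sat_pred_def[abs_def] unsat_pred_def[abs_def]
  by (intro rei cfi re_params re_sat_cert re_unsat_cert cf_sys cf_init_letter)+

section \<open>A counter machine that searches for a certificate\<close>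

lemma halted_stable:
  assumes "halted M c" shows "(step M ^^ n) c = c"
proof -
  have "step M c = c" using assms by (cases c) (simp add: halted_def)
  then show ?thesis by (induction n) auto
qed

lemma halted_conf:
  assumes "halted M (conf M x m)" "m \<le> n" shows "conf M x n = conf M x m"
proof -
  have "conf M x n = (step M ^^ (n - m)) (conf M x m)"
    using assms(2) funpow_add[of "n - m" m "step M"] by (simp add: conf_def)
  then show ?thesis using halted_stable[OF assms(1)] by simp
qed

lemma halts_output:
  assumes "conf M x n = (pc, R)" "length M \<le> pc"
  shows "halts M x \<and> machine_output M x = R 0"
proof -
  have h: "halted M (conf M x n)" using assms by (simp add: halted_def)
  then have "halted M (conf M x (run_time M x))" "run_time M x \<le> n"
    unfolding run_time_def by (auto intro: LeastI Least_le)
  from halted_conf[OF this] assms h show ?thesis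
    unfolding halts_def machine_output_def by (metis snd_conv)
qed

definition reach :: "prog \<Rightarrow> config \<Rightarrow> config \<Rightarrow> bool" where
  "reach M c d \<longleftrightarrow> (\<exists>n. (step M ^^ n) c = d)"

lemma reachI: "(step M ^^ n) c = d \<Longrightarrow> reach M c d"
  unfolding reach_def by blast

lemma reach_trans [trans]: "reach M c d \<Longrightarrow> reach M d e \<Longrightarrow> reach M c e"
proof -
  assume "reach M c d" "reach M d e"
  then obtain m n where "(step M ^^ m) c = d" "(step M ^^ n) d = e" unfolding reach_def by blast
  then have "(step M ^^ (n + m)) c = e" by (simp add: funpow_add)
  then show ?thesis by (rule reachI)
qed

lemma reach_step: "step M c = d \<Longrightarrow> reach M c d"
  by (rule reachI[where n = 1]) simp

lemma reach_compile: "wf_com c \<Longrightarrow> placed M i (compile c i j) \<Longrightarrow> reach M (i, R) (j, den c R)"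
  by (rule reachI[OF compile_correct])

definition search_prog :: "com \<Rightarrow> com \<Rightarrow> com \<Rightarrow> com \<Rightarrow> prog" where
  "search_prog A B N X = (let l1 = clen A; l2 = l1 + clen B; l3 = Suc l2; l4 = l3 + clen N in
     compile A 0 l1 @ compile B l1 l2 @ [Dec 2 l4 l3] @ compile N l3 l1 @ compile X l4 (l4 + clen X))"

lemma ex_search_prog:
  assumes "UF F"
  obtains M where "\<And>x. \<exists>c. F (prod_encode (x, c)) \<noteq> 0 \<Longrightarrow>
    halts M x \<and> (\<exists>c. F (prod_encode (x, c)) \<noteq> 0 \<and> machine_output M x = (if F (prod_encode (x, c)) = 1 then 1 else 0))"
proof -
  have U: "UF (\<lambda>x. prod_encode (x, 0))" "UF (\<lambda>z. prod_encode (pf z, Suc (ps z)))" by (intro UFI)+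
  obtain PI PN PF where PI: "computes PI (\<lambda>x. prod_encode (x, 0))"
    and PN: "computes PN (\<lambda>z. prod_encode (pf z, Suc (ps z)))" and PF: "computes PF F"
    using UF_computable[OF U(1)] UF_computable[OF U(2)] UF_computable[OF assms] by blast
  \<comment> \<open>Register 0 keeps the input, 1 the pair of the input and the current candidate, 2
    receives the value of \<open>F\<close>, 3 the next pair; scratch space begins at 4. The test
    decrements register 2, so at the exit a value 0 there means that \<open>F\<close> was 1.\<close>
  define A B N X where "A = PI 0 1 4" and "B = PF 1 2 4" and "N = (PN 1 3 4 ;; clear 1 4 ;; move 3 1)"
    and "X = (clear 0 4 ;; IfDec 2 (Down 4) (Up 0))"
  define M where "M = search_prog A B N X"
  define l1 l2 l3 l4 where "l1 = clen A" and "l2 = l1 + clen B" and "l3 = Suc l2" and "l4 = l3 + clen N"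
  have wf: "wf_com A" "wf_com B" "wf_com N" "wf_com X"
    using computesD(1)[OF PI, of 0 4 1] computesD(1)[OF PN, of 1 4 3] computesD(1)[OF PF, of 1 4 2]
    by (simp_all add: A_def B_def N_def X_def)
  have "placed M 0 M" by (auto simp: placed_def)
  then have pl: "placed M 0 (compile A 0 l1)" "placed M l1 (compile B l1 l2)" "placed M l3 (compile N l3 l1)"
    "placed M l4 (compile X l4 (l4 + clen X))" and d: "l2 < length M" "M ! l2 = Dec 2 l4 l3"
    by (subst (asm) (2) M_def, simp add: search_prog_def placed_append placed_Cons Let_def l1_def l2_def l3_def l4_def)+
  have len: "length M = l4 + clen X"
    by (simp add: M_def search_prog_def Let_def l1_def l2_def l3_def l4_def)
  define S :: "nat \<Rightarrow> nat \<Rightarrow> nat \<Rightarrow> regs" where "S x z v = (\<lambda>_. 0)(0 := x, 1 := z, 2 := v)" for x z v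
  have A: "den A ((\<lambda>_. 0)(0 := x)) = S x (prod_encode (x, 0)) 0" for x
    unfolding A_def by (subst computesD(3)[OF PI]) (auto simp: S_def fun_eq_iff)
  have B: "den B (S x z 0) = S x z (F z)" for x z
    unfolding B_def by (subst computesD(3)[OF PF]) (auto simp: S_def fun_eq_iff)
  have N: "den N (S x (prod_encode (x, c)) 0) = S x (prod_encode (x, Suc c)) 0" for x c
  proof -
    have 1: "den (PN 1 3 4) (S x (prod_encode (x, c)) 0) = (S x (prod_encode (x, c)) 0)(3 := prod_encode (x, Suc c))"
      by (subst computesD(3)[OF PN]) (auto simp: S_def fun_eq_iff)
    show ?thesis unfolding N_def den.simps 1
      by (subst den_clear) (auto simp: S_def den_move fun_eq_iff)
  qed
  have X: "den X (S x z v) 0 = (if v = 0 then 1 else 0)" for x z v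
    unfolding X_def den.simps by (subst den_clear, simp, simp add: S_def)+ (simp add: S_def)
  have loop: "reach M (l1, S x (prod_encode (x, c)) 0)
      (if F (prod_encode (x, c)) = 0 then (l1, S x (prod_encode (x, Suc c)) 0)
       else (length M, den X (S x (prod_encode (x, c)) (F (prod_encode (x, c)) - 1))))" for x c
  proof -
    let ?z = "prod_encode (x, c)"
    have 1: "reach M (l1, S x ?z 0) (l2, S x ?z (F ?z))"
      using reach_compile[OF wf(2) pl(2)] unfolding B[symmetric] by blast
    show ?thesis
    proof (cases "F ?z = 0")
      case True
      note 1
      also have "reach M (l2, S x ?z (F ?z)) (l3, S x ?z 0)" using d True by (intro reach_step) (simp add: S_def)
      also have "reach M (l3, S x ?z 0) (l1, S x (prod_encode (x, Suc c)) 0)"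
        using reach_compile[OF wf(3) pl(3)] unfolding N[symmetric] by blast
      finally show ?thesis unfolding if_P[OF True] .
    next
      case False
      note 1
      also have "reach M (l2, S x ?z (F ?z)) (l4, S x ?z (F ?z - 1))" using d False
        by (intro reach_step) (simp add: S_def)
      also have "reach M (l4, S x ?z (F ?z - 1)) (length M, den X (S x ?z (F ?z - 1)))"
        using reach_compile[OF wf(4) pl(4)] unfolding len by blast
      finally show ?thesis unfolding if_not_P[OF False] .
    qed
  qed
  have "halts M x \<and> (\<exists>c. F (prod_encode (x, c)) \<noteq> 0 \<and> machine_output M x = (if F (prod_encode (x, c)) = 1 then 1 else 0))"
    if ex: "\<exists>c. F (prod_encode (x, c)) \<noteq> 0" for x
  proof -
    define c where "c = (LEAST c. F (prod_encode (x, c)) \<noteq> 0)"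
    have c: "F (prod_encode (x, c)) \<noteq> 0" "\<And>i. i < c \<Longrightarrow> F (prod_encode (x, i)) = 0"
      using LeastI_ex[OF ex] not_less_Least unfolding c_def by blast+
    let ?E = "den X (S x (prod_encode (x, c)) (F (prod_encode (x, c)) - 1))"
    have "reach M (0, (\<lambda>_. 0)(0 := x)) (l1, S x (prod_encode (x, i)) 0)" if "i \<le> c" for i
      using that
    proof (induction i)
      case 0
      show ?case using reach_compile[OF wf(1) pl(1)] unfolding A[symmetric] .
    next
      case (Suc i)
      then have "reach M (0, (\<lambda>_. 0)(0 := x)) (l1, S x (prod_encode (x, i)) 0)" by (simp only: Suc_leD)
      also have "reach M (l1, S x (prod_encode (x, i)) 0) (l1, S x (prod_encode (x, Suc i)) 0)"
        using loop[of x i] c(2)[of i] Suc.prems by simp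
      finally show ?case .
    qed
    then have "reach M (0, (\<lambda>_. 0)(0 := x)) (l1, S x (prod_encode (x, c)) 0)" by simp
    also have "reach M (l1, S x (prod_encode (x, c)) 0) (length M, ?E)" using loop[of x c] c(1) by (simp only: if_False)
    finally obtain n where "conf M x n = (length M, ?E)" unfolding reach_def conf_def by blast
    from halts_output[OF this order_refl] show ?thesis
      using c(1) by (intro conjI exI[of _ c]) (auto simp: X)
  qed
  then show thesis by (rule that)
qed

theorem decidable: "\<exists>M. decides_sat M"
proof -
  obtain P Q where PQ: "re0 P" "re0 Q" and P: "\<And>x. sat_pred x \<longleftrightarrow> P (cd x)" and Q: "\<And>x. unsat_pred x \<longleftrightarrow> Q (cd x)"
    using re_sat_pred re_unsat_pred unfolding re_def by blast
  obtain f g where f: "UF f" "P = (\<lambda>x. \<exists>c. f (prod_encode (x, c)) = 0)" and g: "UF g" "Q = (\<lambda>x. \<exists>c. g (prod_encode (x, c)) = 0)"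
    using PQ by (elim re0E)
  \<comment> \<open>1 if the candidate is a witness for satisfiability, 2 if it is only one for
    unsatisfiability, 0 if it is neither. Both cannot occur for the same constrained
    formula.\<close>
  define F where "F = (\<lambda>z. (1 - f z) + 2 * ((1 - g z) * (1 - (1 - f z))))"
  have "UF F" unfolding F_def by (intro UFI f g)
  obtain M where M: "\<And>x. \<exists>c. F (prod_encode (x, c)) \<noteq> 0 \<Longrightarrow>
    halts M x \<and> (\<exists>c. F (prod_encode (x, c)) \<noteq> 0 \<and> machine_output M x = (if F (prod_encode (x, c)) = 1 then 1 else 0))"
    by (rule ex_search_prog[OF \<open>UF F\<close>]) blast
  have F0: "F z \<noteq> 0 \<longleftrightarrow> f z = 0 \<or> g z = 0" and F1: "F z = 1 \<longleftrightarrow> f z = 0" for z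
    unfolding F_def by (cases "f z"; cases "g z"; simp)+
  have "halts M (code k a) \<and> (machine_output M (code k a) = 1 \<longleftrightarrow> tptl_sat k a)" if a: "constrained a" for k a
  proof -
    let ?x = "code k a"
    have cd: "cd (k, a) = ?x" by (simp add: cd_prod_def cd_nat_def cd_tptl_def code_def)
    have s: "tptl_sat k a \<longleftrightarrow> (\<exists>c. f (prod_encode (?x, c)) = 0)"
      and u: "\<not> tptl_sat k a \<longleftrightarrow> (\<exists>c. g (prod_encode (?x, c)) = 0)"
      using sat_pred_iff[OF a] P[of "(k, a)"] unsat_pred_iff[OF a] Q[of "(k, a)"] by (auto simp: cd f(2) g(2))
    then have "\<exists>c. F (prod_encode (?x, c)) \<noteq> 0" unfolding F0 by blast
    from M[OF this] show ?thesis using s u F0 F1 by (metis zero_neq_one)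
  qed
  then show ?thesis unfolding decides_sat_def by blast
qed

section \<open>Fast-growing functions\<close>

text \<open>The argument \<open>Suc x\<close> in place of \<open>x\<close> is dictated by the
  budget: one operation turns an application of level \<open>m + 1\<close> to \<open>x\<close> into
  \<open>x\<close> applications of level \<open>m\<close> and increments \<open>x\<close>.\<close>

fun fgh :: "nat \<Rightarrow> nat \<Rightarrow> nat" where
  "fgh 0 x = Suc x"
| "fgh (Suc m) x = (fgh m ^^ x) (Suc x)"

lemma funpow_inflate:
  fixes f :: "nat \<Rightarrow> nat"
  assumes "\<And>x. x < f x" shows "x + k \<le> (f ^^ k) x"
proof (induction k)
  case (Suc k)
  then show ?case using assms[of "(f ^^ k) x"] by simp
qed simp

lemma funpow_le_funpow:
  fixes f :: "nat \<Rightarrow> nat"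
  assumes "\<And>x. x < f x" "j \<le> k" shows "(f ^^ j) x \<le> (f ^^ k) x"
proof -
  have "(f ^^ k) x = (f ^^ (k - j)) ((f ^^ j) x)" using assms(2) funpow_add[of "k - j" j f] by simp
  then show ?thesis using funpow_inflate[OF assms(1), of "(f ^^ j) x" "k - j"] by simp
qed

lemma funpow_strict:
  fixes f :: "nat \<Rightarrow> nat"
  assumes "\<And>x y. x < y \<Longrightarrow> f x < f y" shows "x < y \<Longrightarrow> (f ^^ k) x < (f ^^ k) y"
  by (induction k) (auto intro: assms)

lemma fgh_props: "x < fgh m x \<and> (x < y \<longrightarrow> fgh m x < fgh m y)"
proof (induction m arbitrary: x y)
  case (Suc m)
  have gt: "\<And>x. x < fgh m x" and st: "\<And>x y. x < y \<Longrightarrow> fgh m x < fgh m y" using Suc by auto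
  have "x < (fgh m ^^ x) (Suc x)" using funpow_inflate[OF gt, of "Suc x" x] by simp
  moreover have "(fgh m ^^ x) (Suc x) < (fgh m ^^ y) (Suc y)" if "x < y"
    using funpow_strict[where f = "fgh m" and x = "Suc x" and y = "Suc y" and k = x, OF st] funpow_le_funpow[OF gt, of x y "Suc y"] that by simp
  ultimately show ?case by simp
qed simp

lemma fgh_gt: "x < fgh m x" and fgh_strict: "x < y \<Longrightarrow> fgh m x < fgh m y"
  using fgh_props by auto

lemma fgh_mono: "x \<le> y \<Longrightarrow> fgh m x \<le> fgh m y"
  using fgh_strict[of x y m] by (cases "x = y") auto

lemma fgh_pow_mono: "x \<le> y \<Longrightarrow> j \<le> k \<Longrightarrow> (fgh m ^^ j) x \<le> (fgh m ^^ k) y"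
proof -
  assume a: "x \<le> y" "j \<le> k"
  have "(fgh m ^^ j) x \<le> (fgh m ^^ j) y" using funpow_strict[where f = "fgh m" and x = x and y = y and k = j, OF fgh_strict] a by (cases "x = y") auto
  also have "\<dots> \<le> (fgh m ^^ k) y" using a by (intro funpow_le_funpow fgh_gt)
  finally show ?thesis .
qed

lemma fgh_add: "fgh m x + y \<le> fgh m (x + y)"
proof (induction y)
  case (Suc y)
  then show ?case using fgh_strict[of "x + y" "x + Suc y" m] by simp
qed simp

lemma fgh_level: "m \<le> m' \<Longrightarrow> fgh m x \<le> fgh m' x"
proof (induction rule: dec_induct)
  case (step n)
  have "fgh n x \<le> fgh (Suc n) x"
  proof (cases x)
    case 0
    have "fgh n 0 = 1" by (cases n) auto
    then show ?thesis using 0 by simp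
  next
    case (Suc y)
    have "(fgh n ^^ 1) x \<le> (fgh n ^^ x) (Suc x)" using Suc by (intro fgh_pow_mono) auto
    then show ?thesis by simp
  qed
  with step show ?case by simp
qed simp

text \<open>One number serves both as level and as shift of the argument, so that combining bounds
  only means enlarging it.\<close>

definition dominated :: "(nat \<Rightarrow> nat) \<Rightarrow> bool" where
  "dominated t \<longleftrightarrow> (\<exists>m. \<forall>x. t x \<le> fgh m (x + m))"

lemma dominatedI: "(\<And>x. t x \<le> fgh m (x + m)) \<Longrightarrow> dominated t"
  unfolding dominated_def by blast

lemma dominated_le: "dominated t \<Longrightarrow> (\<And>x. s x \<le> t x) \<Longrightarrow> dominated s"
  unfolding dominated_def by (meson le_trans)

lemma dominated_fgh: "dominated (\<lambda>x. fgh m (x + c))"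
proof (rule dominatedI)
  show "fgh m (x + c) \<le> fgh (max m c) (x + max m c)" for x
    by (rule le_trans[OF fgh_level fgh_mono]) auto
qed

lemma fgh_Suc_ge: "m + 2 \<le> y \<Longrightarrow> fgh m (Suc y) + m + 1 \<le> fgh (Suc m) y"
proof -
  assume "m + 2 \<le> y"
  have "fgh m (Suc y) + (m + 1) \<le> (fgh m ^^ (m + 1)) (fgh m (Suc y))" by (rule funpow_inflate[OF fgh_gt])
  also have "\<dots> = (fgh m ^^ (m + 2)) (Suc y)" by (simp add: funpow_swap1)
  also have "\<dots> \<le> (fgh m ^^ y) (Suc y)" using \<open>m + 2 \<le> y\<close> by (intro fgh_pow_mono) auto
  finally show ?thesis by simp
qed

lemma dominated_comp:
  assumes "dominated s" "dominated t" shows "dominated (\<lambda>x. s (t x))"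
proof -
  obtain a b where a: "\<And>x. s x \<le> fgh a (x + a)" and b: "\<And>x. t x \<le> fgh b (x + b)"
    using assms unfolding dominated_def by blast
  define c where "c = max a b"
  have A: "s x \<le> fgh c (x + c)" and B: "t x \<le> fgh c (x + c)" for x
  proof -
    show "s x \<le> fgh c (x + c)" by (rule le_trans[OF a le_trans[OF fgh_level[of a c] fgh_mono]]) (auto simp: c_def)
    show "t x \<le> fgh c (x + c)" by (rule le_trans[OF b le_trans[OF fgh_level[of b c] fgh_mono]]) (auto simp: c_def)
  qed
  have "s (t x) \<le> fgh (c + 2) (x + (c + 2))" for x
  proof -
    let ?y = "x + (c + 2)"
    have "s (t x) \<le> fgh c (t x + c)" by (rule A)
    also have "\<dots> \<le> fgh c (fgh c (x + c) + c)" using B[of x] by (intro fgh_mono) simp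
    also have "\<dots> \<le> fgh (Suc c) (fgh (Suc c) ?y)"
    proof -
      have "fgh c (x + c) \<le> fgh c (Suc ?y)" by (intro fgh_mono) simp
      then have "fgh c (x + c) + c \<le> fgh (Suc c) ?y" using fgh_Suc_ge[of c ?y] by linarith
      then show ?thesis by (intro le_trans[OF fgh_mono fgh_level]) auto
    qed
    also have "\<dots> = (fgh (Suc c) ^^ 2) ?y" by (simp add: numeral_2_eq_2)
    also have "\<dots> \<le> (fgh (Suc c) ^^ ?y) (Suc ?y)" by (intro fgh_pow_mono) auto
    finally show ?thesis by simp
  qed
  then show ?thesis by (rule dominatedI)
qed

lemma dominated_id: "dominated (\<lambda>x. x)" and dominated_Suc: "dominated Suc"
  by (rule dominatedI[of _ 0]; simp)+

lemma dominated_const: "dominated (\<lambda>x. c)"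
  by (rule dominated_le[OF dominated_fgh[of 0 c]]) simp

lemma dominated_double: "dominated (\<lambda>x. x + x)"
proof (rule dominatedI[of _ 1])
  have "(fgh 0 ^^ k) y = y + k" for k y by (induction k) auto
  then show "x + x \<le> fgh 1 (x + 1)" for x by (simp add: One_nat_def del: funpow.simps)
qed

lemma dominated_add:
  assumes "dominated s" "dominated t" shows "dominated (\<lambda>x. s x + t x)"
proof -
  obtain a b where a: "\<And>x. s x \<le> fgh a (x + a)" and b: "\<And>x. t x \<le> fgh b (x + b)"
    using assms unfolding dominated_def by blast
  define c where "c = max a b"
  have "dominated (\<lambda>x. fgh c (x + c) + fgh c (x + c))"
    by (rule dominated_comp[OF dominated_double dominated_fgh])
  then show ?thesis
  proof (rule dominated_le)
    fix x
    have "s x \<le> fgh c (x + c)" by (rule le_trans[OF a le_trans[OF fgh_level[of a c] fgh_mono]]) (auto simp: c_def)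
    moreover have "t x \<le> fgh c (x + c)" by (rule le_trans[OF b le_trans[OF fgh_level[of b c] fgh_mono]]) (auto simp: c_def)
    ultimately show "s x + t x \<le> fgh c (x + c) + fgh c (x + c)" by simp
  qed
qed

text \<open>Up to \<open>z\<close> iterations of a function below level \<open>m\<close>, started
  below \<open>z\<close>, stay below a single application of level \<open>m + 2\<close>. Here
  \<open>z\<close> bounds the start and the number of rounds at the same time.\<close>

lemma dominated_rec:
  assumes "dominated g"
  obtains m where "\<And>W i z. (\<And>j. j < i \<Longrightarrow> W (Suc j) \<le> g (W j)) \<Longrightarrow> W 0 \<le> z \<Longrightarrow> i \<le> z \<Longrightarrow> W i \<le> fgh m (z + m)"
proof -
  obtain m where m: "\<And>x. g x \<le> fgh m (x + m)" using assms unfolding dominated_def by blast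
  have "W i \<le> fgh (m + 2) (z + (m + 2))"
    if W: "\<And>j. j < i \<Longrightarrow> W (Suc j) \<le> g (W j)" and z: "W 0 \<le> z" "i \<le> z" for W i z
  proof -
    have "W j + m + 2 \<le> (fgh (Suc m) ^^ j) (W 0 + m + 2)" if "j \<le> i" for j
      using that
    proof (induction j)
      case (Suc j)
      have "W (Suc j) \<le> fgh m (W j + m)" using W[of j] m[of "W j"] Suc.prems by linarith
      then have "W (Suc j) + m + 2 \<le> fgh (Suc m) (W j + m + 2)"
        using fgh_Suc_ge[of m "W j + m + 2"] fgh_strict[of "W j + m" "Suc (W j + m + 2)" m] by simp
      also have "\<dots> \<le> fgh (Suc m) ((fgh (Suc m) ^^ j) (W 0 + m + 2))"
        using Suc by (intro fgh_mono) (simp del: fgh.simps)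
      finally show ?case by (simp del: fgh.simps)
    qed simp
    from this[of i] have "W i \<le> (fgh (Suc m) ^^ i) (W 0 + m + 2)" by simp
    also have "\<dots> \<le> (fgh (Suc m) ^^ (z + (m + 2))) (Suc (z + (m + 2)))" using z by (intro fgh_pow_mono) auto
    finally show ?thesis by simp
  qed
  then show thesis by (rule that)
qed

lemma primrec_dominated:
  assumes "primrec_fn n f"
  shows "\<exists>t. dominated t \<and> (\<forall>xs. length xs = n \<longrightarrow> f xs \<le> t (sum_list xs))"
  using assms
proof (induction rule: primrec_fn.induct)
  case (zero n)
  then show ?case using dominated_const[of 0] by auto
next
  case succ
  have "Suc (hd xs) \<le> Suc (sum_list xs)" if "length xs = 1" for xs :: "nat list"
    using that by (cases xs) auto
  then show ?case using dominated_Suc by blast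
next
  case (proj i n)
  then show ?case using dominated_id by (intro exI[of _ "\<lambda>x. x"]) (auto intro: member_le_sum_list)
next
  case (comp m g fs n)
  obtain t where t: "dominated t" "\<And>ys. length ys = m \<Longrightarrow> g ys \<le> t (sum_list ys)" using comp by blast
  then obtain b where b: "\<And>x. t x \<le> fgh b (x + b)" unfolding dominated_def by blast
  have "\<exists>s. dominated s \<and> (\<forall>xs. length xs = n \<longrightarrow> sum_list (map (\<lambda>f. f xs) gs) \<le> s (sum_list xs))"
    if "set gs \<subseteq> set fs" for gs
    using that
  proof (induction gs)
    case Nil
    then show ?case using dominated_const[of 0] by auto
  next
    case (Cons g gs)
    then obtain s where s: "dominated s" "\<And>xs. length xs = n \<Longrightarrow> sum_list (map (\<lambda>f. f xs) gs) \<le> s (sum_list xs)" by auto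
    obtain u where u: "dominated u" "\<And>xs. length xs = n \<Longrightarrow> g xs \<le> u (sum_list xs)" using comp.IH Cons.prems by fastforce
    show ?case by (rule exI[of _ "\<lambda>x. u x + s x"]) (auto intro: dominated_add s u add_mono)
  qed
  then obtain s where s: "dominated s" "\<And>xs. length xs = n \<Longrightarrow> sum_list (map (\<lambda>f. f xs) fs) \<le> s (sum_list xs)" by blast
  have "g (map (\<lambda>f. f xs) fs) \<le> fgh b (s (sum_list xs) + b)" if "length xs = n" for xs
  proof -
    have "g (map (\<lambda>f. f xs) fs) \<le> fgh b (sum_list (map (\<lambda>f. f xs) fs) + b)"
      using le_trans[OF t(2) b] comp.hyps by simp
    also have "\<dots> \<le> fgh b (s (sum_list xs) + b)" using s(2)[OF that] by (intro fgh_mono) simp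
    finally show ?thesis .
  qed
  moreover have "dominated (\<lambda>x. fgh b (s x + b))" by (rule dominated_comp[OF dominated_fgh s(1)])
  ultimately show ?case by (intro exI[of _ "\<lambda>x. fgh b (s x + b)"]) auto
next
  case (prec n g h)
  obtain t where t: "dominated t" "\<And>ys. length ys = n \<Longrightarrow> g ys \<le> t (sum_list ys)" using prec by blast
  then obtain b where b: "\<And>x. t x \<le> fgh b (x + b)" unfolding dominated_def by blast
  obtain u where u: "dominated u" "\<And>ys. length ys = n + 2 \<Longrightarrow> h ys \<le> u (sum_list ys)" using prec by blast
  then obtain c where c: "\<And>x. u x \<le> fgh c (x + c)" unfolding dominated_def by blast
  have "dominated (\<lambda>x. Suc (x + fgh c (x + c)))"
    by (rule dominated_comp[OF dominated_Suc dominated_add[OF dominated_id dominated_fgh]])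
  then obtain m where m: "\<And>W i z. (\<And>j. j < i \<Longrightarrow> W (Suc j) \<le> Suc (W j + fgh c (W j + c))) \<Longrightarrow>
    W 0 \<le> z \<Longrightarrow> i \<le> z \<Longrightarrow> W i \<le> fgh m (z + m)"
    by (rule dominated_rec) blast
  define s where "s = (\<lambda>x. fgh m ((x + fgh b (x + b)) + m))"
  have "dominated s" unfolding s_def
    by (rule dominated_comp[OF dominated_fgh dominated_add[OF dominated_id dominated_fgh]])
  moreover have "rec_nat (g (tl xs)) (\<lambda>y acc. h (y # acc # tl xs)) (hd xs) \<le> s (sum_list xs)" if len: "length xs = Suc n" for xs
  proof -
    obtain x ys where xs: "xs = x # ys" "length ys = n" using len by (cases xs) auto
    define r where "r = rec_nat (g ys) (\<lambda>y acc. h (y # acc # ys))"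
    \<comment> \<open>Counter, accumulator and parameters are added up to one number, which turns
      primitive recursion into an iteration.\<close>
    define W where "W = (\<lambda>j. j + r j + sum_list ys)"
    have "W x \<le> fgh m ((sum_list xs + fgh b (sum_list xs + b)) + m)"
    proof (rule m[where W = W])
      have "r 0 \<le> fgh b (sum_list xs + b)"
        using le_trans[OF t(2) le_trans[OF b fgh_mono]] xs by (simp add: r_def)
      then show "W 0 \<le> sum_list xs + fgh b (sum_list xs + b)" by (simp add: W_def xs)
      show "x \<le> sum_list xs + fgh b (sum_list xs + b)" by (simp add: xs)
      show "W (Suc j) \<le> Suc (W j + fgh c (W j + c))" for j
      proof -
        have "r (Suc j) \<le> fgh c (W j + c)"
          using le_trans[OF u(2)[of "j # r j # ys"] c] xs(2) by (simp add: r_def W_def add.assoc)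
        then show ?thesis by (simp add: W_def)
      qed
    qed
    then show ?thesis by (simp add: s_def xs W_def r_def)
  qed
  ultimately show ?case by blast
qed

text \<open>Time and final register contents are bounded together, because the contents after each
  round of a loop enter the time of the next.\<close>

lemma com_dominated:
  assumes "finite A" "used c \<subseteq> A"
  shows "\<exists>m. \<forall>R. tm c R + sum (den c R) A \<le> fgh m (sum R A + m)"
  using assms(2)
proof (induction c)
  case (Up r)
  have "sum (R(r := Suc (R r))) A = Suc (sum R A)" for R :: regs
  proof -
    have "sum (R(r := Suc (R r))) (A - {r}) = sum R (A - {r})" by (intro sum.cong) auto
    then show ?thesis using assms(1) Up sum.remove[of A r R] sum.remove[of A r "R(r := Suc (R r))"] by simp
  qed
  then have "tm (Up r) R + sum (den (Up r) R) A \<le> fgh 0 (sum R A + 1)" for R by simp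
  then show ?case using dominated_fgh[of 0 1] unfolding dominated_def by (metis le_trans)
next
  case (Down r)
  have "sum (R(r := R r - 1)) A \<le> sum R A" for R :: regs by (intro sum_mono) auto
  then have "tm (Down r) R + sum (den (Down r) R) A \<le> fgh 0 (sum R A + 0)" for R by simp
  then show ?case by blast
next
  case (Seq c d)
  then obtain a b where a: "\<And>R. tm c R + sum (den c R) A \<le> fgh a (sum R A + a)"
    and b: "\<And>R. tm d R + sum (den d R) A \<le> fgh b (sum R A + b)" by auto
  have "dominated (\<lambda>x. fgh a (x + a) + fgh b (fgh a (x + a) + b))"
    by (intro dominated_add dominated_fgh dominated_comp[OF dominated_fgh])
  then obtain m where m: "\<And>x. fgh a (x + a) + fgh b (fgh a (x + a) + b) \<le> fgh m (x + m)"
    unfolding dominated_def by blast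
  have "tm (c ;; d) R + sum (den (c ;; d) R) A \<le> fgh m (sum R A + m)" for R
  proof -
    have "fgh b (sum (den c R) A + b) \<le> fgh b (fgh a (sum R A + a) + b)"
      using a[of R] by (intro fgh_mono) simp
    then show ?thesis using a[of R] b[of "den c R"] m[of "sum R A"] by simp
  qed
  then show ?case by blast
next
  case (IfDec r c d)
  then obtain a b where a: "\<And>R. tm c R + sum (den c R) A \<le> fgh a (sum R A + a)"
    and b: "\<And>R. tm d R + sum (den d R) A \<le> fgh b (sum R A + b)" by auto
  have "dominated (\<lambda>x. Suc (fgh a (x + a) + fgh b (x + b)))"
    by (rule dominated_comp[OF dominated_Suc dominated_add[OF dominated_fgh dominated_fgh]])
  then obtain m where m: "\<And>x. Suc (fgh a (x + a) + fgh b (x + b)) \<le> fgh m (x + m)"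
    unfolding dominated_def by blast
  have "tm (IfDec r c d) R + sum (den (IfDec r c d) R) A \<le> fgh m (sum R A + m)" for R
  proof -
    have "sum (R(r := R r - 1)) A \<le> sum R A" by (intro sum_mono) auto
    then have "fgh a (sum (R(r := R r - 1)) A + a) \<le> fgh a (sum R A + a)" by (intro fgh_mono) simp
    then show ?thesis using a[of "R(r := R r - 1)"] b[of R] m[of "sum R A"] by simp
  qed
  then show ?case by blast
next
  case (For r c)
  then obtain a where a: "\<And>R. tm c R + sum (den c R) A \<le> fgh a (sum R A + a)" by auto
  have "dominated (\<lambda>x. Suc (fgh a (x + a)))" by (rule dominated_comp[OF dominated_Suc dominated_fgh])
  then obtain m where m: "\<And>W i z. (\<And>j. j < i \<Longrightarrow> W (Suc j) \<le> Suc (fgh a (W j + a))) \<Longrightarrow>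
    W 0 \<le> z \<Longrightarrow> i \<le> z \<Longrightarrow> W i \<le> fgh m (z + m)"
    by (rule dominated_rec) blast
  have r: "r \<in> A" using For.prems by simp
  have *: "tm (For r c) R + sum (den (For r c) R) A \<le> Suc (fgh m (sum R A + m))" for R
  proof -
    define S where "S = (\<lambda>i. (den c ^^ i) (R(r := 0)))"
    define W where "W = (\<lambda>i. (\<Sum>j<i. Suc (tm c (S j))) + sum (S i) A)"
    have "W (R r) \<le> fgh m (sum R A + m)"
    proof (rule m[where W = W])
      show "W (Suc j) \<le> Suc (fgh a (W j + a))" for j
      proof -
        have "tm c (S j) + sum (S (Suc j)) A \<le> fgh a (sum (S j) A + a)" using a[of "S j"] by (simp add: S_def)
        then show ?thesis using fgh_add[of a "sum (S j) A + a" "\<Sum>j<j. Suc (tm c (S j))"]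
          by (simp add: W_def ac_simps)
      qed
      show "W 0 \<le> sum R A" by (simp add: W_def S_def) (intro sum_mono, auto)
      show "R r \<le> sum R A" using r assms(1) by (simp add: member_le_sum)
    qed
    then show ?thesis by (simp add: W_def S_def)
  qed
  have "dominated (\<lambda>x. Suc (fgh m (x + m)))" by (rule dominated_comp[OF dominated_Suc dominated_fgh])
  then show ?case using * unfolding dominated_def by (meson le_trans)
qed

section \<open>Counter systems with gains in TPTL\<close>

text \<open>Control events at unit distances cut a timed word into blocks. An event \<open>Pt S S'\<close> is a token that belongs to
  the counters in \<open>S\<close> before and to those in \<open>S'\<close> after the operation of its block; it is repeated one time
  unit later. Letters 0 to 3 are the token of no counter, the token of all counters in \<open>L0\<close>, the start and the halt.\<close>

datatype 'c ltr = Ctl 'c | Pt "nat set" "nat set"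

fun Ors :: "tptl list \<Rightarrow> tptl" where
  "Ors [] = FF"
| "Ors (f # fs) = Or f (Ors fs)"

lemma sat_Ors: "sat w i v (Ors fs) \<longleftrightarrow> (\<exists>f\<in>set fs. sat w i v f)"
  by (induction fs) auto

lemma positive_FF: "positive FF"
  unfolding FF_def by (intro positive.intros)

lemma positive_Ors: "(\<And>f. f \<in> set fs \<Longrightarrow> positive f) \<Longrightarrow> positive (Ors fs)"
  by (induction fs) (auto intro: positive.intros positive_FF)

lemma sat_Fin: "sat w i v (Fin b) \<longleftrightarrow> (\<exists>j>i. sat w j v b)"
  by (auto simp: Fin_def)

lemma sat_Glob: "sat w i v (Release FF b) \<longleftrightarrow> (\<forall>j>i. sat w j v b)"
  by simp

text \<open>Fixes an exact count, which the punctual constraints alone cannot do: the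
  \<open>e\<close> tokens before clock value 1 are named one by one by nested unbounded
  eventualities. These lie outside the positive fragment and are therefore available only at the two
  ends of a run.\<close>

fun ticks :: "nat \<Rightarrow> tptl" where
  "ticks 0 = Release FF (Or (Constr CGe 1) (Prop 0))"
| "ticks (Suc e) = Until (Prop 0) (And (Constr CLt 1) (And (Prop 1) (ticks e)))"

definition ends :: "nat \<Rightarrow> tptl" where
  "ends e = And (Freeze (ticks e)) (Until TT (And (Prop 3) (Freeze (ticks e))))"

lemma constrained_ends: "constrained (ends e)"
proof -
  have "constrained (ticks e)"
    by (induction e) (auto intro!: constrained.intros(1-6) intro: constrained.intros(7) positive.intros positive_FF)
  then show ?thesis unfolding ends_def
    by (intro constrained.intros(1-6)) (auto intro: constrained.intros(7) positive_TT)
qed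

lemma sat_ticks:
  assumes t: "\<And>i j. i < j \<Longrightarrow> snd (w i) < snd (w j)" and fin: "\<And>T. finite {i. snd (w i) < T}"
  shows "sat w i v (ticks e) \<longleftrightarrow> (\<forall>j>i. snd (w j) - v < 1 \<longrightarrow> fst (w j) = 0 \<or> fst (w j) = 1) \<and>
    card {j. i < j \<and> snd (w j) - v < 1 \<and> fst (w j) = 1} = e"
proof (induction e arbitrary: i)
  have finb: "finite {j. i < j \<and> snd (w j) - v < 1 \<and> fst (w j) = 1}" for i
    by (rule finite_subset[OF _ fin[of "1 + v"]]) auto
  {
    case 0
    show ?case unfolding ticks.simps sat_Glob using finb[of i] by (auto simp: not_less) force+
  next
    case (Suc e)
    let ?B = "\<lambda>i. {j. i < j \<and> snd (w j) - v < 1 \<and> fst (w j) = 1}"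
    have mono: "snd (w j) - v < 1" if "j \<le> m" "snd (w m) - v < 1" for j m
      using t[of j m] that by (cases "j = m") auto
    show ?case
    proof
      assume "sat w i v (ticks (Suc e))"
      then obtain j where j: "j > i" "snd (w j) - v < 1" "fst (w j) = 1" "sat w j v (ticks e)"
        and bet: "\<And>k. i < k \<Longrightarrow> k < j \<Longrightarrow> fst (w k) = 0" by auto
      have "m \<in> ?B i \<longleftrightarrow> m \<in> insert j (?B j)" for m
        using j(1-3) bet[of m] by (cases m j rule: linorder_cases) auto
      then have "?B i = insert j (?B j)" by blast
      then have "card (?B i) = Suc e" using j(4) Suc.IH[of j] finb[of j] by simp
      moreover have "fst (w m) = 0 \<or> fst (w m) = 1" if "m > i" "snd (w m) - v < 1" for m
        using that bet[of m] j Suc.IH[of j] by (cases m j rule: linorder_cases) auto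
      ultimately show "(\<forall>j>i. snd (w j) - v < 1 \<longrightarrow> fst (w j) = 0 \<or> fst (w j) = 1) \<and> card (?B i) = Suc e" by blast
    next
      assume a: "(\<forall>j>i. snd (w j) - v < 1 \<longrightarrow> fst (w j) = 0 \<or> fst (w j) = 1) \<and> card (?B i) = Suc e"
      define j where "j = (LEAST j. j \<in> ?B i)"
      from a have "?B i \<noteq> {}" by (metis card.empty nat.distinct(1))
      then have jB: "j \<in> ?B i" unfolding j_def by (metis (mono_tags, lifting) LeastI_ex ex_in_conv)
      have least: "k \<notin> ?B i" if "k < j" for k using that unfolding j_def by (rule not_less_Least)
      have bet: "fst (w k) = 0" if "i < k" "k < j" for k
      proof -
        have "snd (w k) - v < 1" using mono[of k j] jB that by simp
        then show ?thesis using a least[of k] that by auto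
      qed
      have "m \<in> ?B i \<longleftrightarrow> m \<in> insert j (?B j)" for m
        using jB bet[of m] by (cases m j rule: linorder_cases) auto
      then have "?B i = insert j (?B j)" by blast
      then have "card (?B j) = e" using a finb[of j] by simp
      then have "sat w j v (ticks e)" using Suc.IH[of j] a jB by auto
      then show "sat w i v (ticks (Suc e))" using jB bet by auto
    qed
  }
qed

text \<open>A control letter is an operation with its test. The disjointness assumptions keep an
  operation from both adding and removing tokens of one counter. The final letter \<open>hl\<close>
  repeats itself without effect, since words are infinite.\<close>

locale gainy =
  fixes Q :: "'c set" and V :: nat and Zs :: "'c \<Rightarrow> nat set" and dc ic cp rs :: "'c \<Rightarrow> nat option"
    and nx :: "'c \<Rightarrow> 'c \<Rightarrow> bool" and st hl :: 'c and L0 :: "nat set"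
  assumes finite_Q: "finite Q" and stQ: "st \<in> Q" and hlQ: "hl \<in> Q" and st_hl: "st \<noteq> hl"
    and nxQ: "nx E E' \<Longrightarrow> E' \<in> Q" and nx_hl: "nx hl hl"
    and L0: "L0 \<noteq> {}" "L0 \<subseteq> {..<V}" and V0: "0 < V"
    and icV: "E \<in> Q \<Longrightarrow> ic E = Some c \<Longrightarrow> c < V" and ic_dc: "ic E = Some c \<Longrightarrow> dc E \<noteq> Some c" and ic_rs: "ic E = Some c \<Longrightarrow> rs E \<noteq> Some c"
    and dc_rs: "dc E = Some c \<Longrightarrow> rs E \<noteq> Some c"
    and cpV: "E \<in> Q \<Longrightarrow> cp E = Some c \<Longrightarrow> c < V"
    and hl_id: "Zs hl = {}" "dc hl = None" "ic hl = None" "cp hl = None" "rs hl = None"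
begin

text \<open>The inequalities leave room for tokens that are inserted into the next block. The operations are: test \<open>Zs\<close>
  for zero, decrement \<open>dc\<close>, increment \<open>ic\<close>, copy counter 0 to \<open>cp\<close>, and reset \<open>rs\<close> provided that it does not exceed counter 0.\<close>

definition gstep :: "'c \<Rightarrow> (nat \<Rightarrow> nat) \<Rightarrow> (nat \<Rightarrow> nat) \<Rightarrow> bool" where
  "gstep E R R' \<longleftrightarrow> (\<forall>z\<in>Zs E. R z = 0) \<and>
     (\<forall>r. rs E \<noteq> Some r \<longrightarrow> R r \<le> R' r + (if dc E = Some r then 1 else 0)) \<and>
     (\<forall>c. ic E = Some c \<longrightarrow> R c < R' c) \<and>
     (\<forall>c. cp E = Some c \<longrightarrow> R 0 \<le> R' c) \<and> (\<forall>c. rs E = Some c \<longrightarrow> R c \<le> R' 0)"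

text \<open>A token written by \<open>al\<close> may lose its label of a decremented counter, one
  written by \<open>nd\<close> may not. The separation lets a formula grant this loss to a single
  token of a block.\<close>

fun al :: "'c \<Rightarrow> 'c ltr \<Rightarrow> bool" where
  "al E (Pt S S') \<longleftrightarrow> S \<inter> Zs E = {} \<and> (\<forall>r\<in>S. r \<in> S' \<or> dc E = Some r \<or> rs E = Some r) \<and>
     (\<forall>c. cp E = Some c \<longrightarrow> 0 \<in> S \<longrightarrow> c \<in> S') \<and> (\<forall>c. rs E = Some c \<longrightarrow> c \<in> S \<longrightarrow> 0 \<in> S')"
| "al E (Ctl _) \<longleftrightarrow> False"

fun nd :: "'c \<Rightarrow> 'c ltr \<Rightarrow> bool" where
  "nd E (Pt S S') \<longleftrightarrow> al E (Pt S S') \<and> (\<forall>r. dc E = Some r \<longrightarrow> r \<in> S \<longrightarrow> r \<in> S')"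
| "nd E (Ctl _) \<longleftrightarrow> False"

definition isinc :: "nat \<Rightarrow> 'c ltr \<Rightarrow> bool" where
  "isinc c l \<longleftrightarrow> (\<exists>S S'. l = Pt S S' \<and> c \<notin> S \<and> c \<in> S')"

definition succs :: "'c ltr \<Rightarrow> 'c ltr \<Rightarrow> bool" where
  "succs l l' \<longleftrightarrow> (case l of Ctl E \<Rightarrow> (\<exists>E'. l' = Ctl E' \<and> nx E E') | Pt S S' \<Rightarrow> (\<exists>S''. l' = Pt S' S''))"

definition lset :: "'c ltr set" where
  "lset = Ctl ` Q \<union> (\<lambda>(S, S'). Pt S S') ` (Pow {..<V} \<times> Pow {..<V})"

definition ll :: "'c ltr list" where
  "ll = (SOME l. distinct l \<and> set l = lset \<and> take 4 l = [Pt {} {}, Pt L0 L0, Ctl st, Ctl hl])"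

lemma ll: "distinct ll" "set ll = lset" "4 \<le> length ll" "ll ! 0 = Pt {} {}" "ll ! 1 = Pt L0 L0" "ll ! 2 = Ctl st" "ll ! 3 = Ctl hl"
proof -
  let ?h = "[Pt {} {}, Pt L0 L0, Ctl st, Ctl hl]"
  have "finite (lset - set ?h)" unfolding lset_def using finite_Q by simp
  then obtain l where l: "distinct l" "set l = lset - set ?h" using finite_distinct_list by metis
  have "set ?h \<subseteq> lset" using stQ hlQ L0(2) by (auto simp: lset_def image_iff)
  then have "distinct (?h @ l) \<and> set (?h @ l) = lset \<and> take 4 (?h @ l) = ?h"
    using l st_hl L0(1) by auto
  from someI[of "\<lambda>l. distinct l \<and> set l = lset \<and> take 4 l = ?h", OF this]
  have *: "distinct ll" "set ll = lset" "take 4 ll = ?h" unfolding ll_def by auto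
  from this(1,2) show "distinct ll" "set ll = lset" by auto
  have "length (take 4 ll) = 4" using *(3) by simp
  then show len: "4 \<le> length ll" by simp
  have "ll ! i = ?h ! i" if "i < 4" for i using nth_take[OF that, of ll] *(3) by simp
  from this[of 0] this[of 1] this[of 2] this[of 3]
  show "ll ! 0 = Pt {} {}" "ll ! 1 = Pt L0 L0" "ll ! 2 = Ctl st" "ll ! 3 = Ctl hl" by auto
qed

definition Ps :: "('c ltr \<Rightarrow> bool) \<Rightarrow> tptl" where
  "Ps P = Ors (map Prop (filter (\<lambda>p. P (ll ! p)) [0..<length ll]))"

lemma sat_Ps: "sat w i v (Ps P) \<longleftrightarrow> fst (w i) < length ll \<and> P (ll ! fst (w i))"
  by (auto simp: Ps_def sat_Ors)

lemma positive_Ps: "positive (Ps P)"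
  unfolding Ps_def by (rule positive_Ors) (auto intro: positive.intros)

text \<open>At most one loss per block, said without negation: a token that is not \<open>nd\<close>
  is tolerated if all later ones within the same unit are. The inner \<open>Release\<close> uses the
  clock frozen at the control event.\<close>

definition blockF :: "'c \<Rightarrow> tptl" where
  "blockF E = Release FF (Or (Constr CGe 1) (Or (Ps (nd E)) (And (Ps (al E)) (Release FF (Or (Constr CGe 1) (Ps (nd E)))))))"

text \<open>The conjunct \<open>CLe 1\<close> gives the eventuality the bounded form of positive
  formulas; the strict bound keeps the new token inside the block.\<close>

definition incF :: "'c \<Rightarrow> tptl" where
  "incF E = (case ic E of None \<Rightarrow> TT | Some c \<Rightarrow> Fin (And (Constr CLe 1) (And (Constr CLt 1) (Ps (isinc c)))))"

definition body :: "'c ltr \<Rightarrow> tptl" where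
  "body l = And (Fin (And (Constr CLe 1) (And (Constr CEq 1) (Ps (succs l)))))
     (case l of Ctl E \<Rightarrow> And (blockF E) (incF E) | Pt S S' \<Rightarrow> TT)"

definition ruleF :: tptl where
  "ruleF = Ors (map (\<lambda>p. And (Prop p) (Freeze (body (ll ! p)))) [0..<length ll])"

definition machF :: tptl where
  "machF = And (Prop 2) (And ruleF (Release FF ruleF))"

lemma positive_machF: "positive machF"
proof -
  have "positive (body l)" for l
    by (auto simp: body_def blockF_def incF_def split: ltr.split option.split
        intro!: positive.intros positive_Ps positive_FF positive_TT)
  then show ?thesis unfolding machF_def ruleF_def
    by (auto intro!: positive.intros positive_Ors positive_FF)
qed

definition letter :: "tword \<Rightarrow> nat \<Rightarrow> 'c ltr" where "letter w i = ll ! fst (w i)"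

definition obeys :: "tword \<Rightarrow> nat \<Rightarrow> bool" where
  "obeys w i \<longleftrightarrow> fst (w i) < length ll \<and>
     (\<exists>j>i. snd (w j) - snd (w i) = 1 \<and> fst (w j) < length ll \<and> succs (letter w i) (letter w j)) \<and>
     (\<forall>E. letter w i = Ctl E \<longrightarrow>
        (\<forall>j>i. snd (w j) - snd (w i) < 1 \<longrightarrow> fst (w j) < length ll \<and> (nd E (letter w j) \<or>
          (al E (letter w j) \<and> (\<forall>j'>j. snd (w j') - snd (w i) < 1 \<longrightarrow> fst (w j') < length ll \<and> nd E (letter w j'))))) \<and>
        (\<forall>c. ic E = Some c \<longrightarrow> (\<exists>j>i. snd (w j) - snd (w i) < 1 \<and> fst (w j) < length ll \<and> isinc c (letter w j))))"

lemma sat_ruleF: "sat w i v ruleF \<longleftrightarrow> obeys w i"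
proof -
  have 1: "sat w i v ruleF \<longleftrightarrow> fst (w i) < length ll \<and> sat w i (snd (w i)) (body (letter w i))"
    by (auto simp: ruleF_def sat_Ors letter_def)
  have 2: "sat w i (snd (w i)) (body (letter w i)) \<longleftrightarrow>
     (\<exists>j>i. snd (w j) - snd (w i) = 1 \<and> fst (w j) < length ll \<and> succs (letter w i) (letter w j)) \<and>
     (\<forall>E. letter w i = Ctl E \<longrightarrow> sat w i (snd (w i)) (blockF E) \<and> sat w i (snd (w i)) (incF E))"
    unfolding body_def by (auto simp: sat_Fin sat_Ps letter_def[symmetric] split: ltr.split)
  have le: "real 1 \<le> x \<longleftrightarrow> \<not> x < 1" for x :: real by auto
  have 3: "sat w i (snd (w i)) (blockF E) \<longleftrightarrow> (\<forall>j>i. snd (w j) - snd (w i) < 1 \<longrightarrow> fst (w j) < length ll \<and> (nd E (letter w j) \<or>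
          (al E (letter w j) \<and> (\<forall>j'>j. snd (w j') - snd (w i) < 1 \<longrightarrow> fst (w j') < length ll \<and> nd E (letter w j')))))" for E
    unfolding blockF_def sat_Glob sat.simps(3-5) sat_Ps cmp_holds.simps le letter_def by blast
  have 4: "sat w i (snd (w i)) (incF E) \<longleftrightarrow>
     (\<forall>c. ic E = Some c \<longrightarrow> (\<exists>j>i. snd (w j) - snd (w i) < 1 \<and> fst (w j) < length ll \<and> isinc c (letter w j)))" for E
    unfolding incF_def by (auto simp: sat_Fin sat_Ps letter_def[symmetric] split: option.split)
  show ?thesis unfolding 1 2 3 4 obeys_def by blast
qed

lemma sat_machF: "sat w 0 v machF \<longleftrightarrow> fst (w 0) = 2 \<and> (\<forall>i. obeys w i)"
proof -
  have "(obeys w 0 \<and> (\<forall>i>0. obeys w i)) \<longleftrightarrow> (\<forall>i. obeys w i)" by (metis neq0_conv)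
  then show ?thesis unfolding machF_def sat.simps(1,4) sat_Glob sat_ruleF by blast
qed

definition ini :: "nat \<Rightarrow> nat \<Rightarrow> nat" where "ini e r = (if r \<in> L0 then e else 0)"

fun lold :: "'c ltr \<Rightarrow> nat set" where "lold (Pt S S') = S" | "lold (Ctl _) = {}"
fun lnew :: "'c ltr \<Rightarrow> nat set" where "lnew (Pt S S') = S'" | "lnew (Ctl _) = {}"

text \<open>A counter is the number of tokens carrying its label. Inside a run nothing bounds the
  tokens of a block from above, hence the inequalities of \<open>gstep\<close>; at both ends
  \<open>ends e\<close> fixes the counts.\<close>

lemma gainy_sound:
  assumes w: "timed_word k w" and s: "sat w 0 0 (And machF (ends e))"
  shows "\<exists>J E R. E 0 = st \<and> E J = hl \<and> R 0 = ini e \<and> R J = ini e \<and>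
    (\<forall>j<J. gstep (E j) (R j) (R (Suc j)) \<and> nx (E j) (E (Suc j)))"
proof -
  let ?t = "\<lambda>i. snd (w i)"
  have smono: "strict_mono ?t" using w by (intro strict_mono_Suc_iff[THEN iffD2]) (auto simp: timed_word_def)
  have lt: "?t i < ?t j \<longleftrightarrow> i < j" for i j using smono by (rule strict_mono_less)
  have inj: "?t i = ?t j \<longleftrightarrow> i = j" for i j using smono by (rule strict_mono_eq)
  have fin: "finite {i. ?t i < T}" for T
  proof -
    obtain i where "T < ?t i" using w unfolding timed_word_def by blast
    then have "{j. ?t j < T} \<subseteq> {..<i}" using lt less_trans by fastforce
    then show ?thesis by (rule finite_subset) simp
  qed
  have w0: "fst (w 0) = 2" and ob: "obeys w i" for i using s by (auto simp: sat_machF)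
  obtain h where h: "fst (w h) = 3" "sat w h (?t h) (ticks e)" using s by (auto simp: ends_def)
  have c0: "sat w 0 (?t 0) (ticks e)" using s by (simp add: ends_def)
  have len: "fst (w i) < length ll" for i using ob[of i] by (simp add: obeys_def)
  have letin: "letter w i \<in> lset" for i using len[of i] ll(2) unfolding letter_def by (metis nth_mem)
  have succ: "\<exists>j>i. ?t j = ?t i + 1 \<and> succs (letter w i) (letter w j)" for i
    using ob[of i] unfolding obeys_def by (metis add.commute diff_add_cancel)
  have "\<exists>i E. ?t i = ?t 0 + real j \<and> letter w i = Ctl E" for j
  proof (induction j)
    case 0
    show ?case using w0 ll(6) by (intro exI[of _ 0]) (auto simp: letter_def)
  next
    case (Suc j)
    then obtain i E where i: "?t i = ?t 0 + real j" "letter w i = Ctl E" by blast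
    obtain i' where "?t i' = ?t i + 1" "succs (letter w i) (letter w i')" using succ by blast
    then show ?case using i by (intro exI[of _ i']) (auto simp: succs_def)
  qed
  then obtain c E where c: "\<And>j. ?t (c j) = ?t 0 + real j" and cE: "\<And>j. letter w (c j) = Ctl (E j)" by metis
  have c0': "c 0 = 0" using c[of 0] inj by simp
  have E0: "E 0 = st" using cE[of 0] w0 ll(6) by (simp add: letter_def c0')
  have nxE: "nx (E j) (E (Suc j))" for j
  proof -
    obtain i where i: "?t i = ?t (c j) + 1" "succs (letter w (c j)) (letter w i)" using succ by blast
    then have "i = c (Suc j)" using c[of j] c[of "Suc j"] inj[of i "c (Suc j)"] by simp
    then show ?thesis using i(2) cE by (auto simp: succs_def)
  qed
  define B where "B j = {i. c j < i \<and> ?t i < ?t (c j) + 1}" for j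
  have finB: "finite (B j)" for j unfolding B_def by (rule finite_subset[OF _ fin[of "?t (c j) + 1"]]) auto
  have blk: "nd (E j) (letter w i) \<or> (al (E j) (letter w i) \<and> (\<forall>i'\<in>B j. i < i' \<longrightarrow> nd (E j) (letter w i')))"
    if "i \<in> B j" for i j
    using ob[of "c j"] that cE[of j] unfolding obeys_def B_def by (auto simp: algebra_simps)
  have ndal: "nd (E j) l \<Longrightarrow> al (E j) l" for j l by (cases l) auto
  have pt: "\<exists>S S'. letter w i = Pt S S' \<and> S \<subseteq> {..<V} \<and> S' \<subseteq> {..<V}" if "i \<in> B j" for i j
    using blk[OF that] letin[of i] by (cases "letter w i") (auto simp: lset_def)
  define R N where "R j r = card {i \<in> B j. r \<in> lold (letter w i)}"
    and "N j r = card {i \<in> B j. r \<in> lnew (letter w i)}" for j r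
  \<comment> \<open>Moving each token to its successor one unit later is injective; tokens of the
    next block outside the image are the spontaneous gains.\<close>
  have RN: "N j r \<le> R (Suc j) r" for j r
  proof -
    obtain f where f: "\<And>i. ?t (f i) = ?t i + 1 \<and> succs (letter w i) (letter w (f i))" using succ by metis
    have "inj f" using f inj by (metis (no_types, lifting) add_right_cancel injI)
    moreover have "f ` {i \<in> B j. r \<in> lnew (letter w i)} \<subseteq> {i \<in> B (Suc j). r \<in> lold (letter w i)}"
    proof safe
      fix i assume i: "i \<in> B j" "r \<in> lnew (letter w i)"
      obtain S S' where S: "letter w i = Pt S S'" using pt[OF i(1)] by blast
      show "r \<in> lold (letter w (f i))" using f[of i] i(2) S by (auto simp: succs_def)
      have "?t (c (Suc j)) < ?t (f i)" using f[of i] i(1) c[of j] c[of "Suc j"] lt[of "c j" i] by (simp add: B_def)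
      then have "c (Suc j) < f i" using lt by blast
      then show "f i \<in> B (Suc j)" using f[of i] i(1) c[of j] c[of "Suc j"] by (simp add: B_def)
    qed
    ultimately show ?thesis unfolding R_def N_def using finB[of "Suc j"]
      by (intro card_inj_on_le[of f]) (auto intro: inj_on_subset)
  qed
  have g: "gstep (E j) (R j) (R (Suc j))" for j
    unfolding gstep_def
  proof (intro conjI allI ballI impI)
    have alB: "al (E j) (letter w i)" if "i \<in> B j" for i using blk[OF that] ndal by blast
    have fs: "finite {i \<in> B j. P i}" for P using finB by simp
    show "R j z = 0" if "z \<in> Zs (E j)" for z
    proof -
      have "z \<notin> lold (letter w i)" if i: "i \<in> B j" for i
        using alB[OF i] \<open>z \<in> Zs (E j)\<close> pt[OF i] by auto
      then have "{i \<in> B j. z \<in> lold (letter w i)} = {}" by blast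
      then show ?thesis unfolding R_def by (simp only: card.empty)
    qed
    show "R j r \<le> R (Suc j) r + (if dc (E j) = Some r then 1 else 0)" if r: "rs (E j) \<noteq> Some r" for r
    proof -
      let ?D = "{i \<in> B j. r \<in> lold (letter w i) \<and> r \<notin> lnew (letter w i)}"
      have D: "dc (E j) = Some r \<and> \<not> nd (E j) (letter w i)" if d: "i \<in> ?D" for i
      proof -
        obtain S S' where S: "letter w i = Pt S S'" using d pt[of i j] by blast
        then have "dc (E j) = Some r" using d alB[of i] r by auto
        then show ?thesis using S d by auto
      qed
      have "card ?D \<le> (if dc (E j) = Some r then 1 else 0)"
      proof (cases "?D = {}")
        case False
        have "i = i'" if "i \<in> ?D" "i' \<in> ?D" for i i'
        proof (rule ccontr)
          assume "i \<noteq> i'"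
          then show False using blk[of i j] blk[of i' j] D[of i] D[of i'] that by (cases "i < i'") auto
        qed
        then have "card ?D \<le> 1" using card_le_Suc0_iff_eq[OF fs[of "\<lambda>i. r \<in> lold (letter w i) \<and> r \<notin> lnew (letter w i)"]] by auto
        then show ?thesis using D False by auto
      next
        case True
        show ?thesis unfolding True by simp
      qed
      moreover have "R j r \<le> card ({i \<in> B j. r \<in> lnew (letter w i)} \<union> ?D)"
        unfolding R_def using finB[of j] by (intro card_mono) auto
      moreover have "card ({i \<in> B j. r \<in> lnew (letter w i)} \<union> ?D) \<le> N j r + card ?D" unfolding N_def by (rule card_Un_le)
      ultimately show ?thesis using RN[of j r] by linarith
    qed
    show "R j r < R (Suc j) r" if r: "ic (E j) = Some r" for r
    proof -
      obtain i where i: "i \<in> B j" "isinc r (letter w i)"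
        using ob[of "c j"] cE[of j] r unfolding obeys_def B_def by (auto simp: algebra_simps)
      have keep: "i' \<in> B j \<Longrightarrow> r \<in> lold (letter w i') \<Longrightarrow> r \<in> lnew (letter w i')" for i'
        using alB[of i'] pt[of i' j] ic_dc[OF r] ic_rs[OF r] by auto
      have "{i \<in> B j. r \<in> lold (letter w i)} \<subset> {i \<in> B j. r \<in> lnew (letter w i)}"
      proof (rule psubsetI)
        show "{i \<in> B j. r \<in> lold (letter w i)} \<subseteq> {i \<in> B j. r \<in> lnew (letter w i)}" using keep by blast
        have "i \<in> {i \<in> B j. r \<in> lnew (letter w i)} - {i \<in> B j. r \<in> lold (letter w i)}" using i by (auto simp: isinc_def)
        then show "{i \<in> B j. r \<in> lold (letter w i)} \<noteq> {i \<in> B j. r \<in> lnew (letter w i)}" by blast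
      qed
      then have "R j r < N j r" unfolding R_def N_def by (intro psubset_card_mono fs)
      then show ?thesis using RN[of j r] by simp
    qed
    show "R j 0 \<le> R (Suc j) r" if r: "cp (E j) = Some r" for r
    proof -
      have "R j 0 \<le> N j r" unfolding R_def N_def
        using alB pt r by (intro card_mono fs) fastforce
      then show ?thesis using RN[of j r] by simp
    qed
    show "R j r \<le> R (Suc j) 0" if r: "rs (E j) = Some r" for r
    proof -
      have "R j r \<le> N j 0" unfolding R_def N_def
        using alB pt r by (intro card_mono fs) fastforce
      then show ?thesis using RN[of j 0] by simp
    qed
  qed
  have Rini: "R j = ini e" if "sat w (c j) (?t (c j)) (ticks e)" for j
  proof
    fix r
    have "(\<forall>i>c j. ?t i - ?t (c j) < 1 \<longrightarrow> fst (w i) = 0 \<or> fst (w i) = 1) \<and>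
      card {i. c j < i \<and> ?t i - ?t (c j) < 1 \<and> fst (w i) = 1} = e"
      using that sat_ticks[of w "c j" "?t (c j)" e] lt fin by blast
    then have a: "\<And>i. i \<in> B j \<Longrightarrow> fst (w i) = 0 \<or> fst (w i) = 1" and b: "card {i \<in> B j. fst (w i) = 1} = e"
      by (auto simp: B_def algebra_simps)
    have "lold (letter w i) = (if fst (w i) = 1 then L0 else {})" if "i \<in> B j" for i
      using a[OF that] ll(4,5) by (auto simp: letter_def)
    then have "{i \<in> B j. r \<in> lold (letter w i)} = (if r \<in> L0 then {i \<in> B j. fst (w i) = 1} else {})" by (auto split: if_splits)
    then show "R j r = ini e r" using b by (simp add: R_def ini_def)
  qed
  \<comment> \<open>The halting event carries a control letter, whereas the events strictly inside a
    block are tokens, so it lies on the grid of control events.\<close>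
  obtain J where J: "c J = h"
  proof -
    define J where "J = nat \<lfloor>?t h - ?t 0\<rfloor>"
    have "?t 0 \<le> ?t h" using lt[of h 0] by simp
    then have "real J = of_int \<lfloor>?t h - ?t 0\<rfloor>" by (simp add: J_def)
    then have b: "?t (c J) \<le> ?t h" "?t h < ?t (c J) + 1" unfolding c using floor_correct[of "?t h - ?t 0"] by linarith+
    have "letter w h = Ctl hl" using h(1) ll(7) by (simp add: letter_def)
    then have "h \<notin> B J" using pt[of h J] by auto
    then have "\<not> ?t (c J) < ?t h" using b lt[of "c J" h] by (simp add: B_def)
    then have "c J = h" using b inj[of "c J" h] by simp
    then show thesis by (rule that)
  qed
  have "E J = hl" using cE[of J] h(1) ll(7) by (simp add: J letter_def)
  moreover have "R 0 = ini e" "R J = ini e" using Rini[of 0] Rini[of J] c0 h(2) by (simp_all add: c0' J)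
  ultimately show ?thesis using E0 g nxE by blast
qed

text \<open>The tokens counted by \<open>ends e\<close> carry the labels before and after the block,
  both equal to \<open>L0\<close>. This is why the counters have to keep their values over the first
  step; after the halt they do so by the idle letter.\<close>

lemma gainy_complete:
  assumes E: "E 0 = st" "E J = hl" and R: "R 0 = ini e" "R 1 = ini e" "R J = ini e"
    and run: "\<And>j. j < J \<Longrightarrow> gstep (E j) (R j) (R (Suc j)) \<and> nx (E j) (E (Suc j))" and k: "length ll \<le> k"
  shows "tptl_sat k (And machF (ends e))"
proof -
  have J: "1 \<le> J" using E st_hl by (cases J) auto
  \<comment> \<open>Beyond \<open>J\<close> the final letter and the final counters are repeated for
    ever.\<close>
  define E' R' where "E' j = E (min j J)" and "R' j = R (min j J)" for j
  have id: "gstep hl X X" for X by (simp add: gstep_def hl_id)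
  have g: "gstep (E' j) (R' j) (R' (Suc j))" and n: "nx (E' j) (E' (Suc j))" for j
    using run[of j] id nx_hl E(2) by (cases "j < J"; simp add: E'_def R'_def min_def)+
  have R': "R' 0 = ini e" "R' (Suc 0) = ini e" "R' J = ini e" "R' (Suc J) = ini e"
    using R J by (auto simp: R'_def min_def)
  have EQ: "E' j \<in> Q" for j
  proof (cases j)
    case 0
    then show ?thesis using E(1) stQ by (simp add: E'_def)
  qed (use nxQ[OF n] in auto)
  define P where "P = (\<Sum>j\<le>J. \<Sum>r<V. R j r)"
  have P: "R' j r \<le> P" if "r < V" for j r
  proof -
    have "R' j r \<le> (\<Sum>r<V. R' j r)" using that by (intro member_le_sum) auto
    also have "\<dots> \<le> P" unfolding P_def R'_def by (rule member_le_sum[where f = "\<lambda>j. \<Sum>r<V. R j r"]) auto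
    finally show ?thesis .
  qed
  obtain r0 where "r0 \<in> L0" using L0(1) by blast
  then have eP: "e \<le> P" using P[of r0 0] R' L0(2) by (auto simp: ini_def)
  \<comment> \<open>A block has \<open>D\<close> equidistant events: its control event and
    \<open>P\<close> slots, enough for all counter values of the run. Slot \<open>x\<close> carries
    the label \<open>r\<close> iff \<open>x < R' j r\<close>, so comparing counters means comparing
    initial segments of slots.\<close>
  define D where "D = Suc P"
  have D0: "0 < D" by (simp add: D_def)
  define S where "S j x = {r. r < V \<and> x < R' j r}" for j x
  define lt where "lt i = (if i mod D = 0 then Ctl (E' (i div D)) else
    Pt (S (i div D) (i mod D - 1)) (S (Suc (i div D)) (i mod D - 1)))" for i
  have lt0: "lt (q * D) = Ctl (E' q)" for q using D0 by (simp add: lt_def)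
  have ltS: "lt (q * D + Suc x) = Pt (S q x) (S (Suc q) x)" if "Suc x < D" for q x
  proof -
    have "(q * D + s) div D = q" "(q * D + s) mod D = s" if "s < D" for s using that by simp_all
    from this[OF that] show ?thesis unfolding lt_def by simp
  qed
  have ltin: "lt i \<in> lset" for i using EQ by (auto simp: lt_def lset_def S_def)
  have "\<forall>l\<in>lset. \<exists>i. i < length ll \<and> ll ! i = l" unfolding ll(2)[symmetric] by (simp add: in_set_conv_nth)
  from bchoice[OF this] obtain ix where ix: "\<And>l. l \<in> lset \<Longrightarrow> ix l < length ll \<and> ll ! ix l = l" by blast
  define w where "w i = (ix (lt i), real i / real D)" for i
  have len: "fst (w i) < length ll" and lw: "letter w i = lt i" for i
    using ix[OF ltin[of i]] by (auto simp: w_def letter_def)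
  have fstw: "fst (w i) = p \<longleftrightarrow> lt i = ll ! p" if "p < 4" for i p
    using lw[of i] len[of i] ll(1,3) that unfolding letter_def by (metis less_le_trans nth_eq_iff_index_eq)
  have t1: "snd (w j) - snd (w i) = 1 \<longleftrightarrow> j = i + D" and tl: "snd (w j) - snd (w i) < 1 \<longleftrightarrow> j < i + D" for i j
  proof -
    have *: "snd (w j) - snd (w i) = (real j - real i) / real D" by (simp add: w_def diff_divide_distrib)
    show "snd (w j) - snd (w i) = 1 \<longleftrightarrow> j = i + D" unfolding * using D0 by (simp add: field_simps) linarith
    show "snd (w j) - snd (w i) < 1 \<longleftrightarrow> j < i + D" unfolding * using D0 by (simp add: field_simps) linarith
  qed
  have tm: "snd (w i) < snd (w j)" if "i < j" for i j using that D0 by (simp add: w_def divide_strict_right_mono)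
  have unb: "\<exists>i. T < snd (w i)" for T
  proof -
    obtain i where "T * real D < real i" using reals_Archimedean2 by blast
    then show ?thesis using D0 by (intro exI[of _ i]) (simp add: w_def field_simps)
  qed
  have fin: "finite {i. snd (w i) < T}" for T
  proof -
    obtain i where "T < snd (w i)" using unb by blast
    then have "{j. snd (w j) < T} \<subseteq> {..<i}" using tm by (auto simp: not_less) (metis less_asym less_trans linorder_neqE_nat not_less)
    then show ?thesis by (rule finite_subset) simp
  qed
  have tw: "timed_word k w" unfolding timed_word_def
  proof (intro conjI allI)
    show "fst (w i) < k" for i using len[of i] k by simp
    show "0 \<le> snd (w i)" for i by (simp add: w_def)
  qed (use tm unb in simp_all)
  have gz: "R' q z = 0" if "z \<in> Zs (E' q)" for q z using g[of q] that by (simp add: gstep_def)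
  have gr: "R' q r \<le> R' (Suc q) r + (if dc (E' q) = Some r then 1 else 0)" if "rs (E' q) \<noteq> Some r" for q r
    using g[of q] that by (simp add: gstep_def)
  have gi: "R' q c < R' (Suc q) c" if "ic (E' q) = Some c" for q c using g[of q] that by (simp add: gstep_def)
  have gc: "R' q 0 \<le> R' (Suc q) c" if "cp (E' q) = Some c" for q c using g[of q] that by (simp add: gstep_def)
  have gs: "R' q c \<le> R' (Suc q) 0" if "rs (E' q) = Some c" for q c using g[of q] that by (simp add: gstep_def)
  have al: "al (E' q) (Pt (S q x) (S (Suc q) x))" for q x
  proof -
    have "S q x \<inter> Zs (E' q) = {}" using gz by (fastforce simp: S_def)
    moreover have "r \<in> S (Suc q) x \<or> dc (E' q) = Some r \<or> rs (E' q) = Some r" if "r \<in> S q x" for r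
      using that gr[of q r] by (auto simp: S_def split: if_splits)
    moreover have "c \<in> S (Suc q) x" if "cp (E' q) = Some c" "0 \<in> S q x" for c
      using that gc[of q c] cpV[OF EQ] by (auto simp: S_def)
    moreover have "0 \<in> S (Suc q) x" if "rs (E' q) = Some c" "c \<in> S q x" for c
      using that gs[of q c] V0 by (auto simp: S_def)
    ultimately show ?thesis by simp
  qed
  \<comment> \<open>The decremented counter drops by at most one, so the initial segments before and
    after differ in at most one slot.\<close>
  have nd: "nd (E' q) (Pt (S q x') (S (Suc q) x'))" if nn: "\<not> nd (E' q) (Pt (S q x) (S (Suc q) x))" "x < x'" for q x x'
  proof (rule ccontr)
    assume a: "\<not> ?thesis"
    obtain r where r: "dc (E' q) = Some r" "r \<in> S q x" "r \<notin> S (Suc q) x" using nn(1) al[of q x] by auto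
    have "r \<in> S q x'" "r \<notin> S (Suc q) x'" using a al[of q x'] r(1) by auto
    then show False using r gr[OF dc_rs[OF r(1)]] nn(2) by (auto simp: S_def)
  qed
  have ob: "obeys w i" for i
    unfolding obeys_def lw
  proof (intro conjI allI impI)
    show "fst (w i) < length ll" by (rule len)
    have "succs (lt i) (lt (i + D))" using n D0 by (auto simp: succs_def lt_def)
    then show "\<exists>j>i. snd (w j) - snd (w i) = 1 \<and> fst (w j) < length ll \<and> succs (lt i) (lt j)"
      using D0 len by (intro exI[of _ "i + D"]) (simp add: t1)
  next
    fix E assume E: "lt i = Ctl E"
    define q where "q = i div D"
    have "i mod D = 0" "E = E' q" using E by (auto simp: lt_def q_def split: if_splits)
    then have i: "i = q * D" "E = E' q" by (auto simp: q_def)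
    have sx: "\<exists>x. j = q * D + Suc x \<and> Suc x < D" if "i < j" "snd (w j) - snd (w i) < 1" for j
      using that unfolding tl i(1) by (intro exI[of _ "j - q * D - 1"]) auto
    {
      fix j assume j: "i < j" "snd (w j) - snd (w i) < 1"
      show "fst (w j) < length ll" by (rule len)
      obtain x where x: "j = q * D + Suc x" "Suc x < D" using sx[OF j] by blast
      show "nd E (lt j) \<or> (al E (lt j) \<and> (\<forall>j'>j. snd (w j') - snd (w i) < 1 \<longrightarrow> fst (w j') < length ll \<and> nd E (lt j')))"
      proof (cases "nd E (lt j)")
        case False
        have "nd E (lt j')" if j': "j < j'" "snd (w j') - snd (w i) < 1" for j'
        proof -
          obtain x' where x': "j' = q * D + Suc x'" "Suc x' < D" using sx[of j'] j j' by (meson less_trans)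
          then show ?thesis using nd[of q x x'] False x j' ltS i(2) by simp
        qed
        then show ?thesis using al x ltS i(2) len by simp
      qed simp
    next
      fix c assume c: "ic E = Some c"
      let ?x = "R' q c"
      have x: "?x < R' (Suc q) c" "c < V" using gi[of q c] icV[of E] EQ c i by auto
      then have D: "Suc ?x < D" using P[of c "Suc q"] by (simp add: D_def)
      have "isinc c (lt (q * D + Suc ?x))" unfolding ltS[OF D] isinc_def using x by (simp add: S_def)
      moreover have "i < q * D + Suc ?x" "snd (w (q * D + Suc ?x)) - snd (w i) < 1" using D by (simp_all add: tl i(1))
      ultimately show "\<exists>j>i. snd (w j) - snd (w i) < 1 \<and> fst (w j) < length ll \<and> isinc c (lt j)"
        using len by blast
    }
  qed
  have w0: "fst (w 0) = 2" using fstw[of 2 0] lt0[of 0] ll(6) E by (simp add: E'_def)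
  have ch: "sat w (q * D) (snd (w (q * D))) (ticks e)" if q: "R' q = ini e" "R' (Suc q) = ini e" for q
  proof -
    have SS: "S q x = (if x < e then L0 else {})" "S (Suc q) x = (if x < e then L0 else {})" for x
      using L0(2) by (auto simp: S_def q ini_def)
    have l: "fst (w (q * D + Suc x)) = (if x < e then 1 else 0)" if "Suc x < D" for x
      using fstw[of 1 "q * D + Suc x"] fstw[of 0 "q * D + Suc x"] ltS[OF that, of q] ll(4,5) by (auto simp: SS)
    have bl: "q * D < j \<and> snd (w j) - snd (w (q * D)) < 1 \<longleftrightarrow> (\<exists>x. j = q * D + Suc x \<and> Suc x < D)" for j
      unfolding tl by (auto intro: exI[of _ "j - q * D - 1"])
    have "{j. q * D < j \<and> snd (w j) - snd (w (q * D)) < 1 \<and> fst (w j) = 1} = (\<lambda>x. q * D + Suc x) ` {..<e}"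
    proof -
      have "q * D < j \<and> snd (w j) - snd (w (q * D)) < 1 \<and> fst (w j) = 1 \<longleftrightarrow> (\<exists>x<e. j = q * D + Suc x)" for j
      proof
        assume a: "q * D < j \<and> snd (w j) - snd (w (q * D)) < 1 \<and> fst (w j) = 1"
        then obtain x where "j = q * D + Suc x" "Suc x < D" using bl[of j] by blast
        then show "\<exists>x<e. j = q * D + Suc x" using l[of x] a by (metis zero_neq_one)
      next
        assume "\<exists>x<e. j = q * D + Suc x"
        then obtain x where x: "x < e" "j = q * D + Suc x" by blast
        then have "Suc x < D" using eP by (simp add: D_def)
        then show "q * D < j \<and> snd (w j) - snd (w (q * D)) < 1 \<and> fst (w j) = 1" using l[of x] x bl[of j] by auto
      qed
      then show ?thesis by blast
    qed
    then have "card {j. q * D < j \<and> snd (w j) - snd (w (q * D)) < 1 \<and> fst (w j) = 1} = e"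
      by (simp add: card_image inj_on_def)
    moreover have "fst (w j) = 0 \<or> fst (w j) = 1" if "q * D < j" "snd (w j) - snd (w (q * D)) < 1" for j
      using that bl[of j] l by (metis (full_types))
    ultimately show ?thesis using sat_ticks[OF tm fin] by blast
  qed
  have "fst (w (J * D)) = 3" using fstw[of 3 "J * D"] lt0[of J] ll(7) E by (simp add: E'_def)
  moreover have "0 < J * D" using J D0 by simp
  ultimately have "\<exists>j>0. fst (w j) = 3 \<and> sat w j (snd (w j)) (ticks e)" using ch[OF R'(3,4)] by blast
  moreover have "sat w 0 (snd (w 0)) (ticks e)" using ch[of 0] R'(1,2) by simp
  ultimately have "sat w 0 0 (And machF (ends e))" using ob w0 by (simp add: sat_machF ends_def)
  then show ?thesis using tw unfolding tptl_sat_def by blast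
qed

lemma constrained_gainy: "constrained (And machF (ends e))"
  by (intro constrained.intros(5) constrained_ends constrained.intros(7) positive_machF)

end

section \<open>Programs on a Hardy budget\<close>

text \<open>\<open>EUp\<close> and \<open>EUpB i\<close> unfold an application of level 0 and of
  level \<open>i + 1\<close>; \<open>EDn\<close> and \<open>EDnB i\<close> fold it up again.
  \<open>EGo\<close> enters the program, whose zero branch \<open>EZero\<close> is an edge of its
  own. \<open>EStart\<close> supplies the idle first block that exact counting requires.\<close>

datatype edge = EStart | EUp | EUpB nat | EGo | EInc nat | EDec nat | EZero nat | EDn | EDnB nat | EHalt

fun rg :: "instr \<Rightarrow> nat" where "rg (Inc r l) = r" | "rg (Dec r l l') = r"
fun jmp :: "instr \<Rightarrow> nat" where "jmp (Inc r l) = l" | "jmp (Dec r l l') = l"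
fun jmp0 :: "instr \<Rightarrow> nat" where "jmp0 (Inc r l) = l" | "jmp0 (Dec r l l') = l'"
fun isInc :: "instr \<Rightarrow> bool" where "isInc (Inc r l) = True" | "isInc (Dec r l l') = False"

text \<open>Label 0 is the argument n of the Hardy computation, label i + 1 counts the pending
  applications of fgh i, and label m + 2 + r is register r of the program.\<close>

fun hardy :: "nat \<Rightarrow> (nat \<Rightarrow> nat) \<Rightarrow> nat" where
  "hardy 0 R = R 0"
| "hardy (Suc j) R = (fgh j ^^ R (Suc j)) (hardy j R)"

text \<open>Low levels are applied first, so a comparison made there passes through the higher
  levels by monotonicity.\<close>

lemma hardy_extend:
  assumes "j \<le> k" "hardy j R \<le> hardy j R'" "\<And>i. j < i \<Longrightarrow> i \<le> k \<Longrightarrow> R i \<le> R' i"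
  shows "hardy k R \<le> hardy k R'"
  using assms
proof (induction rule: dec_induct)
  case (step k)
  then have "hardy k R \<le> hardy k R'" "R (Suc k) \<le> R' (Suc k)" by auto
  then show ?case by (simp add: fgh_pow_mono)
qed

lemma hardy_ge: "R 0 \<le> hardy j R"
proof (induction j)
  case (Suc j)
  then show ?case using funpow_inflate[where f = "fgh j" and x = "hardy j R" and k = "R (Suc j)", OF fgh_gt] by simp
qed simp

lemma hardy_zero: "(\<And>i. i < j \<Longrightarrow> R (Suc i) = 0) \<Longrightarrow> hardy j R = R 0"
  by (induction j) auto

locale budget =
  fixes D :: prog and K m :: nat
  assumes K: "\<And>p. p < length D \<Longrightarrow> rg (D ! p) < K" and K0: "0 < K"
begin

fun Zs :: "edge \<Rightarrow> nat set" where
  "Zs (EUpB i) = Suc ` {..i}"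
| "Zs (EInc p) = Suc ` {..m}"
| "Zs (EDec p) = Suc ` {..m}"
| "Zs (EZero p) = insert (m + 2 + rg (D ! p)) (Suc ` {..m})"
| "Zs (EDnB i) = Suc ` {..<i}"
| "Zs _ = {}"

fun dc :: "edge \<Rightarrow> nat option" where
  "dc EUp = Some 1"
| "dc (EUpB i) = Some (Suc (Suc i))"
| "dc (EInc p) = Some 0"
| "dc (EDec p) = Some (m + 2 + rg (D ! p))"
| "dc EDn = Some 0"
| "dc (EDnB i) = Some 0"
| "dc _ = None"

fun ic :: "edge \<Rightarrow> nat option" where
  "ic EUp = Some 0"
| "ic (EUpB i) = Some 0"
| "ic (EInc p) = Some (m + 2 + rg (D ! p))"
| "ic (EDec p) = Some 0"
| "ic EDn = Some 1"
| "ic (EDnB i) = Some (Suc (Suc i))"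
| "ic _ = None"

fun cp :: "edge \<Rightarrow> nat option" where
  "cp (EUpB i) = Some (Suc i)"
| "cp _ = None"

fun rs :: "edge \<Rightarrow> nat option" where
  "rs (EDnB i) = Some (Suc i)"
| "rs _ = None"

fun tgt :: "edge \<Rightarrow> nat" where
  "tgt EGo = 1"
| "tgt (EInc p) = Suc (jmp (D ! p))"
| "tgt (EDec p) = Suc (jmp (D ! p))"
| "tgt (EZero p) = Suc (jmp0 (D ! p))"
| "tgt EDn = Suc (length D)"
| "tgt (EDnB i) = Suc (length D)"
| "tgt _ = 0"

fun ok :: "nat \<Rightarrow> edge \<Rightarrow> bool" where
  "ok s EStart = False"
| "ok s EUp = (s = 0)"
| "ok s (EUpB i) = (s = 0 \<and> i < m)"
| "ok s EGo = (s = 0)"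
| "ok s (EInc p) = (s = Suc p \<and> p < length D \<and> isInc (D ! p))"
| "ok s (EDec p) = (s = Suc p \<and> p < length D \<and> \<not> isInc (D ! p))"
| "ok s (EZero p) = (s = Suc p \<and> p < length D \<and> \<not> isInc (D ! p))"
| "ok s EDn = (s = Suc (length D))"
| "ok s (EDnB i) = (s = Suc (length D) \<and> i < m)"
| "ok s EHalt = (s = Suc (length D))"

definition nx :: "edge \<Rightarrow> edge \<Rightarrow> bool" where
  "nx E E' \<longleftrightarrow> (if E = EHalt then E' = EHalt else ok (tgt E) E')"

definition Q :: "edge set" where "Q = {EStart, EHalt} \<union> {E. \<exists>s. ok s E}"

text \<open>The argument n, the top level of the budget and program register 0 all start with
  \<open>e\<close>. Hence a single kind of token suffices in the initial and the final
  block.\<close>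

definition L0 :: "nat set" where "L0 = {0, Suc m, m + 2}"

lemma finite_Q: "finite Q"
proof -
  have "Q \<subseteq> {EStart, EUp, EGo, EDn, EHalt} \<union> EUpB ` {..<m} \<union> EDnB ` {..<m} \<union> EInc ` {..<length D} \<union>
    EDec ` {..<length D} \<union> EZero ` {..<length D}"
  proof
    fix E assume "E \<in> Q"
    then show "E \<in> {EStart, EUp, EGo, EDn, EHalt} \<union> EUpB ` {..<m} \<union> EDnB ` {..<m} \<union> EInc ` {..<length D} \<union>
      EDec ` {..<length D} \<union> EZero ` {..<length D}" by (cases E) (auto simp: Q_def)
  qed
  then show ?thesis by (rule finite_subset) simp
qed

sublocale G: gainy Q "m + 2 + K" Zs dc ic cp rs nx EStart EHalt L0
proof
  show "finite Q" by (rule finite_Q)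
  show "nx E E' \<Longrightarrow> E' \<in> Q" for E E' by (auto simp: nx_def Q_def split: if_splits)
  show "E \<in> Q \<Longrightarrow> ic E = Some c \<Longrightarrow> c < m + 2 + K" for E c by (cases E) (auto simp: Q_def K)
  show "E \<in> Q \<Longrightarrow> cp E = Some c \<Longrightarrow> c < m + 2 + K" for E c by (cases E) (auto simp: Q_def)
  show "ic E = Some c \<Longrightarrow> dc E \<noteq> Some c" for E c by (cases E) auto
  show "ic E = Some c \<Longrightarrow> rs E \<noteq> Some c" for E c by (cases E) auto
  show "dc E = Some c \<Longrightarrow> rs E \<noteq> Some c" for E c by (cases E) auto
qed (use K0 in \<open>auto simp: Q_def nx_def L0_def\<close>)

definition regs :: "(nat \<Rightarrow> nat) \<Rightarrow> nat \<Rightarrow> nat" where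
  "regs R r = (if r < K then R (m + 2 + r) else 0)"

text \<open>The potential of a configuration: the value of the budget plus what the program
  registers hold. Exact operations preserve it and gains can only raise it.\<close>

definition mu :: "(nat \<Rightarrow> nat) \<Rightarrow> nat" where
  "mu R = hardy (Suc m) R + (\<Sum>r<K. regs R r)"

fun sem :: "edge \<Rightarrow> (nat \<Rightarrow> nat) \<Rightarrow> (nat \<Rightarrow> nat) \<Rightarrow> bool" where
  "sem (EInc p) R R' = (step D (p, regs R) = (jmp (D ! p), regs R'))"
| "sem (EDec p) R R' = (step D (p, regs R) = (jmp (D ! p), regs R'))"
| "sem (EZero p) R R' = (step D (p, regs R) = (jmp0 (D ! p), regs R'))"
| "sem _ R R' = (regs R' = regs R)"

lemma gstepD:
  assumes "G.gstep E R R'"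
  shows "z \<in> Zs E \<Longrightarrow> R z = 0"
    and "rs E \<noteq> Some r \<Longrightarrow> R r \<le> R' r + (if dc E = Some r then 1 else 0)"
    and "ic E = Some c \<Longrightarrow> R c < R' c" and "cp E = Some c \<Longrightarrow> R 0 \<le> R' c" and "rs E = Some c \<Longrightarrow> R c \<le> R' 0"
  using assms by (auto simp: G.gstep_def)

lemma mu_keep:
  assumes "hardy (Suc m) R \<le> hardy (Suc m) R'" "\<And>r. r < K \<Longrightarrow> R (m + 2 + r) \<le> R' (m + 2 + r)"
  shows "mu R \<le> mu R' \<and> (mu R = mu R' \<longrightarrow> regs R' = regs R)"
proof -
  have le: "\<And>r. r \<in> {..<K} \<Longrightarrow> regs R r \<le> regs R' r" using assms(2) by (auto simp: regs_def)
  then have s: "(\<Sum>r<K. regs R r) \<le> (\<Sum>r<K. regs R' r)" by (rule sum_mono)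
  have "regs R' = regs R" if "mu R = mu R'"
  proof
    have eq: "(\<Sum>r<K. regs R r) = (\<Sum>r<K. regs R' r)" using that s assms(1) unfolding mu_def by linarith
    show "regs R' r = regs R r" for r
    proof (cases "r < K")
      case True
      then show ?thesis using sum_mono_inv[OF eq le, of r] by simp
    qed (simp add: regs_def)
  qed
  then show ?thesis using s assms(1) unfolding mu_def by linarith
qed

text \<open>In a program step the increment of one of n and a register pays for the decrement of the other.\<close>

lemma mu_move:
  assumes z: "\<forall>i\<le>m. R (Suc i) = 0" and q: "q < K"
    and le: "\<forall>r<K. r \<noteq> q \<longrightarrow> regs R r \<le> regs R' r" and pay: "R 0 + regs R q \<le> R' 0 + regs R' q"
  shows "mu R \<le> mu R'" "mu R = mu R' \<Longrightarrow> R 0 + regs R q = R' 0 + regs R' q \<and> (\<forall>r. r \<noteq> q \<longrightarrow> regs R' r = regs R r)"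
proof -
  have h: "hardy (Suc m) R = R 0" using z by (intro hardy_zero) auto
  have h': "R' 0 \<le> hardy (Suc m) R'" by (rule hardy_ge)
  have sp: "(\<Sum>r<K. f r) = f q + (\<Sum>r\<in>{..<K} - {q}. f r)" for f :: "nat \<Rightarrow> nat"
    using q by (intro sum.remove) auto
  have s: "(\<Sum>r\<in>{..<K} - {q}. regs R r) \<le> (\<Sum>r\<in>{..<K} - {q}. regs R' r)" by (rule sum_mono) (use le in auto)
  show "mu R \<le> mu R'" using h h' s pay unfolding mu_def sp[of "regs R"] sp[of "regs R'"] by linarith
  assume e: "mu R = mu R'"
  have e1: "(\<Sum>r\<in>{..<K} - {q}. regs R r) = (\<Sum>r\<in>{..<K} - {q}. regs R' r)"
    and e2: "R 0 + regs R q = R' 0 + regs R' q"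
    using e h h' s pay unfolding mu_def sp[of "regs R"] sp[of "regs R'"] by linarith+
  have "regs R' r = regs R r" if "r \<noteq> q" for r
  proof (cases "r < K")
    case True
    then show ?thesis using sum_mono_inv[OF e1, of r] le that by auto
  qed (simp add: regs_def)
  with e2 show "R 0 + regs R q = R' 0 + regs R' q \<and> (\<forall>r. r \<noteq> q \<longrightarrow> regs R' r = regs R r)" by blast
qed

text \<open>Equality of the potentials is what recovers exactness: for program edges it turns the
  inequalities of \<open>gstep\<close> into a step of \<open>D\<close>. The zero tests make the
  Hardy value computable at the levels concerned; in the program phase all levels are empty and the
  value is n itself.\<close>

lemma step_mu:
  assumes g: "G.gstep E R R'" and E: "E \<in> Q"
  shows "mu R \<le> mu R' \<and> (mu R = mu R' \<longrightarrow> sem E R R')"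
proof -
  note gd = gstepD[OF g]
  have same: ?thesis if "hardy (Suc m) R \<le> hardy (Suc m) R'" "\<And>X Y. sem E X Y \<longleftrightarrow> regs Y = regs X"
    "\<And>r. rs E \<noteq> Some (m + 2 + r) \<and> dc E \<noteq> Some (m + 2 + r)"
  proof -
    have "R (m + 2 + r) \<le> R' (m + 2 + r)" for r using gd(2)[of "m + 2 + r"] that(3)[of r] by simp
    then show ?thesis using mu_keep[OF that(1)] that(2) by blast
  qed
  show ?thesis
  proof (cases E)
    case EStart
    have "R r \<le> R' r" for r using gd(2)[of r] by (simp add: EStart)
    then have "hardy (Suc m) R \<le> hardy (Suc m) R'" by (intro hardy_extend[of 0 "Suc m" R R']) simp_all
    then show ?thesis by (rule same) (auto simp: EStart)
  next
    case EGo
    have "R r \<le> R' r" for r using gd(2)[of r] by (simp add: EGo)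
    then have "hardy (Suc m) R \<le> hardy (Suc m) R'" by (intro hardy_extend[of 0 "Suc m" R R']) simp_all
    then show ?thesis by (rule same) (auto simp: EGo)
  next
    case EHalt
    have "R r \<le> R' r" for r using gd(2)[of r] by (simp add: EHalt)
    then have "hardy (Suc m) R \<le> hardy (Suc m) R'" by (intro hardy_extend[of 0 "Suc m" R R']) simp_all
    then show ?thesis by (rule same) (auto simp: EHalt)
  next
    case EUp
    have p0: "(fgh 0 ^^ k) y = y + k" for k y by (induction k) auto
    have "hardy (Suc m) R \<le> hardy (Suc m) R'"
    proof (rule hardy_extend[of 1])
      have "R 0 + R 1 \<le> R' 0 + R' 1" using gd(2)[of 1] gd(3)[of 0] by (simp add: EUp)
      then show "hardy 1 R \<le> hardy 1 R'" unfolding One_nat_def hardy.simps p0 by simp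
      show "R i \<le> R' i" if "1 < i" for i using gd(2)[of i] that by (simp add: EUp)
    qed simp
    then show ?thesis by (rule same) (auto simp: EUp)
  next
    case EDn
    have p0: "(fgh 0 ^^ k) y = y + k" for k y by (induction k) auto
    have "hardy (Suc m) R \<le> hardy (Suc m) R'"
    proof (rule hardy_extend[of 1])
      have "R 0 + R 1 \<le> R' 0 + R' 1" using gd(2)[of 0] gd(3)[of 1] by (simp add: EDn)
      then show "hardy 1 R \<le> hardy 1 R'" unfolding One_nat_def hardy.simps p0 by simp
      show "R i \<le> R' i" if "1 < i" for i using gd(2)[of i] that by (simp add: EDn)
    qed simp
    then show ?thesis by (rule same) (auto simp: EDn)
  next
    case (EUpB i)
    have i: "i < m" using E by (auto simp: Q_def EUpB)
    have "hardy (Suc m) R \<le> hardy (Suc m) R'"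
    proof (rule hardy_extend[of "Suc (Suc i)"])
      \<comment> \<open>With the levels up to \<open>i\<close> empty, the unfolded application of
        \<open>fgh (Suc i)\<close> acts directly on n. By its recursion equation it becomes the
        copies made by \<open>cp\<close> together with the incremented n.\<close>
      have "R (Suc j) = 0" if "j \<le> i" for j using gd(1)[of "Suc j"] that by (simp add: EUpB)
      then have h: "hardy (Suc i) R = R 0" by (intro hardy_zero) auto
      have "fgh (Suc i) (R 0) \<le> hardy (Suc i) R'"
      proof -
        have "R 0 \<le> R' (Suc i)" "Suc (R 0) \<le> hardy i R'" using gd(4)[of "Suc i"] gd(3)[of 0] hardy_ge[of R' i] by (auto simp: EUpB)
        then show ?thesis by (simp add: fgh_pow_mono)
      qed
      then have "(fgh (Suc i) ^^ R' (Suc (Suc i))) (fgh (Suc i) (R 0)) \<le> hardy (Suc (Suc i)) R'" 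
        unfolding hardy.simps(2)[of "Suc i"] by (rule fgh_pow_mono) simp
      moreover have "(fgh (Suc i) ^^ R (Suc (Suc i))) (R 0) \<le> (fgh (Suc i) ^^ Suc (R' (Suc (Suc i)))) (R 0)"
        using gd(2)[of "Suc (Suc i)"] by (intro fgh_pow_mono) (auto simp: EUpB)
      ultimately show "hardy (Suc (Suc i)) R \<le> hardy (Suc (Suc i)) R'"
        unfolding hardy.simps(2)[of "Suc i" R] h funpow_Suc_right comp_apply by (rule le_trans[rotated])
      show "R j \<le> R' j" if "Suc (Suc i) < j" for j using gd(2)[of j] that by (simp add: EUpB)
    qed (use i in simp)
    then show ?thesis by (rule same) (use i in \<open>auto simp: EUpB\<close>)
  next
    case (EDnB i)
    have i: "i < m" using E by (auto simp: Q_def EDnB)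
    have "hardy (Suc m) R \<le> hardy (Suc m) R'"
    proof (rule hardy_extend[of "Suc (Suc i)"])
      have "R (Suc j) = 0" if "j < i" for j using gd(1)[of "Suc j"] that by (simp add: EDnB)
      then have h: "hardy i R = R 0" by (intro hardy_zero) auto
      \<comment> \<open>\<open>rs\<close> bounds the pending applications of \<open>fgh i\<close> by
        the new n, and \<open>dc\<close> bounds the old n by the successor of the new one; so they
        fit into one application of \<open>fgh (Suc i)\<close>.\<close>
      have "hardy (Suc i) R \<le> fgh (Suc i) (R' 0)"
        unfolding hardy.simps h fgh.simps using gd(5)[of "Suc i"] gd(2)[of 0] by (intro fgh_pow_mono) (auto simp: EDnB)
      also have "\<dots> \<le> fgh (Suc i) (hardy (Suc i) R')" by (intro fgh_mono hardy_ge)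
      finally have "hardy (Suc (Suc i)) R \<le> (fgh (Suc i) ^^ R (Suc (Suc i))) (fgh (Suc i) (hardy (Suc i) R'))"
        unfolding hardy.simps(2)[of "Suc i"] by (rule fgh_pow_mono) simp
      also have "\<dots> = (fgh (Suc i) ^^ Suc (R (Suc (Suc i)))) (hardy (Suc i) R')" by (simp only: funpow_Suc_right comp_apply)
      also have "\<dots> \<le> hardy (Suc (Suc i)) R'"
        unfolding hardy.simps(2)[of "Suc i"] using gd(3)[of "Suc (Suc i)"] by (intro fgh_pow_mono) (auto simp: EDnB)
      finally show "hardy (Suc (Suc i)) R \<le> hardy (Suc (Suc i)) R'" .
      show "R j \<le> R' j" if "Suc (Suc i) < j" for j using gd(2)[of j] that by (simp add: EDnB)
    qed (use i in simp)
    then show ?thesis by (rule same) (use i in \<open>auto simp: EDnB\<close>)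
  next
    case (EInc p)
    have p: "p < length D" "isInc (D ! p)" using E by (auto simp: Q_def EInc)
    let ?q = "rg (D ! p)"
    have q: "?q < K" using K p by blast
    have z: "\<forall>i\<le>m. R (Suc i) = 0" using gd(1) by (simp add: EInc)
    have a: "R 0 \<le> R' 0 + 1" "regs R ?q < regs R' ?q" using gd(2)[of 0] gd(3)[of "m + 2 + ?q"] q by (auto simp: EInc regs_def)
    have "regs R r \<le> regs R' r" if "r < K" "r \<noteq> ?q" for r
      using gd(2)[of "m + 2 + r"] that by (simp add: EInc regs_def)
    then have le: "\<forall>r<K. r \<noteq> ?q \<longrightarrow> regs R r \<le> regs R' r" by blast
    have pay: "R 0 + regs R ?q \<le> R' 0 + regs R' ?q" using a by simp
    note mv = mu_move[OF z q le pay]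
    have "sem E R R'" if "mu R = mu R'"
    proof -
      obtain r l where D: "D ! p = Inc r l" using p by (cases "D ! p") auto
      have "R 0 + regs R r = R' 0 + regs R' r" and o: "\<And>s. s \<noteq> r \<Longrightarrow> regs R' s = regs R s" using mv(2)[OF that] D by auto
      then have "regs R' = (regs R)(r := Suc (regs R r))" using a D by (intro ext) auto
      then show ?thesis using p D by (simp add: EInc)
    qed
    then show ?thesis using mv(1) by blast
  next
    case (EDec p)
    have p: "p < length D" "\<not> isInc (D ! p)" using E by (auto simp: Q_def EDec)
    let ?q = "rg (D ! p)"
    have q: "?q < K" using K p by blast
    have z: "\<forall>i\<le>m. R (Suc i) = 0" using gd(1) by (simp add: EDec)
    have a: "R 0 < R' 0" "regs R ?q \<le> regs R' ?q + 1" using gd(3)[of 0] gd(2)[of "m + 2 + ?q"] q by (auto simp: EDec regs_def)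
    have "regs R r \<le> regs R' r" if "r < K" "r \<noteq> ?q" for r
      using gd(2)[of "m + 2 + r"] that by (simp add: EDec regs_def)
    then have le: "\<forall>r<K. r \<noteq> ?q \<longrightarrow> regs R r \<le> regs R' r" by blast
    have pay: "R 0 + regs R ?q \<le> R' 0 + regs R' ?q" using a by simp
    note mv = mu_move[OF z q le pay]
    have "sem E R R'" if "mu R = mu R'"
    proof -
      obtain r l l' where D: "D ! p = Dec r l l'" using p by (cases "D ! p") auto
      have b: "R 0 + regs R r = R' 0 + regs R' r" and o: "\<And>s. s \<noteq> r \<Longrightarrow> regs R' s = regs R s" using mv(2)[OF that] D by auto
      have c: "regs R r = Suc (regs R' r)" using a b D by simp
      then have "regs R' = (regs R)(r := regs R r - 1)" using o by (intro ext) auto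
      then show ?thesis using p D c by (simp add: EDec)
    qed
    then show ?thesis using mv(1) by blast
  next
    case (EZero p)
    have p: "p < length D" "\<not> isInc (D ! p)" using E by (auto simp: Q_def EZero)
    let ?q = "rg (D ! p)"
    have q: "?q < K" using K p by blast
    have z: "\<forall>i\<le>m. R (Suc i) = 0" using gd(1) by (simp add: EZero)
    have a: "R 0 \<le> R' 0" "regs R ?q = 0" using gd(2)[of 0] gd(1)[of "m + 2 + ?q"] q by (auto simp: EZero regs_def)
    have "regs R r \<le> regs R' r" if "r < K" "r \<noteq> ?q" for r
      using gd(2)[of "m + 2 + r"] that by (simp add: EZero regs_def)
    then have le: "\<forall>r<K. r \<noteq> ?q \<longrightarrow> regs R r \<le> regs R' r" by blast
    have pay: "R 0 + regs R ?q \<le> R' 0 + regs R' ?q" using a by simp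
    note mv = mu_move[OF z q le pay]
    have "sem E R R'" if "mu R = mu R'"
    proof -
      obtain r l l' where D: "D ! p = Dec r l l'" using p by (cases "D ! p") auto
      have "R 0 + regs R r = R' 0 + regs R' r" and o: "\<And>s. s \<noteq> r \<Longrightarrow> regs R' s = regs R s" using mv(2)[OF that] D by auto
      then have "regs R' r = 0" using a D by simp
      then have "regs R' = regs R" using o a D by (intro ext) (metis rg.simps(2))
      then show ?thesis using p D a by (simp add: EZero)
    qed
    then show ?thesis using mv(1) by blast
  qed
qed

text \<open>Equal configurations at both ends have equal potentials, so the monotone potential is
  constant and no step gains anything that matters to the program. Hence the registers follow the
  computation of \<open>D\<close> exactly.\<close>

lemma run_accepts:
  assumes E: "E 0 = EStart" "E J = EHalt" and R: "R 0 = G.ini e" "R J = G.ini e"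
    and run: "\<And>j. j < J \<Longrightarrow> G.gstep (E j) (R j) (R (Suc j)) \<and> nx (E j) (E (Suc j))"
  shows "\<exists>t. fst (conf D e t) = length D"
proof (rule ccontr)
  assume na: "\<not> ?thesis"
  have EQ: "E j \<in> Q" if "j \<le> J" for j
  proof (cases j)
    case (Suc i)
    then show ?thesis using run[of i] G.nxQ that by auto
  qed (simp add: E Q_def)
  have sm: "mu (R j) \<le> mu (R (Suc j)) \<and> (mu (R j) = mu (R (Suc j)) \<longrightarrow> sem (E j) (R j) (R (Suc j)))" if "j < J" for j
    using step_mu[of "E j" "R j" "R (Suc j)"] run[OF that] EQ[of j] that by simp
  have mono: "mu (R i) \<le> mu (R j)" if "i \<le> j" "j \<le> J" for i j
    using that
  proof (induction rule: dec_induct)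
    case (step n)
    then show ?case using sm[of n] by simp
  qed simp
  have sem: "sem (E j) (R j) (R (Suc j))" if "j < J" for j
  proof -
    have "mu (R 0) \<le> mu (R j)" "mu (R (Suc j)) \<le> mu (R J)" using mono that by auto
    then show ?thesis using sm[OF that] R by simp
  qed
  have r0: "regs (G.ini e) = (\<lambda>_. 0)(0 := e)"
    unfolding regs_def G.ini_def fun_eq_iff using K0 by (auto simp: L0_def)
  \<comment> \<open>State 0 is the unwinding, during which the registers rest; state
    \<open>Suc p\<close> means that the program is at address \<open>p\<close>. As
    \<open>length D\<close> is assumed never to be reached, the state that enables the rewinding and
    the halting edge never occurs.\<close>
  let ?pre = "\<lambda>s X. (s = 0 \<and> regs X = (\<lambda>_. 0)(0 := e)) \<or> (\<exists>t p. s = Suc p \<and> conf D e t = (p, regs X))"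
  have claim: "j < J \<Longrightarrow> E j \<noteq> EHalt \<and> ?pre (tgt (E j)) (R (Suc j))" for j
  proof (induction j)
    case 0
    then show ?case using sem[of 0] E R r0 by simp
  next
    case (Suc j)
    then have IH: "E j \<noteq> EHalt" "?pre (tgt (E j)) (R (Suc j))" by auto
    have ok: "ok (tgt (E j)) (E (Suc j))" using run[of j] IH(1) Suc.prems by (simp add: nx_def)
    have sm': "sem (E (Suc j)) (R (Suc j)) (R (Suc (Suc j)))" using sem Suc.prems by simp
    have noacc: "tgt (E j) \<noteq> Suc (length D)" using IH(2) na by (metis fst_conv nat.distinct(1) nat.inject)
    have st: "\<exists>t. conf D e t = step D (p, regs (R (Suc j)))" if p: "tgt (E j) = Suc p" for p
    proof -
      obtain t where "conf D e t = (p, regs (R (Suc j)))" using IH(2) p by auto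
      then have "conf D e (Suc t) = step D (p, regs (R (Suc j)))" by (simp add: conf_def)
      then show ?thesis by blast
    qed
    show ?case
      using ok sm' noacc IH(2)
    proof (cases "E (Suc j)")
      case EGo
      have "conf D e 0 = (0, (\<lambda>_. 0)(0 := e))" by (simp add: conf_def)
      then show ?thesis using EGo ok sm' IH(2) by (auto intro!: exI[of _ 0] simp del: fun_upd_apply)
    qed (auto dest!: st simp del: step.simps)
  qed
  have "0 < J" using E by (cases J) auto
  then obtain j where j: "J = Suc j" by (cases J) auto
  have "ok (tgt (E j)) EHalt" using run[of j] claim[of j] E(2) j by (simp add: nx_def)
  then have "tgt (E j) = Suc (length D)" by simp
  then show False using claim[of j] na j by (metis fst_conv lessI nat.distinct(1) nat.inject)
qed

section \<open>Exact runs for accepting computations\<close>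

definition sstep :: "nat \<times> (nat \<Rightarrow> nat) \<Rightarrow> nat \<times> (nat \<Rightarrow> nat) \<Rightarrow> bool" where
  "sstep c d \<longleftrightarrow> (\<exists>E. ok (fst c) E \<and> E \<noteq> EHalt \<and> G.gstep E (snd c) (snd d) \<and> tgt E = fst d)"

lemma sstepI: "ok s E \<Longrightarrow> E \<noteq> EHalt \<Longrightarrow> G.gstep E R R' \<Longrightarrow> tgt E = s' \<Longrightarrow> sstep (s, R) (s', R')"
  unfolding sstep_def by auto

text \<open>An unwinding step is paired with its inverse, so that one derivation yields both the
  first and the last phase of the run.\<close>

definition up :: "(nat \<Rightarrow> nat) \<Rightarrow> (nat \<Rightarrow> nat) \<Rightarrow> bool" where
  "up R R' \<longleftrightarrow> sstep (0, R) (0, R') \<and> sstep (Suc (length D), R') (Suc (length D), R)"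

lemma up_first:
  assumes "R (Suc 0) = Suc x" shows "up R (R(Suc 0 := x, 0 := Suc (R 0)))"
  unfolding up_def
proof
  show "sstep (0, R) (0, R(Suc 0 := x, 0 := Suc (R 0)))"
    by (rule sstepI[of _ EUp]) (use assms in \<open>auto simp: G.gstep_def\<close>)
  show "sstep (Suc (length D), R(Suc 0 := x, 0 := Suc (R 0))) (Suc (length D), R)"
    by (rule sstepI[of _ EDn]) (use assms in \<open>auto simp: G.gstep_def\<close>)
qed

lemma up_next:
  assumes "i < m" "\<And>j. j \<le> i \<Longrightarrow> R (Suc j) = 0" "R (Suc (Suc i)) = Suc x"
  shows "up R (R(Suc (Suc i) := x, Suc i := R 0, 0 := Suc (R 0)))"
  unfolding up_def
proof
  show "sstep (0, R) (0, R(Suc (Suc i) := x, Suc i := R 0, 0 := Suc (R 0)))"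
    by (rule sstepI[of _ "EUpB i"]) (use assms in \<open>auto simp: G.gstep_def\<close>)
  show "sstep (Suc (length D), R(Suc (Suc i) := x, Suc i := R 0, 0 := Suc (R 0))) (Suc (length D), R)"
    by (rule sstepI[of _ "EDnB i"]) (use assms in \<open>auto simp: G.gstep_def\<close>)
qed

lemma up_iter:
  assumes lev: "\<And>R x. (\<And>i. i < j \<Longrightarrow> R (Suc i) = 0) \<Longrightarrow> R (Suc j) = Suc x \<Longrightarrow>
      up\<^sup>*\<^sup>* R (R(Suc j := x, 0 := fgh j (R 0)))"
    and "\<And>i. i < j \<Longrightarrow> R (Suc i) = 0" "R (Suc j) = x + y"
  shows "up\<^sup>*\<^sup>* R (R(Suc j := x, 0 := (fgh j ^^ y) (R 0)))"
  using assms(2,3)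
proof (induction y arbitrary: x)
  case 0
  then have "R(Suc j := x, 0 := R 0) = R" by auto
  then show ?case by (simp only: funpow_0 rtranclp.rtrancl_refl)
next
  case (Suc y)
  let ?S = "R(Suc j := Suc x, 0 := (fgh j ^^ y) (R 0))"
  have 1: "up\<^sup>*\<^sup>* R ?S" by (rule Suc.IH) (use Suc.prems in auto)
  have 2: "up\<^sup>*\<^sup>* ?S (?S(Suc j := x, 0 := fgh j (?S 0)))" by (rule lev) (use Suc.prems in auto)
  have 3: "?S(Suc j := x, 0 := fgh j (?S 0)) = R(Suc j := x, 0 := (fgh j ^^ Suc y) (R 0))" by (auto simp: fun_eq_iff)
  from rtranclp_trans[OF 1 2] show ?case unfolding 3 .
qed

text \<open>Follows the recursion of \<open>fgh\<close>: one operation replaces an application of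
  level \<open>j + 1\<close> by n applications of level \<open>j\<close>, and these are then used up
  one after the other.\<close>

lemma up_level:
  assumes "j \<le> m" "\<And>i. i < j \<Longrightarrow> R (Suc i) = 0" "R (Suc j) = Suc x"
  shows "up\<^sup>*\<^sup>* R (R(Suc j := x, 0 := fgh j (R 0)))"
  using assms
proof (induction j arbitrary: R x)
  case 0
  then show ?case using up_first[of R x] by (intro r_into_rtranclp) (simp only: fgh.simps)
next
  case (Suc j)
  let ?S = "R(Suc (Suc j) := x, Suc j := R 0, 0 := Suc (R 0))"
  have 1: "up\<^sup>*\<^sup>* R ?S" by (intro r_into_rtranclp up_next) (use Suc.prems in auto)
  have 2: "up\<^sup>*\<^sup>* ?S (?S(Suc j := 0, 0 := (fgh j ^^ R 0) (?S 0)))"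
  proof (rule up_iter)
    show "up\<^sup>*\<^sup>* R (R(Suc j := x, 0 := fgh j (R 0)))" if "\<And>i. i < j \<Longrightarrow> R (Suc i) = 0" "R (Suc j) = Suc x" for R x
      by (rule Suc.IH) (use Suc.prems(1) that in auto)
  qed (use Suc.prems in auto)
  have 3: "?S(Suc j := 0, 0 := (fgh j ^^ R 0) (?S 0)) = R(Suc (Suc j) := x, 0 := fgh (Suc j) (R 0))"
    using Suc.prems(2)[of j] by (auto simp: fun_eq_iff)
  from rtranclp_trans[OF 1 2] show ?case unfolding 3 .
qed

lemma up_sstep:
  assumes "up\<^sup>*\<^sup>* R R'" shows "sstep\<^sup>*\<^sup>* (0, R) (0, R') \<and> sstep\<^sup>*\<^sup>* (Suc (length D), R') (Suc (length D), R)"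
  using assms
proof induction
  case (step S S')
  then show ?case unfolding up_def by (meson converse_rtranclp_into_rtranclp rtranclp.rtrancl_into_rtrancl)
qed simp

text \<open>During the program the total \<open>B\<close> is conserved: n holds whatever the
  registers do not, and all levels are empty.\<close>

definition embed :: "nat \<Rightarrow> (nat \<Rightarrow> nat) \<Rightarrow> nat \<Rightarrow> nat" where
  "embed B c l = (if l = 0 then B - sum c {..<K} else if l \<le> Suc m then 0 else c (l - (m + 2)))"

lemma sum_upd:
  assumes "r < K" shows "sum (c(r := v)) {..<K} + c r = sum c {..<K} + (v :: nat)"
proof -
  have "sum (c(r := v)) ({..<K} - {r}) = sum c ({..<K} - {r})" by (intro sum.cong) auto
  then show ?thesis using assms sum.remove[of "{..<K}" r c] sum.remove[of "{..<K}" r "c(r := v)"] by simp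
qed

lemma embed_step:
  assumes p: "p < length D" and B: "sum c {..<K} \<le> B"
  shows "sstep (Suc p, embed B c) (Suc (fst (step D (p, c))), embed B (snd (step D (p, c))))"
proof (cases "D ! p")
  case (Inc r l)
  have r: "r < K" using K[OF p] Inc by simp
  have s: "sum (c(r := Suc (c r))) {..<K} = Suc (sum c {..<K})" using sum_upd[OF r, of c "Suc (c r)"] by simp
  have "G.gstep (EInc p) (embed B c) (embed B (c(r := Suc (c r))))"
    unfolding G.gstep_def using s by (auto simp: Inc embed_def)
  then have "sstep (Suc p, embed B c) (Suc l, embed B (c(r := Suc (c r))))"
    by (intro sstepI[of _ "EInc p"]) (use p Inc in auto)
  then show ?thesis using p Inc by simp
next
  case (Dec r l l')
  have r: "r < K" using K[OF p] Dec by simp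
  show ?thesis
  proof (cases "c r = 0")
    case True
    have "G.gstep (EZero p) (embed B c) (embed B c)"
      unfolding G.gstep_def using True by (auto simp: Dec embed_def)
    then have "sstep (Suc p, embed B c) (Suc l', embed B c)"
      by (intro sstepI[of _ "EZero p"]) (use p Dec in auto)
    then show ?thesis using p Dec True by simp
  next
    case False
    have s: "Suc (sum (c(r := c r - 1)) {..<K}) = sum c {..<K}" using sum_upd[OF r, of c "c r - 1"] False by simp
    have "G.gstep (EDec p) (embed B c) (embed B (c(r := c r - 1)))"
      unfolding G.gstep_def using s B by (auto simp: Dec embed_def)
    then have "sstep (Suc p, embed B c) (Suc l, embed B (c(r := c r - 1)))"
      by (intro sstepI[of _ "EDec p"]) (use p Dec in auto)
    then show ?thesis using p Dec False by simp
  qed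
qed

lemma sstep_edges:
  assumes "sstep\<^sup>*\<^sup>* c (Suc (length D), X)"
  shows "tgt E = fst c \<Longrightarrow> E \<noteq> EHalt \<Longrightarrow> G.gstep E R (snd c) \<Longrightarrow>
    (\<lambda>(E, R) (E', R'). G.gstep E R R' \<and> nx E E')\<^sup>*\<^sup>* (E, R) (EHalt, X)"
  using assms
proof (induction arbitrary: E R rule: converse_rtranclp_induct)
  case base
  then show ?case by (intro r_into_rtranclp) (auto simp: nx_def)
next
  case (step c d)
  from step.hyps(1) obtain E' where E': "ok (fst c) E'" "E' \<noteq> EHalt" "G.gstep E' (snd c) (snd d)" "tgt E' = fst d"
    unfolding sstep_def by blast
  have "(\<lambda>(E, R) (E', R'). G.gstep E R R' \<and> nx E E')\<^sup>*\<^sup>* (E', snd c) (EHalt, X)" using E' step.IH by simp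
  moreover have "(\<lambda>(E, R) (E', R'). G.gstep E R R' \<and> nx E E') (E, R) (E', snd c)"
    using step.prems E' by (auto simp: nx_def)
  ultimately show ?case by (rule converse_rtranclp_into_rtranclp[rotated])
qed

lemma accepts_run:
  assumes acc: "conf D e T = (length D, (\<lambda>_. 0)(0 := e))" and before: "\<And>t. t < T \<Longrightarrow> fst (conf D e t) < length D"
    and T: "T \<le> (fgh m ^^ e) e"
  shows "\<exists>J E R. E 0 = EStart \<and> E J = EHalt \<and> R 0 = G.ini e \<and> R 1 = G.ini e \<and> R J = G.ini e \<and>
    (\<forall>j<J. G.gstep (E j) (R j) (R (Suc j)) \<and> nx (E j) (E (Suc j)))"
proof -
  let ?top = "(G.ini e)(Suc m := 0, 0 := (fgh m ^^ e) e)"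
  have ini: "G.ini e l = (if l = 0 \<or> l = Suc m \<or> l = m + 2 then e else 0)" for l
    unfolding G.ini_def by (auto simp: L0_def)
  have "up\<^sup>*\<^sup>* (G.ini e) ((G.ini e)(Suc m := 0, 0 := (fgh m ^^ e) (G.ini e 0)))"
    by (rule up_iter[OF up_level]) (auto simp: ini)
  then have U: "up\<^sup>*\<^sup>* (G.ini e) ?top" by (simp add: ini)
  \<comment> \<open>The unwound budget plus the input. After \<open>t\<close> steps the registers
    hold at most \<open>e + t\<close>, so by the bound on \<open>T\<close> the subtraction in
    \<open>embed\<close> never truncates.\<close>
  define B where "B = (fgh m ^^ e) e + e"
  have s0: "sum ((\<lambda>_. 0)(0 := e)) {..<K} = e"
    using sum_upd[OF K0, of "\<lambda>_. 0" e] by simp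
  have top: "embed B ((\<lambda>_. 0)(0 := e)) = ?top"
    using s0 by (auto simp: embed_def B_def ini fun_eq_iff)
  have sb: "sum (snd (conf D e t)) {..<K} \<le> e + t" for t
  proof (induction t)
    case 0
    then show ?case using s0 by (simp add: conf_def)
  next
    case (Suc t)
    obtain p c where c: "conf D e t = (p, c)" by (cases "conf D e t")
    have "sum (snd (step D (p, c))) {..<K} \<le> Suc (sum c {..<K})"
    proof (cases "p < length D")
      case True
      then show ?thesis
        using sum_upd[OF K[OF True], of c "Suc (c (rg (D ! p)))"] sum_upd[OF K[OF True], of c "c (rg (D ! p)) - 1"]
        by (cases "D ! p") auto
    qed simp
    then show ?case using Suc c by (simp add: conf_def del: step.simps)
  qed
  have "sstep\<^sup>*\<^sup>* (1, ?top) (Suc (fst (conf D e t)), embed B (snd (conf D e t)))" if "t \<le> T" for t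
    using that
  proof (induction t)
    case 0
    have "conf D e 0 = (0, (\<lambda>_. 0)(0 := e))" by (simp add: conf_def)
    then show ?case using top by (simp del: fun_upd_apply)
  next
    case (Suc t)
    have c: "step D (fst (conf D e t), snd (conf D e t)) = conf D e (Suc t)" by (simp add: conf_def del: step.simps)
    have "sum (snd (conf D e t)) {..<K} \<le> B" using sb[of t] Suc.prems T unfolding B_def by linarith
    then have "sstep (Suc (fst (conf D e t)), embed B (snd (conf D e t)))
      (Suc (fst (conf D e (Suc t))), embed B (snd (conf D e (Suc t))))"
      using embed_step[of "fst (conf D e t)" "snd (conf D e t)" B] before[of t] Suc.prems c by simp
    moreover have "sstep\<^sup>*\<^sup>* (1, ?top) (Suc (fst (conf D e t)), embed B (snd (conf D e t)))" by (rule Suc.IH) (use Suc.prems in simp)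
    ultimately show ?case by (rule rtranclp.rtrancl_into_rtrancl[rotated])
  qed
  from this[of T] have mid: "sstep\<^sup>*\<^sup>* (1, ?top) (Suc (length D), ?top)" using acc top by simp
  have go: "sstep (0, ?top) (1, ?top)" by (rule sstepI[of _ EGo]) (auto simp: G.gstep_def)
  have "sstep\<^sup>*\<^sup>* (0, G.ini e) (Suc (length D), G.ini e)"
    using up_sstep[OF U] go mid by (meson converse_rtranclp_into_rtranclp rtranclp_trans)
  then obtain d where d: "sstep (0, G.ini e) d" "sstep\<^sup>*\<^sup>* d (Suc (length D), G.ini e)"
    by (auto elim: converse_rtranclpE)
  from d(1) obtain E1 where E1: "ok 0 E1" "E1 \<noteq> EHalt" "G.gstep E1 (G.ini e) (snd d)" "tgt E1 = fst d"
    unfolding sstep_def by auto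
  let ?es = "\<lambda>(E, R) (E', R'). G.gstep E R R' \<and> nx E E'"
  have "?es\<^sup>*\<^sup>* (E1, G.ini e) (EHalt, G.ini e)" by (rule sstep_edges[OF d(2)]) (use E1 in auto)
  then obtain n where "(?es ^^ n) (E1, G.ini e) (EHalt, G.ini e)" using rtranclp_imp_relpowp by fast
  then obtain f where f: "f 0 = (E1, G.ini e)" "f n = (EHalt, G.ini e)" "\<And>i. i < n \<Longrightarrow> ?es (f i) (f (Suc i))"
    unfolding relpowp_fun_conv by blast
  define E R where "E j = (case j of 0 \<Rightarrow> EStart | Suc i \<Rightarrow> fst (f i))"
    and "R j = (case j of 0 \<Rightarrow> G.ini e | Suc i \<Rightarrow> snd (f i))" for j
  have "G.gstep EStart (G.ini e) (G.ini e)" "nx EStart E1" using E1 by (auto simp: G.gstep_def nx_def)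
  then have "G.gstep (E j) (R j) (R (Suc j)) \<and> nx (E j) (E (Suc j))" if "j < Suc n" for j
    using that f(1) f(3)[of "j - 1"] by (cases j) (auto simp: E_def R_def split: prod.splits)
  then show ?thesis using f(1,2) by (intro exI[of _ "Suc n"] exI[of _ E] exI[of _ R]) (auto simp: E_def R_def)
qed

end

section \<open>Diagonalisation\<close>

fun clears :: "nat \<Rightarrow> nat \<Rightarrow> com" where
  "clears 0 s = Down s"
| "clears (Suc n) s = clears n s ;; clear n s"

lemma den_clears: "n \<le> s \<Longrightarrow> R s = 0 \<Longrightarrow> den (clears n s) R = (\<lambda>r. if r < n then 0 else R r)"
proof (induction n)
  case (Suc n)
  then show ?case by (simp add: den_clear) (auto simp: fun_eq_iff)
qed (auto simp: fun_eq_iff)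

lemma wf_clears: "n \<le> s \<Longrightarrow> wf_com (clears n s)"
  by (induction n) auto

lemma sum_step:
  assumes "finite A" shows "sum (snd (step M (p, R))) A \<le> Suc (sum R A)"
proof -
  have 1: "sum (R(r := Suc (R r))) A \<le> Suc (sum R A)" for r
  proof -
    have "sum (R(r := Suc (R r))) A \<le> (\<Sum>s\<in>A. R s + (if s = r then 1 else 0))" by (intro sum_mono) auto
    also have "\<dots> \<le> Suc (sum R A)" using assms by (simp add: sum.distrib)
    finally show ?thesis .
  qed
  have 2: "sum (R(r := R r - 1)) A \<le> sum R A" for r by (intro sum_mono) auto
  show ?thesis using 1 2 by (cases "M ! p") (auto intro: le_SucI)
qed

lemma sum_conf:
  assumes "finite A" shows "sum (snd (conf M x n)) A \<le> x + n"
proof (induction n)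
  case 0
  have "sum ((\<lambda>_. 0)(0 := x)) A \<le> (\<Sum>s\<in>A. if s = 0 then x else 0)" by (intro sum_mono) auto
  also have "\<dots> \<le> x" using assms by simp
  finally show ?case by (simp add: conf_def)
next
  case (Suc n)
  then show ?case using sum_step[OF assms, of M "fst (conf M x n)" "snd (conf M x n)"]
    by (simp add: conf_def del: step.simps)
qed

lemma conf_unused:
  assumes "\<And>ins. ins \<in> set M \<Longrightarrow> rg ins < h" "0 < h" "h \<le> r" shows "snd (conf M x n) r = 0"
proof (induction n)
  case (Suc n)
  obtain p R where c: "conf M x n = (p, R)" by (cases "conf M x n")
  have "snd (step M (p, R)) r = R r"
  proof (cases "p < length M")
    case True
    then have "rg (M ! p) < h" using assms(1) by simp
    then show ?thesis using True assms(3) by (cases "M ! p") auto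
  qed simp
  then show ?case using Suc c by (simp add: conf_def del: step.simps)
qed (use assms in \<open>simp add: conf_def\<close>)

fun reloc :: "(nat \<Rightarrow> nat) \<Rightarrow> instr \<Rightarrow> instr" where
  "reloc f (Inc r l) = Inc r (f l)"
| "reloc f (Dec r l l') = Dec r (f l) (f l')"

lemma placed_nth: "placed N i P \<Longrightarrow> p < length P \<Longrightarrow> i + p < length N \<and> N ! (i + p) = P ! p"
  by (auto simp: placed_def nth_append)

lemma reloc_step:
  assumes "placed N i (map (reloc f) M)" "p < length M" "rg (M ! p) < h" "f p = i + p"
  shows "step N (f p, R(h := v)) = (f (fst (step M (p, R))), (snd (step M (p, R)))(h := v))"
  using placed_nth[OF assms(1), of p] assms(2-) by (cases "M ! p") (auto simp: fun_upd_twist)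

lemma reloc_run:
  assumes pl: "placed N i (map (reloc f) M)" and rgs: "\<And>ins. ins \<in> set M \<Longrightarrow> rg ins < h"
    and f: "\<And>p. p < length M \<Longrightarrow> f p = i + p" and n: "n \<le> run_time M x"
  shows "(step N ^^ n) (f 0, ((\<lambda>_. 0)(0 := x))(h := v)) = (f (fst (conf M x n)), (snd (conf M x n))(h := v))"
  using n
proof (induction n)
  case (Suc n)
  obtain p R where c: "conf M x n = (p, R)" by (cases "conf M x n")
  have "\<not> halted M (conf M x n)" using Suc.prems not_less_Least[of n "\<lambda>n. halted M (conf M x n)"] by (simp add: run_time_def)
  then have p: "p < length M" using c by (simp add: halted_def)
  have "(step N ^^ Suc n) (f 0, ((\<lambda>_. 0)(0 := x))(h := v)) = step N (f p, R(h := v))"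
    using Suc.IH Suc.prems c by (simp del: step.simps fun_upd_apply)
  also have "\<dots> = (f (fst (step M (p, R))), (snd (step M (p, R)))(h := v))"
    by (rule reloc_step[OF pl p]) (use rgs p f in auto)
  also have "step M (p, R) = conf M x (Suc n)" using c by (simp add: conf_def del: step.simps)
  finally show ?case .
qed (simp add: conf_def)

lemma funpow_trans: "(f ^^ m) a = b \<Longrightarrow> (f ^^ n) b = c \<Longrightarrow> (f ^^ (n + m)) a = c"
  by (simp add: funpow_add)

lemma ex_reg_bound: "\<exists>h>0. \<forall>ins\<in>set (M :: prog). rg ins < h"
  by (intro exI[of _ "Suc (sum_list (map rg M))"]) (auto intro!: le_imp_less_Suc member_le_sum_list)

text \<open>\<open>D\<close> computes \<open>g e\<close>, simulates \<open>M\<close> on it and takes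
  the exit \<open>length D\<close> only if the answer is not 1. The input survives in register
  \<open>h\<close>, above the registers of \<open>M\<close>, and is put back at the end, because the
  budget run has to return to its initial counts.\<close>

lemma reject_program:
  assumes "UF g" and f: "dominated f"
  obtains D K m where "0 < K" "\<And>p. p < length D \<Longrightarrow> rg (D ! p) < K"
    "\<And>e. halts M (g e) \<Longrightarrow> machine_output M (g e) = 1 \<Longrightarrow> \<not> (\<exists>t. fst (conf D e t) = length D)"
    "\<And>e. halts M (g e) \<Longrightarrow> machine_output M (g e) \<noteq> 1 \<Longrightarrow> run_time M (g e) \<le> f (g e) \<Longrightarrow>
      \<exists>T \<le> fgh m (e + m). conf D e T = (length D, (\<lambda>_. 0)(0 := e)) \<and> (\<forall>t<T. fst (conf D e t) < length D)"
proof -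
  obtain P where P: "computes P g" using UF_computable[OF assms(1)] by blast
  obtain h where h: "0 < h" "\<And>ins. ins \<in> set M \<Longrightarrow> rg ins < h" using ex_reg_bound[of M] by blast
  define C where "C = (P 0 (Suc h) (Suc (Suc h)) ;; move 0 h ;; move (Suc h) 0)"
  define Cl where "Cl = (clears h (Suc h) ;; move h 0)"
  define l1 where "l1 = clen C"
  define l2 where "l2 = l1 + length M"
  define l3 where "l3 = Suc (Suc l2)"
  define fin where "fin = l3 + clen Cl"
  \<comment> \<open>\<open>M\<close> may halt at any address beyond its end; all of these are
    redirected to \<open>l2\<close>.\<close>
  define j where "j p = (if p < length M then l1 + p else l2)" for p
  \<comment> \<open>Two decrements inspect the answer: 0 is noticed by the first, 1 by the second,
    which jumps to \<open>Suc fin\<close>, one address beyond the accepting exit. Every other answer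
    goes on to the cleaning part.\<close>
  define D where "D = compile C 0 l1 @ map (reloc j) M @ [Dec 0 (Suc l2) l3, Dec 0 l3 (Suc fin)] @ compile Cl l3 fin"
  have len: "length D = fin" by (simp add: D_def fin_def l3_def l2_def l1_def)
  have wf: "wf_com C" "wf_com Cl" using computesD(1)[OF P, of 0 "Suc (Suc h)" "Suc h"] h(1)
    by (simp_all add: C_def Cl_def wf_clears)
  have "placed D 0 D" by (auto simp: placed_def)
  then have "placed D 0 (compile C 0 l1 @ map (reloc j) M @ [Dec 0 (Suc l2) l3, Dec 0 l3 (Suc fin)] @ compile Cl l3 fin)"
    by (simp only: D_def)
  then have pl: "placed D 0 (compile C 0 l1)" "placed D l1 (map (reloc j) M)" "placed D l3 (compile Cl l3 fin)"
    and d: "l2 < length D" "D ! l2 = Dec 0 (Suc l2) l3" "Suc l2 < length D" "D ! Suc l2 = Dec 0 l3 (Suc fin)"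
    by (auto simp: placed_append placed_Cons l1_def[symmetric] l2_def[symmetric] l3_def[symmetric])
  let ?i = "\<lambda>e. (\<lambda>_. 0)(0 := e) :: nat \<Rightarrow> nat"
  have denC: "den C (?i e) = (?i (g e))(h := e)" for e
  proof -
    have 1: "den (P 0 (Suc h) (Suc (Suc h))) (?i e) = (?i e)(Suc h := g e)"
      by (subst computesD(3)[OF P]) auto
    show ?thesis unfolding C_def den.simps 1 using h(1) by (subst den_move, simp)+ (auto simp: fun_eq_iff)
  qed
  define X where "X e = snd (conf M (g e) (run_time M (g e)))" for e
  have X0: "X e r = 0" if "h \<le> r" for e r unfolding X_def by (rule conf_unused[of M h]) (use h that in auto)
  have denCl: "den Cl ((X e)(0 := v, h := e)) = ?i e" for e v
  proof -
    have 1: "den (clears h (Suc h)) ((X e)(0 := v, h := e)) = (\<lambda>_. 0)(h := e)"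
      by (subst den_clears) (use X0 h(1) in \<open>auto simp: fun_eq_iff\<close>)
    show ?thesis unfolding Cl_def den.simps 1 using h(1) by (subst den_move) (auto simp: fun_eq_iff)
  qed
  have jump: "(step D ^^ (run_time M (g e) + tm C (?i e))) (0, ?i e) = (l2, (X e)(h := e))" if "halts M (g e)" for e
  proof (rule funpow_trans)
    show "(step D ^^ tm C (?i e)) (0, ?i e) = (l1, (?i (g e))(h := e))"
      using compile_correct[OF wf(1) pl(1), of "?i e"] unfolding denC .
    have "halted M (conf M (g e) (run_time M (g e)))" using that unfolding halts_def run_time_def by (rule LeastI_ex)
    then have "j (fst (conf M (g e) (run_time M (g e)))) = l2" by (simp add: j_def halted_def)
    moreover have "j 0 = l1" by (simp add: j_def l2_def)
    ultimately show "(step D ^^ run_time M (g e)) (l1, (?i (g e))(h := e)) = (l2, (X e)(h := e))"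
      using reloc_run[OF pl(2) h(2), of "run_time M (g e)" "g e" e] by (simp add: j_def X_def)
  qed
  have out: "machine_output M (g e) = X e 0" for e by (simp add: machine_output_def X_def)
  have fin_unique: "pc = pc'" if "conf D e s = (pc, R)" "conf D e t = (pc', R')" "length D \<le> pc" "length D \<le> pc'" for e s t pc pc' R R'
    using halted_conf[of D e s t] halted_conf[of D e t s] that by (cases "s \<le> t") (auto simp: halted_def)
  have rej: "\<not> (\<exists>t. fst (conf D e t) = length D)" if "halts M (g e)" "machine_output M (g e) = 1" for e
  proof
    assume "\<exists>t. fst (conf D e t) = length D"
    then obtain t R where t: "conf D e t = (length D, R)" by (metis prod.collapse)
    have "X e 0 = 1" using that(2) out by simp
    then have "(step D ^^ 2) (l2, (X e)(h := e)) = (Suc fin, (X e)(h := e, 0 := 0))"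
      using d h(1) by (simp add: numeral_2_eq_2)
    from funpow_trans[OF jump[OF that(1)] this]
    have "conf D e (2 + (run_time M (g e) + tm C (?i e))) = (Suc fin, (X e)(h := e, 0 := 0))" by (simp only: conf_def)
    from fin_unique[OF this t] show False by (simp add: len)
  qed
  obtain A where A: "finite A" "used C \<subseteq> A" "used Cl \<subseteq> A" "0 \<in> A" "h \<in> A"
    by (rule that[of "insert 0 (insert h (used C \<union> used Cl))"]) auto
  obtain a where a: "\<And>R. tm C R + sum (den C R) A \<le> fgh a (sum R A + a)" using com_dominated[OF A(1,2)] by blast
  obtain b where b: "\<And>R. tm Cl R + sum (den Cl R) A \<le> fgh b (sum R A + b)" using com_dominated[OF A(1,3)] by blast
  obtain c where c: "\<And>x. f x \<le> fgh c (x + c)" using f unfolding dominated_def by blast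
  let ?G = "\<lambda>e. fgh a (e + a)"
  let ?H = "\<lambda>e. fgh c (?G e + c)"
  have domG: "dominated ?G" by (rule dominated_fgh)
  have domH: "dominated ?H" by (rule dominated_comp[OF dominated_fgh domG])
  have "dominated (\<lambda>e. (?G e + ?H e) + (2 + fgh b ((?G e + ?H e) + e + b)))"
    by (intro dominated_add domG domH dominated_const dominated_comp[OF dominated_fgh] dominated_id)
  then obtain m where m: "\<And>e. (?G e + ?H e) + (2 + fgh b ((?G e + ?H e) + e + b)) \<le> fgh m (e + m)"
    unfolding dominated_def by blast
  have acc: "\<exists>T \<le> fgh m (e + m). conf D e T = (length D, ?i e) \<and> (\<forall>t<T. fst (conf D e t) < length D)"
    if hl: "halts M (g e)" and o: "machine_output M (g e) \<noteq> 1" and rt: "run_time M (g e) \<le> f (g e)" for e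
  proof -
    have "X e 0 \<noteq> 1" using o out by simp
    then obtain q v where q: "q \<le> 2" "(step D ^^ q) (l2, (X e)(h := e)) = (l3, (X e)(0 := v, h := e))" "v \<le> X e 0"
    proof (cases "X e 0 = 0")
      case True
      then have "(step D ^^ 1) (l2, (X e)(h := e)) = (l3, (X e)(0 := 0, h := e))"
        using d h(1) by (auto simp: fun_eq_iff)
      then show thesis by (intro that[of 1]) auto
    next
      case False
      then have "(step D ^^ 2) (l2, (X e)(h := e)) = (l3, (X e)(0 := X e 0 - 2, h := e))"
        using d h(1) \<open>X e 0 \<noteq> 1\<close> by (auto simp: numeral_2_eq_2 fun_eq_iff)
      then show thesis by (intro that[of 2]) auto
    qed
    let ?R = "(X e)(0 := v, h := e)"
    have "(step D ^^ tm Cl ?R) (l3, ?R) = (fin, ?i e)"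
      using compile_correct[OF wf(2) pl(3), of ?R] unfolding denCl .
    from funpow_trans[OF funpow_trans[OF jump[OF hl] q(2)] this]
    have fi: "conf D e (tm Cl ?R + (q + (run_time M (g e) + tm C (?i e)))) = (length D, ?i e)" unfolding conf_def len .
    let ?T = "tm Cl ?R + (q + (run_time M (g e) + tm C (?i e)))"
    have sA: "sum (?i e) A = e" using A(1,4) sum.remove[of A 0 "?i e"] by simp
    have GC: "tm C (?i e) + g e \<le> ?G e"
    proof -
      have "g e = den C (?i e) 0" using h(1) by (simp add: denC)
      also have "\<dots> \<le> sum (den C (?i e)) A" using A by (intro member_le_sum) auto
      finally show ?thesis using a[of "?i e"] sA by simp
    qed
    have H: "run_time M (g e) \<le> ?H e"
    proof -
      have "run_time M (g e) \<le> fgh c (g e + c)" using rt c le_trans by blast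
      also have "\<dots> \<le> ?H e" using GC by (intro fgh_mono) simp
      finally show ?thesis .
    qed
    have "sum ?R A \<le> sum (\<lambda>r. X e r + (if r = h then e else 0)) A" using q(3) by (intro sum_mono) auto
    also have "\<dots> = sum (X e) A + e" using A by (simp add: sum.distrib)
    also have "\<dots> \<le> g e + run_time M (g e) + e" using sum_conf[OF A(1), of M "g e" "run_time M (g e)"] by (simp add: X_def)
    finally have "sum ?R A + b \<le> (?G e + ?H e) + e + b" using GC H by simp
    then have "fgh b (sum ?R A + b) \<le> fgh b ((?G e + ?H e) + e + b)" by (rule fgh_mono)
    then have Tb: "?T \<le> fgh m (e + m)" using b[of ?R] m[of e] GC H q(1) by linarith
    define T where "T = (LEAST t. length D \<le> fst (conf D e t))"
    have "length D \<le> fst (conf D e ?T)" unfolding fi by simp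
    then have T: "length D \<le> fst (conf D e T)" "T \<le> ?T" unfolding T_def by (rule LeastI, rule Least_le)
    have "conf D e T = (length D, ?i e)" using halted_conf[of D e T ?T] T fi by (simp add: halted_def)
    moreover have "fst (conf D e t) < length D" if "t < T" for t
      using not_less_Least[OF that[unfolded T_def]] by simp
    ultimately show ?thesis using T(2) Tb by (intro exI[of _ T]) auto
  qed
  obtain K where K: "0 < K" "\<And>ins. ins \<in> set D \<Longrightarrow> rg ins < K" using ex_reg_bound[of D] by blast
  show thesis by (rule that[of K D m]) (use K rej acc in auto)
qed

text \<open>Needed because the program has to construct the code of the formula from
  \<open>e\<close>; the nesting of \<open>ticks\<close> makes its code an iteration.\<close>

lemma UF_enc_ends: "UF (\<lambda>e. enc (ends e))"
proof -
  let ?F = "\<lambda>z. prod_encode (5, prod_encode (enc (Prop 0), prod_encode (3, prod_encode (enc (Constr CLt 1),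
    prod_encode (3, prod_encode (enc (Prop 1), z))))))"
  have F: "(?F ^^ e) (enc (ticks 0)) = enc (ticks e)" for e by (induction e) auto
  have "UF (\<lambda>e. (?F ^^ e) (enc (ticks 0)))" by (intro UF_funpow UFI)
  then have t: "UF (\<lambda>e. enc (ticks e))" unfolding F .
  have "enc (ends e) = prod_encode (3, prod_encode (prod_encode (1, enc (ticks e)), prod_encode (5, prod_encode (enc TT,
    prod_encode (3, prod_encode (enc (Prop 3), prod_encode (1, enc (ticks e))))))))" for e by (simp add: ends_def)
  then show ?thesis by (simp only:) (intro UFI t)
qed

text \<open>If the formula is satisfiable, \<open>M\<close> answers 1 and \<open>D\<close> does not
  accept, but a model is a gain-free run and shows acceptance. If it is not, \<open>D\<close>
  accepts within the budget, and that computation provides a model.\<close>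

theorem not_primrec_bounded:
  assumes M: "decides_sat M" and f: "primrec_fn 1 f"
    and bound: "\<And>k a. constrained a \<Longrightarrow> run_time M (code k a) \<le> f [code k a]"
  shows False
proof -
  obtain t where t: "dominated t" "\<And>xs. length xs = 1 \<Longrightarrow> f xs \<le> t (sum_list xs)"
    using primrec_dominated[OF f] by blast
  \<comment> \<open>Applied to the code of a pair \<open>(k, b)\<close>, this gives the code of the
    alphabet size \<open>k\<close> with \<open>And b (ends e)\<close>. For
    \<open>b = G.machF\<close> the argument \<open>e\<close> thereby becomes the data of a formula
    whose code the program can reconstruct.\<close>
  define g where "g e = prod_encode (pf e, prod_encode (3, prod_encode (ps e, enc (ends e))))" for e
  have "UF g" unfolding g_def[abs_def] by (intro UFI UF_enc_ends)
  from reject_program[OF this t(1), of M] obtain D K m where K: "0 < K" "\<And>p. p < length D \<Longrightarrow> rg (D ! p) < K"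
    and rej: "\<And>e. halts M (g e) \<Longrightarrow> machine_output M (g e) = 1 \<Longrightarrow> \<not> (\<exists>t. fst (conf D e t) = length D)"
    and acc: "\<And>e. halts M (g e) \<Longrightarrow> machine_output M (g e) \<noteq> 1 \<Longrightarrow> run_time M (g e) \<le> t (g e) \<Longrightarrow>
      \<exists>T \<le> fgh m (e + m). conf D e T = (length D, (\<lambda>_. 0)(0 := e)) \<and> (\<forall>t<T. fst (conf D e t) < length D)"
    by metis
  interpret budget D K m by standard (use K in auto)
  \<comment> \<open>The alphabet is padded by \<open>m + 1\<close> letters to make \<open>e\<close>,
    which is at least \<open>k\<close>, large compared with \<open>m\<close>.\<close>
  define k where "k = length G.ll + m + 1"
  define e where "e = prod_encode (k, enc G.machF)"
  define a where "a = And G.machF (ends e)"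
  have a: "constrained a" unfolding a_def by (rule G.constrained_gainy)
  have code: "code k a = g e" by (simp add: code_def g_def a_def e_def)
  have hlt: "halts M (g e)" and dec: "machine_output M (g e) = 1 \<longleftrightarrow> tptl_sat k a"
    using M a unfolding decides_sat_def code[symmetric] by auto
  have rt: "run_time M (g e) \<le> t (g e)" using bound[OF a, of k] t(2)[of "[g e]"] by (simp add: code)
  show False
  proof (cases "tptl_sat k a")
    case True
    then obtain w where w: "timed_word k w" "sat w 0 0 (And G.machF (ends e))" unfolding tptl_sat_def a_def by blast
    obtain J E R where "E 0 = EStart" "E J = EHalt" "R 0 = G.ini e" "R J = G.ini e"
      "\<And>j. j < J \<Longrightarrow> G.gstep (E j) (R j) (R (Suc j)) \<and> nx (E j) (E (Suc j))"
      using G.gainy_sound[OF w] by blast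
    then have "\<exists>t. fst (conf D e t) = length D" by (rule run_accepts)
    then show False using rej hlt dec True by blast
  next
    case False
    obtain T where T: "T \<le> fgh m (e + m)" "conf D e T = (length D, (\<lambda>_. 0)(0 := e))"
      "\<And>t. t < T \<Longrightarrow> fst (conf D e t) < length D"
      using acc[OF hlt _ rt] dec False by blast
    have "k \<le> e" unfolding e_def by (rule le_prod_encode_1)
    then have e: "m + 1 \<le> e" by (simp add: k_def)
    \<comment> \<open>Of the \<open>e\<close> applications in the budget, \<open>e - 1\<close> raise
      the argument \<open>e\<close> beyond \<open>e + m\<close>, and the last one yields the time
      bound.\<close>
    have "e + m \<le> (fgh m ^^ (e - 1)) e" using funpow_inflate[where f = "fgh m" and x = e and k = "e - 1", OF fgh_gt] e by simp
    then have "fgh m (e + m) \<le> (fgh m ^^ Suc (e - 1)) e" by (simp add: fgh_mono)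
    then have "T \<le> (fgh m ^^ e) e" using T(1) e by simp
    from accepts_run[OF T(2,3) this] obtain J E R where "E 0 = EStart" "E J = EHalt" "R 0 = G.ini e" "R 1 = G.ini e"
      "R J = G.ini e" "\<And>j. j < J \<Longrightarrow> G.gstep (E j) (R j) (R (Suc j)) \<and> nx (E j) (E (Suc j))" by blast
    from G.gainy_complete[OF this] have "tptl_sat k a" by (simp add: a_def k_def)
    then show False using False by simp
  qed
qed

theorem theorem4p1:
  shows "(\<exists>M. decides_sat M) \<and>
         (\<forall>M. decides_sat M \<longrightarrow>
            (\<forall>f. primrec_fn 1 f \<longrightarrow>
               \<not> (\<forall>k a. constrained a \<longrightarrow> run_time M (code k a) \<le> f [code k a])))"
  using decidable not_primrec_bounded by blast

end
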